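(* Let $G$ be a compact Lie group with Lie algebra $\mathfrak g$, let $\Theta$ be the trivial flat connection on the trivial $G$-bundle over $\mathbb T^2$, and let $p>2$. With the notation of the context: 1. If $\mathfrak g$ is abelian, then $\theta_{\mathrm{LS}}(\mathcal E_{\mathrm{gf}},0)=\frac12$. 2. If $\mathfrak g$ is nonabelian, then there are $C,\varepsilon>0$ such that $$|\mathcal E_{\mathrm{gf}}(a)-\mathcal E_{\mathrm{gf}}(0)|^{3/4}\le C\|\mathcal M(a)\|_{W^{-1,p}}$$ for $\|a\|_{W^{1,p}}<\varepsilon$, and $\theta_{\mathrm{LS}}(\mathcal E_{\mathrm{gf}},0)=\frac34$.
   Context: $\mathfrak g$ carries an $\operatorname{Ad}G$-invariant inner product; $\mathbb T^2=\mathbb R^2/\mathbb Z^2$ carries the flat metric; $P=\mathbb T^2\times G$. Connections near $\Theta$ are written $A=\Theta+a$ with $a\in X:=W^{1,p}(\mathbb T^2;\Lambda^1\otimes\mathfrak g)$. Put $Y:=\bigl(W^{1,p'}(\mathbb T^2;\Lambda^1\otimes\mathfrak g)\bigr)^*=:W^{-1,p}$, $p'=p/(p-1)$, with the pairing $\langle\cdot,\cdot\rangle_{Y,X}$ given by duality (using $X\hookrightarrow W^{1,p'}$). The curvature is $F_{\Theta+a}=da+\frac12[a\wedge a]$, with $\frac12[a\wedge a](v,w)=[a(v),a(w)]$. The gauge-fixed functional and its gradient map are $$\mathcal E_{\mathrm{gf}}(a)=\frac12\|F_{\Theta+a}\|_{L^2}^2+\frac12\|d^*a\|_{L^2}^2,\qquad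 \mathcal M(a)=d_{\Theta+a}^*F_{\Theta+a}+dd^*a\in Y,$$ where $d_{\Theta+a}^*$ is the formal $L^2$-adjoint of the covariant exterior derivative $d_{\Theta+a}=d+[a\wedge\cdot\,]$; thus $d\mathcal E_{\mathrm{gf}}(a)[b]=\langle\mathcal M(a),b\rangle_{Y,X}$ for $b\in X$. $\theta_{\mathrm{LS}}(\mathcal E_{\mathrm{gf}},0):=\inf\{\theta\in[1/2,1):\exists C>0,\ \|\mathcal M(a)\|_Y\ge C|\mathcal E_{\mathrm{gf}}(a)|^\theta$ for all $a\in X$ sufficiently close to $0\}$ (note $\mathcal E_{\mathrm{gf}}(0)=0$). *)

theory Defs
  imports "HOL-Analysis.Analysis" "HOL-Algebra.Group"
begin

section \<open>Compact Lie groups and their Lie algebras\<close>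

text \<open>
  Smooth maps between open subsets of finite-dimensional spaces: \<open>Ck_on (Suc k)\<close> asks for
  differentiability and for all directional derivatives to be of class \<open>Ck_on k\<close>.
\<close>

primrec Ck_on ::
  "nat \<Rightarrow> 'a::real_normed_vector set \<Rightarrow> ('a \<Rightarrow> 'b::real_normed_vector) \<Rightarrow> bool" where
  "Ck_on 0 S f \<longleftrightarrow> continuous_on S f"
| "Ck_on (Suc k) S f \<longleftrightarrow>
     (\<forall>x\<in>S. f differentiable (at x)) \<and> (\<forall>v. Ck_on k S (\<lambda>x. frechet_derivative f (at x) v))"

definition smooth_on :: "'a::real_normed_vector set \<Rightarrow> ('a \<Rightarrow> 'b::real_normed_vector) \<Rightarrow> bool" where
  "smooth_on S f \<longleftrightarrow> (\<forall>k. Ck_on k S f)"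

text \<open>
  The model space of all manifolds below is a type of sort \<open>{real_inner, heine_borel}\<close>.  This is
  the same as a finite-dimensional real inner product space; unlike \<open>euclidean_space\<close>, the sort
  admits the zero space, i.e. finite groups as Lie groups of dimension 0.  (The sorts \<open>banach\<close> and
  \<open>second_countable_topology\<close> used later are automatic in finite dimension.)
\<close>

lemma heine_borel_finite_dimensional:
  "\<exists>B :: 'e::{real_inner, heine_borel} set. finite B \<and> span B = UNIV"
proof -
  have "compact (cball (0::'e) 1)"
    by (simp add: compact_eq_bounded_closed)
  then obtain K where K: "finite K" "cball (0::'e) 1 \<subseteq> (\<Union>x\<in>K. ball x (1/2))"
    unfolding compact_eq_totally_bounded by (meson half_gt_zero zero_less_one)
  obtain B where B: "finite B" "span B = span K" "pairwise orthogonal B"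
    using basis_orthogonal[OF K(1)] by blast
  have "x \<in> span B" for x
  proof (rule ccontr)
    assume x: "x \<notin> span B"
    define y where "y = x - (\<Sum>b\<in>B. (b \<bullet> x / (b \<bullet> b)) *\<^sub>R b)"
    have "y \<noteq> 0"
    proof
      assume "y = 0"
      then have "x = (\<Sum>b\<in>B. (b \<bullet> x / (b \<bullet> b)) *\<^sub>R b)" by (simp add: y_def)
      also have "\<dots> \<in> span B" by (intro span_sum span_scale span_base)
      finally show False using x by simp
    qed
    have orth: "orthogonal z y" if "z \<in> span B" for z
    proof -
      have "orthogonal y b" if "b \<in> B" for b
      proof -
        have "(\<Sum>c\<in>B. (c \<bullet> x / (c \<bullet> c)) * (c \<bullet> b)) = (\<Sum>c\<in>B. if c = b then b \<bullet> x else 0)"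
          using B(3) that
          by (intro sum.cong) (auto simp: pairwise_def orthogonal_def)
        then have "x \<bullet> b = (\<Sum>c\<in>B. (c \<bullet> x / (c \<bullet> c)) * (c \<bullet> b))"
          using B(1) that by (simp add: inner_commute)
        then show ?thesis
          by (simp add: y_def orthogonal_def inner_diff_left inner_sum_left)
      qed
      then show ?thesis
        using orthogonal_to_span[OF that, of y] by (simp add: orthogonal_commute)
    qed
    define u where "u = y /\<^sub>R norm y"
    have u: "norm u = 1" using \<open>y \<noteq> 0\<close> by (simp add: u_def)
    then have "u \<in> cball 0 1" by simp
    then obtain k where k: "k \<in> K" "u \<in> ball k (1/2)" using K(2) by blast
    have "k \<in> span B" using k(1) B(2) by (simp add: span_base)
    then have "k \<bullet> u = 0" using orth[of k] by (simp add: u_def orthogonal_def)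
    then have "(norm (k - u))\<^sup>2 = (norm k)\<^sup>2 + (norm u)\<^sup>2"
      by (simp add: power2_norm_eq_inner inner_diff_left inner_diff_right inner_commute)
    then have "1 \<le> (norm (k - u))\<^sup>2" using u by simp
    then have "1 \<le> norm (k - u)"
      by (metis abs_norm_cancel abs_square_less_1 not_less)
    then show False using k(2) by (simp add: dist_norm)
  qed
  then show ?thesis using B(1) by blast
qed

text \<open>
  A Lie group: a group with a second countable Hausdorff topology and a smooth atlas \<open>\<A>\<close> (not
  required to be maximal) for which multiplication and inversion are smooth.  A chart is a pair
  \<open>(U, \<phi>)\<close>; its inverse is \<open>inv_into U \<phi>\<close>.  The sets on which smoothness is required are open.
\<close>

locale lie_group = group G for G :: "('g, 'm) monoid_scheme" (structure) +
  fixes T :: "'g topology"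
    and \<A> :: "('g set \<times> ('g \<Rightarrow> 'e::{real_inner, heine_borel})) set"
  assumes topspace_eq: "topspace T = carrier G"
    and Hausdorff: "Hausdorff_space T"
    and second_countable: "second_countable T"
    and chart: "(U, \<phi>) \<in> \<A> \<Longrightarrow> openin T U \<and> open (\<phi> ` U) \<and>
          homeomorphic_map (subtopology T U) (top_of_set (\<phi> ` U)) \<phi>"
    and charts_cover: "\<Union> (fst ` \<A>) = carrier G"
    and transition_smooth: "(U, \<phi>) \<in> \<A> \<Longrightarrow> (V, \<psi>) \<in> \<A> \<Longrightarrow>
          smooth_on (\<phi> ` (U \<inter> V)) (\<lambda>u. \<psi> (inv_into U \<phi> u))"
    and mult_continuous:
          "continuous_map (prod_topology T T) T (\<lambda>(g, h). g \<otimes> h)"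
    and mult_smooth: "(U, \<phi>) \<in> \<A> \<Longrightarrow> (V, \<psi>) \<in> \<A> \<Longrightarrow> (W, \<rho>) \<in> \<A> \<Longrightarrow>
          smooth_on {(u, v) \<in> \<phi> ` U \<times> \<psi> ` V. inv_into U \<phi> u \<otimes> inv_into V \<psi> v \<in> W}
            (\<lambda>(u, v). \<rho> (inv_into U \<phi> u \<otimes> inv_into V \<psi> v))"
    and inv_continuous: "continuous_map T T (\<lambda>g. inv g)"
    and inv_smooth: "(U, \<phi>) \<in> \<A> \<Longrightarrow> (W, \<rho>) \<in> \<A> \<Longrightarrow>
          smooth_on {u \<in> \<phi> ` U. inv (inv_into U \<phi> u) \<in> W} (\<lambda>u. \<rho> (inv (inv_into U \<phi> u)))"

text \<open>
  Let \<open>(U, \<phi>)\<close> be a chart around \<open>\<one>\<close>.  The differential of \<open>\<phi>\<close> at \<open>\<one>\<close> identifies the Lie algebra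
  \<open>\<gg>\<close>, the tangent space of \<open>G\<close> at \<open>\<one>\<close>, with the model space \<open>'e\<close>.  In these terms, \<open>Ad g\<close> is the
  differential at \<open>\<one>\<close> of the conjugation \<open>h \<mapsto> g h g\<inverse>\<close>, and \<open>[x, y] = ad x y\<close>, where \<open>ad\<close> is the
  differential of \<open>Ad\<close> at \<open>\<one>\<close>.
\<close>

definition Ad :: "('g, 'm) monoid_scheme \<Rightarrow> 'g set \<times> ('g \<Rightarrow> 'e::real_normed_vector) \<Rightarrow> 'g \<Rightarrow> 'e \<Rightarrow> 'e"
  where
  "Ad G = (\<lambda>(U, \<phi>) g.
     frechet_derivative (\<lambda>v. \<phi> (g \<otimes>\<^bsub>G\<^esub> inv_into U \<phi> v \<otimes>\<^bsub>G\<^esub> inv\<^bsub>G\<^esub> g)) (at (\<phi> \<one>\<^bsub>G\<^esub>)))"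

definition lie_bracket ::
  "('g, 'm) monoid_scheme \<Rightarrow> 'g set \<times> ('g \<Rightarrow> 'e::real_normed_vector) \<Rightarrow> 'e \<Rightarrow> 'e \<Rightarrow> 'e" where
  "lie_bracket G = (\<lambda>(U, \<phi>) x y.
     frechet_derivative (\<lambda>u. Ad G (U, \<phi>) (inv_into U \<phi> u) y) (at (\<phi> \<one>\<^bsub>G\<^esub>)) x)"

definition abelian_bracket :: "('e::real_vector \<Rightarrow> 'e \<Rightarrow> 'e) \<Rightarrow> bool" where
  "abelian_bracket br \<longleftrightarrow> (\<forall>x y. br x y = 0)"


section \<open>Sobolev spaces on the flat torus\<close>

text \<open>
  Functions on \<open>\<real>\<^sup>2/\<int>\<^sup>2\<close> are \<open>\<int>\<^sup>2\<close>-periodic functions on \<open>\<real>\<^sup>2\<close>, integrated over the unit square.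
  Elements of \<open>L\<^sup>q\<close> and \<open>W\<^sup>1\<^sup>,\<^sup>q\<close> are represented by functions; everything below is invariant under
  change on a null set.
\<close>

definition periodic :: "(real \<times> real \<Rightarrow> 'b) \<Rightarrow> bool" where
  "periodic f \<longleftrightarrow> (\<forall>x. \<forall>e\<in>Basis. f (x + e) = f x)"

definition torus :: "(real \<times> real) measure" where
  "torus = restrict_space lborel (cbox (0, 0) (1, 1))"

definition Lq :: "real \<Rightarrow> (real \<times> real \<Rightarrow> 'b::real_normed_vector) \<Rightarrow> bool" where
  "Lq q f \<longleftrightarrow> f \<in> borel_measurable borel \<and> periodic f \<and>
     integrable torus (\<lambda>x. norm (f x) powr q)"

definition has_weak_partial ::
  "real \<times> real \<Rightarrow> (real \<times> real \<Rightarrow> 'b::{banach, second_countable_topology}) \<Rightarrow>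
     (real \<times> real \<Rightarrow> 'b) \<Rightarrow> bool" where
  "has_weak_partial e f g \<longleftrightarrow>
     (\<forall>\<eta> :: real \<times> real \<Rightarrow> real. smooth_on UNIV \<eta> \<longrightarrow> periodic \<eta> \<longrightarrow>
        (LINT x|torus. frechet_derivative \<eta> (at x) e *\<^sub>R f x) = - (LINT x|torus. \<eta> x *\<^sub>R g x))"

definition W1 :: "real \<Rightarrow> (real \<times> real \<Rightarrow> 'b::{banach, second_countable_topology}) \<Rightarrow> bool" where
  "W1 q f \<longleftrightarrow> Lq q f \<and> (\<forall>e\<in>Basis. \<exists>g. Lq q g \<and> has_weak_partial e f g)"

text \<open>The weak partial derivative in direction \<open>e\<close>; it is unique up to a null set.\<close>

definition wpartial ::
  "real \<times> real \<Rightarrow> (real \<times> real \<Rightarrow> 'b::{banach, second_countable_topology}) \<Rightarrow>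
     real \<times> real \<Rightarrow> 'b" where
  "wpartial e f = (SOME g. Lq 1 g \<and> has_weak_partial e f g)"

definition W1_norm :: "real \<Rightarrow> (real \<times> real \<Rightarrow> 'b::{banach, second_countable_topology}) \<Rightarrow> real"
  where
  "W1_norm q f =
     (LINT x|torus. norm (f x) powr q + (\<Sum>e\<in>Basis. norm (wpartial e f x) powr q)) powr (1 / q)"

text \<open>
  The norm of the dual of \<open>W\<^sup>1\<^sup>,\<^sup>q\<close> with \<open>q = p / (p - 1)\<close>, i.e. of \<open>W\<^sup>-\<^sup>1\<^sup>,\<^sup>p\<close>.  It is meaningful for
  functionals that are bounded on \<open>W\<^sup>1\<^sup>,\<^sup>q\<close>.
\<close>

definition W_minus1_norm ::
  "real \<Rightarrow> ((real \<times> real \<Rightarrow> 'b::{banach, second_countable_topology}) \<Rightarrow> real) \<Rightarrow> real" where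
  "W_minus1_norm p \<Lambda> =
     (let q = p / (p - 1) in SUP b\<in>{b. W1 q b \<and> W1_norm q b \<le> 1}. \<bar>\<Lambda> b\<bar>)"


section \<open>The gauge-fixed Yang--Mills functional\<close>

text \<open>
  A \<open>\<gg>\<close>-valued 1-form \<open>a\<^sub>1 dx\<^sup>1 + a\<^sub>2 dx\<^sup>2\<close> is the function \<open>(a\<^sub>1, a\<^sub>2)\<close> with values in \<open>'e \<times> 'e\<close>, and a
  2-form \<open>\<omega> dx\<^sup>1 \<and> dx\<^sup>2\<close> is its coefficient \<open>\<omega>\<close>, the value on the pair of standard basis vectors.
  The argument \<open>br\<close> is the Lie bracket, and the invariant inner product on \<open>\<gg>\<close> is that of \<open>'e\<close>.
\<close>

type_synonym 'e form0 = "real \<times> real \<Rightarrow> 'e"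
type_synonym 'e form1 = "real \<times> real \<Rightarrow> 'e \<times> 'e"
type_synonym 'e form2 = "real \<times> real \<Rightarrow> 'e"

definition ext_d :: "'e::{real_inner, banach, second_countable_topology} form1 \<Rightarrow> 'e form2" where
  "ext_d a x = snd (wpartial (1, 0) a x) - fst (wpartial (0, 1) a x)"

definition codiff :: "'e::{real_inner, banach, second_countable_topology} form1 \<Rightarrow> 'e form0" where
  "codiff a x = - (fst (wpartial (1, 0) a x) + snd (wpartial (0, 1) a x))"

text \<open>\<open>[a \<and> b](v, w) = [a(v), b(w)] - [a(w), b(v)]\<close>\<close>

definition bracket_wedge ::
  "('e \<Rightarrow> 'e \<Rightarrow> 'e::ab_group_add) \<Rightarrow> 'e form1 \<Rightarrow> 'e form1 \<Rightarrow> 'e form2" where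
  "bracket_wedge br a b x = br (fst (a x)) (snd (b x)) - br (snd (a x)) (fst (b x))"

definition curvature :: "('e \<Rightarrow> 'e \<Rightarrow> 'e::{real_inner, banach, second_countable_topology}) \<Rightarrow>
    'e form1 \<Rightarrow> 'e form2" where
  "curvature br a x = ext_d a x + (1/2) *\<^sub>R bracket_wedge br a a x"

definition cov_d :: "('e \<Rightarrow> 'e \<Rightarrow> 'e::{real_inner, banach, second_countable_topology}) \<Rightarrow>
    'e form1 \<Rightarrow> 'e form1 \<Rightarrow> 'e form2" where
  "cov_d br a b x = ext_d b x + bracket_wedge br a b x"

definition E_gf :: "('e \<Rightarrow> 'e \<Rightarrow> 'e::{real_inner, banach, second_countable_topology}) \<Rightarrow>
    'e form1 \<Rightarrow> real" where
  "E_gf br a = (1/2) * (LINT x|torus. (norm (curvature br a x))\<^sup>2)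
             + (1/2) * (LINT x|torus. (norm (codiff a x))\<^sup>2)"

text \<open>
  The formal adjoints of \<open>d\<^sub>\<Theta>\<^sub>+\<^sub>a\<close> (on 2-forms) and of \<open>d\<^sup>*\<close> (on functions), as distributions, i.e.
  as functionals of the 1-form \<open>b\<close>.
\<close>

definition cov_d_adj :: "('e \<Rightarrow> 'e \<Rightarrow> 'e::{real_inner, banach, second_countable_topology}) \<Rightarrow>
    'e form1 \<Rightarrow> 'e form2 \<Rightarrow> 'e form1 \<Rightarrow> real" where
  "cov_d_adj br a \<omega> b = (LINT x|torus. \<omega> x \<bullet> cov_d br a b x)"

definition weak_d0 :: "'e::{real_inner, banach, second_countable_topology} form0 \<Rightarrow>
    'e form1 \<Rightarrow> real" where
  "weak_d0 u b = (LINT x|torus. u x \<bullet> codiff b x)"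

definition M_gf :: "('e \<Rightarrow> 'e \<Rightarrow> 'e::{real_inner, banach, second_countable_topology}) \<Rightarrow>
    'e form1 \<Rightarrow> 'e form1 \<Rightarrow> real" where
  "M_gf br a b = cov_d_adj br a (curvature br a) b + weak_d0 (codiff a) b"

text \<open>
  The exponent \<open>\<theta>\<^sub>L\<^sub>S(\<E>, 0)\<close> of a functional \<open>\<E>\<close> on \<open>W\<^sup>1\<^sup>,\<^sup>p\<close> with gradient map \<open>M\<close> into \<open>W\<^sup>-\<^sup>1\<^sup>,\<^sup>p\<close>.  The
  infimum is taken in \<open>ereal\<close>, so that it is \<open>\<infinity>\<close> if there is no admissible exponent.
\<close>

definition theta_LS ::
  "real \<Rightarrow> ((real \<times> real \<Rightarrow> 'b::{banach, second_countable_topology}) \<Rightarrow> real) \<Rightarrow>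
    ((real \<times> real \<Rightarrow> 'b) \<Rightarrow> (real \<times> real \<Rightarrow> 'b) \<Rightarrow> real) \<Rightarrow> ereal" where
  "theta_LS p \<E> M = Inf (ereal ` {\<theta>. 1/2 \<le> \<theta> \<and> \<theta> < 1 \<and>
     (\<exists>C>0. \<exists>\<delta>>0. \<forall>a. W1 p a \<and> W1_norm p a < \<delta> \<longrightarrow>
        W_minus1_norm p (M a) \<ge> C * \<bar>\<E> a\<bar> powr \<theta>)})"

end

theory Submission
  imports Defs
begin

text \<open>
  Write \<open>a = c + w\<close>, where \<open>c\<close> is the mean of \<open>a\<close> over the torus, and let \<open>r\<close> be the \<open>L\<^sup>2\<close> norm of the
  derivatives of \<open>a\<close>.  The harmonic 1-forms on the flat torus are the constants, so that \<open>r\<close> measures the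
  directions in which the second derivative of the functional at the trivial connection is
  nondegenerate, while \<open>c\<close> ranges over its finite-dimensional kernel.

  In the nondegenerate directions, test the gradient with \<open>b = w\<close>.  The main term is
  \<open>\<integral> |da|\<^sup>2 + |d\<^sup>*a|\<^sup>2 = r\<^sup>2\<close>, an identity (\<open>div_curl\<close>) that rests on the symmetry of mixed derivatives
  in weak form (\<open>integral_partials_commute\<close>).  The terms that contain \<open>w\<close> once have mean zero, and the
  remaining ones are at most a small multiple of \<open>r\<^sup>2\<close>: by Morrey's inequality for \<open>p > 2\<close> the field \<open>a\<close> is
  uniformly small, and by Poincare's inequality \<open>w\<close> is at most of size \<open>r\<close> in \<open>L\<^sup>2\<close>.  As \<open>p/(p-1) < 2\<close>, the
  norm of \<open>w\<close> as a test function is of size \<open>r\<close> as well, and \<open>r \<le> 12 \<parallel>M(a)\<parallel>\<close> follows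
  (\<open>gradient_estimate\<close>).

  In the directions of the kernel, test with a constant \<open>b\<close>.  Now all terms of first order in \<open>w\<close> integrate
  to zero, and with \<open>F0 = [c\<^sub>1, c\<^sub>2]\<close> one obtains \<open>|\<langle>F0, [c \<and> b]\<rangle>| \<le> |b| (\<parallel>M(a)\<parallel> + C r\<^sup>2)\<close>
  (\<open>constant_test_estimate\<close>).  The operators \<open>ad x\<close> are skew, so suitable \<open>b\<close> turn this into
  \<open>|[c\<^sub>i, F0]| \<le> C \<parallel>M(a)\<parallel>\<close>.

  The functional itself is at most \<open>|F0|\<^sup>2 + C r\<^sup>2\<close> (\<open>E_gf_bound\<close>).  If the bracket vanishes, this gives the
  exponent \<open>1/2\<close>.  Otherwise \<open>|F0|\<^sup>3\<^sup>/\<^sup>2\<close> has to be bounded by \<open>\<parallel>M(a)\<parallel>\<close>, which is the inequality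
  \<open>|[x, y]|\<^sup>3\<^sup>/\<^sup>2 \<le> C max (|[x, [x, y]]|, |[y, [x, y]]|)\<close> (\<open>bracket_lojasiewicz\<close>).  By homogeneity it says that
  \<open>H = [x, y]\<close> of norm one cannot nearly commute with both \<open>x\<close> and \<open>y\<close>.  If it did so along a sequence,
  let \<open>K\<close> be a limit of such \<open>H\<close>.  An isometric automorphism \<open>\<tau>\<close> that maximises \<open>\<langle>\<tau> H, K\<rangle>\<close> makes \<open>\<tau> H\<close>
  commute with \<open>K\<close> (\<open>commuting_conjugate\<close>).  So one may assume that \<open>[H, K] = 0\<close>; then the components of
  \<open>x\<close> and \<open>y\<close> in the range of \<open>ad K\<close> are small, because \<open>ad H\<close> is near \<open>ad K\<close> and bounded below there.
  But \<open>\<langle>H, K\<rangle>\<close> depends only on these components, and it is close to one.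

  The exponent \<open>3/4\<close> is optimal since on the constant fields \<open>t u\<close> the functional is of order \<open>t\<^sup>4\<close> and the
  gradient of order \<open>t\<^sup>3\<close> (\<open>exponent_lower_bound\<close>).

  The calculus on the torus starts from one formula: \<open>f (x + y) - f x\<close> is the integral of the weak
  derivative of \<open>f\<close> along the segment from \<open>x\<close> to \<open>x + y\<close>, for almost all \<open>x\<close> (\<open>W1_segment\<close>).  Poincare's and
  Morrey's inequalities and the convergence of difference quotients follow from it by averaging.
\<close>

(* Points of the plane are treated as vectors; splitting them into coordinates would only hide
   the translations. *)
declare split_paired_All [simp del] split_paired_Ex [simp del]

section \<open>Trigonometric test functions\<close>

text \<open>
  The test functions are taken from a class that is visibly closed under derivatives and translations.
  The exponential is admitted because iterating it yields bounded pointwise approximations of indicator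
  functions, without any construction of bump functions.
\<close>

inductive trigexp :: "(real \<times> real \<Rightarrow> real) \<Rightarrow> bool" where
  const: "trigexp (\<lambda>_. c)"
| cos: "e \<in> Basis \<Longrightarrow> trigexp (\<lambda>x. cos (2 * pi * (x \<bullet> e - m)))"
| add: "trigexp f \<Longrightarrow> trigexp g \<Longrightarrow> trigexp (\<lambda>x. f x + g x)"
| mult: "trigexp f \<Longrightarrow> trigexp g \<Longrightarrow> trigexp (\<lambda>x. f x * g x)"
| exp: "trigexp f \<Longrightarrow> trigexp (\<lambda>x. exp (f x))"

lemma trigexp_has_derivative:
  assumes "trigexp f"
  shows "\<exists>f'. (\<forall>x. (f has_derivative f' x) (at x)) \<and> (\<forall>v. trigexp (\<lambda>x. f' x v))"
  using assms
proof induction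
  case (const c)
  show ?case by (intro exI[of _ "\<lambda>_ _. 0"]) (auto intro: trigexp.const)
next
  case (cos e m)
  (* a sine is a cosine of shifted phase, so that derivatives stay in the class *)
  have "cos (2 * pi * (x \<bullet> e - (m - 1/4))) = - sin (2 * pi * (x \<bullet> e - m))" for x
    using cos_add[of "2 * pi * (x \<bullet> e - m)" "pi / 2"] by (simp add: algebra_simps)
  then have s: "sin (2 * pi * (x \<bullet> e - m)) = - cos (2 * pi * (x \<bullet> e - (m - 1/4)))" for x
    by (metis add.inverse_inverse)
  have "trigexp (\<lambda>x. cos (2 * pi * (x \<bullet> e - (m - 1/4))) * (2 * pi * (v \<bullet> e)))" for v
    by (intro trigexp.mult trigexp.const trigexp.cos cos)
  then have "trigexp (\<lambda>x. - sin (2 * pi * (x \<bullet> e - m)) * (2 * pi * (v \<bullet> e)))" for v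
    by (simp only: s minus_minus)
  moreover have "((\<lambda>x. cos (2 * pi * (x \<bullet> e - m))) has_derivative
      (\<lambda>v. - sin (2 * pi * (x \<bullet> e - m)) * (2 * pi * (v \<bullet> e)))) (at x)" for x
    by (auto intro!: derivative_eq_intros)
  ultimately show ?case
    by (intro exI[of _ "\<lambda>x v. - sin (2 * pi * (x \<bullet> e - m)) * (2 * pi * (v \<bullet> e))"]) simp
next
  case (add f g)
  then obtain f' g' where "\<forall>x. (f has_derivative f' x) (at x)" "\<forall>v. trigexp (\<lambda>x. f' x v)"
    "\<forall>x. (g has_derivative g' x) (at x)" "\<forall>v. trigexp (\<lambda>x. g' x v)" by blast
  then show ?case
    by (intro exI[of _ "\<lambda>x v. f' x v + g' x v"]) (auto intro!: derivative_eq_intros trigexp.add)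
next
  case (mult f g)
  then obtain f' g' where "\<forall>x. (f has_derivative f' x) (at x)" "\<forall>v. trigexp (\<lambda>x. f' x v)"
    "\<forall>x. (g has_derivative g' x) (at x)" "\<forall>v. trigexp (\<lambda>x. g' x v)" by blast
  then show ?case using mult.hyps
    by (intro exI[of _ "\<lambda>x v. f x * g' x v + f' x v * g x"])
       (auto intro!: trigexp.add trigexp.mult has_derivative_mult)
next
  case (exp f)
  then obtain f' where "\<forall>x. (f has_derivative f' x) (at x)" "\<forall>v. trigexp (\<lambda>x. f' x v)" by blast
  then show ?case using exp.hyps
    by (intro exI[of _ "\<lambda>x v. exp (f x) * f' x v"])
       (auto intro!: derivative_eq_intros trigexp.mult trigexp.exp)
qed

lemma trigexp_differentiable: "trigexp f \<Longrightarrow> f differentiable (at x)"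
  using trigexp_has_derivative unfolding differentiable_def by blast

lemma trigexp_frechet: "trigexp f \<Longrightarrow> trigexp (\<lambda>x. frechet_derivative f (at x) v)"
proof -
  assume "trigexp f"
  then obtain f' where f': "\<And>x. (f has_derivative f' x) (at x)" "\<And>v. trigexp (\<lambda>x. f' x v)"
    using trigexp_has_derivative by blast
  have "frechet_derivative f (at x) = f' x" for x
    using frechet_derivative_at[OF f'(1)] by simp
  then show ?thesis using f'(2) by simp
qed

lemma trigexp_continuous: "trigexp f \<Longrightarrow> continuous_on UNIV f"
  using trigexp_differentiable differentiable_imp_continuous_within
  by (metis continuous_at_imp_continuous_on)

lemma trigexp_smooth:
  assumes "trigexp f" shows "smooth_on UNIV f"
proof -
  have "trigexp f \<Longrightarrow> Ck_on k UNIV f" for k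
    by (induction k arbitrary: f)
       (simp_all add: trigexp_continuous trigexp_differentiable trigexp_frechet)
  then show ?thesis using assms by (simp add: smooth_on_def)
qed

lemma trigexp_periodic: "trigexp f \<Longrightarrow> periodic f"
proof (induction rule: trigexp.induct)
  case (cos e m)
  have "cos (2 * pi * ((x + b) \<bullet> e - m)) = cos (2 * pi * (x \<bullet> e - m))" if "b \<in> Basis" for x b
  proof (cases "b = e")
    case True
    then have "2 * pi * ((x + b) \<bullet> e - m) = 2 * pi * (x \<bullet> e - m) + 2 * pi"
      using cos by (simp add: algebra_simps)
    then show ?thesis by (simp only: cos_periodic)
  next
    case False
    then show ?thesis using cos that by (simp add: inner_add_left inner_not_same_Basis)
  qed
  then show ?case by (simp add: periodic_def)
qed (auto simp: periodic_def)

lemma trigexp_bounded: "trigexp f \<Longrightarrow> \<exists>K. \<forall>x. \<bar>f x\<bar> \<le> K"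
proof (induction rule: trigexp.induct)
  case (cos e m) show ?case by (auto intro!: exI[of _ 1])
next
  case (add f g)
  then obtain K L where "\<forall>x. \<bar>f x\<bar> \<le> K" "\<forall>x. \<bar>g x\<bar> \<le> L" by blast
  then show ?case by (intro exI[of _ "K + L"] allI order_trans[OF abs_triangle_ineq add_mono]) auto
next
  case (mult f g)
  then obtain K L where "\<forall>x. \<bar>f x\<bar> \<le> K" "\<forall>x. \<bar>g x\<bar> \<le> L" by blast
  then show ?case by (intro exI[of _ "K * L"] allI) (simp add: abs_mult mult_mono')
next
  case (exp f)
  then obtain K where "\<forall>x. \<bar>f x\<bar> \<le> K" by blast
  then show ?case by (intro exI[of _ "exp K"]) (auto simp: abs_le_iff)
qed auto

lemma trigexp_translate: "trigexp f \<Longrightarrow> trigexp (\<lambda>x. f (x + y))"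
proof (induction rule: trigexp.induct)
  case (cos e m)
  have "trigexp (\<lambda>x. cos (2 * pi * (x \<bullet> e - (m - y \<bullet> e))))" by (intro trigexp.cos cos)
  then show ?case by (simp add: inner_add_left algebra_simps)
qed (auto intro: trigexp.intros)

lemma trigexp_measurable: "trigexp f \<Longrightarrow> f \<in> borel_measurable borel"
  by (simp add: borel_measurable_continuous_onI trigexp_continuous)

section \<open>Translation invariance on the torus\<close>

definition cell :: "real \<times> real \<Rightarrow> real \<times> real" where
  "cell x = (frac (fst x), frac (snd x))"

lemma borel_measurable_fst_snd [measurable]:
  "(fst :: real \<times> real \<Rightarrow> real) \<in> borel_measurable borel"
  "(snd :: real \<times> real \<Rightarrow> real) \<in> borel_measurable borel"
  by (simp_all add: borel_measurable_continuous_onI continuous_on_fst continuous_on_snd)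

lemma cell_measurable [measurable]: "cell \<in> borel_measurable borel"
  unfolding cell_def frac_def by (intro borel_measurable_Pair borel_measurable_diff) measurable

lemma periodic_int:
  assumes "periodic f" shows "f (x + (of_int i, of_int j)) = f x"
proof -
  have 1: "f (x + (1, 0)) = f x" and 2: "f (x + (0, 1)) = f x" for x
    using assms unfolding periodic_def by (metis (no_types) Basis_prod_def insertI1 UnI1 UnI2 Basis_real_def image_insert)+
  have 3: "f (x + (of_int i, 0)) = f x" for x i
  proof (induction i arbitrary: x rule: int_induct[where k=0])
    case (step1 i)
    show ?case using step1(2)[of x] 1[of "x + (of_int i, 0)"] by (cases x) (simp add: add.commute add.left_commute)
  next
    case (step2 i)
    show ?case using step2(2)[of x] 1[of "x + (of_int (i - 1), 0)"] by (simp add: add.assoc)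
  qed (simp add: zero_prod_def[symmetric])
  have 4: "f (x + (0, of_int i)) = f x" for x i
  proof (induction i arbitrary: x rule: int_induct[where k=0])
    case (step1 i)
    show ?case using step1(2)[of x] 2[of "x + (0, of_int i)"] by (simp add: add.assoc)
  next
    case (step2 i)
    show ?case using step2(2)[of x] 2[of "x + (0, of_int (i - 1))"] by (simp add: add.assoc)
  qed (simp add: zero_prod_def[symmetric])
  show ?thesis using 3[of x i] 4[of "x + (of_int i, 0)" j] by (simp add: add.assoc)
qed

lemma periodic_cell: "periodic f \<Longrightarrow> f (cell x) = f x"
  using periodic_int[of f "cell x" "\<lfloor>fst x\<rfloor>" "\<lfloor>snd x\<rfloor>"]
  by (simp add: cell_def frac_def prod_eq_iff)

lemma cell_periodic: "periodic (\<lambda>x. h (cell x))"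
  by (auto simp: periodic_def cell_def Basis_prod_def frac_def)

lemma space_torus [simp]: "space torus = cbox (0, 0) (1, 1)"
  by (simp add: torus_def space_restrict_space)

lemma measurable_torus [measurable_dest, intro]:
  "f \<in> measurable borel N \<Longrightarrow> f \<in> measurable torus N"
  unfolding torus_def by (rule measurable_restrict_space1) (simp add: measurable_lborel1)

lemma emeasure_torus: "emeasure torus (space torus) = 1"
  by (simp add: torus_def emeasure_restrict_space space_restrict_space emeasure_lborel_cbox_eq Basis_prod_def)

interpretation torus: finite_measure torus
  by (rule finite_measureI) (simp add: emeasure_torus del: space_torus)

lemma measure_torus [simp]: "measure torus (cbox (0,0) (1,1)) = 1"
  using emeasure_torus by (simp add: measure_def)

lemma nn_integral_torus:
  "f \<in> borel_measurable borel \<Longrightarrow>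
    (\<integral>\<^sup>+x. f x \<partial>torus) = (\<integral>\<^sup>+x. f x * indicator ({0..<1} \<times> {0..<1}) x \<partial>lborel)"
proof -
  assume f: "f \<in> borel_measurable borel"
  have 0: "emeasure lborel (cbox (0,0) (1,1) - box (0,0) (1::real,1::real)) = 0"
    by (subst emeasure_Diff) (auto simp: emeasure_lborel_cbox_eq emeasure_lborel_box_eq Basis_prod_def box_subset_cbox)
  have "AE x in lborel. x \<notin> cbox (0,0) (1,1) - box (0,0) (1::real,1::real)"
    by (rule AE_not_in) (simp add: null_setsI 0)
  then have "AE x in lborel. f x * indicator (cbox (0,0) (1,1)) x = f x * indicator ({0..<1} \<times> {0..<1}) x"
    by eventually_elim (auto simp: indicator_def box_def cbox_def Basis_prod_def less_eq_real_def)
  then show ?thesis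
    unfolding torus_def by (subst nn_integral_restrict_space) (auto intro: nn_integral_cong_AE)
qed

lemma nn_integral_translate:
  fixes f :: "'a::euclidean_space \<Rightarrow> ennreal"
  assumes "f \<in> borel_measurable borel"
  shows "(\<integral>\<^sup>+x. f (x + y) \<partial>lborel) = (\<integral>\<^sup>+x. f x \<partial>lborel)"
proof -
  have "(\<integral>\<^sup>+x. f x \<partial>lborel) = (\<integral>\<^sup>+x. f x \<partial>distr lborel borel ((+) y))"
    by (simp add: lborel_distr_plus)
  also have "\<dots> = (\<integral>\<^sup>+x. f (x + y) \<partial>lborel)"
    using assms by (subst nn_integral_distr) (auto simp: add.commute)
  finally show ?thesis by simp
qed

lemma cell_tiling:
  "(\<integral>\<^sup>+k. indicator ({0..<1} \<times> {0..<1}) (x + (of_int (fst k), of_int (snd k)) :: real \<times> real)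
     \<partial>count_space UNIV) = 1"
proof -
  have "(0 \<le> t + of_int i \<and> t + of_int i < 1) \<longleftrightarrow> i = - \<lfloor>t\<rfloor>" for t :: real and i
    by linarith
  then have "indicator ({0..<1} \<times> {0..<1}) (x + (of_int (fst k), of_int (snd k)) :: real \<times> real)
     = (indicator {(- \<lfloor>fst x\<rfloor>, - \<lfloor>snd x\<rfloor>)} k :: ennreal)" for k
    by (cases x; cases k) (auto simp: indicator_def)
  then show ?thesis by simp
qed

text \<open>
  The translated unit square is cut along the lattice, and each piece is moved back into the unit square
  by a lattice vector, under which \<open>f\<close> is invariant.
\<close>

lemma nn_integral_torus_shift:
  assumes [measurable]: "f \<in> borel_measurable borel" and per: "periodic f"
  shows "(\<integral>\<^sup>+x. f (x + y) \<partial>torus) = (\<integral>\<^sup>+x. f x \<partial>torus)"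
proof -
  let ?Q = "{0..<1} \<times> {0..<1} :: (real \<times> real) set"
  let ?i = "indicator ?Q :: _ \<Rightarrow> ennreal"
  let ?k = "\<lambda>k::int \<times> int. (of_int (fst k), of_int (snd k)) :: real \<times> real"
  have Q[measurable]: "?Q \<in> sets borel" by (simp add: borel_Times)
  have "(\<integral>\<^sup>+x. f (x + y) \<partial>torus) = (\<integral>\<^sup>+x. f (x + y) * ?i (x + y - y) \<partial>lborel)"
    by (subst nn_integral_torus) auto
  also have "\<dots> = (\<integral>\<^sup>+x. f x * ?i (x - y) \<partial>lborel)"
    by (rule nn_integral_translate[of "\<lambda>x. f x * ?i (x - y)"]) measurable
  also have "\<dots> = (\<integral>\<^sup>+x. (\<integral>\<^sup>+k. f x * ?i (x - y) * ?i (x + ?k k) \<partial>count_space UNIV) \<partial>lborel)"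
    by (simp add: nn_integral_cmult cell_tiling)
  also have "\<dots> = (\<integral>\<^sup>+k. (\<integral>\<^sup>+x. f x * ?i (x - y) * ?i (x + ?k k) \<partial>lborel) \<partial>count_space UNIV)"
    by (rule nn_integral_count_space_nn_integral) auto
  also have "\<dots> = (\<integral>\<^sup>+k. (\<integral>\<^sup>+x. f (x - ?k k) * ?i ((x - ?k k) - y) * ?i (x - ?k k + ?k k) \<partial>lborel) \<partial>count_space UNIV)"
  proof (rule nn_integral_cong)
    fix k
    show "(\<integral>\<^sup>+x. f x * ?i (x - y) * ?i (x + ?k k) \<partial>lborel) =
          (\<integral>\<^sup>+x. f (x - ?k k) * ?i ((x - ?k k) - y) * ?i (x - ?k k + ?k k) \<partial>lborel)"
      using nn_integral_translate[of "\<lambda>x. f x * ?i (x - y) * ?i (x + ?k k)" "- ?k k"]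
      unfolding add_uminus_conv_diff by simp
  qed
  also have "\<dots> = (\<integral>\<^sup>+k. (\<integral>\<^sup>+x. f x * ?i x * ?i ((x - y) + ?k (- fst k, - snd k)) \<partial>lborel) \<partial>count_space UNIV)"
  proof -
    have "f (x - ?k k) = f x" for x k
      using periodic_int[OF per, of x "- fst k" "- snd k"] by (simp add: prod_eq_iff diff_conv_add_uminus del: add_uminus_conv_diff)
    then show ?thesis by (intro nn_integral_cong) (auto simp: algebra_simps minus_prod_def)
  qed
  also have "\<dots> = (\<integral>\<^sup>+k. (\<integral>\<^sup>+x. f x * ?i x * ?i ((x - y) + ?k k) \<partial>lborel) \<partial>count_space UNIV)"
    by (rule nn_integral_bij_count_space[where g="\<lambda>k. (- fst k, - snd k)"])
       (auto intro!: bij_betw_byWitness[where f'="\<lambda>k. (- fst k, - snd k)"])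
  also have "\<dots> = (\<integral>\<^sup>+x. (\<integral>\<^sup>+k. f x * ?i x * ?i ((x - y) + ?k k) \<partial>count_space UNIV) \<partial>lborel)"
    by (rule nn_integral_count_space_nn_integral[symmetric]) auto
  also have "\<dots> = (\<integral>\<^sup>+x. f x * ?i x \<partial>lborel)"
    by (simp add: nn_integral_cmult cell_tiling)
  also have "\<dots> = (\<integral>\<^sup>+x. f x \<partial>torus)"
    by (subst nn_integral_torus) auto
  finally show ?thesis .
qed

text \<open>
  In terms of the image measure under \<open>cell\<close>, invariance passes from non-negative functions to vector-valued
  ones.
\<close>

lemma distr_torus_shift: "distr torus borel (\<lambda>x. cell (x + y)) = distr torus borel cell"
proof (rule measure_eqI)
  fix A assume "A \<in> sets (distr torus borel (\<lambda>x. cell (x + y)))"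
  then have [measurable]: "A \<in> sets borel" by simp
  have *: "emeasure (distr torus borel g) A = (\<integral>\<^sup>+x. indicator A (g x) \<partial>torus)"
    if "g \<in> borel_measurable borel" for g
    using that by (subst nn_integral_distr[symmetric]) (auto simp: measurable_torus)
  have "periodic (\<lambda>x. indicator A (cell x) :: ennreal)" by (rule cell_periodic)
  then have "(\<integral>\<^sup>+x. indicator A (cell (x + y)) \<partial>torus) = (\<integral>\<^sup>+x. (indicator A (cell x) :: ennreal) \<partial>torus)"
    by (intro nn_integral_torus_shift) measurable
  then show "emeasure (distr torus borel (\<lambda>x. cell (x + y))) A = emeasure (distr torus borel cell) A"
    by (simp add: *)
qed simp

lemma integral_torus_shift:
  fixes f :: "real \<times> real \<Rightarrow> 'b::{banach, second_countable_topology}"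
  assumes [measurable]: "f \<in> borel_measurable borel" and per: "periodic f"
  shows "(LINT x|torus. f (x + y)) = (LINT x|torus. f x)"
    and "integrable torus (\<lambda>x. f (x + y)) \<longleftrightarrow> integrable torus f"
proof -
  have "(LINT x|torus. f (x + y)) = (LINT x|torus. f (cell (x + y)))" by (simp add: periodic_cell per)
  also have "\<dots> = (LINT x|distr torus borel (\<lambda>x. cell (x + y)). f x)"
    by (subst integral_distr) (auto intro: measurable_torus)
  also have "\<dots> = (LINT x|torus. f x)"
    unfolding distr_torus_shift by (subst integral_distr) (auto intro: measurable_torus simp: periodic_cell per)
  finally show "(LINT x|torus. f (x + y)) = (LINT x|torus. f x)" .
  have "integrable torus (\<lambda>x. f (x + y)) \<longleftrightarrow> integrable torus (\<lambda>x. f (cell (x + y)))" by (simp add: periodic_cell per)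
  also have "\<dots> \<longleftrightarrow> integrable (distr torus borel (\<lambda>x. cell (x + y))) f"
    by (subst integrable_distr_eq) (auto intro: measurable_torus)
  also have "\<dots> \<longleftrightarrow> integrable torus f"
    unfolding distr_torus_shift by (subst integrable_distr_eq) (auto intro: measurable_torus simp: periodic_cell per)
  finally show "integrable torus (\<lambda>x. f (x + y)) \<longleftrightarrow> integrable torus f" .
qed

section \<open>Test functions determine integrable functions\<close>

text \<open>
  The outer exponential makes the limit at \<open>t = 0\<close> equal to \<open>0\<close>, so that the limit is an indicator function
  without exceptional points.
\<close>

lemma double_exp_limit:
  fixes t :: real
  shows "(\<lambda>n. exp (- (real n * exp (- (real n * t))))) \<longlonglongrightarrow> (if t > 0 then 1 else 0)"
proof (cases "t > 0")
  case True
  have "(\<lambda>n. real n * exp (- t) ^ n) \<longlonglongrightarrow> 0"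
    using True by (intro powser_times_n_limit_0) auto
  then have "(\<lambda>n. real n * exp (- (real n * t))) \<longlonglongrightarrow> 0"
    by (simp add: exp_of_nat_mult[symmetric])
  from tendsto_exp[OF tendsto_minus[OF this]] show ?thesis using True by simp
next
  case False
  have lim: "(\<lambda>n. exp (- 1) ^ n) \<longlonglongrightarrow> (0::real)" by (rule LIMSEQ_power_zero) simp
  have le: "exp (- (real n * exp (- (real n * t)))) \<le> exp (- 1) ^ n" for n
  proof -
    have "0 \<le> - (real n * t)" using False by (simp add: mult_nonneg_nonpos)
    then have "real n * 1 \<le> real n * exp (- (real n * t))"
      by (intro mult_left_mono) (simp_all only: one_le_exp_iff of_nat_0_le_iff)
    then have "exp (- (real n * exp (- (real n * t)))) \<le> exp (real n * (- 1))" by simp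
    then show ?thesis by (simp only: exp_of_nat_mult)
  qed
  have "(\<lambda>n. exp (- (real n * exp (- (real n * t))))) \<longlonglongrightarrow> 0"
  proof (rule tendsto_sandwich)
    show "\<forall>\<^sub>F n in sequentially. exp (- (real n * exp (- (real n * t)))) \<le> exp (- 1) ^ n"
      by (intro always_eventually allI le)
    show "\<forall>\<^sub>F n in sequentially. 0 \<le> exp (- (real n * exp (- (real n * t))))" by simp
  qed (rule tendsto_const lim)+
  then show ?thesis using False by simp
qed

text \<open>
  The arc \<open>(a, 1)\<close> of the circle consists of the points where the cosine centred at its midpoint exceeds the
  value at its end points.
\<close>

lemma arc_cos_iff:
  fixes a t :: real
  assumes a: "0 \<le> a" "a < 1"
  shows "cos (2 * pi * (t - (1 + a) / 2)) > cos (pi * (1 - a)) \<longleftrightarrow> a < frac t"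
proof -
  define s where "s = frac t"
  define d where "d = 2 * pi * \<bar>s - (1 + a) / 2\<bar>"
  have s: "0 \<le> s" "s < 1" by (auto simp: s_def frac_lt_1)
  have "2 * pi * (t - (1 + a) / 2) = 2 * pi * (s - (1 + a) / 2) + 2 * of_int \<lfloor>t\<rfloor> * pi"
    by (simp add: s_def frac_def algebra_simps)
  then have "cos (2 * pi * (t - (1 + a) / 2)) = cos (2 * pi * (s - (1 + a) / 2) + 2 * of_int \<lfloor>t\<rfloor> * pi)"
    by simp
  also have "\<dots> = cos (2 * pi * (s - (1 + a) / 2))"
    using sin_times_pi_eq_0[of "2 * of_int \<lfloor>t\<rfloor>"] cos_int_2pin[of "\<lfloor>t\<rfloor>"] sin_int_2pin[of "\<lfloor>t\<rfloor>"]
    by (simp add: cos_add mult_ac)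
  also have "\<dots> = cos \<bar>2 * pi * (s - (1 + a) / 2)\<bar>" by (simp only: cos_abs_real)
  also have "\<dots> = cos d" by (simp add: d_def abs_mult)
  finally have c: "cos (2 * pi * (t - (1 + a) / 2)) = cos d" .
  show ?thesis
  proof (cases "a < s")
    case True
    then have "\<bar>s - (1 + a) / 2\<bar> < (1 - a) / 2" using s by (auto simp: abs_if field_simps)
    then have "d < pi * (1 - a)"
      using mult_strict_left_mono[of "\<bar>s - (1 + a) / 2\<bar>" "(1 - a) / 2" "2 * pi"] by (simp add: d_def)
    moreover have "pi * (1 - a) \<le> pi" using a by (simp add: mult_left_le)
    moreover have "0 \<le> d" by (simp add: d_def)
    ultimately have "cos d > cos (pi * (1 - a))" by (intro cos_monotone_0_pi)
    then show ?thesis using True c by (simp add: s_def)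
  next
    case False
    have e: "\<bar>s - (1 + a) / 2\<bar> = (1 + a) / 2 - s" using False a by (simp add: field_simps)
    have d1: "pi * (1 - a) \<le> d"
      using mult_left_mono[of "(1 - a) / 2" "(1 + a) / 2 - s" "2 * pi"] False
      unfolding d_def e by (simp add: field_simps)
    have d2: "d \<le> 2 * pi - pi * (1 - a)"
      using s mult_left_mono[of "(1 + a) / 2 - s" "(1 + a) / 2" "2 * pi"]
      unfolding d_def e by (simp add: field_simps)
    have p: "0 \<le> pi * (1 - a)" using a by simp
    have "cos d \<le> cos (pi * (1 - a))"
    proof (cases "d \<le> pi")
      case True then show ?thesis using d1 p by (intro cos_monotone_0_pi_le)
    next
      case False
      then have "cos (2 * pi - d) \<le> cos (pi * (1 - a))" using d2 p by (intro cos_monotone_0_pi_le) auto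
      then show ?thesis by (simp add: cos_diff)
    qed
    then show ?thesis using False c by (simp add: s_def)
  qed
qed

lemma trigexp_approximates_arc:
  assumes e: "e \<in> Basis"
  shows "\<exists>g::nat \<Rightarrow> _. (\<forall>n. trigexp (g n)) \<and> (\<forall>n x. \<bar>g n x\<bar> \<le> 1) \<and>
    (\<forall>x. (\<lambda>n. g n x) \<longlonglongrightarrow> (if a < frac (x \<bullet> e) then 1 else 0))"
proof -
  consider "a < 0" | "a \<ge> 1" | "0 \<le> a" "a < 1" by linarith
  then show ?thesis
  proof cases
    case 1
    then have "a < frac t" for t :: real using frac_ge_0[of t] by linarith
    then show ?thesis by (intro exI[of _ "\<lambda>_ _. 1"]) (auto intro: trigexp.const)
  next
    case 2
    then have "\<not> a < frac t" for t :: real using frac_lt_1[of t] by linarith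
    then show ?thesis by (intro exI[of _ "\<lambda>_ _. 0"]) (auto intro: trigexp.const)
  next
    case 3
    define h where "h x = cos (2 * pi * (x \<bullet> e - (1 + a) / 2)) + - cos (pi * (1 - a))" for x :: "real \<times> real"
    have h: "trigexp h" unfolding h_def by (intro trigexp.intros e)
    define g where "g n x = exp ((- real n) * exp ((- real n) * h x))" for n :: nat and x
    have "trigexp (g n)" for n unfolding g_def by (intro trigexp.exp trigexp.mult trigexp.const h)
    moreover have "\<bar>g n x\<bar> \<le> 1" for n x by (simp add: g_def)
    moreover have "(\<lambda>n. g n x) \<longlonglongrightarrow> (if a < frac (x \<bullet> e) then 1 else 0)" for x
      using double_exp_limit[of "h x"] arc_cos_iff[OF 3, of "x \<bullet> e"] by (simp add: g_def h_def)
    ultimately show ?thesis by blast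
  qed
qed

text \<open>
  The sets \<open>{x. a < x}\<close> generate the Borel sets and are stable under intersection.  On the unit cell their
  indicators are limits of products of the functions from \<open>trigexp_approximates_arc\<close>, and Dynkin's
  induction extends the claim to all Borel sets.
\<close>

lemma trigexp_monotone_class:
  assumes tr: "\<And>f. trigexp f \<Longrightarrow> C f"
    and add: "\<And>f g. C f \<Longrightarrow> C g \<Longrightarrow> C (\<lambda>x. f x + g x)"
    and diff: "\<And>f g. C f \<Longrightarrow> C g \<Longrightarrow> C (\<lambda>x. f x - g x)"
    and lim: "\<And>f g K. (\<And>n::nat. C (f n)) \<Longrightarrow> (\<And>n x. \<bar>f n x\<bar> \<le> K) \<Longrightarrow>
               (\<And>x. (\<lambda>n. f n x) \<longlonglongrightarrow> g x) \<Longrightarrow> C g"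
    and A: "A \<in> sets borel"
  shows "C (\<lambda>x. indicator A (cell x) :: real)"
proof -
  let ?H = "\<lambda>a. {x :: real \<times> real. eucl_less a x}"
  have H: "?H a = {x. fst a < fst x \<and> snd a < snd x}" for a
    by (auto simp: eucl_less_def Basis_prod_def inner_prod_def)
  have A': "A \<in> sigma_sets UNIV (range ?H)"
    using A by (subst (asm) borel_eq_greaterThan) simp
  have Int: "Int_stable (range ?H)"
  proof (rule Int_stableI, safe)
    fix a b
    have "?H a \<inter> ?H b = ?H (max (fst a) (fst b), max (snd a) (snd b))" by (auto simp: H)
    then show "?H a \<inter> ?H b \<in> range ?H" by blast
  qed
  have "range ?H \<subseteq> Pow UNIV" by simp
  from Int this A' show ?thesis
  proof (induction rule: sigma_sets_induct_disjoint)
    case (basic B)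
    then obtain a where a: "B = ?H a" by blast
    have B: "(1, 0) \<in> (Basis :: (real \<times> real) set)" "(0, 1) \<in> (Basis :: (real \<times> real) set)"
      by (simp_all add: Basis_prod_def)
    obtain g1 :: "nat \<Rightarrow> real \<times> real \<Rightarrow> real" where g1: "\<forall>n. trigexp (g1 n)" "\<forall>n x. \<bar>g1 n x\<bar> \<le> 1"
      and l1: "\<forall>x. (\<lambda>n. g1 n x) \<longlonglongrightarrow> (if fst a < frac (x \<bullet> (1,0)) then 1 else 0)"
      using trigexp_approximates_arc[OF B(1), of "fst a"] by blast
    obtain g2 :: "nat \<Rightarrow> real \<times> real \<Rightarrow> real" where g2: "\<forall>n. trigexp (g2 n)" "\<forall>n x. \<bar>g2 n x\<bar> \<le> 1"
      and l2: "\<forall>x. (\<lambda>n. g2 n x) \<longlonglongrightarrow> (if snd a < frac (x \<bullet> (0,1)) then 1 else 0)"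
      using trigexp_approximates_arc[OF B(2), of "snd a"] by blast
    show ?case
    proof (rule lim[of "\<lambda>n x. g1 n x * g2 n x" 1])
      show "C (\<lambda>x. g1 n x * g2 n x)" for n using g1(1) g2(1) by (intro tr trigexp.mult) auto
      show "\<bar>g1 n x * g2 n x\<bar> \<le> 1" for n x
        using g1(2)[rule_format, of n x] g2(2)[rule_format, of n x] mult_le_one[of "\<bar>g1 n x\<bar>" "\<bar>g2 n x\<bar>"] by (simp add: abs_mult)
      show "(\<lambda>n. g1 n x * g2 n x) \<longlonglongrightarrow> indicator B (cell x)" for x
        using tendsto_mult[OF l1[rule_format, of x] l2[rule_format, of x]]
        unfolding a H by (auto simp: indicator_def cell_def inner_prod_def)
    qed
  next
    case empty show ?case using tr[OF trigexp.const[of 0]] by simp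
  next
    case (compl B)
    have "C (\<lambda>x. 1 - indicator B (cell x))" by (intro diff compl tr trigexp.const)
    moreover have "(\<lambda>x. 1 - indicator B (cell x)) = (\<lambda>x. indicator (UNIV - B) (cell x) :: real)"
      by (auto simp: indicator_def)
    ultimately show ?case by simp
  next
    case (union B)
    let ?f = "\<lambda>n x. \<Sum>i<n. indicator (B i) (cell x) :: real"
    have dis: "i \<noteq> j \<Longrightarrow> B i \<inter> B j = {}" for i j using union.hyps(1) by (simp add: disjoint_family_on_def)
    show ?case
    proof (rule lim[of ?f 1])
      show "C (?f n)" for n
      proof (induction n)
        case 0 show ?case using tr[OF trigexp.const[of 0]] by simp
      next
        case (Suc n) then show ?case using add[OF Suc union.IH[of n]] by simp
      qed
      show "(\<lambda>n. ?f n x) \<longlonglongrightarrow> indicator (\<Union> (range B)) (cell x)" for x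
        using indicator_sums[of B "cell x"] dis by (simp add: sums_def)
      show "\<bar>?f n x\<bar> \<le> 1" for n x
      proof -
        have "?f n x = indicator (\<Union>i<n. B i) (cell x)"
          using union.hyps(1) by (subst indicator_UN_disjoint) (auto simp: disjoint_family_on_def)
        then show ?thesis by (simp add: indicator_def)
      qed
    qed
  qed
qed

lemma integrable_bounded_mult:
  fixes g :: "'a \<Rightarrow> 'b::{banach, second_countable_topology}"
  assumes "integrable M g" "h \<in> borel_measurable M" and K: "\<And>x. \<bar>h x\<bar> \<le> K"
  shows "integrable M (\<lambda>x. h x *\<^sub>R g x)"
proof (rule Bochner_Integration.integrable_bound)
  show "integrable M (\<lambda>x. K * norm (g x))" using assms(1) by simp
  show "(\<lambda>x. h x *\<^sub>R g x) \<in> borel_measurable M" using assms(1,2) by simp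
  have "norm (h x *\<^sub>R g x) \<le> norm (K * norm (g x))" for x
  proof -
    have "norm (h x *\<^sub>R g x) \<le> K * norm (g x)"
      using mult_right_mono[OF K[of x], of "norm (g x)"] by simp
    also have "\<dots> \<le> norm (K * norm (g x))" by (simp only: real_norm_def abs_ge_self)
    finally show ?thesis .
  qed
  then show "AE x in M. norm (h x *\<^sub>R g x) \<le> norm (K * norm (g x))" by (intro AE_I2)
qed

lemma AE_torus_cell: "AE x in torus. cell x = x"
proof -
  have 0: "emeasure lborel (cbox (0,0) (1,1) - box (0,0) (1::real,1::real)) = 0"
    by (subst emeasure_Diff) (auto simp: emeasure_lborel_cbox_eq emeasure_lborel_box_eq Basis_prod_def box_subset_cbox)
  have "AE x in lborel. x \<notin> cbox (0,0) (1,1) - box (0,0) (1::real,1::real)"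
    by (rule AE_not_in) (simp add: null_setsI 0)
  then have "AE x in lborel. x \<in> cbox (0,0) (1::real,1::real) \<longrightarrow> cell x = x"
    by eventually_elim (auto simp: cell_def box_def cbox_def Basis_prod_def prod_eq_iff frac_eq)
  then show ?thesis unfolding torus_def by (subst AE_restrict_space_iff) auto
qed

text \<open>
  The bounded functions orthogonal to \<open>g\<close> are closed under bounded pointwise limits, hence contain all
  indicators by \<open>trigexp_monotone_class\<close>, so that \<open>g\<close> has integral zero over every measurable set.
\<close>

lemma AE_zero_if_orthogonal_to_trigexp:
  fixes g :: "real \<times> real \<Rightarrow> 'b::{banach, second_countable_topology}"
  assumes g: "integrable torus g"
    and orth: "\<And>\<eta>. trigexp \<eta> \<Longrightarrow> (LINT x|torus. \<eta> x *\<^sub>R g x) = 0"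
  shows "AE x in torus. g x = 0"
proof (rule torus.density_zero[OF g])
  have gm[measurable]: "g \<in> borel_measurable torus" using g by auto
  fix A assume "A \<in> sets torus"
  then obtain B where B: "B \<in> sets borel" "A = B \<inter> cbox (0,0) (1,1)"
    by (auto simp: torus_def sets_restrict_space)
  define C where "C h \<longleftrightarrow> h \<in> borel_measurable borel \<and> (\<exists>K. \<forall>x. \<bar>h x\<bar> \<le> K) \<and>
    (LINT x|torus. h x *\<^sub>R g x) = 0" for h :: "real \<times> real \<Rightarrow> real"
  have int: "integrable torus (\<lambda>x. h x *\<^sub>R g x)" if h: "C h" for h
  proof -
    obtain K where K: "\<forall>x. \<bar>h x\<bar> \<le> K" using h unfolding C_def by blast
    have hm: "h \<in> borel_measurable torus" using h unfolding C_def by (blast intro: measurable_torus)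
    show ?thesis by (rule integrable_bounded_mult[OF g hm K[rule_format]])
  qed
  have Cm: "h \<in> borel_measurable borel" and CI: "(LINT x|torus. h x *\<^sub>R g x) = 0" if "C h" for h
    using that unfolding C_def by blast+
  have add_diff: "C (\<lambda>x. f x + h x) \<and> C (\<lambda>x. f x - h x)" if f: "C f" and h: "C h" for f h
  proof -
    obtain K L where K: "\<forall>x. \<bar>f x\<bar> \<le> K" "\<forall>x. \<bar>h x\<bar> \<le> L" using f h unfolding C_def by blast
    have "\<bar>f x + h x\<bar> \<le> K + L" "\<bar>f x - h x\<bar> \<le> K + L" for x using K(1)[rule_format, of x] K(2)[rule_format, of x] by linarith+
    then have ex: "\<exists>K. \<forall>x. \<bar>f x + h x\<bar> \<le> K" "\<exists>K. \<forall>x. \<bar>f x - h x\<bar> \<le> K" by blast+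
    have me: "(\<lambda>x. f x + h x) \<in> borel_measurable borel" "(\<lambda>x. f x - h x) \<in> borel_measurable borel"
      using Cm[OF f] Cm[OF h] by simp_all
    have li: "(LINT x|torus. (f x + h x) *\<^sub>R g x) = 0" "(LINT x|torus. (f x - h x) *\<^sub>R g x) = 0"
      unfolding scaleR_add_left scaleR_diff_left
        Bochner_Integration.integral_add[OF int[OF f] int[OF h]] Bochner_Integration.integral_diff[OF int[OF f] int[OF h]]
      using CI[OF f] CI[OF h] by simp_all
    show ?thesis unfolding C_def
      by (rule conjI[OF conjI[OF me(1) conjI[OF ex(1) li(1)]] conjI[OF me(2) conjI[OF ex(2) li(2)]]])
  qed
  have tr: "C f" if t: "trigexp f" for f
    unfolding C_def by (rule conjI[OF trigexp_measurable[OF t] conjI[OF trigexp_bounded[OF t] orth[OF t]]])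
  have lim: "C h" if f: "\<And>n. C (f n)" and K: "\<And>n x. \<bar>f n x\<bar> \<le> K" and l: "\<And>x. (\<lambda>n. f n x) \<longlonglongrightarrow> h x"
    for f :: "nat \<Rightarrow> real \<times> real \<Rightarrow> real" and h :: "real \<times> real \<Rightarrow> real" and K :: real
  proof -
    have [measurable]: "f n \<in> borel_measurable borel" for n using f[of n] unfolding C_def by (rule conjunct1)
    have [measurable]: "h \<in> borel_measurable borel" by (rule borel_measurable_LIMSEQ_metric[OF _ l]) measurable
    have hb: "\<bar>h x\<bar> \<le> K" for x using tendsto_rabs[OF l[of x]] by (rule LIMSEQ_le_const2) (use K in auto)
    have "(\<lambda>n. LINT x|torus. f n x *\<^sub>R g x) \<longlonglongrightarrow> (LINT x|torus. h x *\<^sub>R g x)"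
    proof (rule integral_dominated_convergence[where w="\<lambda>x. K * norm (g x)"])
      show "(\<lambda>x. h x *\<^sub>R g x) \<in> borel_measurable torus" "(\<lambda>x. f n x *\<^sub>R g x) \<in> borel_measurable torus" for n
        by (intro borel_measurable_scaleR measurable_torus gm; measurable)+
      show "integrable torus (\<lambda>x. K * norm (g x))" using g by simp
      show "AE x in torus. (\<lambda>n. f n x *\<^sub>R g x) \<longlonglongrightarrow> h x *\<^sub>R g x" using l by (intro AE_I2 tendsto_intros)
      show "AE x in torus. norm (f n x *\<^sub>R g x) \<le> K * norm (g x)" for n
        using mult_right_mono[OF K] by (intro AE_I2) simp
    qed
    moreover have "(LINT x|torus. f n x *\<^sub>R g x) = 0" for n using f[of n] unfolding C_def by blast
    ultimately have "(LINT x|torus. h x *\<^sub>R g x) = 0" by (simp add: LIMSEQ_const_iff)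
    moreover have "\<exists>K. \<forall>x. \<bar>h x\<bar> \<le> K" using hb by blast
    ultimately show ?thesis using \<open>h \<in> borel_measurable borel\<close> unfolding C_def by simp
  qed
  have "C (\<lambda>x. indicator B (cell x) :: real)"
    by (rule trigexp_monotone_class[of C, OF tr conjunct1[OF add_diff] conjunct2[OF add_diff] lim B(1)])
  then have "(LINT x|torus. indicator B (cell x) *\<^sub>R g x) = 0" by (simp add: C_def)
  moreover have "AE x in torus. indicat_real A x *\<^sub>R g x = indicat_real B (cell x) *\<^sub>R g x"
    using AE_torus_cell AE_space by eventually_elim (auto simp: B indicator_def)
  then have "(LINT x|torus. indicator A x *\<^sub>R g x) = (LINT x|torus. indicator B (cell x) *\<^sub>R g x)"
  proof (rule integral_cong_AE[rotated 2])
    show "(\<lambda>x. indicat_real A x *\<^sub>R g x) \<in> borel_measurable torus"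
      using \<open>A \<in> sets torus\<close> by measurable
    have "(\<lambda>x. indicat_real B (cell x)) \<in> borel_measurable borel" using B(1) by measurable
    then show "(\<lambda>x. indicat_real B (cell x) *\<^sub>R g x) \<in> borel_measurable torus"
      by (intro borel_measurable_scaleR measurable_torus gm)
  qed
  ultimately show "set_lebesgue_integral torus A g = 0" by (simp add: set_lebesgue_integral_def)
qed

lemma powr_le_1_plus: "0 \<le> (t::real) \<Longrightarrow> 0 \<le> q' \<Longrightarrow> q' \<le> q \<Longrightarrow> t powr q' \<le> 1 + t powr q"
proof (cases "t \<le> 1")
  case True
  assume "0 \<le> t" "0 \<le> q'" "q' \<le> q"
  then have "t powr q' \<le> 1" using True by (simp add: powr_le1)
  then show ?thesis using powr_ge_zero[of t q] by linarith
next
  case False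
  assume "0 \<le> t" "0 \<le> q'" "q' \<le> q"
  then have "t powr q' \<le> t powr q" using False by (intro powr_mono) auto
  then show ?thesis by simp
qed

lemma Lq_mono:
  assumes "Lq q f" "0 \<le> q'" "q' \<le> q" shows "Lq q' f"
proof -
  have [measurable]: "f \<in> borel_measurable borel" using assms by (simp add: Lq_def)
  have "integrable torus (\<lambda>x. norm (f x) powr q')"
    by (rule Bochner_Integration.integrable_bound[of _ "\<lambda>x. 1 + norm (f x) powr q"])
       (use assms in \<open>simp_all add: Lq_def powr_le_1_plus AE_I2 measurable_torus\<close>)
  then show ?thesis using assms by (simp add: Lq_def)
qed

lemma Lq_1:
  fixes f :: "real \<times> real \<Rightarrow> 'b::{banach, second_countable_topology}"
  shows "Lq 1 f \<longleftrightarrow> f \<in> borel_measurable borel \<and> periodic f \<and> integrable torus f"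
proof -
  have "integrable torus (\<lambda>x. norm (f x) powr 1) \<longleftrightarrow> integrable torus f" if f: "f \<in> borel_measurable borel"
    using integrable_norm_iff[OF measurable_torus[OF f]] by simp
  then show ?thesis unfolding Lq_def by blast
qed

lemma Lq_cong_AE:
  assumes "Lq q f" "Lq 1 g" "AE x in torus. f x = g x" shows "Lq q g"
proof -
  have [measurable]: "f \<in> borel_measurable borel" "g \<in> borel_measurable borel"
    using assms by (auto simp: Lq_def)
  have "integrable torus (\<lambda>x. norm (g x) powr q) \<longleftrightarrow> integrable torus (\<lambda>x. norm (f x) powr q)"
  proof (rule integrable_cong_AE)
    show "(\<lambda>x. norm (g x) powr q) \<in> borel_measurable torus" "(\<lambda>x. norm (f x) powr q) \<in> borel_measurable torus"
      by (rule measurable_torus, measurable)+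
    show "AE x in torus. norm (g x) powr q = norm (f x) powr q" using assms(3) by eventually_elim simp
  qed
  then show ?thesis using assms unfolding Lq_def by blast
qed

lemma integrable_trigexp_mult:
  fixes g :: "real \<times> real \<Rightarrow> 'b::{banach, second_countable_topology}"
  assumes "trigexp \<eta>" "integrable torus g"
  shows "integrable torus (\<lambda>x. \<eta> x *\<^sub>R g x)"
proof -
  obtain K where K: "\<forall>x. \<bar>\<eta> x\<bar> \<le> K" using trigexp_bounded assms by blast
  show ?thesis
    by (rule integrable_bounded_mult[OF assms(2) measurable_torus[OF trigexp_measurable[OF assms(1)]] K[rule_format]])
qed

lemma weak_partial_unique:
  fixes f :: "real \<times> real \<Rightarrow> 'b::{banach, second_countable_topology}"
  assumes "Lq 1 g" "has_weak_partial e f g" "Lq 1 g'" "has_weak_partial e f g'"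
  shows "AE x in torus. g x = g' x"
proof -
  have "AE x in torus. g x - g' x = 0"
  proof (rule AE_zero_if_orthogonal_to_trigexp)
    show "integrable torus (\<lambda>x. g x - g' x)" using assms by (auto simp: Lq_1)
    fix \<eta> assume \<eta>: "trigexp \<eta>"
    have "(LINT x|torus. \<eta> x *\<^sub>R g x) = (LINT x|torus. \<eta> x *\<^sub>R g' x)"
      using assms(2,4)[unfolded has_weak_partial_def, rule_format, OF trigexp_smooth[OF \<eta>] trigexp_periodic[OF \<eta>]]
      by simp
    then show "(LINT x|torus. \<eta> x *\<^sub>R (g x - g' x)) = 0"
      using assms integrable_trigexp_mult[OF \<eta>, of g] integrable_trigexp_mult[OF \<eta>, of g']
      by (simp add: Lq_1 scaleR_diff_right)
  qed
  then show ?thesis by simp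
qed

lemma wpartial:
  assumes "Lq 1 g" "has_weak_partial e f g"
  shows "Lq 1 (wpartial e f)" "has_weak_partial e f (wpartial e f)" "AE x in torus. wpartial e f x = g x"
proof -
  have *: "Lq 1 (wpartial e f) \<and> has_weak_partial e f (wpartial e f)"
    unfolding wpartial_def by (rule someI[of _ g]) (use assms in simp)
  then show "Lq 1 (wpartial e f)" "has_weak_partial e f (wpartial e f)" by auto
  show "AE x in torus. wpartial e f x = g x"
    using weak_partial_unique * assms by blast
qed

lemma W1_wpartial:
  assumes "W1 q f" "1 \<le> q" "e \<in> Basis"
  shows "Lq q (wpartial e f)" "has_weak_partial e f (wpartial e f)"
proof -
  obtain g where g: "Lq q g" "has_weak_partial e f g" using assms by (auto simp: W1_def)
  have g1: "Lq 1 g" using assms(2) by (intro Lq_mono[OF g(1)]) auto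
  have "AE x in torus. g x = wpartial e f x" using wpartial(3)[OF g1 g(2)] by auto
  then show "Lq q (wpartial e f)" by (rule Lq_cong_AE[OF g(1) wpartial(1)[OF g1 g(2)]])
  show "has_weak_partial e f (wpartial e f)" by (rule wpartial(2)[OF g1 g(2)])
qed

section \<open>Weak derivatives along segments\<close>

lemma periodic_shift: "periodic f \<Longrightarrow> periodic (\<lambda>x. f (x + z))"
  unfolding periodic_def by (metis (no_types) add.commute add.left_commute)

lemma periodic_scaleR: "periodic h \<Longrightarrow> periodic f \<Longrightarrow> periodic (\<lambda>x. h x *\<^sub>R f x)"
  unfolding periodic_def by metis

lemma periodic_comp: "periodic f \<Longrightarrow> periodic (\<lambda>x. F (f x))"
  unfolding periodic_def by metis

lemma periodic_comp2: "periodic f \<Longrightarrow> periodic g \<Longrightarrow> periodic (\<lambda>x. F (f x) (g x))"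
  unfolding periodic_def by metis

definition unit_interval :: "real measure" where
  "unit_interval = restrict_space lborel {0..1}"

lemma space_unit_interval [simp]: "space unit_interval = {0..1}"
  by (simp add: unit_interval_def space_restrict_space)

lemma emeasure_unit_interval: "emeasure unit_interval (space unit_interval) = 1"
  by (simp add: unit_interval_def emeasure_restrict_space space_restrict_space)

interpretation unit_interval: finite_measure unit_interval
  by (rule finite_measureI) (simp add: emeasure_unit_interval del: space_unit_interval)

lemma measure_unit_interval [simp]: "measure unit_interval {0..1} = 1"
  using emeasure_unit_interval by (simp add: measure_def)

lemma measurable_unit_interval:
  "f \<in> measurable borel N \<Longrightarrow> f \<in> measurable unit_interval N"
  unfolding unit_interval_def by (rule measurable_restrict_space1) (simp add: measurable_lborel1)

lemma id_measurable [measurable]: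
  "(\<lambda>x. x) \<in> borel_measurable torus" "(\<lambda>x. x) \<in> borel_measurable unit_interval"
  by (auto intro: measurable_torus measurable_unit_interval)

lemma FTC_unit_interval:
  fixes F :: "real \<Rightarrow> 'b::euclidean_space"
  assumes "\<And>s. (F has_vector_derivative f s) (at s)" "continuous_on UNIV f"
  shows "(LINT s|unit_interval. f s) = F 1 - F 0"
proof -
  have "(LINT s|unit_interval. f s) = (LINT s|lborel. indicator {0..1} s *\<^sub>R f s)"
    unfolding unit_interval_def by (subst integral_restrict_space) auto
  also have "\<dots> = F 1 - F 0"
    by (rule integral_FTC_atLeastAtMost)
       (use assms in \<open>auto intro: has_vector_derivative_at_within continuous_on_subset\<close>)
  finally show ?thesis .
qed

interpretation ut: pair_sigma_finite unit_interval torus ..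
interpretation tu: pair_sigma_finite torus unit_interval ..
interpretation tt: pair_sigma_finite torus torus ..

lemma measurable_segment:
  assumes [measurable]: "U \<in> measurable borel N"
  shows "(\<lambda>(s, x). U (x + s *\<^sub>R y)) \<in> measurable (unit_interval \<Otimes>\<^sub>M torus) N"
    and "(\<lambda>(x, s). U (x + s *\<^sub>R y)) \<in> measurable (torus \<Otimes>\<^sub>M unit_interval) N"
    and "(\<lambda>s. U (x + s *\<^sub>R y)) \<in> measurable unit_interval N"
    and "(\<lambda>x. U (x + y)) \<in> measurable torus N"
    and "(\<lambda>x. U (y + x)) \<in> measurable torus N"
    and "(\<lambda>x. U (y + s *\<^sub>R x)) \<in> measurable torus N"
    and "(\<lambda>(x, y). U (x + y)) \<in> measurable (torus \<Otimes>\<^sub>M torus) N"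
    and "(\<lambda>((x, y), s). U (x + s *\<^sub>R y)) \<in> measurable ((torus \<Otimes>\<^sub>M torus) \<Otimes>\<^sub>M unit_interval) N"
    and "(\<lambda>(s, y). U (x + s *\<^sub>R y)) \<in> measurable (unit_interval \<Otimes>\<^sub>M torus) N"
    and "(\<lambda>(y, s). U (x + s *\<^sub>R y)) \<in> measurable (torus \<Otimes>\<^sub>M unit_interval) N"
proof -
  note f = measurable_compose[OF measurable_fst] and s = measurable_compose[OF measurable_snd]
  have [measurable]: "(\<lambda>p. fst p) \<in> borel_measurable (unit_interval \<Otimes>\<^sub>M torus)"
    "(\<lambda>p. snd p) \<in> borel_measurable (unit_interval \<Otimes>\<^sub>M torus)"
    "(\<lambda>p. fst p) \<in> borel_measurable (torus \<Otimes>\<^sub>M unit_interval)"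
    "(\<lambda>p. snd p) \<in> borel_measurable (torus \<Otimes>\<^sub>M unit_interval)"
    "(\<lambda>p. fst p) \<in> borel_measurable (torus \<Otimes>\<^sub>M torus)"
    "(\<lambda>p. snd p) \<in> borel_measurable (torus \<Otimes>\<^sub>M torus)"
    by (rule f[OF id_measurable(2)] s[OF id_measurable(1)] f[OF id_measurable(1)] s[OF id_measurable(2)])+
  have [measurable]: "(\<lambda>p. fst (fst p)) \<in> borel_measurable ((torus \<Otimes>\<^sub>M torus) \<Otimes>\<^sub>M unit_interval)"
    "(\<lambda>p. snd (fst p)) \<in> borel_measurable ((torus \<Otimes>\<^sub>M torus) \<Otimes>\<^sub>M unit_interval)"
    "(\<lambda>p. snd p) \<in> borel_measurable ((torus \<Otimes>\<^sub>M torus) \<Otimes>\<^sub>M unit_interval)"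
    by (rule f[OF f[OF id_measurable(1)]] f[OF s[OF id_measurable(1)]] s[OF id_measurable(2)])+
  show "(\<lambda>(s, x). U (x + s *\<^sub>R y)) \<in> measurable (unit_interval \<Otimes>\<^sub>M torus) N"
    "(\<lambda>(x, s). U (x + s *\<^sub>R y)) \<in> measurable (torus \<Otimes>\<^sub>M unit_interval) N"
    "(\<lambda>s. U (x + s *\<^sub>R y)) \<in> measurable unit_interval N"
    "(\<lambda>x. U (x + y)) \<in> measurable torus N"
    "(\<lambda>x. U (y + x)) \<in> measurable torus N"
    "(\<lambda>x. U (y + s *\<^sub>R x)) \<in> measurable torus N"
    "(\<lambda>(x, y). U (x + y)) \<in> measurable (torus \<Otimes>\<^sub>M torus) N"
    "(\<lambda>((x, y), s). U (x + s *\<^sub>R y)) \<in> measurable ((torus \<Otimes>\<^sub>M torus) \<Otimes>\<^sub>M unit_interval) N"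
    "(\<lambda>(s, y). U (x + s *\<^sub>R y)) \<in> measurable (unit_interval \<Otimes>\<^sub>M torus) N"
    "(\<lambda>(y, s). U (x + s *\<^sub>R y)) \<in> measurable (torus \<Otimes>\<^sub>M unit_interval) N"
    unfolding case_prod_beta by measurable
qed

lemma integrable_segment:
  fixes U :: "real \<times> real \<Rightarrow> 'b::{banach, second_countable_topology}"
  assumes U: "Lq 1 U"
  shows "integrable (unit_interval \<Otimes>\<^sub>M torus) (\<lambda>(s, x). U (x + s *\<^sub>R y))"
proof (rule ut.Fubini_integrable)
  have [measurable]: "U \<in> borel_measurable borel" and per: "periodic U" and int: "integrable torus U"
    using U by (auto simp: Lq_1)
  show "(\<lambda>(s, x). U (x + s *\<^sub>R y)) \<in> borel_measurable (unit_interval \<Otimes>\<^sub>M torus)"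
    by (rule measurable_segment) measurable
  have "periodic (\<lambda>x. norm (U x))" using per by (auto simp: periodic_def)
  then have "(LINT x|torus. norm (U (x + s *\<^sub>R y))) = (LINT x|torus. norm (U x))" for s
    by (intro integral_torus_shift(1)[of "\<lambda>x. norm (U x)"]) auto
  then show "integrable unit_interval (\<lambda>s. LINT x|torus. norm (case (s, x) of (s, x) \<Rightarrow> U (x + s *\<^sub>R y)))"
    by simp
  show "AE s in unit_interval. integrable torus (\<lambda>x. case (s, x) of (s, x) \<Rightarrow> U (x + s *\<^sub>R y))"
    using integral_torus_shift(2)[OF _ per] int by simp
qed

text \<open>
  The fundamental theorem of calculus in weak form.  Integrated against a test function \<open>\<eta>\<close>, the
  translations on the right-hand side are moved to \<open>\<eta>\<close> by invariance of the integral; then the weak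
  derivative is moved to \<open>\<eta>\<close> as well, and the classical theorem applies to \<open>\<eta>\<close>.
\<close>

lemma weak_partial_segment:
  fixes f :: "real \<times> real \<Rightarrow> 'b::{banach, second_countable_topology}"
  assumes f: "Lq 1 f" and U: "Lq 1 U"
    and w: "\<And>\<eta>. trigexp \<eta> \<Longrightarrow>
      (LINT x|torus. frechet_derivative \<eta> (at x) y *\<^sub>R f x) = - (LINT x|torus. \<eta> x *\<^sub>R U x)"
  shows "AE x in torus. f (x + y) - f x = (LINT s|unit_interval. U (x + s *\<^sub>R y))"
proof -
  define V where "V x = (LINT s|unit_interval. U (x + s *\<^sub>R y))" for x
  have fm[measurable]: "f \<in> borel_measurable borel" and fp: "periodic f" and fi: "integrable torus f"
    using f by (auto simp: Lq_1)
  have Um[measurable]: "U \<in> borel_measurable borel" and Up: "periodic U" and Ui: "integrable torus U"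
    using U by (auto simp: Lq_1)
  have fyi: "integrable torus (\<lambda>x. f (x + y))" using fi integral_torus_shift(2)[OF fm fp] by simp
  have iseg: "integrable (unit_interval \<Otimes>\<^sub>M torus) (\<lambda>(s, x). U (x + s *\<^sub>R y))"
    by (rule integrable_segment[OF U])
  then have Vi: "integrable torus V"
    unfolding V_def by (rule ut.integrable_snd)
  have "AE x in torus. f (x + y) - f x - V x = 0"
  proof (rule AE_zero_if_orthogonal_to_trigexp)
    show "integrable torus (\<lambda>x. f (x + y) - f x - V x)" using fyi fi Vi by auto
    fix \<eta> assume \<eta>: "trigexp \<eta>"
    obtain K where K: "\<And>x. \<bar>\<eta> x\<bar> \<le> K" using trigexp_bounded[OF \<eta>] by blast
    have \<eta>m[measurable]: "\<eta> \<in> borel_measurable borel" by (rule trigexp_measurable[OF \<eta>])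
    define \<eta>' where "\<eta>' x = frechet_derivative \<eta> (at x) y" for x
    have \<eta>': "trigexp \<eta>'" unfolding \<eta>'_def by (rule trigexp_frechet[OF \<eta>])
    obtain K' where K': "\<And>x. \<bar>\<eta>' x\<bar> \<le> K'" using trigexp_bounded[OF \<eta>'] by blast
    have \<eta>'m[measurable]: "\<eta>' \<in> borel_measurable borel" by (rule trigexp_measurable[OF \<eta>'])
    have D: "(\<eta> has_derivative frechet_derivative \<eta> (at x)) (at x)" for x
      using trigexp_differentiable[OF \<eta>] frechet_derivative_works by blast
    have per: "periodic (\<lambda>x. \<eta> x *\<^sub>R f (x + z))" "periodic (\<lambda>x. \<eta> x *\<^sub>R U (x + z))" for z
      by (intro periodic_scaleR trigexp_periodic \<eta> periodic_shift fp Up)+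
    have mseg: "(\<lambda>x. \<eta> x *\<^sub>R f (x + z)) \<in> borel_measurable borel"
      "(\<lambda>x. \<eta> x *\<^sub>R U (x + z)) \<in> borel_measurable borel" for z
      by measurable
    have "(LINT x|torus. \<eta> x *\<^sub>R V x) = (LINT x|torus. (LINT s|unit_interval. \<eta> x *\<^sub>R U (x + s *\<^sub>R y)))"
      by (simp add: V_def)
    also have "\<dots> = (LINT s|unit_interval. (LINT x|torus. \<eta> x *\<^sub>R U (x + s *\<^sub>R y)))"
    proof (rule ut.Fubini_integral)
      have "integrable (unit_interval \<Otimes>\<^sub>M torus) (\<lambda>p. \<eta> (snd p) *\<^sub>R (case p of (s, x) \<Rightarrow> U (x + s *\<^sub>R y)))"
        by (rule integrable_bounded_mult[OF iseg measurable_compose[OF measurable_snd measurable_torus[OF \<eta>m]] K])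
      then show "integrable (unit_interval \<Otimes>\<^sub>M torus) (\<lambda>(s, x). \<eta> x *\<^sub>R U (x + s *\<^sub>R y))"
        by (simp only: case_prod_unfold)
    qed
    also have "\<dots> = (LINT s|unit_interval. - (LINT x|torus. \<eta>' (x - s *\<^sub>R y) *\<^sub>R f x))"
    proof (rule Bochner_Integration.integral_cong[OF refl])
      fix s
      have t: "trigexp (\<lambda>x. \<eta> (x - s *\<^sub>R y))" using trigexp_translate[OF \<eta>, of "- s *\<^sub>R y"] by simp
      have D': "((\<lambda>x. \<eta> (x - s *\<^sub>R y)) has_derivative frechet_derivative \<eta> (at (x - s *\<^sub>R y))) (at x)" for x
      proof -
        have "((\<lambda>x. x - s *\<^sub>R y) has_derivative (\<lambda>v. v)) (at x)"
          using has_derivative_diff[OF has_derivative_ident has_derivative_const] by simp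
        from has_derivative_compose[OF this D] show ?thesis by simp
      qed
      then have fr: "frechet_derivative (\<lambda>x. \<eta> (x - s *\<^sub>R y)) (at x) y = \<eta>' (x - s *\<^sub>R y)" for x
        unfolding \<eta>'_def by (simp only: frechet_derivative_at[OF D', symmetric])
      have "(LINT x|torus. \<eta> x *\<^sub>R U (x + s *\<^sub>R y)) = (LINT x|torus. \<eta> (x - s *\<^sub>R y) *\<^sub>R U x)"
        using integral_torus_shift(1)[OF mseg(2)[of "s *\<^sub>R y"] per(2), of "- (s *\<^sub>R y)"] by simp
      also have "\<dots> = - (LINT x|torus. \<eta>' (x - s *\<^sub>R y) *\<^sub>R f x)"
        using w[OF t] unfolding fr by simp
      finally show "(LINT x|torus. \<eta> x *\<^sub>R U (x + s *\<^sub>R y)) = - (LINT x|torus. \<eta>' (x - s *\<^sub>R y) *\<^sub>R f x)" .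
    qed
    also have "\<dots> = - (LINT s|unit_interval. (LINT x|torus. \<eta>' (x - s *\<^sub>R y) *\<^sub>R f x))"
      by simp
    also have "(LINT s|unit_interval. (LINT x|torus. \<eta>' (x - s *\<^sub>R y) *\<^sub>R f x)) =
        (LINT x|torus. (LINT s|unit_interval. \<eta>' (x - s *\<^sub>R y) *\<^sub>R f x))"
    proof (rule tu.Fubini_integral)
      have 1: "integrable (torus \<Otimes>\<^sub>M unit_interval) (\<lambda>(x, s). f x)"
      proof (rule tu.Fubini_integrable)
        show "(\<lambda>(x, s). f x) \<in> borel_measurable (torus \<Otimes>\<^sub>M unit_interval)"
          unfolding case_prod_unfold by (rule measurable_compose[OF measurable_fst measurable_torus[OF fm]])
      qed (use fi in simp_all)
      have m: "(\<lambda>p. case p of (x, s) \<Rightarrow> \<eta>' (x - s *\<^sub>R y)) \<in> borel_measurable (torus \<Otimes>\<^sub>M unit_interval)"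
        using measurable_segment(2)[OF \<eta>'m, of "- y"] by simp
      have b: "\<bar>case p of (x, s) \<Rightarrow> \<eta>' (x - s *\<^sub>R y)\<bar> \<le> K'" for p
        unfolding case_prod_unfold by (rule K')
      have "integrable (torus \<Otimes>\<^sub>M unit_interval) (\<lambda>p. (case p of (x, s) \<Rightarrow> \<eta>' (x - s *\<^sub>R y)) *\<^sub>R (case p of (x, s) \<Rightarrow> f x))"
        by (rule integrable_bounded_mult[OF 1 m b])
      then show "integrable (torus \<Otimes>\<^sub>M unit_interval) (\<lambda>(x, s). \<eta>' (x - s *\<^sub>R y) *\<^sub>R f x)"
        by (simp only: case_prod_unfold)
    qed
    also have "\<dots> = (LINT x|torus. (\<eta> x - \<eta> (x - y)) *\<^sub>R f x)"
    proof (rule Bochner_Integration.integral_cong[OF refl])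
      fix x
      have "((\<lambda>s. - \<eta> (x - s *\<^sub>R y)) has_vector_derivative \<eta>' (x - s *\<^sub>R y)) (at s)" for s
      proof -
        have l: "linear (frechet_derivative \<eta> (at z))" for z
          using trigexp_differentiable[OF \<eta>] by (rule linear_frechet_derivative)
        have "((\<lambda>s. \<eta> (x - s *\<^sub>R y)) has_derivative (\<lambda>h. frechet_derivative \<eta> (at (x - s *\<^sub>R y)) (- (h *\<^sub>R y)))) (at s)"
        proof (rule has_derivative_compose[OF _ D])
          show "((\<lambda>s. x - s *\<^sub>R y) has_derivative (\<lambda>h. - (h *\<^sub>R y))) (at s)"
            using has_derivative_diff[OF has_derivative_const has_derivative_scaleR_left[OF has_derivative_ident]]
            by simp
        qed
        from has_derivative_minus[OF this] show ?thesis
          unfolding has_vector_derivative_def \<eta>'_def linear_neg[OF l] linear_scale[OF l] minus_minus .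
      qed
      moreover have "continuous_on UNIV (\<lambda>s. \<eta>' (x - s *\<^sub>R y))"
        by (rule continuous_on_compose2[OF trigexp_continuous[OF \<eta>']]) (intro continuous_intros, simp)
      ultimately have "(LINT s|unit_interval. \<eta>' (x - s *\<^sub>R y)) = \<eta> x - \<eta> (x - y)"
        by (subst FTC_unit_interval) auto
      moreover have "integrable unit_interval (\<lambda>s. \<eta>' (x - s *\<^sub>R y))"
        using measurable_segment(3)[OF \<eta>'m, of x "- y"] K'
        by (intro unit_interval.integrable_const_bound[where B=K'] AE_I2) simp_all
      ultimately show "(LINT s|unit_interval. \<eta>' (x - s *\<^sub>R y) *\<^sub>R f x) = (\<eta> x - \<eta> (x - y)) *\<^sub>R f x"
        by simp
    qed
    also have "- \<dots> = (LINT x|torus. \<eta> (x - y) *\<^sub>R f x) - (LINT x|torus. \<eta> x *\<^sub>R f x)"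
    proof -
      have t: "trigexp (\<lambda>x. \<eta> (x - y))" using trigexp_translate[OF \<eta>, of "- y"] by simp
      show ?thesis
        using integrable_trigexp_mult[OF t fi] integrable_trigexp_mult[OF \<eta> fi]
        by (simp add: scaleR_left.diff)
    qed
    also have "(LINT x|torus. \<eta> (x - y) *\<^sub>R f x) = (LINT x|torus. \<eta> x *\<^sub>R f (x + y))"
      using integral_torus_shift(1)[OF mseg(1)[of y] per(1), of "- y"] by simp
    finally show "(LINT x|torus. \<eta> x *\<^sub>R (f (x + y) - f x - V x)) = 0"
      using integrable_trigexp_mult[OF \<eta> fi] integrable_trigexp_mult[OF \<eta> fyi] integrable_trigexp_mult[OF \<eta> Vi]
      by (simp add: scaleR_diff_right)
  qed
  then show ?thesis by (simp add: V_def)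
qed

lemma integral_lincomb:
  fixes g1 g2 :: "'a \<Rightarrow> 'b::{banach, second_countable_topology}"
  assumes "integrable M g1" "integrable M g2"
  shows "(LINT x|M. a *\<^sub>R g1 x + b *\<^sub>R g2 x) = a *\<^sub>R (LINT x|M. g1 x) + b *\<^sub>R (LINT x|M. g2 x)"
  using Bochner_Integration.integral_add[of M "\<lambda>x. a *\<^sub>R g1 x" "\<lambda>x. b *\<^sub>R g2 x"] assms
  by (simp only: integrable_scaleR_right integral_scaleR_right)

lemma W1_segment:
  fixes f :: "real \<times> real \<Rightarrow> 'b::{banach, second_countable_topology}"
  assumes f: "Lq 1 f" and u: "Lq 1 u1" "Lq 1 u2"
    and w: "has_weak_partial (1, 0) f u1" "has_weak_partial (0, 1) f u2"
  shows "AE x in torus. f (x + y) - f x =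
    (LINT s|unit_interval. fst y *\<^sub>R u1 (x + s *\<^sub>R y) + snd y *\<^sub>R u2 (x + s *\<^sub>R y))"
proof (rule weak_partial_segment[OF f])
  have um[measurable]: "u1 \<in> borel_measurable borel" "u2 \<in> borel_measurable borel"
    and ui: "integrable torus u1" "integrable torus u2" using u by (simp_all add: Lq_1)
  show "Lq 1 (\<lambda>x. fst y *\<^sub>R u1 x + snd y *\<^sub>R u2 x)"
    using u ui periodic_comp2[of u1 u2 "\<lambda>a b. fst y *\<^sub>R a + snd y *\<^sub>R b"] by (simp add: Lq_1)
  fix \<eta> assume \<eta>: "trigexp \<eta>"
  have fi: "integrable torus f" using f by (simp add: Lq_1)
  have lin: "linear (frechet_derivative \<eta> (at x))" for x
    using trigexp_differentiable[OF \<eta>] by (rule linear_frechet_derivative)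
  have "frechet_derivative \<eta> (at x) y = fst y * frechet_derivative \<eta> (at x) (1, 0)
      + snd y * frechet_derivative \<eta> (at x) (0, 1)" for x
  proof -
    have "y = fst y *\<^sub>R (1, 0) + snd y *\<^sub>R (0, 1)" by (simp add: prod_eq_iff)
    then have "frechet_derivative \<eta> (at x) y = frechet_derivative \<eta> (at x) (fst y *\<^sub>R (1, 0) + snd y *\<^sub>R (0, 1))"
      by (rule arg_cong)
    then show ?thesis by (simp only: linear_add[OF lin] linear_scale[OF lin] real_scaleR_def)
  qed
  then have "(LINT x|torus. frechet_derivative \<eta> (at x) y *\<^sub>R f x) =
     (LINT x|torus. fst y *\<^sub>R (frechet_derivative \<eta> (at x) (1, 0) *\<^sub>R f x)
       + snd y *\<^sub>R (frechet_derivative \<eta> (at x) (0, 1) *\<^sub>R f x))"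
    by (simp add: scaleR_add_left)
  also have "\<dots> = fst y *\<^sub>R (LINT x|torus. frechet_derivative \<eta> (at x) (1, 0) *\<^sub>R f x)
     + snd y *\<^sub>R (LINT x|torus. frechet_derivative \<eta> (at x) (0, 1) *\<^sub>R f x)"
    by (rule integral_lincomb[OF integrable_trigexp_mult[OF trigexp_frechet[OF \<eta>] fi]
        integrable_trigexp_mult[OF trigexp_frechet[OF \<eta>] fi]])
  also have "\<dots> = fst y *\<^sub>R (- (LINT x|torus. \<eta> x *\<^sub>R u1 x)) + snd y *\<^sub>R (- (LINT x|torus. \<eta> x *\<^sub>R u2 x))"
    using w[unfolded has_weak_partial_def, rule_format, OF trigexp_smooth[OF \<eta>] trigexp_periodic[OF \<eta>]]
    by simp
  also have "\<dots> = - (LINT x|torus. fst y *\<^sub>R (\<eta> x *\<^sub>R u1 x) + snd y *\<^sub>R (\<eta> x *\<^sub>R u2 x))"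
    by (simp only: integral_lincomb[OF integrable_trigexp_mult[OF \<eta> ui(1)] integrable_trigexp_mult[OF \<eta> ui(2)]]
        scaleR_minus_right minus_add_distrib)
  also have "\<dots> = - (LINT x|torus. \<eta> x *\<^sub>R (fst y *\<^sub>R u1 x + snd y *\<^sub>R u2 x))"
    by (simp add: scaleR_add_right mult.commute)
  finally show "(LINT x|torus. frechet_derivative \<eta> (at x) y *\<^sub>R f x) = - (LINT x|torus. \<eta> x *\<^sub>R (fst y *\<^sub>R u1 x + snd y *\<^sub>R u2 x))" .
qed

section \<open>Poincare's and Morrey's inequalities\<close>

lemma nn_integral_square_le:
  fixes g :: "'a \<Rightarrow> ennreal"
  assumes [measurable]: "g \<in> borel_measurable M" and "emeasure M (space M) = 1"
  shows "(\<integral>\<^sup>+x. g x \<partial>M)\<^sup>2 \<le> (\<integral>\<^sup>+x. (g x)\<^sup>2 \<partial>M)"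
  using Cauchy_Schwarz_nn_integral[of g M "\<lambda>_. 1"] assms by simp

text \<open>
  For fixed \<open>s\<close> and \<open>y\<close>, the inner integrand is a translate of \<open>F\<close>.
\<close>

lemma nn_integral_torus_segments:
  fixes F :: "real \<times> real \<Rightarrow> ennreal"
  assumes F[measurable]: "F \<in> borel_measurable borel" and per: "periodic F"
  shows "(\<integral>\<^sup>+x. \<integral>\<^sup>+y. \<integral>\<^sup>+s. F (x + s *\<^sub>R y) \<partial>unit_interval \<partial>torus \<partial>torus) = (\<integral>\<^sup>+x. F x \<partial>torus)"
proof -
  have m: "(\<lambda>p. \<integral>\<^sup>+s. F (fst p + s *\<^sub>R snd p) \<partial>unit_interval) \<in> borel_measurable (torus \<Otimes>\<^sub>M torus)"
    using unit_interval.borel_measurable_nn_integral_fst[OF measurable_segment(8)[OF F]]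
    by (simp only: case_prod_unfold fst_conv snd_conv)
  have "(\<integral>\<^sup>+x. \<integral>\<^sup>+y. \<integral>\<^sup>+s. F (x + s *\<^sub>R y) \<partial>unit_interval \<partial>torus \<partial>torus) =
      (\<integral>\<^sup>+y. \<integral>\<^sup>+x. \<integral>\<^sup>+s. F (x + s *\<^sub>R y) \<partial>unit_interval \<partial>torus \<partial>torus)"
    using tt.Fubini[OF m] by simp
  also have "\<dots> = (\<integral>\<^sup>+y. \<integral>\<^sup>+x. F x \<partial>torus \<partial>torus)"
  proof (rule nn_integral_cong)
    fix y
    have "(\<integral>\<^sup>+x. \<integral>\<^sup>+s. F (x + s *\<^sub>R y) \<partial>unit_interval \<partial>torus) = (\<integral>\<^sup>+s. \<integral>\<^sup>+x. F (x + s *\<^sub>R y) \<partial>torus \<partial>unit_interval)"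
      using tu.Fubini[OF measurable_segment(2)[OF F, of y]] by simp
    also have "\<dots> = (\<integral>\<^sup>+s. \<integral>\<^sup>+x. F x \<partial>torus \<partial>unit_interval)"
      by (intro nn_integral_cong nn_integral_torus_shift F per)
    also have "\<dots> = (\<integral>\<^sup>+x. F x \<partial>torus)"
      using emeasure_unit_interval by simp
    finally show "(\<integral>\<^sup>+x. \<integral>\<^sup>+s. F (x + s *\<^sub>R y) \<partial>unit_interval \<partial>torus) = (\<integral>\<^sup>+x. F x \<partial>torus)" .
  qed
  also have "\<dots> = (\<integral>\<^sup>+x. F x \<partial>torus)" using emeasure_torus by simp
  finally show ?thesis .
qed

text \<open>
  Averages over a square of side \<open>s\<close> cost the factor \<open>s\<^sup>-\<^sup>2\<close>: the dilation by \<open>s \<le> 1\<close> maps the unit square into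
  itself and has Jacobian \<open>s\<^sup>2\<close>.
\<close>

lemma nn_integral_torus_scale:
  fixes F :: "real \<times> real \<Rightarrow> ennreal"
  assumes F[measurable]: "F \<in> borel_measurable borel" and per: "periodic F" and s: "0 < s" "s \<le> 1"
  shows "ennreal (s\<^sup>2) * (\<integral>\<^sup>+y. F (x + s *\<^sub>R y) \<partial>torus) \<le> (\<integral>\<^sup>+y. F y \<partial>torus)"
proof -
  let ?Q = "{0..<1} \<times> {0..<1} :: (real \<times> real) set"
  have Q[measurable]: "?Q \<in> sets borel" by (simp add: borel_Times)
  define h where "h z = F (x + z) * indicator ?Q (z /\<^sub>R s)" for z
  have h[measurable]: "h \<in> borel_measurable borel" unfolding h_def by measurable
  have "ennreal (s\<^sup>2) * (\<integral>\<^sup>+y. F (x + s *\<^sub>R y) \<partial>torus) = ennreal (s\<^sup>2) * (\<integral>\<^sup>+y. h (s *\<^sub>R y) \<partial>lborel)"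
    using s by (subst nn_integral_torus) (simp_all add: h_def)
  also have "\<dots> = (\<integral>\<^sup>+y. h y \<partial>density (distr lborel borel (\<lambda>x. 0 + s *\<^sub>R x)) (\<lambda>_. ennreal (\<bar>s\<bar> ^ DIM(real \<times> real))))"
    using s by (subst nn_integral_density) (simp_all add: nn_integral_distr nn_integral_cmult power2_eq_square)
  also have "\<dots> = (\<integral>\<^sup>+y. h y \<partial>lborel)"
    using lborel_affine[of s "0 :: real \<times> real"] s by simp
  also have "\<dots> \<le> (\<integral>\<^sup>+y. F (x + y) * indicator ?Q y \<partial>lborel)"
  proof (rule nn_integral_mono)
    fix z
    have "indicator ?Q (z /\<^sub>R s) \<le> (indicator ?Q z :: ennreal)"
    proof (cases "z /\<^sub>R s \<in> ?Q")
      case True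
      then have "0 \<le> fst z / s" "fst z / s < 1" "0 \<le> snd z / s" "snd z / s < 1"
        by (auto simp: mem_Times_iff divide_inverse mult.commute)
      then have "0 \<le> fst z" "fst z < 1" "0 \<le> snd z" "snd z < 1"
        using s by (auto simp: divide_simps split: if_splits)
      then show ?thesis by (simp add: mem_Times_iff indicator_def)
    qed simp
    then show "h z \<le> F (x + z) * indicator ?Q z" unfolding h_def by (rule mult_left_mono) simp
  qed
  also have "\<dots> = (\<integral>\<^sup>+y. F (y + x) \<partial>torus)"
    by (subst nn_integral_torus) (simp_all add: add.commute)
  also have "\<dots> = (\<integral>\<^sup>+y. F y \<partial>torus)" by (rule nn_integral_torus_shift[OF F per])
  finally show ?thesis .
qed

text \<open>
  After integration, with \<open>\<alpha>\<close> a bound for the \<open>L\<^sup>p\<close> norm, this gives the same bound for the \<open>L\<^sup>1\<close> norm,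
  as Hoelder's inequality would.
\<close>

lemma young_scaled:
  fixes t \<alpha> p :: real
  assumes "0 \<le> t" "0 < \<alpha>" "1 < p"
  shows "t \<le> (1 / p) * \<alpha> powr (1 - p) * t powr p + (1 - 1 / p) * \<alpha>"
proof -
  have "t / \<alpha> * 1 \<le> (t / \<alpha>) powr p / p + 1 powr (p / (p - 1)) / (p / (p - 1))"
    using assms by (intro Youngs_inequality) (auto simp: field_simps)
  then have "t / \<alpha> \<le> (t / \<alpha>) powr p / p + (1 - 1 / p)"
    using assms by (simp add: field_simps)
  then have "\<alpha> * (t / \<alpha>) \<le> \<alpha> * ((t / \<alpha>) powr p / p + (1 - 1 / p))"
    using assms by (intro mult_left_mono) auto
  moreover have "\<alpha> * ((t / \<alpha>) powr p / p) = (1 / p) * \<alpha> powr (1 - p) * t powr p"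
    using assms by (simp add: powr_divide powr_diff)
  ultimately show ?thesis using assms by (simp add: distrib_left mult.commute)
qed

text \<open>
  The weak partial derivatives are arguments here, so that statements do not depend on the
  representatives chosen by \<open>wpartial\<close>.
\<close>

locale weak_gradient =
  fixes f u1 u2 :: "real \<times> real \<Rightarrow> 'b::{banach, second_countable_topology}"
  assumes f: "Lq 1 f" and u1: "Lq 1 u1" and u2: "Lq 1 u2"
    and partial1: "has_weak_partial (1, 0) f u1" and partial2: "has_weak_partial (0, 1) f u2"
begin

definition slope :: "real \<times> real \<Rightarrow> real" where "slope x = norm (u1 x) + norm (u2 x)"

lemma slope_nonneg: "0 \<le> slope x" by (simp add: slope_def)

lemma f_measurable [measurable]: "f \<in> borel_measurable borel" using f by (simp add: Lq_1)
lemma u1_measurable [measurable]: "u1 \<in> borel_measurable borel" using u1 by (simp add: Lq_1)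
lemma u2_measurable [measurable]: "u2 \<in> borel_measurable borel" using u2 by (simp add: Lq_1)
lemma slope_measurable [measurable]: "slope \<in> borel_measurable borel" unfolding slope_def by measurable
lemma slope_periodic: "periodic slope"
  using periodic_comp2[of u1 u2 "\<lambda>a b. norm a + norm b"] u1 u2 unfolding slope_def Lq_1 by blast

lemma increment_bound:
  assumes y: "y \<in> cbox (0, 0) (1, 1)"
  shows "AE x in torus. ennreal (norm (f (x + y) - f x)) \<le> (\<integral>\<^sup>+s. ennreal (slope (x + s *\<^sub>R y)) \<partial>unit_interval)"
  using W1_segment[OF f u1 u2 partial1 partial2, of y]
proof eventually_elim
  case (elim x)
  let ?g = "\<lambda>s. fst y *\<^sub>R u1 (x + s *\<^sub>R y) + snd y *\<^sub>R u2 (x + s *\<^sub>R y)"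
  have y: "0 \<le> fst y" "fst y \<le> 1" "0 \<le> snd y" "snd y \<le> 1"
    using y by (auto simp: cbox_def Basis_prod_def inner_prod_def)
  have le: "norm (?g s) \<le> slope (x + s *\<^sub>R y)" for s
  proof -
    have "norm (?g s) \<le> fst y * norm (u1 (x + s *\<^sub>R y)) + snd y * norm (u2 (x + s *\<^sub>R y))"
      using norm_triangle_ineq[of "fst y *\<^sub>R u1 (x + s *\<^sub>R y)" "snd y *\<^sub>R u2 (x + s *\<^sub>R y)"] y by simp
    also have "\<dots> \<le> slope (x + s *\<^sub>R y)"
      unfolding slope_def using y by (intro add_mono mult_left_le_one_le) simp_all
    finally show ?thesis .
  qed
  have "ennreal (norm (LINT s|unit_interval. ?g s)) \<le> (\<integral>\<^sup>+s. ennreal (norm (?g s)) \<partial>unit_interval)"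
  proof (cases "integrable unit_interval ?g")
    case True then show ?thesis by (rule integral_norm_bound_ennreal)
  next
    case False then show ?thesis by (simp add: not_integrable_integral_eq)
  qed
  also have "\<dots> \<le> (\<integral>\<^sup>+s. ennreal (slope (x + s *\<^sub>R y)) \<partial>unit_interval)"
    by (intro nn_integral_mono ennreal_leI le)
  finally show ?case using elim by simp
qed

definition avg :: 'b where "avg = (LINT x|torus. f x)"

text \<open>
  By translation invariance, \<open>avg\<close> is also the mean of \<open>y \<mapsto> f (x + y)\<close>, so that \<open>avg - f x\<close> is a mean of
  increments of \<open>f\<close>.
\<close>

lemma avg_bound:
  "AE x in torus. ennreal (norm (f x - avg)) \<le>
     (\<integral>\<^sup>+y. \<integral>\<^sup>+s. ennreal (slope (x + s *\<^sub>R y)) \<partial>unit_interval \<partial>torus)"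
proof -
  have s[measurable]: "(\<lambda>x. ennreal (slope x)) \<in> borel_measurable borel" by measurable
  have m1: "(\<lambda>p. \<integral>\<^sup>+s. ennreal (slope (fst p + s *\<^sub>R snd p)) \<partial>unit_interval) \<in> borel_measurable (torus \<Otimes>\<^sub>M torus)"
    using unit_interval.borel_measurable_nn_integral_fst[OF measurable_segment(8)[OF s]]
    by (simp only: case_prod_unfold fst_conv snd_conv)
  have m2: "(\<lambda>p. f (fst p + snd p)) \<in> borel_measurable (torus \<Otimes>\<^sub>M torus)"
    using measurable_segment(7)[OF f_measurable] by (simp only: case_prod_unfold)
  have m3: "(\<lambda>p. f (fst p)) \<in> borel_measurable (torus \<Otimes>\<^sub>M torus)"
    by (rule measurable_compose[OF measurable_fst measurable_torus[OF f_measurable]])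
  have "AE y in torus. AE x in torus. ennreal (norm (f (x + y) - f x)) \<le>
      (\<integral>\<^sup>+s. ennreal (slope (x + s *\<^sub>R y)) \<partial>unit_interval)"
    using AE_space by eventually_elim (simp add: increment_bound)
  moreover have "{p \<in> space (torus \<Otimes>\<^sub>M torus). ennreal (norm (f (fst p + snd p) - f (fst p))) \<le>
      (\<integral>\<^sup>+s. ennreal (slope (fst p + s *\<^sub>R snd p)) \<partial>unit_interval)} \<in> sets (torus \<Otimes>\<^sub>M torus)"
    using m1 m2 m3 by measurable
  ultimately have "AE x in torus. AE y in torus. ennreal (norm (f (x + y) - f x)) \<le>
      (\<integral>\<^sup>+s. ennreal (slope (x + s *\<^sub>R y)) \<partial>unit_interval)"
    using tt.AE_commute[of "\<lambda>x y. ennreal (norm (f (x + y) - f x)) \<le>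
      (\<integral>\<^sup>+s. ennreal (slope (x + s *\<^sub>R y)) \<partial>unit_interval)"] by blast
  then show ?thesis
  proof eventually_elim
    case (elim x)
    have int: "integrable torus (\<lambda>y. f (y + x))"
      using f integral_torus_shift(2)[of f x] by (simp add: Lq_1)
    then have int2: "integrable torus (\<lambda>y. f (x + y) - f x)" by (simp add: add.commute)
    have "(LINT y|torus. f (x + y) - f x) = (LINT y|torus. f (y + x)) - (LINT y|torus. f x)"
      using int by (subst Bochner_Integration.integral_diff[symmetric]) (simp_all add: add.commute)
    also have "\<dots> = avg - f x"
      using integral_torus_shift(1)[of f x] f by (simp add: Lq_1 avg_def)
    finally have "norm (f x - avg) = norm (LINT y|torus. f (x + y) - f x)"
      by (simp add: norm_minus_commute)
    then have "ennreal (norm (f x - avg)) \<le> (\<integral>\<^sup>+y. ennreal (norm (f (x + y) - f x)) \<partial>torus)"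
      using integral_norm_bound_ennreal[OF int2] by simp
    also have "\<dots> \<le> (\<integral>\<^sup>+y. \<integral>\<^sup>+s. ennreal (slope (x + s *\<^sub>R y)) \<partial>unit_interval \<partial>torus)"
      by (rule nn_integral_mono_AE[OF elim])
    finally show ?case .
  qed
qed

text \<open>
  The Cauchy--Schwarz inequality moves the square under the two averages in \<open>avg_bound\<close>; what is left are
  translates of \<open>slope\<^sup>2\<close>, all with the same integral.
\<close>

lemma poincare:
  assumes w: "integrable torus (\<lambda>x. (slope x)\<^sup>2)"
  shows "integrable torus (\<lambda>x. (norm (f x - avg))\<^sup>2)"
    and "(LINT x|torus. (norm (f x - avg))\<^sup>2) \<le> (LINT x|torus. (slope x)\<^sup>2)"
proof -
  have s[measurable]: "(\<lambda>x. ennreal (slope x)) \<in> borel_measurable borel" by measurable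
  have [measurable]: "f \<in> borel_measurable torus" by (rule measurable_torus[OF f_measurable])
  let ?I = "\<lambda>x y. \<integral>\<^sup>+s. ennreal (slope (x + s *\<^sub>R y)) \<partial>unit_interval"
  have "(\<integral>\<^sup>+x. ennreal ((norm (f x - avg))\<^sup>2) \<partial>torus) \<le> (\<integral>\<^sup>+x. (\<integral>\<^sup>+y. ?I x y \<partial>torus)\<^sup>2 \<partial>torus)"
  proof (rule nn_integral_mono_AE)
    show "AE x in torus. ennreal ((norm (f x - avg))\<^sup>2) \<le> (\<integral>\<^sup>+y. ?I x y \<partial>torus)\<^sup>2"
      using avg_bound by eventually_elim (simp add: ennreal_power[symmetric] power_mono)
  qed
  also have "\<dots> \<le> (\<integral>\<^sup>+x. \<integral>\<^sup>+y. \<integral>\<^sup>+s. (ennreal (slope (x + s *\<^sub>R y)))\<^sup>2 \<partial>unit_interval \<partial>torus \<partial>torus)"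
  proof (rule nn_integral_mono)
    fix x
    have mI: "(\<lambda>y. ?I x y) \<in> borel_measurable torus"
      using unit_interval.borel_measurable_nn_integral_fst[OF measurable_segment(10)[OF s]]
      by (simp only: case_prod_unfold fst_conv snd_conv)
    have "(\<integral>\<^sup>+y. ?I x y \<partial>torus)\<^sup>2 \<le> (\<integral>\<^sup>+y. (?I x y)\<^sup>2 \<partial>torus)"
      by (rule nn_integral_square_le[OF mI emeasure_torus])
    also have "\<dots> \<le> (\<integral>\<^sup>+y. \<integral>\<^sup>+s. (ennreal (slope (x + s *\<^sub>R y)))\<^sup>2 \<partial>unit_interval \<partial>torus)"
      by (intro nn_integral_mono nn_integral_square_le measurable_segment s emeasure_unit_interval)
    finally show "(\<integral>\<^sup>+y. ?I x y \<partial>torus)\<^sup>2 \<le> (\<integral>\<^sup>+y. \<integral>\<^sup>+s. (ennreal (slope (x + s *\<^sub>R y)))\<^sup>2 \<partial>unit_interval \<partial>torus)" .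
  qed
  also have "\<dots> = (\<integral>\<^sup>+x. (ennreal (slope x))\<^sup>2 \<partial>torus)"
  proof (rule nn_integral_torus_segments[of "\<lambda>x. (ennreal (slope x))\<^sup>2"])
    show "(\<lambda>x. (ennreal (slope x))\<^sup>2) \<in> borel_measurable borel" by measurable
    show "periodic (\<lambda>x. (ennreal (slope x))\<^sup>2)" by (rule periodic_comp[OF slope_periodic])
  qed
  also have "\<dots> = (\<integral>\<^sup>+x. ennreal ((slope x)\<^sup>2) \<partial>torus)" by (simp add: ennreal_power slope_nonneg)
  also have "\<dots> = ennreal (LINT x|torus. (slope x)\<^sup>2)" by (rule nn_integral_eq_integral[OF w]) simp
  finally have le: "(\<integral>\<^sup>+x. ennreal ((norm (f x - avg))\<^sup>2) \<partial>torus) \<le> ennreal (LINT x|torus. (slope x)\<^sup>2)" .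
  show int: "integrable torus (\<lambda>x. (norm (f x - avg))\<^sup>2)"
  proof (rule integrableI_nonneg)
    show "(\<integral>\<^sup>+x. ennreal ((norm (f x - avg))\<^sup>2) \<partial>torus) < \<infinity>"
      unfolding infinity_ennreal_def by (rule le_less_trans[OF le ennreal_less_top])
  qed simp_all
  show "(LINT x|torus. (norm (f x - avg))\<^sup>2) \<le> (LINT x|torus. (slope x)\<^sup>2)"
    using le nn_integral_eq_integral[OF int] by (simp add: integral_nonneg_AE)
qed

text \<open>
  Averaged over \<open>y\<close> first, the bound of \<open>avg_bound\<close> involves the mean of \<open>slope\<close> over a square of side \<open>s\<close>.
  This mean is at most \<open>R s\<^sup>-\<^sup>2\<^sup>/\<^sup>p\<close>, which is integrable over \<open>0 < s < 1\<close> because \<open>p > 2\<close>.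
\<close>

lemma morrey:
  assumes p: "p > 2" and R: "R > 0" and w: "(\<integral>\<^sup>+x. ennreal (slope x powr p) \<partial>torus) \<le> ennreal (R powr p)"
  shows "AE x in torus. norm (f x - avg) \<le> R / (1 - 2 / p)"
proof -
  have s[measurable]: "(\<lambda>x. ennreal (slope x)) \<in> borel_measurable borel" by measurable
  have sp[measurable]: "(\<lambda>x. ennreal (slope x powr p)) \<in> borel_measurable borel" by measurable
  have ball: "(\<integral>\<^sup>+y. ennreal (slope (x + s *\<^sub>R y)) \<partial>torus) \<le> ennreal (R * s powr (- 2 / p))"
    if s01: "0 < s" "s \<le> 1" for s x
  proof -
    (* the bound of the \<open>L\<^sup>p\<close> norm of \<open>y \<mapsto> slope (x + s y)\<close>, hence the right scale for Young's inequality *)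
    define \<alpha> where "\<alpha> = R * s powr (- 2 / p)"
    have \<alpha>: "\<alpha> > 0" using R s01 by (simp add: \<alpha>_def)
    define c where "c = (1 / p) * \<alpha> powr (1 - p)"
    have c: "c \<ge> 0" using p by (simp add: c_def)
    have m: "(\<lambda>y. ennreal (slope (x + s *\<^sub>R y) powr p)) \<in> borel_measurable torus"
      using measurable_segment(6)[OF sp] by simp
    have "(\<integral>\<^sup>+y. ennreal (slope (x + s *\<^sub>R y)) \<partial>torus)
        \<le> (\<integral>\<^sup>+y. ennreal c * ennreal (slope (x + s *\<^sub>R y) powr p) + ennreal ((1 - 1 / p) * \<alpha>) \<partial>torus)"
    proof (rule nn_integral_mono)
      fix y
      have "slope (x + s *\<^sub>R y) \<le> c * slope (x + s *\<^sub>R y) powr p + (1 - 1 / p) * \<alpha>"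
        unfolding c_def using p by (intro young_scaled slope_nonneg \<alpha>) simp
      then have "ennreal (slope (x + s *\<^sub>R y)) \<le> ennreal (c * slope (x + s *\<^sub>R y) powr p + (1 - 1 / p) * \<alpha>)"
        by (rule ennreal_leI)
      also have "\<dots> = ennreal c * ennreal (slope (x + s *\<^sub>R y) powr p) + ennreal ((1 - 1 / p) * \<alpha>)"
        using c p \<alpha> by (subst ennreal_plus) (simp_all add: ennreal_mult)
      finally show "ennreal (slope (x + s *\<^sub>R y)) \<le> \<dots>" .
    qed
    also have "\<dots> = ennreal c * (\<integral>\<^sup>+y. ennreal (slope (x + s *\<^sub>R y) powr p) \<partial>torus) + ennreal ((1 - 1 / p) * \<alpha>)"
      using m emeasure_torus by (simp add: nn_integral_add nn_integral_cmult)
    also have "ennreal c * (\<integral>\<^sup>+y. ennreal (slope (x + s *\<^sub>R y) powr p) \<partial>torus)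
        = ennreal (c / s\<^sup>2) * (ennreal (s\<^sup>2) * (\<integral>\<^sup>+y. ennreal (slope (x + s *\<^sub>R y) powr p) \<partial>torus))"
      using c s01 by (simp add: mult.assoc[symmetric] ennreal_mult[symmetric])
    also have "\<dots> \<le> ennreal (c / s\<^sup>2) * ennreal (R powr p)"
      by (rule mult_left_mono[OF order_trans[OF nn_integral_torus_scale[OF sp periodic_comp[OF slope_periodic] s01] w]]) simp
    also have "\<dots> = ennreal (\<alpha> / p)"
    proof -
      have "- 2 / p * (1 - p) = 2 - 2 / p" using p by (simp add: field_simps)
      then have "\<alpha> powr (1 - p) = R powr (1 - p) * s powr (2 - 2 / p)"
        using R s01 unfolding \<alpha>_def by (simp only: powr_mult powr_powr)
      moreover have "s powr (2 - 2 / p) = s\<^sup>2 * s powr (- 2 / p)"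
        using s01 by (simp add: powr_diff powr_minus_divide)
      moreover have "R powr (1 - p) * R powr p = R" using R by (simp add: powr_add[symmetric])
      ultimately have "c / s\<^sup>2 * R powr p = \<alpha> / p"
        using s01 unfolding c_def \<alpha>_def by (simp add: field_simps)
      then show ?thesis using c by (simp add: ennreal_mult[symmetric])
    qed
    finally have "(\<integral>\<^sup>+y. ennreal (slope (x + s *\<^sub>R y)) \<partial>torus) \<le> ennreal (\<alpha> / p) + ennreal ((1 - 1 / p) * \<alpha>)"
      by (simp add: add_right_mono)
    also have "\<dots> = ennreal \<alpha>"
      using p \<alpha> by (subst ennreal_plus[symmetric]) (simp_all add: field_simps)
    finally show ?thesis unfolding \<alpha>_def .
  qed
  have bd: "(\<integral>\<^sup>+y. \<integral>\<^sup>+s. ennreal (slope (x + s *\<^sub>R y)) \<partial>unit_interval \<partial>torus) \<le> ennreal (R / (1 - 2 / p))" for x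
  proof -
    have "(\<integral>\<^sup>+y. \<integral>\<^sup>+s. ennreal (slope (x + s *\<^sub>R y)) \<partial>unit_interval \<partial>torus)
        = (\<integral>\<^sup>+s. \<integral>\<^sup>+y. ennreal (slope (x + s *\<^sub>R y)) \<partial>torus \<partial>unit_interval)"
      using tu.Fubini[OF measurable_segment(10)[OF s, of x]] by simp
    also have "\<dots> \<le> (\<integral>\<^sup>+s. ennreal (R * s powr (- 2 / p)) \<partial>unit_interval)"
    proof (rule nn_integral_mono_AE)
      have "AE s in lborel. s \<noteq> (0::real)" by (rule AE_lborel_singleton)
      then have "AE s in unit_interval. s \<noteq> 0"
        unfolding unit_interval_def by (subst AE_restrict_space_iff) auto
      then show "AE s in unit_interval. (\<integral>\<^sup>+y. ennreal (slope (x + s *\<^sub>R y)) \<partial>torus) \<le> ennreal (R * s powr (- 2 / p))"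
        using AE_space by eventually_elim (rule ball, simp_all)
    qed
    also have "\<dots> = (\<integral>\<^sup>+s. ennreal ((R * s powr (- 2 / p)) * indicator {0..1} s) \<partial>lborel)"
      unfolding unit_interval_def by (subst nn_integral_restrict_space)
        (auto intro!: nn_integral_cong simp: indicator_def)
    also have "\<dots> = ennreal (R / (1 - 2 / p))"
    proof (rule nn_integral_has_integral_lborel)
      show "(\<lambda>s. (R * s powr (- 2 / p)) * indicator {0..1} s) \<in> borel_measurable borel" by measurable
      show "0 \<le> (R * s powr (- 2 / p)) * indicator {0..1} s" for s using R by simp
      have "((\<lambda>s. s powr (- 2 / p)) has_integral (1 powr (- 2 / p + 1) / (- 2 / p + 1))) {0..1}"
        using p by (intro has_integral_powr_from_0) (auto simp: field_simps)
      from has_integral_mult_right[OF this, of R]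
      have "((\<lambda>s. R * s powr (- 2 / p)) has_integral (R / (1 - 2 / p))) {0..1}" by simp
      then have "((\<lambda>s. if s \<in> {0..1} then R * s powr (- 2 / p) else 0) has_integral (R / (1 - 2 / p))) UNIV"
        by (simp only: has_integral_restrict_UNIV)
      then show "((\<lambda>s. (R * s powr (- 2 / p)) * indicator {0..1} s) has_integral (R / (1 - 2 / p))) UNIV"
        by (rule has_integral_eq[rotated]) (simp add: indicator_def)
    qed
    finally show ?thesis .
  qed
  have "0 \<le> R / (1 - 2 / p)" using R p by simp
  from avg_bound show ?thesis
  proof eventually_elim
    case (elim x)
    then have "ennreal (norm (f x - avg)) \<le> ennreal (R / (1 - 2 / p))" using bd by (rule order_trans)
    then show ?case using \<open>0 \<le> R / (1 - 2 / p)\<close> by (simp only: ennreal_le_iff)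
  qed
qed

end

section \<open>Continuity of translations in the mean\<close>

lemma emeasure_torus_cbox [simp]: "emeasure torus (cbox (0, 0) (1, 1)) = 1"
  using emeasure_torus by simp

lemma emeasure_unit_interval_cbox [simp]: "emeasure unit_interval {0..1} = 1"
  using emeasure_unit_interval by simp

text \<open>
  The square of the \<open>L\<^sup>2\<close> distance, with values in \<open>ennreal\<close> so that no integrability has to be carried along.
  Being a square, it satisfies the triangle inequality up to a factor.
\<close>

definition sq_dist :: "(real \<times> real \<Rightarrow> 'b::real_normed_vector) \<Rightarrow> (real \<times> real \<Rightarrow> 'b) \<Rightarrow> ennreal" where
  "sq_dist u v = (\<integral>\<^sup>+x. ennreal ((norm (u x - v x))\<^sup>2) \<partial>torus)"

lemma measurable_norm_sq:
  fixes u v :: "real \<times> real \<Rightarrow> 'b::{banach, second_countable_topology}"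
  assumes "u \<in> borel_measurable borel" "v \<in> borel_measurable borel"
  shows "(\<lambda>x. ennreal ((norm (u x - v x))\<^sup>2)) \<in> borel_measurable torus"
proof (rule measurable_torus)
  note [measurable] = assms
  show "(\<lambda>x. ennreal ((norm (u x - v x))\<^sup>2)) \<in> borel_measurable borel" by measurable
qed

lemma norm_sq_add_le:
  fixes a b :: "'b::real_normed_vector"
  shows "(norm (a + b))\<^sup>2 \<le> 2 * (norm a)\<^sup>2 + 2 * (norm b)\<^sup>2"
proof -
  have "(norm (a + b))\<^sup>2 \<le> (norm a + norm b)\<^sup>2" by (intro power_mono norm_triangle_ineq) simp
  also have "\<dots> \<le> 2 * (norm a)\<^sup>2 + 2 * (norm b)\<^sup>2"
    using zero_le_power2[of "norm a - norm b"] by (simp add: power2_eq_square algebra_simps)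
  finally show ?thesis .
qed

lemma sq_dist_add:
  fixes u v u' v' :: "real \<times> real \<Rightarrow> 'b::{banach, second_countable_topology}"
  assumes m: "u \<in> borel_measurable borel" "v \<in> borel_measurable borel"
    "u' \<in> borel_measurable borel" "v' \<in> borel_measurable borel"
  shows "sq_dist (\<lambda>x. u x + u' x) (\<lambda>x. v x + v' x) \<le> 2 * sq_dist u v + 2 * sq_dist u' v'"
proof -
  have "sq_dist (\<lambda>x. u x + u' x) (\<lambda>x. v x + v' x) \<le>
     (\<integral>\<^sup>+x. 2 * ennreal ((norm (u x - v x))\<^sup>2) + 2 * ennreal ((norm (u' x - v' x))\<^sup>2) \<partial>torus)"
    unfolding sq_dist_def
  proof (rule nn_integral_mono)
    fix x
    have "(norm (u x + u' x - (v x + v' x)))\<^sup>2 \<le> 2 * (norm (u x - v x))\<^sup>2 + 2 * (norm (u' x - v' x))\<^sup>2"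
      using norm_sq_add_le[of "u x - v x" "u' x - v' x"] by (simp only: add_diff_add)
    then have "ennreal ((norm (u x + u' x - (v x + v' x)))\<^sup>2) \<le> ennreal (2 * (norm (u x - v x))\<^sup>2 + 2 * (norm (u' x - v' x))\<^sup>2)"
      by (rule ennreal_leI)
    then show "ennreal ((norm (u x + u' x - (v x + v' x)))\<^sup>2) \<le> 2 * ennreal ((norm (u x - v x))\<^sup>2) + 2 * ennreal ((norm (u' x - v' x))\<^sup>2)"
      by (simp add: ennreal_mult)
  qed
  also have "\<dots> = 2 * sq_dist u v + 2 * sq_dist u' v'"
    using measurable_norm_sq[OF m(1,2)] measurable_norm_sq[OF m(3,4)]
    unfolding sq_dist_def by (simp add: nn_integral_add nn_integral_cmult)
  finally show ?thesis .
qed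

lemma sq_dist_triangle:
  fixes u v w :: "real \<times> real \<Rightarrow> 'b::{banach, second_countable_topology}"
  assumes m: "u \<in> borel_measurable borel" "v \<in> borel_measurable borel" "w \<in> borel_measurable borel"
  shows "sq_dist u w \<le> 2 * sq_dist u v + 2 * sq_dist v w"
proof -
  have "sq_dist u w = sq_dist (\<lambda>x. u x + v x) (\<lambda>x. v x + w x)"
    by (simp add: sq_dist_def)
  also have "\<dots> \<le> 2 * sq_dist u v + 2 * sq_dist v w" by (rule sq_dist_add) (use m in simp_all)
  finally show ?thesis .
qed

lemma borel_measurable_shift:
  fixes u :: "real \<times> real \<Rightarrow> 'b::{banach, second_countable_topology}"
  assumes [measurable]: "u \<in> borel_measurable borel"
  shows "(\<lambda>x. u (x + y)) \<in> borel_measurable borel"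
  by measurable

definition shift_continuous :: "(real \<times> real \<Rightarrow> 'b::{banach, second_countable_topology}) \<Rightarrow> bool" where
  "shift_continuous u \<longleftrightarrow> u \<in> borel_measurable borel \<and> periodic u \<and>
     (\<forall>h::nat \<Rightarrow> real \<times> real. h \<longlonglongrightarrow> 0 \<longrightarrow> (\<lambda>n. sq_dist (\<lambda>x. u (x + h n)) u) \<longlonglongrightarrow> 0)"

lemma ennreal_tendsto_0_le:
  fixes f g :: "nat \<Rightarrow> ennreal"
  assumes "g \<longlonglongrightarrow> 0" "\<And>n. f n \<le> g n" shows "f \<longlonglongrightarrow> 0"
  by (rule tendsto_sandwich[OF _ _ tendsto_const assms(1)]) (use assms(2) in simp_all)

lemma ennreal_tendsto_cmult_0:
  fixes f :: "nat \<Rightarrow> ennreal"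
  assumes "f \<longlonglongrightarrow> 0" "c < \<infinity>" shows "(\<lambda>n. c * f n) \<longlonglongrightarrow> 0"
  using ennreal_tendsto_cmult[OF _ assms(1), of c] assms(2) by simp

lemma shift_continuous_add:
  assumes "shift_continuous u" "shift_continuous v" shows "shift_continuous (\<lambda>x. u x + v x)"
  unfolding shift_continuous_def
proof (intro conjI allI impI)
  have m: "u \<in> borel_measurable borel" "v \<in> borel_measurable borel" using assms by (simp_all add: shift_continuous_def)
  show "(\<lambda>x. u x + v x) \<in> borel_measurable borel" using m by simp
  show "periodic (\<lambda>x. u x + v x)" using assms periodic_comp2[of u v "(+)"] unfolding shift_continuous_def by blast
  fix h :: "nat \<Rightarrow> real \<times> real" assume h: "h \<longlonglongrightarrow> 0"
  have "(\<lambda>n. sq_dist (\<lambda>x. u (x + h n)) u) \<longlonglongrightarrow> 0" "(\<lambda>n. sq_dist (\<lambda>x. v (x + h n)) v) \<longlonglongrightarrow> 0"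
    using assms h by (simp_all add: shift_continuous_def)
  then have "(\<lambda>n. 2 * sq_dist (\<lambda>x. u (x + h n)) u + 2 * sq_dist (\<lambda>x. v (x + h n)) v) \<longlonglongrightarrow> 0 + 0"
    by (intro tendsto_add ennreal_tendsto_cmult_0) simp_all
  then have "(\<lambda>n. 2 * sq_dist (\<lambda>x. u (x + h n)) u + 2 * sq_dist (\<lambda>x. v (x + h n)) v) \<longlonglongrightarrow> 0" by simp
  then show "(\<lambda>n. sq_dist (\<lambda>x. u (x + h n) + v (x + h n)) (\<lambda>x. u x + v x)) \<longlonglongrightarrow> 0"
    by (rule ennreal_tendsto_0_le) (rule sq_dist_add[OF borel_measurable_shift[OF m(1)] m(1) borel_measurable_shift[OF m(2)] m(2)])
qed

lemma shift_continuous_scaleR: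
  fixes c :: "'b::{banach, second_countable_topology}" and u :: "real \<times> real \<Rightarrow> real"
  assumes "shift_continuous u" shows "shift_continuous (\<lambda>x. u x *\<^sub>R c)"
  unfolding shift_continuous_def
proof (intro conjI allI impI)
  have m[measurable]: "u \<in> borel_measurable borel" using assms by (simp add: shift_continuous_def)
  show "(\<lambda>x. u x *\<^sub>R c) \<in> borel_measurable borel" using m by simp
  show "periodic (\<lambda>x. u x *\<^sub>R c)" using assms unfolding shift_continuous_def by (blast intro: periodic_comp[of u "\<lambda>t. t *\<^sub>R c"])
  fix h :: "nat \<Rightarrow> real \<times> real" assume h: "h \<longlonglongrightarrow> 0"
  then have l: "(\<lambda>n. ennreal ((norm c)\<^sup>2) * sq_dist (\<lambda>x. u (x + h n)) u) \<longlonglongrightarrow> 0"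
    using assms by (intro ennreal_tendsto_cmult_0) (simp_all add: shift_continuous_def)
  have mm: "(\<lambda>x. ennreal ((norm (u (x + y) - u x))\<^sup>2)) \<in> borel_measurable torus" for y
    by (rule measurable_norm_sq) measurable
  have "sq_dist (\<lambda>x. u (x + y) *\<^sub>R c) (\<lambda>x. u x *\<^sub>R c) = ennreal ((norm c)\<^sup>2) * sq_dist (\<lambda>x. u (x + y)) u" for y
    unfolding sq_dist_def nn_integral_cmult[OF mm, symmetric]
  proof (rule nn_integral_cong)
    fix x
    have "(norm (u (x + y) *\<^sub>R c - u x *\<^sub>R c))\<^sup>2 = (norm c)\<^sup>2 * (norm (u (x + y) - u x))\<^sup>2"
      unfolding scaleR_diff_left[symmetric] norm_scaleR real_norm_def power_mult_distrib by (rule mult.commute)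
    then show "ennreal ((norm (u (x + y) *\<^sub>R c - u x *\<^sub>R c))\<^sup>2) = ennreal ((norm c)\<^sup>2) * ennreal ((norm (u (x + y) - u x))\<^sup>2)"
      by (simp only: ennreal_mult[OF zero_le_power2 zero_le_power2])
  qed
  then show "(\<lambda>n. sq_dist (\<lambda>x. u (x + h n) *\<^sub>R c) (\<lambda>x. u x *\<^sub>R c)) \<longlonglongrightarrow> 0" using l by simp
qed

text \<open>
  Compare \<open>u (x + h)\<close> with \<open>v k (x + h)\<close>, then with \<open>v k x\<close> and with \<open>u x\<close>: the first and the last distance
  agree by translation invariance, and they are small uniformly in \<open>h\<close>.
\<close>

lemma shift_continuous_closed:
  fixes u :: "real \<times> real \<Rightarrow> 'b::{banach, second_countable_topology}"
  assumes u: "u \<in> borel_measurable borel" "periodic u"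
    and v: "\<And>k::nat. shift_continuous (v k)" and lim: "(\<lambda>k. sq_dist (v k) u) \<longlonglongrightarrow> 0"
  shows "shift_continuous u"
  unfolding shift_continuous_def
proof (intro conjI allI impI u)
  fix h :: "nat \<Rightarrow> real \<times> real" assume h: "h \<longlonglongrightarrow> 0"
  have m: "v k \<in> borel_measurable borel" "periodic (v k)" for k using v[of k] by (simp_all add: shift_continuous_def)
  have um[measurable]: "u \<in> borel_measurable borel" by (rule u(1))
  have vm'[measurable]: "v k \<in> borel_measurable borel" for k by (rule m(1))
  have us: "(\<lambda>x. u (x + y)) \<in> borel_measurable borel" and vs: "(\<lambda>x. v k (x + y)) \<in> borel_measurable borel" for y k
    by measurable
  have sh: "sq_dist (\<lambda>x. u (x + y)) (\<lambda>x. v k (x + y)) = sq_dist (v k) u" for y k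
  proof -
    have "(\<integral>\<^sup>+x. ennreal ((norm (u (x + y) - v k (x + y)))\<^sup>2) \<partial>torus) = (\<integral>\<^sup>+x. ennreal ((norm (u x - v k x))\<^sup>2) \<partial>torus)"
    proof (rule nn_integral_torus_shift[of "\<lambda>x. ennreal ((norm (u x - v k x))\<^sup>2)"])
      show "(\<lambda>x. ennreal ((norm (u x - v k x))\<^sup>2)) \<in> borel_measurable borel" by measurable
      show "periodic (\<lambda>x. ennreal ((norm (u x - v k x))\<^sup>2))"
        by (rule periodic_comp2[OF u(2) m(2)[of k], of "\<lambda>a b. ennreal ((norm (a - b))\<^sup>2)"])
    qed
    then show ?thesis by (simp add: sq_dist_def norm_minus_commute)
  qed
  have le: "sq_dist (\<lambda>x. u (x + h n)) u \<le> 6 * sq_dist (v k) u + 4 * sq_dist (\<lambda>x. v k (x + h n)) (v k)" for n k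
  proof -
    have "sq_dist (\<lambda>x. u (x + h n)) u \<le> 2 * sq_dist (\<lambda>x. u (x + h n)) (\<lambda>x. v k (x + h n)) + 2 * sq_dist (\<lambda>x. v k (x + h n)) u"
      by (rule sq_dist_triangle[OF us vs um])
    also have "\<dots> \<le> 2 * sq_dist (v k) u + 2 * (2 * sq_dist (\<lambda>x. v k (x + h n)) (v k) + 2 * sq_dist (v k) u)"
      unfolding sh by (intro add_left_mono mult_left_mono sq_dist_triangle um vm' zero_le vs)
    also have "\<dots> = 6 * sq_dist (v k) u + 4 * sq_dist (\<lambda>x. v k (x + h n)) (v k)"
    proof -
      have "6 * a = 2 * a + 4 * a" for a :: ennreal by (simp only: distrib_right[symmetric]) simp
      then show ?thesis by (simp only: distrib_left mult.assoc[symmetric]) (simp add: ac_simps)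
    qed
    finally show ?thesis .
  qed
  show "(\<lambda>n. sq_dist (\<lambda>x. u (x + h n)) u) \<longlonglongrightarrow> 0"
  proof (rule order_tendstoI)
    fix e :: ennreal assume "0 < e"
    then obtain d :: ennreal where d: "0 < d" "d < e" using dense by blast
    have "(\<lambda>k. 6 * sq_dist (v k) u) \<longlonglongrightarrow> 0" by (intro ennreal_tendsto_cmult_0 lim) simp
    from order_tendstoD(2)[OF this d(1)] obtain k where k: "6 * sq_dist (v k) u < d"
      unfolding eventually_sequentially by blast
    have "(\<lambda>n. 6 * sq_dist (v k) u + 4 * sq_dist (\<lambda>x. v k (x + h n)) (v k)) \<longlonglongrightarrow> 6 * sq_dist (v k) u + 0"
      using v[of k] h by (intro tendsto_add tendsto_const ennreal_tendsto_cmult_0) (simp_all add: shift_continuous_def)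
    moreover have "6 * sq_dist (v k) u + 0 < e" using k d by simp
    ultimately have "\<forall>\<^sub>F n in sequentially. 6 * sq_dist (v k) u + 4 * sq_dist (\<lambda>x. v k (x + h n)) (v k) < e"
      by (rule order_tendstoD(2))
    then show "\<forall>\<^sub>F n in sequentially. sq_dist (\<lambda>x. u (x + h n)) u < e"
      by eventually_elim (rule le_less_trans[OF le])
  qed simp
qed

lemma sq_dist_tendsto_0:
  fixes v :: "nat \<Rightarrow> real \<times> real \<Rightarrow> 'b::{banach, second_countable_topology}"
  assumes m: "\<And>n. v n \<in> borel_measurable borel" "u \<in> borel_measurable borel"
    and w: "w \<in> borel_measurable borel" "(\<integral>\<^sup>+x. ennreal (w x) \<partial>torus) < \<infinity>"
    and bd: "\<And>n x. (norm (v n x - u x))\<^sup>2 \<le> w x" and lim: "\<And>x. (\<lambda>n. v n x) \<longlonglongrightarrow> u x"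
  shows "(\<lambda>n. sq_dist (v n) u) \<longlonglongrightarrow> 0"
proof -
  have "(\<lambda>n. \<integral>\<^sup>+x. ennreal ((norm (v n x - u x))\<^sup>2) \<partial>torus) \<longlonglongrightarrow> (\<integral>\<^sup>+x. 0 \<partial>torus)"
  proof (rule nn_integral_dominated_convergence[where w = "\<lambda>x. ennreal (w x)"])
    show "(\<lambda>x. ennreal ((norm (v n x - u x))\<^sup>2)) \<in> borel_measurable torus" for n
      by (rule measurable_norm_sq[OF m])
    show "(\<lambda>x. ennreal (w x)) \<in> borel_measurable torus"
      by (rule measurable_compose[OF measurable_torus[OF w(1)] measurable_ennreal])
    show "AE x in torus. ennreal ((norm (v n x - u x))\<^sup>2) \<le> ennreal (w x)" for n
      by (intro AE_I2 ennreal_leI bd)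
    have "(\<lambda>n. ennreal ((norm (v n x - u x))\<^sup>2)) \<longlonglongrightarrow> ennreal ((norm (u x - u x))\<^sup>2)" for x
      by (intro tendsto_intros lim)
    then show "AE x in torus. (\<lambda>n. ennreal ((norm (v n x - u x))\<^sup>2)) \<longlonglongrightarrow> 0" by (intro AE_I2) simp
  qed (use w(2) in simp_all)
  then show ?thesis by (simp add: sq_dist_def)
qed

lemma shift_continuous_trigexp: assumes "trigexp f" shows "shift_continuous f"
  unfolding shift_continuous_def
proof (intro conjI allI impI)
  show m: "f \<in> borel_measurable borel" by (rule trigexp_measurable[OF assms])
  show "periodic f" by (rule trigexp_periodic[OF assms])
  obtain K where K: "\<And>x. \<bar>f x\<bar> \<le> K" using trigexp_bounded[OF assms] by blast
  fix h :: "nat \<Rightarrow> real \<times> real" assume h: "h \<longlonglongrightarrow> 0"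
  show "(\<lambda>n. sq_dist (\<lambda>x. f (x + h n)) f) \<longlonglongrightarrow> 0"
  proof (rule sq_dist_tendsto_0[where w = "\<lambda>_. (2 * K)\<^sup>2"])
    show "(\<lambda>x. f (x + h n)) \<in> borel_measurable borel" for n
      by (rule borel_measurable_shift[OF m])
    have "\<bar>f (x + h n) - f x\<bar> \<le> \<bar>2 * K\<bar>" for n x using K[of x] K[of "x + h n"] by linarith
    then show "(norm (f (x + h n) - f x))\<^sup>2 \<le> (2 * K)\<^sup>2" for n x
      by (simp only: real_norm_def power2_abs abs_le_square_iff[symmetric])
    have "isCont f x" for x using trigexp_continuous[OF assms] by (simp add: continuous_on_eq_continuous_at)
    moreover have "(\<lambda>n. x + h n) \<longlonglongrightarrow> x" for x using tendsto_add[OF tendsto_const h, of x] by simp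
    ultimately show "(\<lambda>n. f (x + h n)) \<longlonglongrightarrow> f x" for x by (rule isCont_tendsto_compose)
  qed (use m in simp_all)
qed

lemma shift_continuous_diff:
  fixes u v :: "real \<times> real \<Rightarrow> real"
  assumes "shift_continuous u" "shift_continuous v" shows "shift_continuous (\<lambda>x. u x - v x)"
  using shift_continuous_add[OF assms(1) shift_continuous_scaleR[OF assms(2), of "-1"]] by simp

lemma shift_continuous_indicator:
  assumes A: "A \<in> sets borel" shows "shift_continuous (\<lambda>x. indicator A (cell x) :: real)"
proof -
  define C where "C h \<longleftrightarrow> shift_continuous h \<and> (\<exists>K. \<forall>x. \<bar>h x\<bar> \<le> K)" for h :: "real \<times> real \<Rightarrow> real"
  have tr: "C f" if "trigexp f" for f
    unfolding C_def using shift_continuous_trigexp[OF that] trigexp_bounded[OF that] by blast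
  have ad: "C (\<lambda>x. f x + g x) \<and> C (\<lambda>x. f x - g x)" if fg: "C f" "C g" for f g
  proof -
    obtain K L where K: "\<forall>x. \<bar>f x\<bar> \<le> K" "\<forall>x. \<bar>g x\<bar> \<le> L" using fg unfolding C_def by blast
    have "\<bar>f x + g x\<bar> \<le> K + L" "\<bar>f x - g x\<bar> \<le> K + L" for x
      using K(1)[rule_format, of x] K(2)[rule_format, of x] by linarith+
    then have "\<exists>K. \<forall>x. \<bar>f x + g x\<bar> \<le> K" "\<exists>K. \<forall>x. \<bar>f x - g x\<bar> \<le> K" by blast+
    moreover have "shift_continuous (\<lambda>x. f x + g x)" "shift_continuous (\<lambda>x. f x - g x)"
      using fg unfolding C_def by (blast intro: shift_continuous_add, blast intro: shift_continuous_diff)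
    ultimately show ?thesis unfolding C_def by blast
  qed
  have lim: "C h" if f: "\<And>n. C (f n)" and K: "\<And>n x. \<bar>f n x\<bar> \<le> K" and l: "\<And>x. (\<lambda>n. f n x) \<longlonglongrightarrow> h x"
    for f :: "nat \<Rightarrow> real \<times> real \<Rightarrow> real" and h :: "real \<times> real \<Rightarrow> real" and K :: real
  proof -
    have s: "shift_continuous (f n)" for n using f[of n] unfolding C_def by blast
    have m: "f n \<in> borel_measurable borel" "periodic (f n)" for n using s[of n] by (simp_all add: shift_continuous_def)
    have hb: "\<bar>h x\<bar> \<le> K" for x using tendsto_rabs[OF l[of x]] by (rule LIMSEQ_le_const2) (use K in auto)
    have hm: "h \<in> borel_measurable borel" by (rule borel_measurable_LIMSEQ_metric[OF m(1) l])
    have hp: "periodic h"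
      unfolding periodic_def
    proof (intro allI ballI)
      fix x e :: "real \<times> real" assume "e \<in> Basis"
      then have "f n (x + e) = f n x" for n using m(2)[of n] by (simp add: periodic_def)
      then show "h (x + e) = h x" using LIMSEQ_unique[OF l[of x]] l[of "x + e"] by simp
    qed
    have "(\<lambda>n. sq_dist (f n) h) \<longlonglongrightarrow> 0"
    proof (rule sq_dist_tendsto_0[where w = "\<lambda>_. (2 * K)\<^sup>2"])
      have "\<bar>f n x - h x\<bar> \<le> \<bar>2 * K\<bar>" for n x using K[of n x] hb[of x] by linarith
      then show "(norm (f n x - h x))\<^sup>2 \<le> (2 * K)\<^sup>2" for n x
        by (simp only: real_norm_def power2_abs abs_le_square_iff[symmetric])
    qed (use m hm l in simp_all)
    then have "shift_continuous h" by (rule shift_continuous_closed[OF hm hp s])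
    moreover have "\<exists>K. \<forall>x. \<bar>h x\<bar> \<le> K" using hb by blast
    ultimately show ?thesis unfolding C_def by blast
  qed
  have "C (\<lambda>x. indicator A (cell x) :: real)"
    by (rule trigexp_monotone_class[of C, OF tr conjunct1[OF ad] conjunct2[OF ad] lim A])
  then show ?thesis unfolding C_def by blast
qed

lemma Lq2_iff:
  fixes u :: "real \<times> real \<Rightarrow> 'b::{banach, second_countable_topology}"
  shows "Lq 2 u \<longleftrightarrow> u \<in> borel_measurable borel \<and> periodic u \<and> integrable torus (\<lambda>x. (norm (u x))\<^sup>2)"
  by (simp add: Lq_def)

text \<open>
  Simple functions of \<open>cell x\<close> are dense, and for these the claim reduces to indicators, which arise from
  continuous test functions by bounded pointwise limits.
\<close>

lemma shift_continuous_L2: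
  fixes u :: "real \<times> real \<Rightarrow> 'b::{banach, second_countable_topology}"
  assumes u: "Lq 2 u" shows "shift_continuous u"
proof -
  have m[measurable]: "u \<in> borel_measurable borel" and per: "periodic u" and i: "integrable torus (\<lambda>x. (norm (u x))\<^sup>2)"
    using u by (simp_all add: Lq2_iff)
  obtain F where "\<forall>i. simple_function borel (F i)" "\<forall>x. (\<lambda>i. F i x) \<longlonglongrightarrow> u x"
    "\<forall>i x. norm (F i x) \<le> 2 * norm (u x)"
    using borel_measurable_implies_sequence_metric[OF m, of 0] by auto
  then have F: "simple_function borel (F i)" "(\<lambda>i. F i x) \<longlonglongrightarrow> u x" "norm (F i x) \<le> 2 * norm (u x)" for i x
    by simp_all
  define v where "v k x = F k (cell x)" for k x
  have sc: "shift_continuous (v k)" for k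
  proof -
    have fin: "finite (range (F k))" using simple_functionD(1)[OF F(1)[of k]] by simp
    have "v k = (\<lambda>x. \<Sum>y\<in>range (F k). indicator (F k -` {y}) (cell x) *\<^sub>R y)"
    proof
      fix x
      have "(\<Sum>y\<in>range (F k). indicator (F k -` {y}) (cell x) *\<^sub>R y) = (\<Sum>y\<in>range (F k). if F k (cell x) = y then y else 0)"
        by (intro sum.cong refl) (simp add: indicator_def)
      then show "v k x = (\<Sum>y\<in>range (F k). indicator (F k -` {y}) (cell x) *\<^sub>R y)"
        using fin by (simp add: v_def)
    qed
    moreover have "shift_continuous (\<lambda>x. \<Sum>y\<in>Y. indicator (F k -` {y}) (cell x) *\<^sub>R y)" if "finite Y" for Y
      using that
    proof induction
      case empty
      show ?case using shift_continuous_scaleR[OF shift_continuous_trigexp[OF trigexp.const[of 0]], of 0] by simp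
    next
      case (insert y Y)
      have "F k -` {y} \<in> sets borel" using simple_functionD(2)[OF F(1)[of k], of "{y}"] by simp
      then have "shift_continuous (\<lambda>x. indicator (F k -` {y}) (cell x) *\<^sub>R y)"
        by (intro shift_continuous_scaleR shift_continuous_indicator)
      from shift_continuous_add[OF this insert.IH] show ?case unfolding sum.insert[OF insert.hyps] .
    qed
    ultimately show ?thesis using fin by simp
  qed
  have vm: "v k \<in> borel_measurable borel" for k using sc[of k] by (simp add: shift_continuous_def)
  have "(\<lambda>k. sq_dist (v k) u) \<longlonglongrightarrow> 0"
  proof (rule sq_dist_tendsto_0[where w = "\<lambda>x. 9 * (norm (u x))\<^sup>2"])
    have "integrable torus (\<lambda>x. 9 * (norm (u x))\<^sup>2)" using i by simp
    from nn_integral_eq_integral[OF this] show "(\<integral>\<^sup>+x. ennreal (9 * (norm (u x))\<^sup>2) \<partial>torus) < \<infinity>"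
      by simp
    show "(\<lambda>n. v n x) \<longlonglongrightarrow> u x" for x using F(2)[of "cell x"] by (simp add: v_def periodic_cell[OF per])
    show "(norm (v n x - u x))\<^sup>2 \<le> 9 * (norm (u x))\<^sup>2" for n x
    proof -
      have "norm (v n x) \<le> 2 * norm (u x)" using F(3)[of n "cell x"] by (simp add: v_def periodic_cell[OF per])
      then have "norm (v n x - u x) \<le> 3 * norm (u x)" using norm_triangle_ineq4[of "v n x" "u x"] by linarith
      then have "(norm (v n x - u x))\<^sup>2 \<le> (3 * norm (u x))\<^sup>2" by (rule power_mono) simp
      then show ?thesis by (simp add: power_mult_distrib)
    qed
    show "(\<lambda>x. 9 * (norm (u x))\<^sup>2) \<in> borel_measurable borel" by measurable
  qed (rule vm m)+
  then show ?thesis by (rule shift_continuous_closed[OF m per sc])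
qed

section \<open>Weak derivatives in different directions\<close>

lemma mult_le_sum_squares: "(a::real) * b \<le> a\<^sup>2 + b\<^sup>2"
proof -
  have "0 \<le> (a - b)\<^sup>2" "0 \<le> a\<^sup>2" "0 \<le> b\<^sup>2" by simp_all
  moreover have "(a - b)\<^sup>2 = a\<^sup>2 + b\<^sup>2 - 2 * (a * b)" by (simp add: power2_diff)
  ultimately show ?thesis by linarith
qed

text \<open>
  The error splits into products with at least one small factor; Young's inequality with a weight \<open>d\<close> keeps
  the coefficient of the fixed factors below \<open>e\<close>.
\<close>

lemma L2_inner_tendsto:
  fixes A B :: "nat \<Rightarrow> 'a \<Rightarrow> 'b::{real_inner, banach, second_countable_topology}"
  assumes m: "\<And>n. A n \<in> borel_measurable M" "\<And>n. B n \<in> borel_measurable M"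
      "A' \<in> borel_measurable M" "B' \<in> borel_measurable M"
    and i: "integrable M (\<lambda>x. (norm (A' x))\<^sup>2)" "integrable M (\<lambda>x. (norm (B' x))\<^sup>2)"
    and lim: "(\<lambda>n. \<integral>\<^sup>+x. ennreal ((norm (A n x - A' x))\<^sup>2) \<partial>M) \<longlonglongrightarrow> 0"
      "(\<lambda>n. \<integral>\<^sup>+x. ennreal ((norm (B n x - B' x))\<^sup>2) \<partial>M) \<longlonglongrightarrow> 0"
  shows "(\<lambda>n. LINT x|M. A n x \<bullet> B n x) \<longlonglongrightarrow> (LINT x|M. A' x \<bullet> B' x)"
proof (rule LIMSEQ_I)
  fix e :: real assume e: "0 < e"
  note [measurable] = m
  define \<alpha> where "\<alpha> = (LINT x|M. (norm (A' x))\<^sup>2)"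
  define \<beta> where "\<beta> = (LINT x|M. (norm (B' x))\<^sup>2)"
  have ab: "\<alpha> \<ge> 0" "\<beta> \<ge> 0" by (simp_all add: \<alpha>_def \<beta>_def integral_nonneg_AE)
  define d where "d = e / (\<alpha> + \<beta> + 1)"
  have d: "d > 0" using e ab by (simp add: d_def)
  define k where "k = 1 + 1 / d"
  have k: "k > 0" using d by (simp add: k_def add_pos_pos)
  define \<eta> where "\<eta> = e / (2 * k)"
  have \<eta>: "\<eta> > 0" using e k by (simp add: \<eta>_def)
  have "\<forall>\<^sub>F n in sequentially. (\<integral>\<^sup>+x. ennreal ((norm (A n x - A' x))\<^sup>2) \<partial>M) < ennreal \<eta>"
       "\<forall>\<^sub>F n in sequentially. (\<integral>\<^sup>+x. ennreal ((norm (B n x - B' x))\<^sup>2) \<partial>M) < ennreal \<eta>"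
    using lim[THEN order_tendstoD(2)] \<eta> by simp_all
  then have "\<forall>\<^sub>F n in sequentially. norm ((LINT x|M. A n x \<bullet> B n x) - (LINT x|M. A' x \<bullet> B' x)) < e"
  proof eventually_elim
    case (elim n)
    have fin: "integrable M g \<and> (LINT x|M. g x) < \<eta>"
      if "(\<integral>\<^sup>+x. ennreal (g x) \<partial>M) < ennreal \<eta>" "g \<in> borel_measurable M" "\<And>x. 0 \<le> g x" for g
    proof -
      have "integrable M g" using that by (intro integrableI_nonneg) (auto intro: less_trans[OF _ ennreal_less_top])
      then show ?thesis using that \<eta> nn_integral_eq_integral[of M g]
        by (simp add: ennreal_less_iff integral_nonneg_AE)
    qed
    have fA: "integrable M (\<lambda>x. (norm (A n x - A' x))\<^sup>2)" "(LINT x|M. (norm (A n x - A' x))\<^sup>2) < \<eta>"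
      using fin[OF elim(1)] by simp_all
    have fB: "integrable M (\<lambda>x. (norm (B n x - B' x))\<^sup>2)" "(LINT x|M. (norm (B n x - B' x))\<^sup>2) < \<eta>"
      using fin[OF elim(2)] by simp_all
    let ?g = "\<lambda>x. (k / 2) * ((norm (A n x - A' x))\<^sup>2 + (norm (B n x - B' x))\<^sup>2) + (d / 2) * ((norm (A' x))\<^sup>2 + (norm (B' x))\<^sup>2)"
    have gi: "integrable M ?g" using fA(1) fB(1) i by simp
    have young: "s * t \<le> (1 / (2 * d)) * s\<^sup>2 + (d / 2) * t\<^sup>2" for s t :: real
    proof -
      have "0 \<le> (s - d * t)\<^sup>2 / (2 * d)" using d by simp
      also have "\<dots> = (1 / (2 * d)) * s\<^sup>2 + (d / 2) * t\<^sup>2 - s * t"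
        using d by (simp add: power2_eq_square field_simps)
      finally show ?thesis by simp
    qed
    have le: "\<bar>A n x \<bullet> B n x - A' x \<bullet> B' x\<bar> \<le> ?g x" for x
    proof -
      let ?a = "norm (A n x - A' x)" and ?b = "norm (B n x - B' x)"
      have "A n x \<bullet> B n x - A' x \<bullet> B' x =
        (A n x - A' x) \<bullet> (B n x - B' x) + (A n x - A' x) \<bullet> B' x + A' x \<bullet> (B n x - B' x)"
        by (simp add: inner_diff_left inner_diff_right)
      also have "\<bar>\<dots>\<bar> \<le> ?a * ?b + ?a * norm (B' x) + norm (A' x) * ?b"
        by (intro order_trans[OF abs_triangle_ineq add_mono] order_trans[OF abs_triangle_ineq add_mono] Cauchy_Schwarz_ineq2)
      also have "\<dots> \<le> (?a\<^sup>2 / 2 + ?b\<^sup>2 / 2) + ((1 / (2 * d)) * ?a\<^sup>2 + (d / 2) * (norm (B' x))\<^sup>2)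
          + ((1 / (2 * d)) * ?b\<^sup>2 + (d / 2) * (norm (A' x))\<^sup>2)"
      proof (intro add_mono young)
        show "?a * ?b \<le> ?a\<^sup>2 / 2 + ?b\<^sup>2 / 2"
          using zero_le_power2[of "?a - ?b"] by (simp add: power2_eq_square algebra_simps)
        show "norm (A' x) * ?b \<le> (1 / (2 * d)) * ?b\<^sup>2 + (d / 2) * (norm (A' x))\<^sup>2"
          using young[of ?b "norm (A' x)"] by (simp add: mult.commute)
      qed
      also have "\<dots> = ?g x" unfolding k_def using d by (simp add: field_simps)
      finally show ?thesis .
    qed
    have i1: "integrable M (\<lambda>x. A n x \<bullet> B n x - A' x \<bullet> B' x)"
    proof (rule Bochner_Integration.integrable_bound[OF gi])
      show "AE x in M. norm (A n x \<bullet> B n x - A' x \<bullet> B' x) \<le> norm (?g x)"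
        unfolding real_norm_def by (rule AE_I2) (rule order_trans[OF le abs_ge_self])
    qed measurable
    have i2: "integrable M (\<lambda>x. A' x \<bullet> B' x)"
    proof (rule Bochner_Integration.integrable_bound)
      show "integrable M (\<lambda>x. (norm (A' x))\<^sup>2 + (norm (B' x))\<^sup>2)" using i by simp
      show "AE x in M. norm (A' x \<bullet> B' x) \<le> norm ((norm (A' x))\<^sup>2 + (norm (B' x))\<^sup>2)"
      proof (rule AE_I2)
        fix x
        have "\<bar>A' x \<bullet> B' x\<bar> \<le> norm (A' x) * norm (B' x)" by (rule Cauchy_Schwarz_ineq2)
        also have "\<dots> \<le> (norm (A' x))\<^sup>2 + (norm (B' x))\<^sup>2"
          by (rule mult_le_sum_squares)
        finally show "norm (A' x \<bullet> B' x) \<le> norm ((norm (A' x))\<^sup>2 + (norm (B' x))\<^sup>2)" by simp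
      qed
    qed measurable
    have i3: "integrable M (\<lambda>x. A n x \<bullet> B n x)" using Bochner_Integration.integrable_add[OF i1 i2] by simp
    have "norm ((LINT x|M. A n x \<bullet> B n x) - (LINT x|M. A' x \<bullet> B' x)) = \<bar>LINT x|M. A n x \<bullet> B n x - A' x \<bullet> B' x\<bar>"
      using i2 i3 by simp
    also have "\<dots> \<le> (LINT x|M. \<bar>A n x \<bullet> B n x - A' x \<bullet> B' x\<bar>)" by (rule integral_abs_bound)
    also have "\<dots> \<le> (LINT x|M. ?g x)" using i1 gi le by (intro integral_mono) simp_all
    also have "\<dots> = (k / 2) * ((LINT x|M. (norm (A n x - A' x))\<^sup>2) + (LINT x|M. (norm (B n x - B' x))\<^sup>2)) + (d / 2) * (\<alpha> + \<beta>)"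
      using fA(1) fB(1) i by (simp add: \<alpha>_def \<beta>_def)
    also have "\<dots> < (k / 2) * (\<eta> + \<eta>) + (d / 2) * (\<alpha> + \<beta>)"
      using fA(2) fB(2) k by (intro add_strict_right_mono mult_strict_left_mono) simp_all
    also have "\<dots> = e / 2 + (d / 2) * (\<alpha> + \<beta>)" using k by (simp add: \<eta>_def)
    also have "(d / 2) * (\<alpha> + \<beta>) \<le> (d / 2) * (\<alpha> + \<beta> + 1)" using d by simp
    also have "\<dots> = e / 2"
    proof -
      have "(e / c / 2) * c = e / 2" if "c \<noteq> 0" for c using that by simp
      moreover have "\<alpha> + \<beta> + 1 \<noteq> 0" using ab by linarith
      ultimately show ?thesis unfolding d_def by blast
    qed
    finally show ?case by simp
  qed
  then show "\<exists>no. \<forall>n\<ge>no. norm ((LINT x|M. A n x \<bullet> B n x) - (LINT x|M. A' x \<bullet> B' x)) < e"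
    by (simp only: eventually_sequentially)
qed

text \<open>
  By the segment formula the difference quotient is a mean of translates of \<open>u\<close>, and translations are
  continuous in \<open>L\<^sup>2\<close>.
\<close>

lemma (in weak_gradient) difference_quotient_L2:
  assumes e: "(e, u) = ((1, 0), u1) \<or> (e, u) = ((0, 1), u2)" and u: "Lq 2 u"
    and t: "t \<longlonglongrightarrow> 0" "\<And>n::nat. t n \<noteq> (0::real)"
  shows "(\<lambda>n. sq_dist (\<lambda>x. (f (x + t n *\<^sub>R e) - f x) /\<^sub>R t n) u) \<longlonglongrightarrow> 0"
proof -
  have um[measurable]: "u \<in> borel_measurable borel" and up: "periodic u" and ui: "integrable torus (\<lambda>x. (norm (u x))\<^sup>2)"
    using u by (simp_all add: Lq2_iff)
  have uL: "Lq 1 u" using e u1 u2 by blast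
  define G where "G n s = sq_dist (\<lambda>x. u (x + s *\<^sub>R (t n *\<^sub>R e))) u" for n s
  have quot: "AE x in torus. (f (x + h *\<^sub>R e) - f x) /\<^sub>R h = (LINT s|unit_interval. u (x + s *\<^sub>R (h *\<^sub>R e)))"
    if h: "h \<noteq> 0" for h
    using W1_segment[OF f u1 u2 partial1 partial2, of "h *\<^sub>R e"]
  proof eventually_elim
    case (elim x)
    have "f (x + h *\<^sub>R e) - f x = (LINT s|unit_interval. h *\<^sub>R u (x + s *\<^sub>R (h *\<^sub>R e)))"
      using elim e by auto
    then have "f (x + h *\<^sub>R e) - f x = h *\<^sub>R (LINT s|unit_interval. u (x + s *\<^sub>R (h *\<^sub>R e)))"
      by simp
    then show ?case using h by simp
  qed
  have m2: "(\<lambda>p. ennreal ((norm (u (snd p + fst p *\<^sub>R y) - u (snd p)))\<^sup>2)) \<in> borel_measurable (unit_interval \<Otimes>\<^sub>M torus)" for y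
  proof -
    have [measurable]: "(\<lambda>p. u (snd p + fst p *\<^sub>R y)) \<in> borel_measurable (unit_interval \<Otimes>\<^sub>M torus)"
      using measurable_segment(1)[OF um, of y] by (simp only: case_prod_unfold)
    have [measurable]: "(\<lambda>p. u (snd p)) \<in> borel_measurable (unit_interval \<Otimes>\<^sub>M torus)"
      by (rule measurable_compose[OF measurable_snd measurable_torus[OF um]])
    show ?thesis by measurable
  qed
  have le: "sq_dist (\<lambda>x. (f (x + t n *\<^sub>R e) - f x) /\<^sub>R t n) u \<le> (\<integral>\<^sup>+s. G n s \<partial>unit_interval)" for n
  proof -
    let ?y = "t n *\<^sub>R e"
    have int: "AE x in torus. integrable unit_interval (\<lambda>s. u (x + s *\<^sub>R ?y))"
      using ut.AE_integrable_snd[OF integrable_segment[OF uL, of ?y]] by simp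
    have "sq_dist (\<lambda>x. (f (x + t n *\<^sub>R e) - f x) /\<^sub>R t n) u \<le>
      (\<integral>\<^sup>+x. \<integral>\<^sup>+s. ennreal ((norm (u (x + s *\<^sub>R ?y) - u x))\<^sup>2) \<partial>unit_interval \<partial>torus)"
      unfolding sq_dist_def
    proof (rule nn_integral_mono_AE)
      show "AE x in torus. ennreal ((norm ((f (x + t n *\<^sub>R e) - f x) /\<^sub>R t n - u x))\<^sup>2)
        \<le> (\<integral>\<^sup>+s. ennreal ((norm (u (x + s *\<^sub>R ?y) - u x))\<^sup>2) \<partial>unit_interval)"
        using quot[OF t(2)[of n]] int
      proof eventually_elim
        case (elim x)
        have i: "integrable unit_interval (\<lambda>s. u (x + s *\<^sub>R ?y) - u x)" using elim(2) by simp
        have "(LINT s|unit_interval. u (x + s *\<^sub>R ?y)) - u x = (LINT s|unit_interval. u (x + s *\<^sub>R ?y) - u x)"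
          using elim(2) by simp
        then have "ennreal (norm ((f (x + t n *\<^sub>R e) - f x) /\<^sub>R t n - u x)) \<le> (\<integral>\<^sup>+s. ennreal (norm (u (x + s *\<^sub>R ?y) - u x)) \<partial>unit_interval)"
          using elim(1) integral_norm_bound_ennreal[OF i] by simp
        then have "(ennreal (norm ((f (x + t n *\<^sub>R e) - f x) /\<^sub>R t n - u x)))\<^sup>2 \<le> (\<integral>\<^sup>+s. ennreal (norm (u (x + s *\<^sub>R ?y) - u x)) \<partial>unit_interval)\<^sup>2"
          by (rule power_mono) simp
        also have "\<dots> \<le> (\<integral>\<^sup>+s. (ennreal (norm (u (x + s *\<^sub>R ?y) - u x)))\<^sup>2 \<partial>unit_interval)"
        proof (rule nn_integral_square_le[OF _ emeasure_unit_interval])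
          have [measurable]: "(\<lambda>s. u (x + s *\<^sub>R ?y)) \<in> borel_measurable unit_interval" by (rule measurable_segment(3)[OF um])
          show "(\<lambda>s. ennreal (norm (u (x + s *\<^sub>R ?y) - u x))) \<in> borel_measurable unit_interval" by measurable
        qed
        finally show ?case by (simp only: ennreal_power norm_ge_zero)
      qed
    qed
    also have "\<dots> = (\<integral>\<^sup>+s. G n s \<partial>unit_interval)"
      unfolding G_def sq_dist_def using ut.Fubini[OF m2[of ?y]] by simp
    finally show ?thesis .
  qed
  have "(\<lambda>n. \<integral>\<^sup>+s. G n s \<partial>unit_interval) \<longlonglongrightarrow> (\<integral>\<^sup>+s. 0 \<partial>unit_interval)"
  proof (rule nn_integral_dominated_convergence[where w = "\<lambda>_. 4 * ennreal (LINT x|torus. (norm (u x))\<^sup>2)"])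
    show "(\<lambda>s. G n s) \<in> borel_measurable unit_interval" for n
      using torus.borel_measurable_nn_integral_fst[OF m2[of "t n *\<^sub>R e"]] by (simp add: G_def sq_dist_def)
    have N: "(\<integral>\<^sup>+x. ennreal ((norm (u x))\<^sup>2) \<partial>torus) = ennreal (LINT x|torus. (norm (u x))\<^sup>2)"
      using ui by (intro nn_integral_eq_integral) simp_all
    have "G n s \<le> 4 * ennreal (LINT x|torus. (norm (u x))\<^sup>2)" for n s
    proof -
      let ?z = "s *\<^sub>R (t n *\<^sub>R e)"
      have "G n s \<le> 2 * sq_dist (\<lambda>x. u (x + ?z)) (\<lambda>_. 0) + 2 * sq_dist (\<lambda>_. 0) u"
        unfolding G_def by (rule sq_dist_triangle[OF borel_measurable_shift[OF um] _ um]) simp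
      also have "sq_dist (\<lambda>_. 0) u = ennreal (LINT x|torus. (norm (u x))\<^sup>2)" using N by (simp add: sq_dist_def)
      also have "sq_dist (\<lambda>x. u (x + ?z)) (\<lambda>_. 0) = ennreal (LINT x|torus. (norm (u x))\<^sup>2)"
        unfolding N[symmetric] sq_dist_def diff_zero
      proof (rule nn_integral_torus_shift[of "\<lambda>x. ennreal ((norm (u x))\<^sup>2)"])
        show "periodic (\<lambda>x. ennreal ((norm (u x))\<^sup>2))" by (rule periodic_comp[OF up])
      qed measurable
      finally show ?thesis by (simp add: distrib_right[symmetric])
    qed
    then show "AE s in unit_interval. G n s \<le> 4 * ennreal (LINT x|torus. (norm (u x))\<^sup>2)" for n by simp
    show "(\<integral>\<^sup>+s. 4 * ennreal (LINT x|torus. (norm (u x))\<^sup>2) \<partial>unit_interval) < \<infinity>"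
      by (simp add: ennreal_mult_less_top)
    have "(\<lambda>n. G n s) \<longlonglongrightarrow> 0" for s
    proof -
      have "(\<lambda>n. s *\<^sub>R (t n *\<^sub>R e)) \<longlonglongrightarrow> s *\<^sub>R (0 *\<^sub>R e)" by (intro tendsto_intros t)
      then have "(\<lambda>n. s *\<^sub>R (t n *\<^sub>R e)) \<longlonglongrightarrow> 0" by simp
      then show ?thesis using shift_continuous_L2[OF u] by (simp add: shift_continuous_def G_def)
    qed
    then show "AE s in unit_interval. (\<lambda>n. G n s) \<longlonglongrightarrow> 0" by simp
  qed simp_all
  then show ?thesis by (intro ennreal_tendsto_0_le[OF _ le]) simp
qed

lemma integrable_inner_L2:
  fixes A B :: "real \<times> real \<Rightarrow> 'b::{real_inner, banach, second_countable_topology}"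
  assumes "Lq 2 A" "Lq 2 B"
  shows "integrable torus (\<lambda>x. A x \<bullet> B x)"
proof (rule Bochner_Integration.integrable_bound)
  show "integrable torus (\<lambda>x. (norm (A x))\<^sup>2 + (norm (B x))\<^sup>2)" using assms by (simp add: Lq2_iff)
  show "(\<lambda>x. A x \<bullet> B x) \<in> borel_measurable torus"
    using assms by (intro borel_measurable_inner measurable_torus) (simp_all add: Lq2_iff)
  show "AE x in torus. norm (A x \<bullet> B x) \<le> norm ((norm (A x))\<^sup>2 + (norm (B x))\<^sup>2)"
  proof (rule AE_I2)
    fix x
    have "\<bar>A x \<bullet> B x\<bar> \<le> norm (A x) * norm (B x)" by (rule Cauchy_Schwarz_ineq2)
    also have "\<dots> \<le> (norm (A x))\<^sup>2 + (norm (B x))\<^sup>2"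
      by (rule mult_le_sum_squares)
    finally show "norm (A x \<bullet> B x) \<le> norm ((norm (A x))\<^sup>2 + (norm (B x))\<^sup>2)" by simp
  qed
qed

lemma Lq2_shift:
  fixes A :: "real \<times> real \<Rightarrow> 'b::{banach, second_countable_topology}"
  assumes "Lq 2 A" shows "Lq 2 (\<lambda>x. A (x + y))"
proof -
  have m[measurable]: "A \<in> borel_measurable borel" and p: "periodic A" and i: "integrable torus (\<lambda>x. (norm (A x))\<^sup>2)"
    using assms by (simp_all add: Lq2_iff)
  have "integrable torus (\<lambda>x. (norm (A (x + y)))\<^sup>2)"
    using integral_torus_shift(2)[OF _ periodic_comp[OF p, of "\<lambda>a. (norm a)\<^sup>2"], of y] i by simp
  then show ?thesis using borel_measurable_shift[OF m] periodic_shift[OF p] by (simp add: Lq2_iff)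
qed

text \<open>
  Integration by parts would need second derivatives.  For difference quotients the corresponding identity
  is exact: translating the variable by \<open>- s (e\<^sub>1 + e\<^sub>2)\<close>, or by \<open>- s e\<^sub>1\<close> or \<open>- s e\<^sub>2\<close>, exchanges the directions
  and replaces forward by backward quotients.  It remains to let \<open>s\<close> tend to zero.
\<close>

lemma integral_partials_commute:
  fixes f g :: "real \<times> real \<Rightarrow> 'b::{real_inner, banach, second_countable_topology}"
  assumes f: "weak_gradient f u1 u2" and g: "weak_gradient g v1 v2"
    and L: "Lq 2 f" "Lq 2 u1" "Lq 2 u2" "Lq 2 g" "Lq 2 v1" "Lq 2 v2"
  shows "(LINT x|torus. u1 x \<bullet> v2 x) = (LINT x|torus. u2 x \<bullet> v1 x)"
proof -
  define t where "t n = inverse (real (Suc n))" for n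
  have t: "t \<longlonglongrightarrow> 0" "t n \<noteq> 0" for n unfolding t_def using LIMSEQ_inverse_real_of_nat by simp_all
  have t': "(\<lambda>n. - t n) \<longlonglongrightarrow> 0" "- t n \<noteq> 0" for n using tendsto_minus[OF t(1)] t(2) by simp_all
  let ?e1 = "(1, 0) :: real \<times> real" and ?e2 = "(0, 1) :: real \<times> real"
  let ?q = "\<lambda>f t e x. (f (x + t *\<^sub>R e) - f x) /\<^sub>R t :: 'b"
  have m: "u1 \<in> borel_measurable torus" "u2 \<in> borel_measurable torus" "v1 \<in> borel_measurable torus" "v2 \<in> borel_measurable torus"
    and fm[measurable]: "f \<in> borel_measurable borel" and gm[measurable]: "g \<in> borel_measurable borel"
    using L by (auto simp: Lq2_iff intro: measurable_torus)
  have qm: "?q F s e \<in> borel_measurable torus" if [measurable]: "F \<in> borel_measurable borel" for F s e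
    by (rule measurable_torus) measurable
  have i: "integrable torus (\<lambda>x. (norm (w x))\<^sup>2)" if "Lq 2 w" for w :: "real \<times> real \<Rightarrow> 'b" using that by (simp add: Lq2_iff)
  have l1: "(\<lambda>n. LINT x|torus. ?q f (t n) ?e1 x \<bullet> ?q g (t n) ?e2 x) \<longlonglongrightarrow> (LINT x|torus. u1 x \<bullet> v2 x)"
  proof (rule L2_inner_tendsto[OF qm[OF fm] qm[OF gm] m(1) m(4) i[OF L(2)] i[OF L(6)]])
    show "(\<lambda>n. \<integral>\<^sup>+x. ennreal ((norm (?q f (t n) ?e1 x - u1 x))\<^sup>2) \<partial>torus) \<longlonglongrightarrow> 0"
      using weak_gradient.difference_quotient_L2[OF f, of ?e1 u1 t] L(2) t by (simp add: sq_dist_def)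
    show "(\<lambda>n. \<integral>\<^sup>+x. ennreal ((norm (?q g (t n) ?e2 x - v2 x))\<^sup>2) \<partial>torus) \<longlonglongrightarrow> 0"
      using weak_gradient.difference_quotient_L2[OF g, of ?e2 v2 t] L(6) t by (simp add: sq_dist_def)
  qed
  have l2: "(\<lambda>n. LINT x|torus. ?q f (- t n) ?e2 x \<bullet> ?q g (- t n) ?e1 x) \<longlonglongrightarrow> (LINT x|torus. u2 x \<bullet> v1 x)"
  proof (rule L2_inner_tendsto[OF qm[OF fm] qm[OF gm] m(2) m(3) i[OF L(3)] i[OF L(5)]])
    show "(\<lambda>n. \<integral>\<^sup>+x. ennreal ((norm (?q f (- t n) ?e2 x - u2 x))\<^sup>2) \<partial>torus) \<longlonglongrightarrow> 0"
      using weak_gradient.difference_quotient_L2[OF f, of ?e2 u2 "\<lambda>n. - t n"] L(3) t' by (simp add: sq_dist_def)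
    show "(\<lambda>n. \<integral>\<^sup>+x. ennreal ((norm (?q g (- t n) ?e1 x - v1 x))\<^sup>2) \<partial>torus) \<longlonglongrightarrow> 0"
      using weak_gradient.difference_quotient_L2[OF g, of ?e1 v1 "\<lambda>n. - t n"] L(5) t' by (simp add: sq_dist_def)
  qed
  have "(LINT x|torus. ?q f s ?e1 x \<bullet> ?q g s ?e2 x) = (LINT x|torus. ?q f (- s) ?e2 x \<bullet> ?q g (- s) ?e1 x)" for s
  proof -
    define a where "a = s *\<^sub>R ?e1"
    define b where "b = s *\<^sub>R ?e2"
    (* by translation invariance, \<open>J y z\<close> depends only on \<open>y - z\<close> *)
    define J where "J y z = (LINT x|torus. f (x + y) \<bullet> g (x + z))" for y z
    have Ji: "integrable torus (\<lambda>x. f (x + y) \<bullet> g (x + z))" for y z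
      by (intro integrable_inner_L2 Lq2_shift L)
    have Js: "J (y + w) (z + w) = J y z" for y z w
    proof -
      have "periodic (\<lambda>x. f (x + y) \<bullet> g (x + z))"
        using L by (intro periodic_comp2[OF periodic_shift periodic_shift]) (simp_all add: Lq2_iff)
      then have "(LINT x|torus. f (x + w + y) \<bullet> g (x + w + z)) = J y z"
        unfolding J_def by (intro integral_torus_shift(1)[of "\<lambda>x. f (x + y) \<bullet> g (x + z)"]) measurable
      moreover have "x + w + y = x + (y + w)" for x y by (simp add: algebra_simps)
      ultimately show ?thesis by (simp only: J_def)
    qed
    have "(LINT x|torus. ?q f s ?e1 x \<bullet> ?q g s ?e2 x) =
       (LINT x|torus. (inverse s * inverse s) * ((f (x + a) \<bullet> g (x + b) - f (x + a) \<bullet> g (x + 0)) - (f (x + 0) \<bullet> g (x + b) - f (x + 0) \<bullet> g (x + 0))))"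
      by (simp add: a_def b_def inner_diff_left inner_diff_right algebra_simps)
    also have "\<dots> = (inverse s * inverse s) * ((J a b - J a 0) - (J 0 b - J 0 0))"
      unfolding J_def
      by (subst integral_mult_right_zero, subst Bochner_Integration.integral_diff, (intro Bochner_Integration.integrable_diff Ji)+,
          (subst Bochner_Integration.integral_diff, (intro Ji)+)+) (rule refl)
    finally have 1: "(LINT x|torus. ?q f s ?e1 x \<bullet> ?q g s ?e2 x) = (inverse s * inverse s) * ((J a b - J a 0) - (J 0 b - J 0 0))" .
    have "(LINT x|torus. ?q f (- s) ?e2 x \<bullet> ?q g (- s) ?e1 x) =
       (LINT x|torus. (inverse s * inverse s) * ((f (x + - b) \<bullet> g (x + - a) - f (x + - b) \<bullet> g (x + 0)) - (f (x + 0) \<bullet> g (x + - a) - f (x + 0) \<bullet> g (x + 0))))"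
      by (simp add: a_def b_def inner_diff_left inner_diff_right algebra_simps)
    also have "\<dots> = (inverse s * inverse s) * ((J (- b) (- a) - J (- b) 0) - (J 0 (- a) - J 0 0))"
      unfolding J_def
      by (subst integral_mult_right_zero, subst Bochner_Integration.integral_diff, (intro Bochner_Integration.integrable_diff Ji)+,
          (subst Bochner_Integration.integral_diff, (intro Ji)+)+) (rule refl)
    finally have 2: "(LINT x|torus. ?q f (- s) ?e2 x \<bullet> ?q g (- s) ?e1 x) = (inverse s * inverse s) * ((J (- b) (- a) - J (- b) 0) - (J 0 (- a) - J 0 0))" .
    have "J (- b) (- a) = J a b" using Js[of "- b" "a + b" "- a"] by simp
    moreover have "J (- b) 0 = J 0 b" using Js[of "- b" b 0] by simp
    moreover have "J 0 (- a) = J a 0" using Js[of 0 a "- a"] by simp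
    ultimately show ?thesis unfolding 1 2 by simp
  qed
  then have "(\<lambda>n. LINT x|torus. ?q f (t n) ?e1 x \<bullet> ?q g (t n) ?e2 x) = (\<lambda>n. LINT x|torus. ?q f (- t n) ?e2 x \<bullet> ?q g (- t n) ?e1 x)"
    by (intro ext)
  then show ?thesis using LIMSEQ_unique[OF l1] l2 by simp
qed

section \<open>The adjoint action in a chart\<close>

lemma orthonormal_basis_exists:
  "\<exists>B :: 'e::{real_inner, heine_borel} set. finite B \<and> pairwise orthogonal B \<and> (\<forall>b\<in>B. norm b = 1) \<and> span B = UNIV"
proof -
  obtain B0 :: "'e set" where B0: "finite B0" "span B0 = UNIV" using heine_borel_finite_dimensional by blast
  obtain B1 where B1: "finite B1" "span B1 = span B0" "pairwise orthogonal B1" using basis_orthogonal[OF B0(1)] by blast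
  define B where "B = (\<lambda>b. b /\<^sub>R norm b) ` (B1 - {0})"
  have "b \<in> span B" if "b \<in> B1" for b
  proof (cases "b = 0")
    case False
    then have "b /\<^sub>R norm b \<in> B" using that by (auto simp: B_def)
    then have "norm b *\<^sub>R (b /\<^sub>R norm b) \<in> span B" by (intro span_scale span_base)
    then show ?thesis using False by simp
  qed (simp add: span_zero)
  then have "span B1 \<subseteq> span B" by (metis span_mono span_span subsetI)
  then have "span B = UNIV" using B1(2) B0(2) by auto
  moreover have "pairwise orthogonal B"
  proof (rule pairwiseI)
    fix x y assume "x \<in> B" "y \<in> B" "x \<noteq> y"
    then obtain b c where "b \<in> B1" "c \<in> B1" "x = b /\<^sub>R norm b" "y = c /\<^sub>R norm c" "b \<noteq> c"
      unfolding B_def by blast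
    then show "orthogonal x y" using B1(3) by (simp add: pairwise_def orthogonal_def)
  qed
  moreover have "finite B" "\<forall>b\<in>B. norm b = 1" using B1(1) by (auto simp: B_def)
  ultimately show ?thesis by blast
qed

text \<open>
  The sort includes the zero space, so that a chosen orthonormal basis takes the place of the canonical
  basis of a Euclidean space.
\<close>

definition onb :: "'e::{real_inner, heine_borel} set" where
  "onb = (SOME B. finite B \<and> pairwise orthogonal B \<and> (\<forall>b\<in>B. norm b = 1) \<and> span B = UNIV)"

lemma onb: "finite onb" "pairwise orthogonal onb" "b \<in> onb \<Longrightarrow> norm b = 1" "span onb = UNIV"
  using someI_ex[OF orthonormal_basis_exists] unfolding onb_def[symmetric] by blast+

lemma onb_expansion:
  fixes x :: "'e::{real_inner, heine_borel}"
  shows "x = (\<Sum>b\<in>onb. (x \<bullet> b) *\<^sub>R b)"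
proof -
  let ?y = "x - (\<Sum>b\<in>onb. (x \<bullet> b) *\<^sub>R b)"
  have "?y \<bullet> c = 0" if c: "c \<in> onb" for c
  proof -
    have "(\<Sum>b\<in>onb. (x \<bullet> b) * (b \<bullet> c)) = (\<Sum>b\<in>onb. if b = c then x \<bullet> c else 0)"
    proof (intro sum.cong refl)
      fix b :: 'e assume b: "b \<in> onb"
      show "(x \<bullet> b) * (b \<bullet> c) = (if b = c then x \<bullet> c else 0)"
        using onb(2) onb(3)[OF c] b c by (auto simp: pairwise_def orthogonal_def norm_eq_1)
    qed
    then show ?thesis using c onb(1)[where 'a='e] by (simp add: inner_diff_left inner_sum_left)
  qed
  then have "\<And>c. c \<in> onb \<Longrightarrow> orthogonal ?y c" by (simp add: orthogonal_def)
  then have "orthogonal ?y z" for z using orthogonal_to_span[of z onb ?y] onb(4) by auto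
  then have "?y = 0" by (metis orthogonal_self)
  then show ?thesis by simp
qed

lemma linear_onb:
  assumes "linear f" shows "f x = (\<Sum>b\<in>onb. (x \<bullet> b) *\<^sub>R f b)"
proof -
  have "f x = f (\<Sum>b\<in>onb. (x \<bullet> b) *\<^sub>R b)" using onb_expansion[of x] by simp
  then show ?thesis by (simp add: linear_sum[OF assms] linear_scale[OF assms])
qed

lemma norm_inner_onb: "b \<in> onb \<Longrightarrow> \<bar>x \<bullet> b\<bar> \<le> norm x"
  using Cauchy_Schwarz_ineq2[of x b] onb(3)[of b] by simp

lemma linear_bounded_onb:
  fixes f :: "'e::{real_inner, heine_borel} \<Rightarrow> 'b::real_normed_vector"
  assumes "linear f" shows "bounded_linear f"
proof -
  interpret linear f by fact
  show ?thesis
  proof (rule bounded_linear_intro)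
    fix x
    have "norm (f x) \<le> (\<Sum>b\<in>onb. norm ((x \<bullet> b) *\<^sub>R f b))"
      unfolding linear_onb[OF assms, of x] by (rule norm_sum)
    also have "\<dots> \<le> (\<Sum>b\<in>onb. norm x * norm (f b))"
      by (intro sum_mono) (simp add: mult_right_mono norm_inner_onb)
    finally show "norm (f x) \<le> norm x * (\<Sum>b\<in>onb. norm (f b))" by (simp add: sum_distrib_left)
  qed (simp_all add: add scale)
qed

lemma bilinear_bounded_onb:
  fixes h :: "'e::{real_inner, heine_borel} \<Rightarrow> 'e \<Rightarrow> 'b::real_normed_vector"
  assumes l: "\<And>y. linear (\<lambda>x. h x y)" and r: "\<And>x. linear (h x)" shows "bounded_bilinear h"
proof
  have "norm (h a b) \<le> norm a * norm b * (\<Sum>c\<in>onb. \<Sum>d\<in>onb. norm (h c d))" for a b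
  proof -
    have "norm (h a b) \<le> (\<Sum>c\<in>onb. norm ((a \<bullet> c) *\<^sub>R h c b))"
      unfolding linear_onb[OF l, of a b] by (rule norm_sum)
    also have "\<dots> \<le> (\<Sum>c\<in>onb. norm a * (norm b * (\<Sum>d\<in>onb. norm (h c d))))"
    proof (rule sum_mono)
      fix c :: 'e assume c: "c \<in> onb"
      have "norm (h c b) \<le> (\<Sum>d\<in>onb. norm ((b \<bullet> d) *\<^sub>R h c d))"
        unfolding linear_onb[OF r, of c b] by (rule norm_sum)
      also have "\<dots> \<le> (\<Sum>d\<in>onb. norm b * norm (h c d))"
        by (intro sum_mono) (simp add: mult_right_mono norm_inner_onb)
      finally have "norm (h c b) \<le> norm b * (\<Sum>d\<in>onb. norm (h c d))" by (simp add: sum_distrib_left)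
      then show "norm ((a \<bullet> c) *\<^sub>R h c b) \<le> norm a * (norm b * (\<Sum>d\<in>onb. norm (h c d)))"
        unfolding norm_scaleR by (intro mult_mono norm_inner_onb c) (simp_all add: norm_inner_onb c)
    qed
    finally show ?thesis by (simp add: sum_distrib_left mult.assoc)
  qed
  then show "\<exists>K. \<forall>a b. norm (h a b) \<le> norm a * norm b * K" by blast
qed (simp_all add: linear_add[OF l] linear_add[OF r] linear_scale[OF l] linear_scale[OF r])

lemma frechet_derivative_worksI:
  "f differentiable F \<Longrightarrow> (f has_derivative frechet_derivative f F) F"
  by (simp only: frechet_derivative_works)

lemma smooth_on_differentiable: "smooth_on S f \<Longrightarrow> x \<in> S \<Longrightarrow> f differentiable (at x)"
  unfolding smooth_on_def using Ck_on.simps(2)[of 0 S f] by blast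

lemma smooth_on_derivative: "smooth_on S f \<Longrightarrow> smooth_on S (\<lambda>x. frechet_derivative f (at x) v)"
  unfolding smooth_on_def by (metis Ck_on.simps(2))

text \<open>
  The adjoint action near the identity: \<open>A u\<close> stands for the adjoint action of the point with coordinate \<open>u\<close> in a
  chart around the identity, whose coordinate is \<open>e0\<close>.  These are isometric automorphisms of the Lie
  algebra, and the bracket is the derivative of \<open>A\<close> at the identity.
\<close>

locale local_adjoint_action =
  fixes br :: "'e::{real_inner, heine_borel} \<Rightarrow> 'e \<Rightarrow> 'e" and A :: "'e \<Rightarrow> 'e \<Rightarrow> 'e" and N :: "'e set" and e0 :: 'e
  assumes open_N: "open N" and e0_N: "e0 \<in> N"
    and A_linear: "u \<in> N \<Longrightarrow> linear (A u)"
    and A_isometry: "u \<in> N \<Longrightarrow> A u x \<bullet> A u y = x \<bullet> y"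
    and A_automorphism: "u \<in> N \<Longrightarrow> br (A u x) (A u y) = A u (br x y)"
    and A_e0: "A e0 y = y"
    and A_derivative: "((\<lambda>u. A u y) has_derivative (\<lambda>x. br x y)) (at e0)"
    and alternating: "br x x = 0"

locale lie_group_chart = lie_group G T \<A>
  for G :: "('g, 'm) monoid_scheme" (structure) and T :: "'g topology"
    and \<A> :: "('g set \<times> ('g \<Rightarrow> 'e::{real_inner, heine_borel})) set" +
  fixes U :: "'g set" and \<phi> :: "'g \<Rightarrow> 'e"
  assumes chart_mem: "(U, \<phi>) \<in> \<A>" and one_U: "\<one> \<in> U"
begin

definition \<Omega> :: "'e set" where "\<Omega> = \<phi> ` U"
definition \<psi> :: "'e \<Rightarrow> 'g" where "\<psi> = inv_into U \<phi>"
definition e0 :: 'e where "e0 = \<phi> \<one>"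

lemma U_facts: "openin T U" "open \<Omega>" "homeomorphic_map (subtopology T U) (top_of_set \<Omega>) \<phi>"
  using chart[OF chart_mem] by (simp_all add: \<Omega>_def)

lemma U_carrier: "U \<subseteq> carrier G" using openin_subset[OF U_facts(1)] topspace_eq by simp

lemma inj_\<phi>: "inj_on \<phi> U"
  using homeomorphic_imp_injective_map[OF U_facts(3)] U_carrier topspace_eq by (simp add: Int_absorb1)

lemma \<psi>_\<phi> [simp]: "g \<in> U \<Longrightarrow> \<psi> (\<phi> g) = g" by (simp add: \<psi>_def inj_\<phi>)
lemma \<phi>_\<psi> [simp]: "u \<in> \<Omega> \<Longrightarrow> \<phi> (\<psi> u) = u" by (simp add: \<psi>_def \<Omega>_def f_inv_into_f)
lemma \<psi>_U: "u \<in> \<Omega> \<Longrightarrow> \<psi> u \<in> U" by (simp add: \<psi>_def \<Omega>_def inv_into_into)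
lemma \<psi>_carrier [simp]: "u \<in> \<Omega> \<Longrightarrow> \<psi> u \<in> carrier G" using \<psi>_U U_carrier by blast
lemma \<phi>_\<Omega>: "g \<in> U \<Longrightarrow> \<phi> g \<in> \<Omega>" by (simp add: \<Omega>_def)
lemma e0_\<Omega>: "e0 \<in> \<Omega>" using one_U by (simp add: e0_def \<phi>_\<Omega>)
lemma \<psi>_e0 [simp]: "\<psi> e0 = \<one>" using one_U by (simp add: e0_def)

lemma \<psi>_continuous: "continuous_map (top_of_set \<Omega>) T \<psi>"
proof -
  obtain g where g: "homeomorphic_maps (subtopology T U) (top_of_set \<Omega>) \<phi> g"
    using U_facts(3) homeomorphic_map_maps by blast
  have "continuous_map (top_of_set \<Omega>) (subtopology T U) g" using g by (simp add: homeomorphic_maps_def)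
  then have gc: "continuous_map (top_of_set \<Omega>) T g" by (simp add: continuous_map_in_subtopology)
  have "g u = \<psi> u" if "u \<in> \<Omega>" for u
  proof -
    have "g (\<phi> (\<psi> u)) = \<psi> u"
      using g \<psi>_U[OF that] U_carrier topspace_eq by (auto simp: homeomorphic_maps_def)
    then show ?thesis using that by simp
  qed
  then show ?thesis using continuous_map_eq[OF gc] by simp
qed

lemma open_preimage:
  fixes S :: "'x::topological_space set"
  assumes "continuous_map (top_of_set S) T f" "open S" "openin T V"
  shows "open {x \<in> S. f x \<in> V}"
proof -
  have "openin (top_of_set S) {x \<in> topspace (top_of_set S). f x \<in> V}"
    using assms(1,3) by (rule openin_continuous_map_preimage)
  then show ?thesis using assms(2) openin_open_trans by fastforce
qed

text \<open>
  Multiplication \<open>m\<close>, inversion \<open>i\<close> and, below, conjugation \<open>k\<close> in the chart, with their domains.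
\<close>

definition m :: "'e \<times> 'e \<Rightarrow> 'e" where "m = (\<lambda>(u, v). \<phi> (\<psi> u \<otimes> \<psi> v))"
definition D where "D = {(u, v) \<in> \<Omega> \<times> \<Omega>. \<psi> u \<otimes> \<psi> v \<in> U}"
definition i where "i u = \<phi> (inv (\<psi> u))"
definition Di where "Di = {u \<in> \<Omega>. inv (\<psi> u) \<in> U}"

lemma open_D: "open D"
proof -
  have c: "continuous_map (top_of_set (\<Omega> \<times> \<Omega>)) (top_of_set \<Omega>) fst"
    "continuous_map (top_of_set (\<Omega> \<times> \<Omega>)) (top_of_set \<Omega>) snd"
    by (auto simp: continuous_map_in_subtopology intro!: continuous_intros)
  have "continuous_map (top_of_set (\<Omega> \<times> \<Omega>)) T (\<psi> \<circ> fst)" "continuous_map (top_of_set (\<Omega> \<times> \<Omega>)) T (\<psi> \<circ> snd)"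
    by (rule continuous_map_compose[OF c(1) \<psi>_continuous] continuous_map_compose[OF c(2) \<psi>_continuous])+
  then have "continuous_map (top_of_set (\<Omega> \<times> \<Omega>)) (prod_topology T T) (\<lambda>p. (\<psi> (fst p), \<psi> (snd p)))"
    by (intro continuous_map_pairedI) (simp_all add: comp_def)
  from continuous_map_compose[OF this mult_continuous]
  have "continuous_map (top_of_set (\<Omega> \<times> \<Omega>)) T (\<lambda>p. \<psi> (fst p) \<otimes> \<psi> (snd p))" by (simp add: comp_def)
  from open_preimage[OF this open_Times[OF U_facts(2) U_facts(2)] U_facts(1)]
  have "open {p \<in> \<Omega> \<times> \<Omega>. \<psi> (fst p) \<otimes> \<psi> (snd p) \<in> U}" .
  moreover have "D = {p \<in> \<Omega> \<times> \<Omega>. \<psi> (fst p) \<otimes> \<psi> (snd p) \<in> U}" by (auto simp: D_def)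
  ultimately show ?thesis by simp
qed

lemma open_Di: "open Di"
proof -
  have "continuous_map (top_of_set \<Omega>) T (\<lambda>u. inv (\<psi> u))"
    using continuous_map_compose[OF \<psi>_continuous inv_continuous] by (simp add: comp_def)
  from open_preimage[OF this U_facts(2) U_facts(1)] show ?thesis by (simp add: Di_def)
qed

lemma smooth_m: "smooth_on D m"
proof -
  have "D = {(u, v) \<in> \<phi> ` U \<times> \<phi> ` U. inv_into U \<phi> u \<otimes> inv_into U \<phi> v \<in> U}" by (simp add: D_def \<Omega>_def \<psi>_def)
  then show ?thesis using mult_smooth[OF chart_mem chart_mem chart_mem] by (simp add: m_def \<psi>_def)
qed

lemma smooth_i: "smooth_on Di i"
proof -
  have "Di = {u \<in> \<phi> ` U. inv (inv_into U \<phi> u) \<in> U}" by (simp add: Di_def \<Omega>_def \<psi>_def)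
  then show ?thesis using inv_smooth[OF chart_mem chart_mem] by (simp add: i_def[abs_def] \<psi>_def)
qed

lemma m_diff: "p \<in> D \<Longrightarrow> m differentiable (at p)" by (rule smooth_on_differentiable[OF smooth_m])
lemma i_diff: "u \<in> Di \<Longrightarrow> i differentiable (at u)" by (rule smooth_on_differentiable[OF smooth_i])

abbreviation Dm where "Dm p \<equiv> frechet_derivative m (at p)"

lemma Dm_diff: "p \<in> D \<Longrightarrow> (\<lambda>p. Dm p v) differentiable (at p)"
  by (rule smooth_on_differentiable[OF smooth_on_derivative[OF smooth_m]])

lemma Dm_linear: "p \<in> D \<Longrightarrow> linear (Dm p)" using m_diff by (rule linear_frechet_derivative)

text \<open>
  On \<open>W\<close> the conjugate \<open>u v u\<^sup>-\<^sup>1\<close> can be formed in two steps, both within the chart, so that \<open>k\<close> is a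
  composition of \<open>m\<close> and \<open>i\<close>.
\<close>

definition k where "k u v = \<phi> (\<psi> u \<otimes> \<psi> v \<otimes> inv (\<psi> u))"
definition W where "W = {p \<in> D \<inter> fst -` Di. (m p, i (fst p)) \<in> D}"

lemma open_W: "open W"
proof -
  have 1: "open (D \<inter> fst -` Di)" using open_D open_Di by (intro open_Int open_vimage_fst)
  have "continuous_on (D \<inter> fst -` Di) (\<lambda>p. (m p, i (fst p)))"
  proof (intro continuous_on_Pair)
    show "continuous_on (D \<inter> fst -` Di) m"
      using m_diff differentiable_imp_continuous_within by (intro continuous_at_imp_continuous_on) blast
    have "continuous_on Di i" using i_diff differentiable_imp_continuous_within by (intro continuous_at_imp_continuous_on) blast
    then show "continuous_on (D \<inter> fst -` Di) (\<lambda>p. i (fst p))"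
      by (rule continuous_on_compose2) (auto intro!: continuous_intros)
  qed
  from continuous_open_preimage[OF this 1 open_D]
  show ?thesis by (simp add: W_def vimage_def Int_def conj_assoc)
qed

lemma W_mem: "(u, v) \<in> W \<Longrightarrow> u \<in> \<Omega> \<and> v \<in> \<Omega> \<and> \<psi> u \<otimes> \<psi> v \<otimes> inv (\<psi> u) \<in> U \<and> k u v = m (m (u, v), i u)"
  by (auto simp: W_def D_def Di_def m_def i_def k_def)

lemma k_W: "(u, v) \<in> W \<Longrightarrow> k u v \<in> \<Omega> \<and> \<psi> (k u v) = \<psi> u \<otimes> \<psi> v \<otimes> inv (\<psi> u)"
proof -
  assume "(u, v) \<in> W"
  then have "\<psi> u \<otimes> \<psi> v \<otimes> inv (\<psi> u) \<in> U" using W_mem by blast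
  then show ?thesis by (simp add: k_def \<phi>_\<Omega>)
qed

lemma e0_W: "(e0, e0) \<in> W"
  using one_U e0_\<Omega> by (simp add: W_def D_def Di_def m_def i_def e0_def[symmetric])

text \<open>
  The derivative of \<open>k\<close> in its second argument, in the direction \<open>y\<close>.
\<close>

definition Q where "Q y p = Dm (m p, i (fst p)) (Dm p (0, y), 0)"

lemma k_partial:
  assumes W: "(u, v) \<in> W" shows "((\<lambda>v. k u v) has_derivative (\<lambda>y. Q y (u, v))) (at v)"
proof -
  have p: "(u, v) \<in> D" "(m (u, v), i u) \<in> D" using W by (simp_all add: W_def)
  have "((\<lambda>v. (u, v)) has_derivative (\<lambda>y. (0, y))) (at v)" by (auto intro!: derivative_eq_intros)
  from has_derivative_compose[OF this frechet_derivative_worksI[OF m_diff[OF p(1)]]]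
  have "((\<lambda>v. m (u, v)) has_derivative (\<lambda>y. Dm (u, v) (0, y))) (at v)" .
  then have "((\<lambda>v. (m (u, v), i u)) has_derivative (\<lambda>y. (Dm (u, v) (0, y), 0))) (at v)"
    by (auto intro!: derivative_eq_intros)
  from has_derivative_compose[OF this frechet_derivative_worksI[OF m_diff[OF p(2)]]]
  have *: "((\<lambda>v. m (m (u, v), i u)) has_derivative (\<lambda>y. Q y (u, v))) (at v)" by (simp add: Q_def)
  have o: "open {v. (u, v) \<in> W}"
    using open_vimage[OF open_W, of "Pair u"] by (simp add: vimage_def continuous_on_Pair)
  show ?thesis by (rule has_derivative_transform_within_open[OF * o]) (use W W_mem in auto)
qed

text \<open>
  Smoothness of \<open>m\<close> gives differentiability of \<open>Dm p v\<close> in \<open>p\<close> only for a fixed direction \<open>v\<close>.  The direction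
  in the outer derivative depends on \<open>p\<close>, and is expanded in an orthonormal basis.
\<close>

lemma Q_diff: assumes W: "p \<in> W" shows "Q y differentiable (at p)"
proof -
  have p: "p \<in> D" "(m p, i (fst p)) \<in> D" "fst p \<in> Di" using W by (simp_all add: W_def)
  define a where "a q = Dm q (0, y)" for q
  have a: "a differentiable (at p)" unfolding a_def by (rule Dm_diff[OF p(1)])
  have "(\<lambda>p. i (fst p)) differentiable (at p)"
    using i_diff[OF p(3)] by (intro differentiable_compose[of i fst]) (auto intro: differentiableI derivative_intros bounded_linear_imp_differentiable bounded_linear_fst)
  then have b: "(\<lambda>p. (m p, i (fst p))) differentiable (at p)"
    using has_derivative_Pair[OF frechet_derivative_worksI[OF m_diff[OF p(1)]] frechet_derivative_worksI]
    unfolding differentiable_def by blast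
  have d: "(\<lambda>q. Dm (m q, i (fst q)) (c, 0)) differentiable (at p)" for c
    using differentiable_compose[OF Dm_diff[OF p(2)] b] .
  have diff: "(\<lambda>q. \<Sum>c\<in>onb. (a q \<bullet> c) *\<^sub>R Dm (m q, i (fst q)) (c, 0)) differentiable (at p)"
    by (intro differentiable_sum differentiable_scaleR differentiable_inner a d differentiable_const onb(1) ballI)
  have "Q y q = (\<Sum>c\<in>onb. (a q \<bullet> c) *\<^sub>R Dm (m q, i (fst q)) (c, 0))" if "q \<in> W" for q
  proof -
    have q: "(m q, i (fst q)) \<in> D" using that by (simp add: W_def)
    have "linear (\<lambda>c. Dm (m q, i (fst q)) (c, 0))"
      by (rule linear_compose[of "\<lambda>c. (c, 0)", unfolded comp_def, OF _ Dm_linear[OF q]]) (auto intro!: linearI)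
    from linear_onb[OF this, of "a q"] show ?thesis by (simp add: Q_def a_def)
  qed
  then show ?thesis
    using diff open_W W unfolding differentiable_def
    by (metis (no_types, lifting) has_derivative_transform_within_open)
qed

definition Adc where "Adc u = Ad G (U, \<phi>) (\<psi> u)"
definition N where "N = {u. (u, e0) \<in> W}"
definition br where "br = lie_bracket G (U, \<phi>)"

lemma open_N: "open N"
  using open_vimage[OF open_W, of "\<lambda>u. (u, e0)"] by (simp add: N_def vimage_def continuous_on_Pair)
lemma e0_N: "e0 \<in> N" using e0_W by (simp add: N_def)

lemma Adc_Q: assumes "u \<in> N" shows "Adc u y = Q y (u, e0)" "((\<lambda>v. k u v) has_derivative Adc u) (at e0)"
proof -
  have d: "((\<lambda>v. k u v) has_derivative (\<lambda>y. Q y (u, e0))) (at e0)" using assms by (intro k_partial) (simp add: N_def)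
  have "Adc u = frechet_derivative (\<lambda>v. k u v) (at e0)"
    by (simp add: Adc_def Ad_def k_def[abs_def] \<psi>_def e0_def)
  then have e: "Adc u = (\<lambda>y. Q y (u, e0))" using frechet_derivative_at[OF d] by simp
  show "Adc u y = Q y (u, e0)" by (simp add: e)
  show "((\<lambda>v. k u v) has_derivative Adc u) (at e0)" unfolding e by (rule d)
qed

lemma Adc_derivative: "((\<lambda>u. Adc u y) has_derivative (\<lambda>x. br x y)) (at e0)"
  and br_Q: "br x y = frechet_derivative (Q y) (at (e0, e0)) (x, 0)"
proof -
  have "((\<lambda>u. (u, e0)) has_derivative (\<lambda>x. (x, 0))) (at e0)" by (auto intro!: derivative_eq_intros)
  from has_derivative_compose[OF this frechet_derivative_worksI[OF Q_diff[OF e0_W]]]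
  have "((\<lambda>u. Q y (u, e0)) has_derivative (\<lambda>x. frechet_derivative (Q y) (at (e0, e0)) (x, 0))) (at e0)" for y .
  then have d: "((\<lambda>u. Adc u y) has_derivative (\<lambda>x. frechet_derivative (Q y) (at (e0, e0)) (x, 0))) (at e0)" for y
    by (rule has_derivative_transform_within_open[OF _ open_N e0_N]) (simp add: Adc_Q)
  have b0: "br x y = frechet_derivative (\<lambda>u. Adc u y) (at e0) x" for x y
    by (simp add: br_def lie_bracket_def Adc_def \<psi>_def e0_def)
  then have b: "br x y = frechet_derivative (Q y) (at (e0, e0)) (x, 0)" for x y
    by (simp only: b0 frechet_derivative_at[OF d, symmetric])
  show "br x y = frechet_derivative (Q y) (at (e0, e0)) (x, 0)" by (rule b)
  show "((\<lambda>u. Adc u y) has_derivative (\<lambda>x. br x y)) (at e0)" using d by (simp add: b)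
qed

lemma k_e0_left: "v \<in> \<Omega> \<Longrightarrow> k e0 v = v" by (simp add: k_def)
lemma k_e0_right: "u \<in> \<Omega> \<Longrightarrow> k u e0 = e0" using one_U by (simp add: k_def e0_def)
lemma k_self: "u \<in> \<Omega> \<Longrightarrow> k u u = u" by (simp add: k_def m_assoc)

lemma Q_e0_left: assumes "(e0, v) \<in> W" shows "Q y (e0, v) = y"
proof -
  have v: "v \<in> \<Omega>" using W_mem[OF assms] by simp
  have "((\<lambda>v. k e0 v) has_derivative (\<lambda>y. y)) (at v)"
    by (rule has_derivative_transform_within_open[OF has_derivative_ident U_facts(2) v]) (simp add: k_e0_left)
  from fun_cong[OF has_derivative_unique[OF this k_partial[OF assms]], of y] show ?thesis by simp
qed

lemma Adc_e0: "Adc e0 y = y"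
  using Adc_Q(1)[OF e0_N] Q_e0_left[OF e0_W] by simp

text \<open>
  Conjugation satisfies \<open>k u u = u\<close> and \<open>k u e0 = e0\<close>.  By the mean value theorem on the segment from \<open>e0\<close> to
  \<open>u = e0 + t x\<close>, some value \<open>Q x (u, v)\<close> with \<open>v\<close> on this segment agrees with \<open>x\<close> in the direction \<open>c\<close>.  On
  the other hand \<open>Q x (u, v) = x + t [x, x] + o(t)\<close>, as \<open>Q x\<close> is constant in its second argument for
  \<open>u = e0\<close>.
\<close>

lemma br_alternating: "br x x = 0"
proof -
  define L where "L = frechet_derivative (Q x) (at (e0, e0))"
  have L: "(Q x has_derivative L) (at (e0, e0))" unfolding L_def by (rule frechet_derivative_worksI[OF Q_diff[OF e0_W]])
  have L0: "L (0, y) = 0" for y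
  proof -
    have "((\<lambda>v. (e0, v)) has_derivative (\<lambda>y. (0, y))) (at e0)" by (auto intro!: derivative_eq_intros)
    from has_derivative_compose[OF this L] have 1: "((\<lambda>v. Q x (e0, v)) has_derivative (\<lambda>y. L (0, y))) (at e0)" .
    have o: "open {v. (e0, v) \<in> W}"
      using open_vimage[OF open_W, of "Pair e0"] by (simp add: vimage_def continuous_on_Pair)
    have "((\<lambda>v. Q x (e0, v)) has_derivative (\<lambda>y. 0)) (at e0)"
      by (rule has_derivative_transform_within_open[OF has_derivative_const[of x] o]) (use e0_W Q_e0_left in simp_all)
    from has_derivative_unique[OF 1 this] show ?thesis by meson
  qed
  have lin: "linear L" using L by (rule has_derivative_linear)
  have brx: "L (x, y) = br x x" for y
    using linear_add[OF lin, of "(x, 0)" "(0, y)"] L0[of y] br_Q[of x x] by (simp add: L_def)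
  have "br x x \<bullet> c = 0" for c
  proof (rule ccontr)
    assume ne: "br x x \<bullet> c \<noteq> 0"
    then have pos: "norm x > 0" "norm c > 0" using linear_0[OF lin] brx[of 0] by (auto simp: zero_prod_def)
    (* the remainder \<open>\<epsilon> * 2 t |x| |c|\<close> is then half of \<open>t |br x x \<bullet> c|\<close> *)
    define \<epsilon> where "\<epsilon> = \<bar>br x x \<bullet> c\<bar> / (4 * norm x * norm c)"
    have \<epsilon>: "\<epsilon> > 0" using ne pos by (simp add: \<epsilon>_def)
    obtain d where d: "d > 0" "\<And>q. norm (q - (e0, e0)) < d \<Longrightarrow> norm (Q x q - Q x (e0, e0) - L (q - (e0, e0))) \<le> \<epsilon> * norm (q - (e0, e0))"
      using L \<epsilon> unfolding has_derivative_at_alt by blast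
    obtain r where r: "r > 0" "ball (e0, e0) r \<subseteq> W" using open_W e0_W by (meson openE)
    define t where "t = min d r / (4 * norm x)"
    have t: "t > 0" using d r pos by (simp add: t_def)
    have small: "norm ((e0 + t *\<^sub>R x, e0 + s *\<^sub>R x) - (e0, e0)) \<le> 2 * t * norm x"
      "norm ((e0 + t *\<^sub>R x, e0 + s *\<^sub>R x) - (e0, e0)) < min d r" if "0 \<le> s" "s \<le> t" for s
    proof -
      have "norm ((e0 + t *\<^sub>R x, e0 + s *\<^sub>R x) - (e0, e0)) \<le> norm (t *\<^sub>R x) + norm (s *\<^sub>R x)"
        using norm_Pair_le[of "t *\<^sub>R x" "s *\<^sub>R x"] by simp
      also have "\<dots> \<le> t * norm x + t * norm x" using that t by (intro add_mono) (simp_all add: mult_right_mono)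
      finally show 1: "norm ((e0 + t *\<^sub>R x, e0 + s *\<^sub>R x) - (e0, e0)) \<le> 2 * t * norm x" by simp
      also have "2 * t * norm x = min d r / 2" using pos by (simp add: t_def)
      also have "\<dots> < min d r"
      proof -
        have "0 < min d r" using d(1) r(1) by simp
        then show ?thesis by linarith
      qed
      finally show "norm ((e0 + t *\<^sub>R x, e0 + s *\<^sub>R x) - (e0, e0)) < min d r" .
    qed
    have inW: "(e0 + t *\<^sub>R x, e0 + s *\<^sub>R x) \<in> W" if "0 \<le> s" "s \<le> t" for s
    proof -
      have "norm ((e0 + t *\<^sub>R x, e0 + s *\<^sub>R x) - (e0, e0)) < r"
        by (rule less_le_trans[OF small(2)[OF that] min.cobounded2])
      then have "(e0 + t *\<^sub>R x, e0 + s *\<^sub>R x) \<in> ball (e0, e0) r"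
        unfolding mem_ball dist_norm by (subst norm_minus_commute)
      then show ?thesis using r(2) by blast
    qed
    define F where "F s = k (e0 + t *\<^sub>R x) (e0 + s *\<^sub>R x) \<bullet> c" for s
    have "\<exists>s>0. s < t \<and> F t - F 0 = (t - 0) * (Q x (e0 + t *\<^sub>R x, e0 + s *\<^sub>R x) \<bullet> c)"
    proof (rule MVT2[OF t])
      fix s assume s: "0 \<le> s" "s \<le> t"
      have "((\<lambda>s. e0 + s *\<^sub>R x) has_derivative (\<lambda>h. h *\<^sub>R x)) (at s)" by (auto intro!: derivative_eq_intros)
      from has_derivative_compose[OF this k_partial[OF inW[OF s]]]
      have "((\<lambda>s. k (e0 + t *\<^sub>R x) (e0 + s *\<^sub>R x)) has_derivative (\<lambda>h. Q (h *\<^sub>R x) (e0 + t *\<^sub>R x, e0 + s *\<^sub>R x))) (at s)" .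
      then have 1: "(F has_derivative (\<lambda>h. Q (h *\<^sub>R x) (e0 + t *\<^sub>R x, e0 + s *\<^sub>R x) \<bullet> c)) (at s)"
        unfolding F_def by (rule has_derivative_inner_left)
      have ql: "linear (\<lambda>y. Q y (e0 + t *\<^sub>R x, e0 + s *\<^sub>R x))" using k_partial[OF inW[OF s]] by (rule has_derivative_linear)
      show "DERIV F s :> (Q x (e0 + t *\<^sub>R x, e0 + s *\<^sub>R x) \<bullet> c)"
        using 1 unfolding has_field_derivative_def linear_scale[OF ql] inner_scaleR_left mult_commute_abs .
    qed
    then obtain s where s: "0 < s" "s < t" "F t - F 0 = t * (Q x (e0 + t *\<^sub>R x, e0 + s *\<^sub>R x) \<bullet> c)" by auto
    have om: "e0 + t *\<^sub>R x \<in> \<Omega>" using W_mem[OF inW[of 0]] t by simp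
    have "F t - F 0 = t * (x \<bullet> c)" using k_self[OF om] k_e0_right[OF om] by (simp add: F_def inner_diff_left[symmetric])
    then have q: "(Q x (e0 + t *\<^sub>R x, e0 + s *\<^sub>R x) - x) \<bullet> c = 0" using s t by (simp add: inner_diff_left)
    let ?q = "(e0 + t *\<^sub>R x, e0 + s *\<^sub>R x)"
    have "L (?q - (e0, e0)) = t *\<^sub>R L (x, (s / t) *\<^sub>R x)"
      using linear_scale[OF lin, of t "(x, (s / t) *\<^sub>R x)"] t by simp
    then have Lq: "L (?q - (e0, e0)) = t *\<^sub>R br x x" by (simp add: brx)
    have "norm (Q x ?q - x - t *\<^sub>R br x x) \<le> \<epsilon> * norm (?q - (e0, e0))"
      using d(2)[of ?q] small(2)[of s] s Q_e0_left[OF e0_W, of x] Lq by simp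
    also have "\<dots> \<le> \<epsilon> * (2 * t * norm x)" using small(1)[of s] s \<epsilon> by (intro mult_left_mono) simp_all
    finally have n: "norm (Q x ?q - x - t *\<^sub>R br x x) * norm c \<le> \<epsilon> * (2 * t * norm x) * norm c" by (rule mult_right_mono) simp
    have cs: "\<bar>(Q x ?q - x - t *\<^sub>R br x x) \<bullet> c\<bar> \<le> norm (Q x ?q - x - t *\<^sub>R br x x) * norm c" by (rule Cauchy_Schwarz_ineq2)
    have "(Q x ?q - x - t *\<^sub>R br x x) \<bullet> c = - (t * (br x x \<bullet> c))" using q by (simp add: inner_diff_left)
    then have e: "t * \<bar>br x x \<bullet> c\<bar> = \<bar>(Q x ?q - x - t *\<^sub>R br x x) \<bullet> c\<bar>" using t by (simp add: abs_mult)
    have "t * \<bar>br x x \<bullet> c\<bar> \<le> \<epsilon> * (2 * t * norm x) * norm c" unfolding e by (rule order_trans[OF cs n])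
    also have "\<dots> = t * \<bar>br x x \<bullet> c\<bar> / 2" using pos by (simp add: \<epsilon>_def)
    finally show False using t ne by simp
  qed
  then show ?thesis using inner_eq_zero_iff by blast
qed

lemma Adc_linear: "u \<in> N \<Longrightarrow> linear (Adc u)" using Adc_Q(2) has_derivative_linear by blast

text \<open>
  Differentiate \<open>k (k u w) (k u v) = k u (k w v)\<close> with respect to \<open>v\<close> at the identity.
\<close>

lemma Adc_conj:
  assumes u: "u \<in> N"
  shows "\<forall>\<^sub>F w in nhds e0. Adc (k u w) (Adc u y) = Adc u (Adc w y)"
proof -
  have uW: "(u, e0) \<in> W" and u\<Omega>: "u \<in> \<Omega>" using u W_mem by (auto simp: N_def)
  have ke: "k u e0 = e0" by (rule k_e0_right[OF u\<Omega>])
  have slice: "\<forall>\<^sub>F v in nhds e0. (w, v) \<in> W" if "(w, e0) \<in> W" for w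
  proof -
    have "open {v. (w, v) \<in> W}" using open_vimage[OF open_W, of "Pair w"] by (simp add: vimage_def continuous_on_Pair)
    then show ?thesis using that eventually_nhds by blast
  qed
  have cont: "isCont (k u) e0" using Adc_Q(2)[OF u] by (rule has_derivative_continuous)
  have evN: "\<forall>\<^sub>F w in nhds e0. k u w \<in> N"
  proof -
    have "k u e0 \<in> N" using e0_N by (simp only: ke)
    then obtain S where "open S" "e0 \<in> S" "\<forall>w\<in>S. k u w \<in> N"
      using cont open_N unfolding continuous_at_open by blast
    then show ?thesis unfolding eventually_nhds by blast
  qed
  have "\<forall>\<^sub>F w in nhds e0. w \<in> N" using open_N e0_N eventually_nhds by blast
  with evN slice[OF uW] show ?thesis
  proof eventually_elim
    case (elim w)
    have wW: "(w, e0) \<in> W" using elim(3) by (simp add: N_def)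
    have d1: "((\<lambda>v. k (k u w) (k u v)) has_derivative (\<lambda>y. Adc (k u w) (Adc u y))) (at e0)"
      using has_derivative_compose[OF Adc_Q(2)[OF u], of "k (k u w)"] Adc_Q(2)[OF elim(1)] by (simp add: ke)
    have kw: "k w e0 = e0" using W_mem[OF wW] by (intro k_e0_right) simp
    have d2: "((\<lambda>v. k u (k w v)) has_derivative (\<lambda>y. Adc u (Adc w y))) (at e0)"
      using has_derivative_compose[OF Adc_Q(2)[OF elim(3)], of "k u"] Adc_Q(2)[OF u] by (simp add: kw)
    obtain O' where O': "open O'" "e0 \<in> O'" "\<forall>v\<in>O'. (u, v) \<in> W \<and> (w, v) \<in> W"
      using eventually_conj[OF slice[OF uW] slice[OF wW]] unfolding eventually_nhds by blast
    have "k (k u w) (k u v) = k u (k w v)" if v: "v \<in> O'" for v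
    proof -
      have uv: "(u, v) \<in> W" "(w, v) \<in> W" using O'(3) v by auto
      have c: "\<psi> u \<in> carrier G" "\<psi> v \<in> carrier G" "\<psi> w \<in> carrier G" using W_mem[OF uv(1)] W_mem[OF uv(2)] by simp_all
      let ?u = "\<psi> u" and ?v = "\<psi> v" and ?w = "\<psi> w"
      have "(?u \<otimes> ?w \<otimes> inv ?u) \<otimes> (?u \<otimes> ?v \<otimes> inv ?u) \<otimes> inv (?u \<otimes> ?w \<otimes> inv ?u) = ?u \<otimes> (?w \<otimes> ?v \<otimes> inv ?w) \<otimes> inv ?u"
        using c by (simp add: m_assoc inv_mult_group inv_solve_left')
      then show ?thesis unfolding k_def[of "k u w"] k_def[of u "k w v"]
        using k_W[OF elim(2)] k_W[OF uv(1)] k_W[OF uv(2)] by simp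
    qed
    then have "((\<lambda>v. k u (k w v)) has_derivative (\<lambda>y. Adc (k u w) (Adc u y))) (at e0)"
      by (rule has_derivative_transform_within_open[OF d1 O'(1,2)])
    from has_derivative_unique[OF this d2] show ?case by meson
  qed
qed

text \<open>
  Differentiate \<open>Adc_conj\<close> with respect to \<open>w\<close> at the identity.
\<close>

lemma br_equivariant:
  assumes u: "u \<in> N" shows "br (Adc u x) (Adc u y) = Adc u (br x y)"
proof -
  have u\<Omega>: "u \<in> \<Omega>" using u W_mem by (auto simp: N_def)
  have ke: "k u e0 = e0" by (rule k_e0_right[OF u\<Omega>])
  have "((\<lambda>w. Adc w (Adc u y)) has_derivative (\<lambda>x. br x (Adc u y))) (at (k u e0))" unfolding ke by (rule Adc_derivative)
  from has_derivative_compose[OF Adc_Q(2)[OF u] this]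
  have d1: "((\<lambda>w. Adc (k u w) (Adc u y)) has_derivative (\<lambda>x. br (Adc u x) (Adc u y))) (at e0)" .
  have bl: "bounded_linear (Adc u)" by (rule linear_bounded_onb[OF Adc_linear[OF u]])
  have d2: "((\<lambda>w. Adc u (Adc w y)) has_derivative (\<lambda>x. Adc u (br x y))) (at e0)"
    by (rule bounded_linear.has_derivative[OF bl Adc_derivative])
  obtain O' where O': "open O'" "e0 \<in> O'" "\<forall>w\<in>O'. Adc (k u w) (Adc u y) = Adc u (Adc w y)"
    using Adc_conj[OF u, of y] unfolding eventually_nhds by blast
  have "((\<lambda>w. Adc u (Adc w y)) has_derivative (\<lambda>x. br (Adc u x) (Adc u y))) (at e0)"
    by (rule has_derivative_transform_within_open[OF d1 O'(1,2)]) (use O'(3) in simp)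
  from has_derivative_unique[OF this d2] show ?thesis by meson
qed

lemma local_adjoint_action:
  assumes inv: "\<And>g x y. g \<in> carrier G \<Longrightarrow> Ad G (U, \<phi>) g x \<bullet> Ad G (U, \<phi>) g y = x \<bullet> y"
  shows "local_adjoint_action br Adc N e0"
proof (rule local_adjoint_action.intro)
  fix u x y assume u: "u \<in> N"
  then have "\<psi> u \<in> carrier G" using W_mem[of u e0] by (simp add: N_def)
  then show "Adc u x \<bullet> Adc u y = x \<bullet> y" unfolding Adc_def by (rule inv)
qed (simp_all add: open_N e0_N Adc_linear br_equivariant Adc_e0 Adc_derivative br_alternating)

end

section \<open>A Lojasiewicz inequality for the Lie bracket\<close>

context local_adjoint_action
begin

lemma br_linear_left: "linear (\<lambda>x. br x y)"
  using A_derivative by (rule has_derivative_linear)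

lemma br_linear_right: "linear (br x)"
proof (rule linearI)
  fix y z :: 'e and c :: real
  have "((\<lambda>u. A u (y + z)) has_derivative (\<lambda>x. br x y + br x z)) (at e0)"
    by (rule has_derivative_transform_within_open[OF has_derivative_add[OF A_derivative[of y] A_derivative[of z]] open_N e0_N])
       (simp add: linear_add[OF A_linear])
  from fun_cong[OF has_derivative_unique[OF A_derivative[of "y + z"] this], of x]
  show "br x (y + z) = br x y + br x z" .
  have "((\<lambda>u. A u (c *\<^sub>R y)) has_derivative (\<lambda>x. c *\<^sub>R br x y)) (at e0)"
    by (rule has_derivative_transform_within_open[OF has_derivative_scaleR_right[OF A_derivative[of y]] open_N e0_N])
       (simp add: linear_scale[OF A_linear])
  from fun_cong[OF has_derivative_unique[OF A_derivative[of "c *\<^sub>R y"] this], of x]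
  show "br x (c *\<^sub>R y) = c *\<^sub>R br x y" .
qed

lemma br_bounded_bilinear: "bounded_bilinear br"
  by (rule bilinear_bounded_onb[OF br_linear_left br_linear_right])

sublocale br: bounded_bilinear br by (rule br_bounded_bilinear)

lemma br_antisym: "br x y = - br y x"
proof -
  have "br (x + y) (x + y) = br x y + br y x"
    unfolding br.add_left br.add_right alternating[of x] alternating[of y] by simp
  then have "br x y + br y x = 0" by (rule trans[OF sym alternating])
  then show ?thesis by (simp add: eq_neg_iff_add_eq_0)
qed

text \<open>
  Skewness and the Jacobi identity are the derivatives at \<open>e0\<close> of \<open>A_isometry\<close> and \<open>A_automorphism\<close>.
\<close>

lemma br_skew: "br x y \<bullet> z = - (y \<bullet> br x z)"
proof -
  have "((\<lambda>u. A u y \<bullet> A u z) has_derivative (\<lambda>x. A e0 y \<bullet> br x z + br x y \<bullet> A e0 z)) (at e0)"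
    by (rule has_derivative_inner[OF A_derivative A_derivative])
  moreover have "((\<lambda>u. A u y \<bullet> A u z) has_derivative (\<lambda>x. 0)) (at e0)"
    by (rule has_derivative_transform_within_open[OF has_derivative_const[of "y \<bullet> z"] open_N e0_N])
       (simp add: A_isometry)
  ultimately have "(\<lambda>x. A e0 y \<bullet> br x z + br x y \<bullet> A e0 z) = (\<lambda>x. 0)" by (rule has_derivative_unique)
  from fun_cong[OF this, of x] show ?thesis by (simp add: A_e0)
qed

lemma br_invariant: "br x y \<bullet> z = x \<bullet> br y z"
  using br_skew[of y x z] br_antisym[of x y] by simp

lemma jacobi: "br z (br x y) = br (br z x) y + br x (br z y)"
proof -
  have "((\<lambda>u. br (A u x) (A u y)) has_derivative (\<lambda>z. br (A e0 x) (br z y) + br (br z x) (A e0 y))) (at e0)"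
    by (rule br.FDERIV[OF A_derivative A_derivative])
  then have "((\<lambda>u. A u (br x y)) has_derivative (\<lambda>z. br (A e0 x) (br z y) + br (br z x) (A e0 y))) (at e0)"
    by (rule has_derivative_transform_within_open[OF _ open_N e0_N]) (simp add: A_automorphism)
  from fun_cong[OF has_derivative_unique[OF A_derivative this], of z] show ?thesis by (simp add: A_e0 add.commute)
qed

definition isometric_automorphisms :: "('e \<Rightarrow> 'e) set" where
  "isometric_automorphisms = {\<tau>. linear \<tau> \<and> (\<forall>x y. \<tau> x \<bullet> \<tau> y = x \<bullet> y) \<and> (\<forall>x y. br (\<tau> x) (\<tau> y) = \<tau> (br x y))}"

text \<open>
  The isometric automorphisms form a compact set: a maximising sequence converges on an orthonormal basis
  along a subsequence, and the defining identities pass to the limit.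
\<close>

lemma exists_maximizing_automorphism:
  "\<exists>\<tau>\<in>isometric_automorphisms. \<forall>\<sigma>\<in>isometric_automorphisms. \<sigma> H \<bullet> K \<le> \<tau> H \<bullet> K"
proof -
  let ?f = "\<lambda>\<tau>. \<tau> H \<bullet> K"
  have ne: "(\<lambda>x. x) \<in> isometric_automorphisms" by (simp add: isometric_automorphisms_def linear_id[unfolded id_def])
  have nrm: "norm (\<tau> x) = norm x" if "\<tau> \<in> isometric_automorphisms" for \<tau> x
    using that by (simp add: isometric_automorphisms_def norm_eq_sqrt_inner)
  have bdd: "bdd_above (?f ` isometric_automorphisms)"
  proof (rule bdd_aboveI2)
    fix \<tau> assume t: "\<tau> \<in> isometric_automorphisms"
    show "\<tau> H \<bullet> K \<le> norm H * norm K" using norm_cauchy_schwarz[of "\<tau> H" K] nrm[OF t] by simp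
  qed
  define S where "S = Sup (?f ` isometric_automorphisms)"
  have "\<exists>\<tau>\<in>isometric_automorphisms. S - inverse (real (Suc n)) < ?f \<tau>" for n
  proof -
    have "S - inverse (real (Suc n)) < S" by simp
    then show ?thesis unfolding S_def using less_cSUP_iff[OF _ bdd] ne by blast
  qed
  then obtain \<tau> where \<tau>: "\<And>n. \<tau> n \<in> isometric_automorphisms" "\<And>n. S - inverse (real (Suc n)) < ?f (\<tau> n)" by metis
  have sub: "\<exists>r :: nat \<Rightarrow> nat. strict_mono r \<and> (\<forall>b\<in>B. convergent (\<lambda>n. \<tau> (r n) b))" if "finite B" for B
    using that
  proof induction
    case empty show ?case by (auto intro!: exI[of _ id] strict_mono_id)
  next
    case (insert b B)
    then obtain r :: "nat \<Rightarrow> nat" where r: "strict_mono r" "\<forall>b\<in>B. convergent (\<lambda>n. \<tau> (r n) b)" by blast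
    have "bounded (range (\<lambda>n. \<tau> (r n) b))" unfolding bounded_iff using nrm \<tau>(1) by (intro exI[of _ "norm b"]) auto
    then obtain l s where s: "strict_mono (s :: nat \<Rightarrow> nat)" "((\<lambda>n. \<tau> (r n) b) \<circ> s) \<longlonglongrightarrow> l"
      using bounded_imp_convergent_subsequence by blast
    have "convergent (\<lambda>n. \<tau> ((r \<circ> s) n) b)" using s(2) by (auto simp: convergent_def comp_def)
    moreover have "convergent (\<lambda>n. \<tau> ((r \<circ> s) n) c)" if c: "c \<in> B" for c
      using convergent_subseq_convergent[OF r(2)[rule_format, OF c] s(1)] by (simp add: comp_def)
    ultimately show ?case using strict_mono_o[OF r(1) s(1)] by blast
  qed
  obtain r :: "nat \<Rightarrow> nat" where r: "strict_mono r" "\<forall>b\<in>onb. convergent (\<lambda>n. \<tau> (r n) b)"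
    using sub[OF onb(1)] by blast
  define \<sigma> where "\<sigma> x = lim (\<lambda>n. \<tau> (r n) x)" for x
  have lim: "(\<lambda>n. \<tau> (r n) x) \<longlonglongrightarrow> \<sigma> x" for x
  proof -
    have "(\<lambda>n. \<tau> (r n) x) = (\<lambda>n. \<Sum>b\<in>onb. (x \<bullet> b) *\<^sub>R \<tau> (r n) b)"
      using \<tau>(1) by (intro ext linear_onb) (simp add: isometric_automorphisms_def)
    moreover have "(\<lambda>n. \<Sum>b\<in>onb. (x \<bullet> b) *\<^sub>R \<tau> (r n) b) \<longlonglongrightarrow> (\<Sum>b\<in>onb. (x \<bullet> b) *\<^sub>R lim (\<lambda>n. \<tau> (r n) b))"
      using r(2) by (intro tendsto_sum tendsto_scaleR tendsto_const) (simp add: convergent_LIMSEQ_iff)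
    ultimately have "convergent (\<lambda>n. \<tau> (r n) x)" by (auto simp: convergent_def)
    then show ?thesis unfolding \<sigma>_def by (simp add: convergent_LIMSEQ_iff)
  qed
  have \<tau>': "\<tau> n (x + y) = \<tau> n x + \<tau> n y" "\<tau> n (c *\<^sub>R x) = c *\<^sub>R \<tau> n x" "\<tau> n x \<bullet> \<tau> n y = x \<bullet> y"
    "br (\<tau> n x) (\<tau> n y) = \<tau> n (br x y)" for n x y c
    using \<tau>(1)[of n] by (simp_all add: isometric_automorphisms_def linear_add linear_scale)
  have "\<sigma> \<in> isometric_automorphisms"
    unfolding isometric_automorphisms_def
  proof (intro CollectI conjI allI linearI)
    fix x y :: 'e and c :: real
    show "\<sigma> (x + y) = \<sigma> x + \<sigma> y"
      using LIMSEQ_unique[OF lim[of "x + y"]] tendsto_add[OF lim[of x] lim[of y]] by (simp add: \<tau>')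
    show "\<sigma> (c *\<^sub>R x) = c *\<^sub>R \<sigma> x"
      using LIMSEQ_unique[OF lim[of "c *\<^sub>R x"]] tendsto_scaleR[OF tendsto_const lim[of x]] by (simp add: \<tau>')
    show "\<sigma> x \<bullet> \<sigma> y = x \<bullet> y"
      using tendsto_inner[OF lim[of x] lim[of y]] by (simp add: \<tau>' LIMSEQ_const_iff)
    show "br (\<sigma> x) (\<sigma> y) = \<sigma> (br x y)"
      using LIMSEQ_unique[OF br.tendsto[OF lim[of x] lim[of y]]] lim[of "br x y"] by (simp add: \<tau>')
  qed
  moreover have "S \<le> ?f \<sigma>"
  proof (rule LIMSEQ_le)
    have "(\<lambda>n. inverse (real (Suc (r n)))) \<longlonglongrightarrow> 0"
      using LIMSEQ_subseq_LIMSEQ[OF LIMSEQ_inverse_real_of_nat r(1)] by (simp add: comp_def)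
    from tendsto_diff[OF tendsto_const this] show "(\<lambda>n. S - inverse (real (Suc (r n)))) \<longlonglongrightarrow> S" by simp
    show "(\<lambda>n. ?f (\<tau> (r n))) \<longlonglongrightarrow> ?f \<sigma>" by (intro tendsto_inner lim tendsto_const)
    show "\<exists>N. \<forall>n\<ge>N. S - inverse (real (Suc (r n))) \<le> ?f (\<tau> (r n))" using \<tau>(2) less_imp_le by blast
  qed
  moreover have "?f \<sigma>' \<le> S" if "\<sigma>' \<in> isometric_automorphisms" for \<sigma>'
    unfolding S_def by (rule cSUP_upper[OF that bdd])
  ultimately show ?thesis by (meson order_trans)
qed

text \<open>
  This is Hunt's argument for the conjugacy of maximal tori.  At a maximum of \<open>\<langle>\<tau> H, K\<rangle>\<close> the derivative
  along the adjoint action vanishes, that is, \<open>\<langle>[x, \<tau> H], K\<rangle> = \<langle>x, [\<tau> H, K]\<rangle> = 0\<close> for all \<open>x\<close>.  Since the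
  identity is a competitor, \<open>\<tau> H\<close> is no farther from \<open>K\<close> than \<open>H\<close>.
\<close>

lemma commuting_conjugate:
  obtains \<tau> where "\<tau> \<in> isometric_automorphisms" "br (\<tau> H) K = 0" "norm (\<tau> H - K) \<le> norm (H - K)"
proof -
  obtain \<tau> where t: "\<tau> \<in> isometric_automorphisms" and max: "\<And>\<sigma>. \<sigma> \<in> isometric_automorphisms \<Longrightarrow> \<sigma> H \<bullet> K \<le> \<tau> H \<bullet> K"
    using exists_maximizing_automorphism by blast
  have comp: "(\<lambda>x. A u (\<tau> x)) \<in> isometric_automorphisms" if u: "u \<in> N" for u
    using t linear_compose[of \<tau> "A u"] A_linear[OF u] A_isometry[OF u] A_automorphism[OF u]
    by (simp add: isometric_automorphisms_def comp_def)
  have "br x (\<tau> H) \<bullet> K = 0" for x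
  proof -
    have d: "((\<lambda>u. A u (\<tau> H) \<bullet> K) has_derivative (\<lambda>x. br x (\<tau> H) \<bullet> K)) (at e0)"
      by (rule has_derivative_inner_left[OF A_derivative])
    have "A u (\<tau> H) \<bullet> K \<le> A e0 (\<tau> H) \<bullet> K" if "u \<in> N" for u using max[OF comp[OF that]] by (simp add: A_e0)
    then have "(\<lambda>x. br x (\<tau> H) \<bullet> K) = (\<lambda>x. 0)"
      by (intro differential_zero_maxmin[OF e0_N open_N d]) blast
    then show ?thesis by meson
  qed
  then have "x \<bullet> br (\<tau> H) K = 0" for x using br_invariant[of x "\<tau> H" K] by simp
  then have c: "br (\<tau> H) K = 0" using inner_eq_zero_iff by blast
  have id: "(\<lambda>x. x) \<in> isometric_automorphisms" by (simp add: isometric_automorphisms_def linear_id[unfolded id_def])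
  have "(norm (\<tau> H - K))\<^sup>2 \<le> (norm (H - K))\<^sup>2"
    using max[OF id] t by (simp add: power2_norm_eq_inner inner_diff_left inner_diff_right inner_commute isometric_automorphisms_def)
  then have "norm (\<tau> H - K) \<le> norm (H - K)" by (rule power2_le_imp_le) simp
  with t c show ?thesis by (rule that)
qed

text \<open>
  As \<open>ad K\<close> is skew, the orthogonal complement of its range is its kernel.
\<close>

lemma ad_split:
  obtains w k where "c = br K w + k" "br K k = 0"
proof -
  obtain B where B: "finite B" "span B = span (br K ` onb)" "pairwise orthogonal B"
    using basis_orthogonal[of "br K ` onb"] onb(1) by blast
  have sp: "span (onb :: 'e set) = UNIV" by (rule onb(4))
  have rng: "span B = range (br K)"
    using B(2) linear_span_image[OF br_linear_right, of K onb] sp by simp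
  define v where "v = (\<Sum>b\<in>B. (c \<bullet> b / (b \<bullet> b)) *\<^sub>R b)"
  have "v \<in> span B" unfolding v_def by (intro span_sum span_scale span_base)
  then obtain w where w: "v = br K w" using rng by auto
  have o: "orthogonal (c - v) z" if "z \<in> span B" for z
  proof -
    have "orthogonal (c - v) b" if b: "b \<in> B" for b
    proof -
      have "(\<Sum>d\<in>B. (c \<bullet> d / (d \<bullet> d)) * (d \<bullet> b)) = (\<Sum>d\<in>B. if d = b then c \<bullet> b else 0)"
        using B(3) b by (intro sum.cong) (auto simp: pairwise_def orthogonal_def)
      then show ?thesis using B(1) b by (simp add: v_def orthogonal_def inner_diff_left inner_sum_left)
    qed
    then show ?thesis using orthogonal_to_span[OF that] by blast
  qed
  have "br K (c - v) \<bullet> z = 0" for z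
    using o[of "br K z"] br_skew[of K "c - v" z] rng by (simp add: orthogonal_def)
  then have "br K (c - v) = 0" using inner_eq_zero_iff by blast
  then show ?thesis using that[of w "c - v"] w by simp
qed

text \<open>
  On its range the skew map \<open>ad K\<close> is injective, hence bounded below by compactness of the unit sphere.
\<close>

lemma ad_lower_bound:
  "\<exists>\<sigma>>0. \<forall>w. norm (br K (br K w)) \<ge> \<sigma> * norm (br K w)"
proof (rule ccontr)
  assume "\<not> ?thesis"
  then have "\<forall>n. \<exists>w. norm (br K (br K w)) < inverse (real (Suc n)) * norm (br K w)"
    by (simp add: not_le)
  then obtain w where w: "\<And>n. norm (br K (br K (w n))) < inverse (real (Suc n)) * norm (br K (w n))" by metis
  define v where "v n = br K (w n) /\<^sub>R norm (br K (w n))" for n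
  have nz: "norm (br K (w n)) > 0" for n using w[of n] by (metis less_le_trans mult_zero_right norm_ge_zero norm_zero br.zero_right less_irrefl zero_less_norm_iff)
  have v1: "norm (v n) = 1" for n using nz[of n] by (simp add: v_def)
  have vr: "v n = br K (w n /\<^sub>R norm (br K (w n)))" for n by (simp add: v_def br.scaleR_right)
  have vs: "norm (br K (v n)) \<le> inverse (real (Suc n))" for n
  proof -
    have "norm (br K (v n)) = norm (br K (br K (w n))) / norm (br K (w n))"
      by (simp add: v_def br.scaleR_right divide_inverse mult.commute)
    also have "\<dots> \<le> inverse (real (Suc n))" using w[of n] nz[of n] by (simp add: pos_divide_le_eq)
    finally show ?thesis .
  qed
  have "bounded (range v)" unfolding bounded_iff using v1 by (intro exI[of _ 1]) auto
  then obtain l s where s: "strict_mono (s :: nat \<Rightarrow> nat)" "(v \<circ> s) \<longlonglongrightarrow> l"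
    using bounded_imp_convergent_subsequence by blast
  have l: "(\<lambda>n. v (s n)) \<longlonglongrightarrow> l" using s(2) by (simp add: comp_def)
  have "norm l = 1" using tendsto_norm[OF l] by (simp add: v1 LIMSEQ_const_iff)
  have "br K l = 0"
  proof -
    have "(\<lambda>n. inverse (real (Suc (s n)))) \<longlonglongrightarrow> 0"
      using LIMSEQ_subseq_LIMSEQ[OF LIMSEQ_inverse_real_of_nat s(1)] by (simp add: comp_def)
    then have "(\<lambda>n. br K (v (s n))) \<longlonglongrightarrow> 0" by (rule Lim_null_comparison[rotated]) (intro always_eventually allI vs)
    moreover have "(\<lambda>n. br K (v (s n))) \<longlonglongrightarrow> br K l" by (rule br.tendsto[OF tendsto_const l])
    ultimately show ?thesis by (rule LIMSEQ_unique[symmetric])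
  qed
  then have "v n \<bullet> l = 0" for n using br_skew[of K "w n /\<^sub>R norm (br K (w n))" l] vr[of n] by simp
  then have "l \<bullet> l = 0" using tendsto_inner[OF l tendsto_const[of l]] by (simp add: LIMSEQ_const_iff)
  then show False using \<open>norm l = 1\<close> by simp
qed

text \<open>
  After an automorphism, \<open>H = [x, y]\<close> commutes with \<open>K\<close> and is still near \<open>K\<close>.  Then \<open>ad H\<close> respects the
  range and the kernel of \<open>ad K\<close>, and it is bounded below on the range.  If \<open>[H, x]\<close> and \<open>[H, y]\<close> are small,
  so are the components of \<open>x\<close> and \<open>y\<close> in the range, and with them
  \<open>\<langle>H, K\<rangle> = \<langle>x, [y, K]\<rangle> = \<langle>[K, x], [K, y']\<rangle>\<close>, where \<open>y = [K, y'] + k\<close> and \<open>[K, k] = 0\<close>; but this is near one.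
\<close>

lemma bracket_estimate_near:
  assumes K: "norm K = 1"
  shows "\<exists>\<rho>>0. \<exists>\<kappa>>0. \<forall>x y. norm (br x y) = 1 \<longrightarrow> norm (br x y - K) < \<rho> \<longrightarrow>
     \<kappa> \<le> norm (br x (br x y)) \<or> \<kappa> \<le> norm (br y (br x y))"
proof -
  obtain \<sigma> where \<sigma>: "\<sigma> > 0" "\<And>w. norm (br K (br K w)) \<ge> \<sigma> * norm (br K w)" using ad_lower_bound by blast
  obtain M where M: "M > 0" "\<And>a b. norm (br a b) \<le> norm a * norm b * M" using br.pos_bounded by blast
  (* \<open>\<rho>\<close> ensures the lower bound \<open>\<sigma> / 2\<close> for \<open>ad H\<close> on the range of \<open>ad K\<close>, and \<open>\<kappa>\<close> ensures
     \<open>\<langle>H, K\<rangle> \<le> 1/4\<close>, which contradicts \<open>|H - K| < 1/2\<close> *)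
  define \<rho> where "\<rho> = min (1/2) (\<sigma> / (2 * M))"
  define \<kappa> where "\<kappa> = min 1 (\<sigma>\<^sup>2 / (16 * M))"
  have \<rho>: "\<rho> > 0" "\<rho> \<le> 1/2" "\<rho> * M \<le> \<sigma> / 2" using \<sigma> M
  proof -
    have "\<rho> * M \<le> \<sigma> / (2 * M) * M" using M by (intro mult_right_mono) (simp_all add: \<rho>_def)
    then show "\<rho> * M \<le> \<sigma> / 2" using M by simp
  qed (use \<sigma> M in \<open>simp_all add: \<rho>_def\<close>)
  have \<kappa>: "\<kappa> > 0" using \<sigma> M by (simp add: \<kappa>_def)
  have "\<kappa> \<le> norm (br x (br x y)) \<or> \<kappa> \<le> norm (br y (br x y))"
    if 1: "norm (br x y) = 1" and near: "norm (br x y - K) < \<rho>" for x y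
  proof (rule ccontr)
    assume "\<not> ?thesis"
    then have small: "norm (br x (br x y)) < \<kappa>" "norm (br y (br x y)) < \<kappa>" by auto
    obtain \<tau> where \<tau>: "\<tau> \<in> isometric_automorphisms" "br (\<tau> (br x y)) K = 0" "norm (\<tau> (br x y) - K) \<le> norm (br x y - K)"
      by (rule commuting_conjugate)
    define H where "H = \<tau> (br x y)"
    have HK: "br H K = 0" "norm (H - K) < \<rho>" using \<tau>(2,3) near by (simp_all add: H_def)
    have nrm: "norm (\<tau> z) = norm z" for z using \<tau>(1) by (simp add: isometric_automorphisms_def norm_eq_sqrt_inner)
    define a where "a = \<tau> x"
    define b where "b = \<tau> y"
    have H: "H = br a b" using \<tau>(1) by (simp add: H_def a_def b_def isometric_automorphisms_def)
    have sa: "norm (br H a) < \<kappa>" and sb: "norm (br H b) < \<kappa>"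
      using small nrm \<tau>(1) br_antisym[of H a] br_antisym[of H b]
      by (simp_all add: H_def a_def b_def isometric_automorphisms_def)
    have comm: "br H (br K z) = br K (br H z)" for z using jacobi[of H K z] HK(1) by (simp add: br.zero_left)
    obtain wa ka where a: "a = br K wa + ka" "br K ka = 0" by (rule ad_split)
    obtain wb kb where b: "b = br K wb + kb" "br K kb = 0" by (rule ad_split)
    (* the component of \<open>c\<close> in the range of \<open>ad K\<close>; its image under \<open>ad H\<close> is orthogonal to that of \<open>k\<close> *)
    have part: "norm (br K w) \<le> 2 / \<sigma> * \<kappa>" if c: "c = br K w + k" "br K k = 0" and s: "norm (br H c) < \<kappa>" for c w k
    proof -
      have 1: "norm (br H (br K w)) \<le> norm (br H c)"
      proof -
        have orth: "br H (br K w) \<bullet> br H k = 0"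
        proof -
          have "br H (br K w) \<bullet> br H k = br K (br H w) \<bullet> br H k" by (simp add: comm)
          also have "\<dots> = - (br H w \<bullet> br K (br H k))" by (rule br_skew)
          also have "br K (br H k) = 0" using comm[of k] c(2) by (simp add: br.zero_right)
          finally show ?thesis by simp
        qed
        have "(norm (br H c))\<^sup>2 = (norm (br H (br K w)))\<^sup>2 + (norm (br H k))\<^sup>2"
          unfolding c(1) br.add_right power2_norm_eq_inner using orth by (simp add: inner_add_left inner_add_right inner_commute)
        then have "(norm (br H (br K w)))\<^sup>2 \<le> (norm (br H c))\<^sup>2" by simp
        then show ?thesis by (rule power2_le_imp_le) simp
      qed
      have "norm (br K (br K w)) \<le> norm (br H (br K w)) + norm (br (H - K) (br K w))"
        using norm_triangle_ineq4[of "br H (br K w)" "br (H - K) (br K w)"] by (simp add: br.diff_left)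
      also have "norm (br (H - K) (br K w)) \<le> norm (H - K) * norm (br K w) * M" by (rule M(2))
      also have "\<dots> \<le> \<rho> * norm (br K w) * M" using HK(2) M by (intro mult_right_mono) simp_all
      also have "\<dots> = (\<rho> * M) * norm (br K w)" by simp
      also have "\<dots> \<le> \<sigma> / 2 * norm (br K w)" by (rule mult_right_mono[OF \<rho>(3)]) simp
      finally have "\<sigma> * norm (br K w) \<le> norm (br H (br K w)) + \<sigma> / 2 * norm (br K w)"
        using \<sigma>(2)[of w] by linarith
      then have "\<sigma> / 2 * norm (br K w) \<le> \<kappa>" using 1 s by linarith
      then show ?thesis using \<sigma>(1) by (simp add: field_simps)
    qed
    have "H \<bullet> K = a \<bullet> br b K" unfolding H by (rule br_invariant)
    also have "br b K = - br K (br K wb)" using br_antisym[of b K] b by (simp add: br.add_right)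
    also have "a \<bullet> - br K (br K wb) = br K a \<bullet> br K wb" using br_skew[of K a "br K wb"] by simp
    also have "br K a = br K (br K wa)" using a by (simp add: br.add_right)
    also have "br K (br K wa) \<bullet> br K wb \<le> norm (br K (br K wa)) * norm (br K wb)" by (rule norm_cauchy_schwarz)
    also have "\<dots> \<le> (norm (br K wa) * M) * norm (br K wb)" using M(2)[of K "br K wa"] K by (intro mult_right_mono) simp_all
    also have "\<dots> \<le> (2 / \<sigma> * \<kappa> * M) * (2 / \<sigma> * \<kappa>)"
      using part[OF a sa] part[OF b sb] M \<sigma> \<kappa> by (intro mult_mono mult_right_mono) simp_all
    also have "\<dots> = (4 * M / \<sigma>\<^sup>2) * (\<kappa> * \<kappa>)" by (simp add: power2_eq_square)
    also have "\<dots> \<le> (4 * M / \<sigma>\<^sup>2) * (1 * (\<sigma>\<^sup>2 / (16 * M)))"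
      using \<kappa> M by (intro mult_left_mono mult_mono) (simp_all add: \<kappa>_def)
    also have "\<dots> = 1 / 4" using M \<sigma> by simp
    finally have le: "H \<bullet> K \<le> 1 / 4" .
    have "(norm (H - K))\<^sup>2 = (norm H)\<^sup>2 + (norm K)\<^sup>2 - 2 * (H \<bullet> K)"
      by (simp add: power2_norm_eq_inner inner_diff_left inner_diff_right inner_commute)
    also have "\<dots> = 2 - 2 * (H \<bullet> K)" using K nrm[of "br x y"] 1 by (simp add: H_def)
    finally have "(norm (H - K))\<^sup>2 \<ge> 3 / 2" using le by simp
    moreover have "(norm (H - K))\<^sup>2 \<le> (1/2)\<^sup>2" using HK(2) \<rho> by (intro power_mono) simp_all
    ultimately show False by (simp add: power2_eq_square)
  qed
  then show ?thesis using \<rho>(1) \<kappa> by blast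
qed

text \<open>
  Scaling \<open>x\<close> and \<open>y\<close> by \<open>|[x, y]|\<^sup>-\<^sup>1\<^sup>/\<^sup>2\<close> makes the bracket a unit vector and multiplies the double brackets by
  \<open>|[x, y]|\<^sup>-\<^sup>3\<^sup>/\<^sup>2\<close>; this explains the exponent.  For unit brackets, a sequence along which both double brackets
  tend to zero would contradict \<open>bracket_estimate_near\<close> at a limit point of the brackets.
\<close>

lemma bracket_lojasiewicz:
  "\<exists>C>0. \<forall>x y m. norm (br x (br x y)) \<le> m \<longrightarrow> norm (br y (br x y)) \<le> m \<longrightarrow> norm (br x y) powr (3/2) \<le> C * m"
proof -
  have "\<exists>\<kappa>>0. \<forall>x y. norm (br x y) = 1 \<longrightarrow> \<kappa> \<le> norm (br x (br x y)) \<or> \<kappa> \<le> norm (br y (br x y))"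
  proof (rule ccontr)
    assume "\<not> ?thesis"
    then have "\<forall>n. \<exists>x y. norm (br x y) = 1 \<and> norm (br x (br x y)) < inverse (real (Suc n)) \<and> norm (br y (br x y)) < inverse (real (Suc n))"
      by (metis inverse_positive_iff_positive of_nat_0_less_iff zero_less_Suc not_le)
    then obtain x y where xy: "\<And>n. norm (br (x n) (y n)) = 1" "\<And>n. norm (br (x n) (br (x n) (y n))) < inverse (real (Suc n))"
      "\<And>n. norm (br (y n) (br (x n) (y n))) < inverse (real (Suc n))" by metis
    have "bounded (range (\<lambda>n. br (x n) (y n)))" unfolding bounded_iff using xy(1) by (intro exI[of _ 1]) auto
    then obtain K s where s: "strict_mono (s :: nat \<Rightarrow> nat)" "((\<lambda>n. br (x n) (y n)) \<circ> s) \<longlonglongrightarrow> K"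
      using bounded_imp_convergent_subsequence by blast
    then have l: "(\<lambda>n. br (x (s n)) (y (s n))) \<longlonglongrightarrow> K" by (simp add: comp_def)
    have "norm K = 1" using tendsto_norm[OF l] by (simp add: xy(1) LIMSEQ_const_iff)
    from bracket_estimate_near[OF this] obtain \<rho> \<kappa> where r: "\<rho> > 0" "\<kappa> > 0"
      "\<And>x y. norm (br x y) = 1 \<Longrightarrow> norm (br x y - K) < \<rho> \<Longrightarrow> \<kappa> \<le> norm (br x (br x y)) \<or> \<kappa> \<le> norm (br y (br x y))" by blast
    have "(\<lambda>n. inverse (real (Suc (s n)))) \<longlonglongrightarrow> 0"
      using LIMSEQ_subseq_LIMSEQ[OF LIMSEQ_inverse_real_of_nat s(1)] by (simp add: comp_def)
    from order_tendstoD(2)[OF this r(2)] have 1: "\<forall>\<^sub>F n in sequentially. inverse (real (Suc (s n))) < \<kappa>" .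
    have 2: "\<forall>\<^sub>F n in sequentially. norm (br (x (s n)) (y (s n)) - K) < \<rho>"
      using tendstoD[OF l r(1)] by (simp add: dist_norm)
    obtain n where n: "inverse (real (Suc (s n))) < \<kappa>" "norm (br (x (s n)) (y (s n)) - K) < \<rho>"
      using eventually_conj[OF 1 2] unfolding eventually_sequentially by blast
    then show False using r(3)[OF xy(1) n(2)] xy(2,3)[of "s n"] by linarith
  qed
  then obtain \<kappa> where \<kappa>: "\<kappa> > 0" "\<And>x y. norm (br x y) = 1 \<Longrightarrow> \<kappa> \<le> norm (br x (br x y)) \<or> \<kappa> \<le> norm (br y (br x y))" by blast
  have "norm (br x y) powr (3/2) \<le> (1 / \<kappa>) * m" if m: "norm (br x (br x y)) \<le> m" "norm (br y (br x y)) \<le> m" for x y m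
  proof (cases "br x y = 0")
    case True
    then show ?thesis using order_trans[OF norm_ge_zero m(1)] \<kappa>(1) by simp
  next
    case False
    define h where "h = norm (br x y)"
    have h: "h > 0" using False by (simp add: h_def)
    define s where "s = h powr (- (1/2))"
    have s: "s > 0" using h by (simp add: s_def)
    have "s * s = h powr (- (1/2) + - (1/2))" by (simp only: s_def powr_add)
    then have ss: "s * s = inverse h" using h by (simp add: powr_minus)
    have e: "br (s *\<^sub>R x) (s *\<^sub>R y) = (s * s) *\<^sub>R br x y" by (simp add: br.scaleR_left br.scaleR_right)
    have "norm (br (s *\<^sub>R x) (s *\<^sub>R y)) = 1" unfolding e ss using h by (simp add: h_def)
    from \<kappa>(2)[OF this] have "\<kappa> \<le> s * s * s * m"
    proof
      assume "\<kappa> \<le> norm (br (s *\<^sub>R x) (br (s *\<^sub>R x) (s *\<^sub>R y)))"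
      also have "\<dots> = s * s * s * norm (br x (br x y))" unfolding e using s by (simp add: br.scaleR_left br.scaleR_right)
      also have "\<dots> \<le> s * s * s * m" using s m by (intro mult_left_mono) simp_all
      finally show ?thesis .
    next
      assume "\<kappa> \<le> norm (br (s *\<^sub>R y) (br (s *\<^sub>R x) (s *\<^sub>R y)))"
      also have "\<dots> = s * s * s * norm (br y (br x y))" unfolding e using s by (simp add: br.scaleR_left br.scaleR_right)
      also have "\<dots> \<le> s * s * s * m" using s m by (intro mult_left_mono) simp_all
      finally show ?thesis .
    qed
    moreover have "s * s * s = inverse (h powr (3/2))"
    proof -
      have "s * s * s = h powr (- (1/2) + - (1/2) + - (1/2))" by (simp only: s_def powr_add)
      also have "- (1/2) + - (1/2) + - (1/2) = - (3/2 :: real)" by simp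
      finally show ?thesis by (simp only: powr_minus)
    qed
    ultimately have "\<kappa> \<le> inverse (h powr (3/2)) * m" by simp
    then have "\<kappa> * h powr (3/2) \<le> m" using h by (simp add: field_simps)
    then show ?thesis using \<kappa>(1) by (simp add: field_simps h_def)
  qed
  then show ?thesis using \<kappa>(1) by (intro exI[of _ "1 / \<kappa>"]) simp
qed

end

section \<open>Sobolev functions on the torus\<close>

lemma bounded_if_continuous_periodic:
  fixes f :: "real \<times> real \<Rightarrow> real"
  assumes "continuous_on UNIV f" "periodic f" shows "\<exists>K. \<forall>x. \<bar>f x\<bar> \<le> K"
proof -
  have "compact (f ` cbox (0, 0) (1, 1))"
    using assms(1) by (intro compact_continuous_image compact_cbox) (rule continuous_on_subset[OF _ subset_UNIV])
  then obtain K where K: "\<forall>y\<in>f ` cbox (0, 0) (1, 1). norm y \<le> K" using compact_imp_bounded bounded_iff by blast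
  have "\<bar>f x\<bar> \<le> K" for x
  proof -
    have "cell x \<in> cbox (0, 0) (1, 1)"
      by (auto simp: cell_def cbox_def Basis_prod_def inner_prod_def intro: less_imp_le[OF frac_lt_1])
    then show ?thesis using K periodic_cell[OF assms(2), of x] by (metis imageI real_norm_def)
  qed
  then show ?thesis by blast
qed

lemma smooth_periodic_derivative:
  fixes \<eta> :: "real \<times> real \<Rightarrow> real"
  assumes s: "smooth_on UNIV \<eta>" and p: "periodic \<eta>"
  shows "continuous_on UNIV \<eta>" "continuous_on UNIV (\<lambda>x. frechet_derivative \<eta> (at x) e)"
    "periodic (\<lambda>x. frechet_derivative \<eta> (at x) e)"
    "(\<eta> has_derivative frechet_derivative \<eta> (at x)) (at x)"
proof -
  have "Ck_on 0 UNIV \<eta>" using s unfolding smooth_on_def by blast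
  then show "continuous_on UNIV \<eta>" by simp
  have "Ck_on 0 UNIV (\<lambda>x. frechet_derivative \<eta> (at x) e)"
    using smooth_on_derivative[OF s] unfolding smooth_on_def by blast
  then show "continuous_on UNIV (\<lambda>x. frechet_derivative \<eta> (at x) e)" by simp
  have d: "(\<eta> has_derivative frechet_derivative \<eta> (at x)) (at x)" for x
    by (rule frechet_derivative_worksI[OF smooth_on_differentiable[OF s UNIV_I]])
  show "(\<eta> has_derivative frechet_derivative \<eta> (at x)) (at x)" by (rule d)
  show "periodic (\<lambda>x. frechet_derivative \<eta> (at x) e)"
    unfolding periodic_def
  proof (intro allI ballI)
    fix x b :: "real \<times> real" assume b: "b \<in> Basis"
    have "((\<lambda>x. x + b) has_derivative (\<lambda>v. v)) (at x)" by (auto intro!: derivative_eq_intros)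
    from has_derivative_compose[OF this d[of "x + b"]]
    have "((\<lambda>x. \<eta> (x + b)) has_derivative frechet_derivative \<eta> (at (x + b))) (at x)" .
    moreover have "(\<lambda>x. \<eta> (x + b)) = \<eta>" using p b by (auto simp: periodic_def)
    ultimately have "(\<eta> has_derivative frechet_derivative \<eta> (at (x + b))) (at x)" by simp
    from has_derivative_unique[OF this d[of x]]
    show "frechet_derivative \<eta> (at (x + b)) e = frechet_derivative \<eta> (at x) e" by simp
  qed
qed

lemma integrable_continuous_periodic_mult:
  fixes g :: "real \<times> real \<Rightarrow> 'b::{banach, second_countable_topology}"
  assumes h: "continuous_on UNIV h" "periodic h" and g: "integrable torus g"
  shows "integrable torus (\<lambda>x. h x *\<^sub>R g x)"
proof -
  obtain K where K: "\<forall>x. \<bar>h x\<bar> \<le> K" using bounded_if_continuous_periodic[OF h] by blast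
  have "h \<in> borel_measurable torus" by (rule measurable_torus[OF borel_measurable_continuous_onI[OF h(1)]])
  from integrable_bounded_mult[OF g this K[rule_format]] show ?thesis .
qed

text \<open>
  The integral does not change when the integrand is averaged over its translates in the direction \<open>e\<close>, and
  these averages are increments of \<open>\<eta>\<close> over a full period.
\<close>

lemma integral_derivative_periodic:
  fixes \<eta> :: "real \<times> real \<Rightarrow> real"
  assumes s: "smooth_on UNIV \<eta>" and p: "periodic \<eta>" and e: "e \<in> Basis"
  shows "(LINT x|torus. frechet_derivative \<eta> (at x) e) = 0"
proof -
  note sp = smooth_periodic_derivative[OF s p]
  define D where "D x = frechet_derivative \<eta> (at x) e" for x
  have Dc: "continuous_on UNIV D" and Dp: "periodic D" unfolding D_def by (rule sp(2), rule sp(3))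
  have Dm: "D \<in> borel_measurable borel" by (rule borel_measurable_continuous_onI[OF Dc])
  have Di: "integrable torus D"
    using integrable_continuous_periodic_mult[OF Dc Dp, of "\<lambda>_. 1 :: real"] by simp
  have L: "Lq 1 D" using Dm Dp Di by (simp add: Lq_1)
  have "(LINT x|torus. D x) = (LINT s|unit_interval. (LINT x|torus. D (x + s *\<^sub>R e)))"
    using integral_torus_shift(1)[OF Dm Dp] by simp
  also have "\<dots> = (LINT x|torus. (LINT s|unit_interval. D (x + s *\<^sub>R e)))"
    by (rule ut.Fubini_integral[symmetric, OF integrable_segment[OF L]])
  also have "\<dots> = (LINT x|torus. 0)"
  proof (rule Bochner_Integration.integral_cong[OF refl])
    fix x
    have "((\<lambda>s. \<eta> (x + s *\<^sub>R e)) has_vector_derivative D (x + s *\<^sub>R e)) (at s)" for s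
    proof -
      have l: "linear (frechet_derivative \<eta> (at z))" for z using sp(4) by (rule has_derivative_linear)
      have "((\<lambda>s. x + s *\<^sub>R e) has_derivative (\<lambda>h. h *\<^sub>R e)) (at s)" by (auto intro!: derivative_eq_intros)
      from has_derivative_compose[OF this sp(4)] show ?thesis
        unfolding has_vector_derivative_def D_def linear_scale[OF l] .
    qed
    moreover have "continuous_on UNIV (\<lambda>s. D (x + s *\<^sub>R e))"
      by (rule continuous_on_compose2[OF Dc]) (intro continuous_intros, simp)
    ultimately have "(LINT s|unit_interval. D (x + s *\<^sub>R e)) = \<eta> (x + 1 *\<^sub>R e) - \<eta> (x + 0 *\<^sub>R e)"
      by (rule FTC_unit_interval)
    then show "(LINT s|unit_interval. D (x + s *\<^sub>R e)) = 0" using p e by (simp add: periodic_def)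
  qed
  finally show ?thesis by (simp add: D_def)
qed

lemma has_weak_partial_linear_image:
  fixes f :: "real \<times> real \<Rightarrow> 'b::{banach, second_countable_topology}" and L :: "'b \<Rightarrow> 'c::{banach, second_countable_topology}"
  assumes L: "bounded_linear L" and f: "Lq 1 f" "Lq 1 u" and w: "has_weak_partial e f u"
  shows "has_weak_partial e (\<lambda>x. L (f x)) (\<lambda>x. L (u x))"
  unfolding has_weak_partial_def
proof (intro allI impI)
  fix \<eta> :: "real \<times> real \<Rightarrow> real" assume s: "smooth_on UNIV \<eta>" and p: "periodic \<eta>"
  note sp = smooth_periodic_derivative[OF s p]
  interpret L: bounded_linear L by fact
  have i: "integrable torus (\<lambda>x. frechet_derivative \<eta> (at x) e *\<^sub>R f x)" "integrable torus (\<lambda>x. \<eta> x *\<^sub>R u x)"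
    using f unfolding Lq_1 by (blast intro: integrable_continuous_periodic_mult[OF sp(2,3)],
      blast intro: integrable_continuous_periodic_mult[OF sp(1) p])
  have "(LINT x|torus. frechet_derivative \<eta> (at x) e *\<^sub>R L (f x)) = L (LINT x|torus. frechet_derivative \<eta> (at x) e *\<^sub>R f x)"
    using integral_bounded_linear[OF L i(1)] by (simp add: L.scaleR)
  also have "\<dots> = - L (LINT x|torus. \<eta> x *\<^sub>R u x)"
    using w s p unfolding has_weak_partial_def by (simp add: linear_neg[OF bounded_linear.linear[OF L]])
  also have "L (LINT x|torus. \<eta> x *\<^sub>R u x) = (LINT x|torus. \<eta> x *\<^sub>R L (u x))"
    using integral_bounded_linear[OF L i(2)] by (simp add: L.scaleR)
  finally show "(LINT x|torus. frechet_derivative \<eta> (at x) e *\<^sub>R L (f x)) = - (LINT x|torus. \<eta> x *\<^sub>R L (u x))" .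
qed

lemma Lq_1_linear_image:
  fixes f :: "real \<times> real \<Rightarrow> 'b::{banach, second_countable_topology}" and L :: "'b \<Rightarrow> 'c::{banach, second_countable_topology}"
  assumes L: "bounded_linear L" and f: "Lq 1 f" shows "Lq 1 (\<lambda>x. L (f x))"
proof -
  have "L \<in> borel_measurable borel"
    by (rule borel_measurable_continuous_onI) (rule linear_continuous_on[OF L])
  then have "(\<lambda>x. L (f x)) \<in> borel_measurable borel" using f by (intro measurable_compose[of f borel borel L]) (simp_all add: Lq_1)
  then show ?thesis using f periodic_comp[of f L] integrable_bounded_linear[OF L, of torus f] by (simp add: Lq_1)
qed

lemma weak_gradient_linear_image:
  fixes f :: "real \<times> real \<Rightarrow> 'b::{banach, second_countable_topology}" and L :: "'b \<Rightarrow> 'c::{banach, second_countable_topology}"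
  assumes L: "bounded_linear L" and g: "weak_gradient f u1 u2"
  shows "weak_gradient (\<lambda>x. L (f x)) (\<lambda>x. L (u1 x)) (\<lambda>x. L (u2 x))"
proof -
  interpret weak_gradient f u1 u2 by fact
  show ?thesis
    by (rule weak_gradient.intro[OF Lq_1_linear_image[OF L f] Lq_1_linear_image[OF L u1] Lq_1_linear_image[OF L u2]
        has_weak_partial_linear_image[OF L f u1 partial1] has_weak_partial_linear_image[OF L f u2 partial2]])
qed

lemma Lq_const [simp]: "Lq q (\<lambda>_. c)"
  by (simp add: Lq_def periodic_def)

lemma weak_gradient_minus_const:
  fixes f :: "real \<times> real \<Rightarrow> 'b::{banach, second_countable_topology}"
  assumes "weak_gradient f u1 u2" shows "weak_gradient (\<lambda>x. f x - c) u1 u2"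
proof -
  interpret weak_gradient f u1 u2 by fact
  have L: "Lq 1 (\<lambda>x. f x - c)" using f periodic_comp[of f "\<lambda>y. y - c"] by (simp add: Lq_1)
  have "has_weak_partial e (\<lambda>x. f x - c) u" if w: "has_weak_partial e f u" and e: "e \<in> Basis" for e u
    unfolding has_weak_partial_def
  proof (intro allI impI)
    fix \<eta> :: "real \<times> real \<Rightarrow> real" assume s: "smooth_on UNIV \<eta>" and p: "periodic \<eta>"
    note sp = smooth_periodic_derivative[OF s p]
    have i: "integrable torus (\<lambda>x. frechet_derivative \<eta> (at x) e *\<^sub>R f x)"
      "integrable torus (\<lambda>x. frechet_derivative \<eta> (at x) e *\<^sub>R c)"
      "integrable torus (\<lambda>x. frechet_derivative \<eta> (at x) e *\<^sub>R (1::real))"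
      using f by (intro integrable_continuous_periodic_mult[OF sp(2,3)]; simp add: Lq_1)+
    have "(LINT x|torus. frechet_derivative \<eta> (at x) e *\<^sub>R (f x - c)) =
       (LINT x|torus. frechet_derivative \<eta> (at x) e *\<^sub>R f x) - (LINT x|torus. frechet_derivative \<eta> (at x) e) *\<^sub>R c"
      using i by (simp add: scaleR_diff_right)
    then show "(LINT x|torus. frechet_derivative \<eta> (at x) e *\<^sub>R (f x - c)) = - (LINT x|torus. \<eta> x *\<^sub>R u x)"
      using integral_derivative_periodic[OF s p e] w s p by (simp add: has_weak_partial_def)
  qed
  then show ?thesis using L u1 u2 partial1 partial2 by (intro weak_gradient.intro) (simp_all add: Basis_prod_def)
qed

lemma weak_gradient_const:
  fixes c :: "'b::{banach, second_countable_topology}"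
  shows "weak_gradient (\<lambda>_. c) (\<lambda>_. 0) (\<lambda>_. 0)"
proof -
  have "weak_gradient (\<lambda>_. 0 :: 'b) (\<lambda>_. 0) (\<lambda>_. 0)" by (rule weak_gradient.intro) (simp_all add: has_weak_partial_def)
  from weak_gradient_minus_const[OF this, of "- c"] show ?thesis by simp
qed

lemma (in weak_gradient) integral_gradient_0: "(LINT x|torus. u1 x) = 0" "(LINT x|torus. u2 x) = 0"
proof -
  have s: "smooth_on UNIV (\<lambda>_ :: real \<times> real. 1 :: real)" "periodic (\<lambda>_ :: real \<times> real. 1 :: real)"
    by (rule trigexp_smooth trigexp_periodic, rule trigexp.const)+
  have "frechet_derivative (\<lambda>_. 1 :: real) (at x) e = 0" for x e :: "real \<times> real" by (simp add: frechet_derivative_const)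
  then show "(LINT x|torus. u1 x) = 0" "(LINT x|torus. u2 x) = 0"
    using partial1[unfolded has_weak_partial_def, rule_format, OF s] partial2[unfolded has_weak_partial_def, rule_format, OF s]
    by simp_all
qed

lemma (in weak_gradient) wpartial_AE:
  "AE x in torus. wpartial (1, 0) f x = u1 x" "AE x in torus. wpartial (0, 1) f x = u2 x"
  by (rule wpartial(3)[OF u1 partial1], rule wpartial(3)[OF u2 partial2])

lemma (in weak_gradient) W1I: "Lq q f \<Longrightarrow> Lq q u1 \<Longrightarrow> Lq q u2 \<Longrightarrow> W1 q f"
  using partial1 partial2 by (auto simp: W1_def Basis_prod_def)

lemma W1_weak_gradient:
  assumes "W1 q f" "1 \<le> q" shows "weak_gradient f (wpartial (1, 0) f) (wpartial (0, 1) f)"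
proof -
  have b: "(1, 0) \<in> (Basis :: (real \<times> real) set)" "(0, 1) \<in> (Basis :: (real \<times> real) set)" by (simp_all add: Basis_prod_def)
  have "Lq 1 g" if "Lq q g" for g :: "real \<times> real \<Rightarrow> 'a" using assms(2) by (intro Lq_mono[OF that]) simp_all
  then show ?thesis
    using W1_wpartial[OF assms b(1)] W1_wpartial[OF assms b(2)] assms(1)
    by (intro weak_gradient.intro) (simp_all add: W1_def)
qed

text \<open>
  The \<open>q\<close>-th power of the Sobolev norm, for arbitrary representatives of the weak derivatives.
\<close>

definition grad_energy :: "real \<Rightarrow> (real \<times> real \<Rightarrow> 'b::{banach, second_countable_topology}) \<Rightarrow> (real \<times> real \<Rightarrow> 'b) \<Rightarrow> (real \<times> real \<Rightarrow> 'b) \<Rightarrow> real" where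
  "grad_energy q f u1 u2 = (LINT x|torus. norm (f x) powr q + (norm (u1 x) powr q + norm (u2 x) powr q))"

lemma sum_Basis_plane:
  fixes g :: "real \<times> real \<Rightarrow> 'b::comm_monoid_add"
  shows "(\<Sum>e\<in>Basis. g e) = g (1, 0) + g (0, 1)"
proof -
  have B: "(Basis :: (real \<times> real) set) = {(1, 0), (0, 1)}" by (auto simp: Basis_prod_def)
  have "sum g {(1, 0), (0, 1)} = g (1, 0) + g (0, 1)" by (subst sum.insert) auto
  then show ?thesis by (simp only: B)
qed

lemma (in weak_gradient) W1_norm_eq: "W1_norm q f = grad_energy q f u1 u2 powr (1 / q)"
proof -
  have [measurable]: "wpartial (1, 0) f \<in> borel_measurable torus" "wpartial (0, 1) f \<in> borel_measurable torus"
    "f \<in> borel_measurable torus" "u1 \<in> borel_measurable torus" "u2 \<in> borel_measurable torus"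
    using wpartial(1)[OF u1 partial1] wpartial(1)[OF u2 partial2] by (auto simp: Lq_1 intro: measurable_torus)
  have "(LINT x|torus. norm (f x) powr q + (\<Sum>e\<in>Basis. norm (wpartial e f x) powr q)) = grad_energy q f u1 u2"
    unfolding grad_energy_def sum_Basis_plane
  proof (rule integral_cong_AE)
    show "AE x in torus. norm (f x) powr q + (norm (wpartial (1, 0) f x) powr q + norm (wpartial (0, 1) f x) powr q) =
      norm (f x) powr q + (norm (u1 x) powr q + norm (u2 x) powr q)"
      using wpartial_AE by eventually_elim simp
  qed measurable
  then show ?thesis by (simp add: W1_norm_def)
qed

lemma grad_energy_nonneg: "0 \<le> grad_energy q f u1 u2"
  unfolding grad_energy_def by (rule Bochner_Integration.integral_nonneg) simp

lemma abs_integral_le: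
  fixes g h :: "'a \<Rightarrow> real"
  assumes h: "integrable M h" and le: "AE x in M. \<bar>g x\<bar> \<le> h x"
  shows "\<bar>LINT x|M. g x\<bar> \<le> (LINT x|M. h x)"
proof (cases "integrable M g")
  case True
  have "\<bar>LINT x|M. g x\<bar> \<le> (LINT x|M. \<bar>g x\<bar>)" by (rule integral_abs_bound)
  also have "\<dots> \<le> (LINT x|M. h x)" using True h le by (intro integral_mono_AE) simp_all
  finally show ?thesis .
next
  case False
  have "AE x in M. 0 \<le> h x" using le by eventually_elim simp
  then show ?thesis using False by (simp add: not_integrable_integral_eq integral_nonneg_AE)
qed

lemma young_simple:
  fixes s t p :: real
  assumes "0 \<le> s" "0 \<le> t" "1 < p" shows "s * t \<le> s powr p + t powr (p / (p - 1))"
proof -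
  have "s * t \<le> s powr p / p + t powr (p / (p - 1)) / (p / (p - 1))"
    using assms by (intro Youngs_inequality) (auto simp: field_simps)
  also have "s powr p / p \<le> s powr p" using assms mult_left_mono[of 1 p "s powr p"] by (simp add: divide_le_eq)
  also have "t powr (p / (p - 1)) / (p / (p - 1)) \<le> t powr (p / (p - 1))"
  proof -
    have "1 \<le> p / (p - 1)" using assms by simp
    then show ?thesis using mult_left_mono[of 1 "p / (p - 1)" "t powr (p / (p - 1))"] by (simp only: pos_divide_le_eq) simp
  qed
  finally show ?thesis by simp
qed

lemma Lq_AE_bounded:
  fixes f :: "real \<times> real \<Rightarrow> 'b::{banach, second_countable_topology}"
  assumes m: "f \<in> borel_measurable borel" and per: "periodic f" and b: "AE x in torus. norm (f x) \<le> K" and q: "0 \<le> q"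
  shows "Lq q f"
proof -
  have mt[measurable]: "f \<in> borel_measurable torus" by (rule measurable_torus[OF m])
  have "integrable torus (\<lambda>x. norm (f x) powr q)"
  proof (rule torus.integrable_const_bound[where B="\<bar>K\<bar> powr q"])
    show "AE x in torus. norm (norm (f x) powr q) \<le> \<bar>K\<bar> powr q"
      using b by eventually_elim (use q in \<open>simp add: powr_mono2\<close>)
  qed measurable
  then show ?thesis using m per by (simp add: Lq_def)
qed

lemma powr_add_le_double:
  fixes s t q :: real
  assumes "0 \<le> s" "0 \<le> t" "0 \<le> q" shows "(s + t) powr q \<le> 2 powr q * (s powr q + t powr q)"
proof -
  have "(s + t) powr q \<le> (2 * max s t) powr q" using assms by (intro powr_mono2) auto
  also have "\<dots> = 2 powr q * max s t powr q" using assms by (simp add: powr_mult)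
  also have "\<dots> \<le> 2 powr q * (s powr q + t powr q)" by (intro mult_left_mono) (auto simp: max_def)
  finally show ?thesis .
qed

lemma Lq_add:
  fixes f g :: "real \<times> real \<Rightarrow> 'b::{banach, second_countable_topology}"
  assumes f: "Lq q f" and g: "Lq q g" and q: "0 \<le> q" shows "Lq q (\<lambda>x. f x + g x)"
proof -
  have m[measurable]: "f \<in> borel_measurable borel" "g \<in> borel_measurable borel" using f g by (simp_all add: Lq_def)
  have "integrable torus (\<lambda>x. norm (f x + g x) powr q)"
  proof (rule Bochner_Integration.integrable_bound)
    show "integrable torus (\<lambda>x. 2 powr q * (norm (f x) powr q + norm (g x) powr q))" using f g by (simp add: Lq_def)
    show "(\<lambda>x. norm (f x + g x) powr q) \<in> borel_measurable torus" by (rule measurable_torus) measurable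
    show "AE x in torus. norm (norm (f x + g x) powr q) \<le> norm (2 powr q * (norm (f x) powr q + norm (g x) powr q))"
    proof (rule AE_I2)
      fix x
      have "norm (f x + g x) powr q \<le> (norm (f x) + norm (g x)) powr q" using q by (intro powr_mono2 norm_triangle_ineq) simp_all
      also have "\<dots> \<le> 2 powr q * (norm (f x) powr q + norm (g x) powr q)" using q by (intro powr_add_le_double) simp_all
      finally show "norm (norm (f x + g x) powr q) \<le> norm (2 powr q * (norm (f x) powr q + norm (g x) powr q))" by simp
    qed
  qed
  then show ?thesis using m periodic_comp2[of f g "(+)"] f g by (simp add: Lq_def)
qed

lemma Lq_linear_image:
  fixes f :: "real \<times> real \<Rightarrow> 'b::{banach, second_countable_topology}" and L :: "'b \<Rightarrow> 'c::{banach, second_countable_topology}"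
  assumes L: "bounded_linear L" and f: "Lq q f" and q: "1 \<le> q" shows "Lq q (\<lambda>x. L (f x))"
proof -
  have f1: "Lq 1 f" using q by (intro Lq_mono[OF f]) simp_all
  have L1: "Lq 1 (\<lambda>x. L (f x))" by (rule Lq_1_linear_image[OF L f1])
  then have m: "(\<lambda>x. L (f x)) \<in> borel_measurable borel" "periodic (\<lambda>x. L (f x))" by (simp_all add: Lq_1)
  have [measurable]: "(\<lambda>x. L (f x)) \<in> borel_measurable torus" by (rule measurable_torus[OF m(1)])
  obtain K where K: "K > 0" "\<And>x. norm (L x) \<le> norm x * K" using bounded_linear.pos_bounded[OF L] by blast
  have "integrable torus (\<lambda>x. norm (L (f x)) powr q)"
  proof (rule Bochner_Integration.integrable_bound)
    show "integrable torus (\<lambda>x. K powr q * norm (f x) powr q)" using f by (simp add: Lq_def)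
    show "AE x in torus. norm (norm (L (f x)) powr q) \<le> norm (K powr q * norm (f x) powr q)"
    proof (rule AE_I2)
      fix x
      have "norm (L (f x)) powr q \<le> (norm (f x) * K) powr q" using K q by (intro powr_mono2) simp_all
      also have "\<dots> = K powr q * norm (f x) powr q" using K by (simp add: powr_mult)
      finally show "norm (norm (L (f x)) powr q) \<le> norm (K powr q * norm (f x) powr q)" by simp
    qed
  qed measurable
  then show ?thesis using m by (simp add: Lq_def)
qed

text \<open>
  Morrey's inequality controls the oscillation of \<open>a\<close>, and the \<open>L\<^sup>p\<close> norm its mean.  Young's inequalities at the
  scale \<open>\<delta>\<close> stand in for those of Hoelder.
\<close>

lemma sobolev_sup_bound:
  fixes a :: "real \<times> real \<Rightarrow> 'b::{banach, second_countable_topology}"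
  assumes p: "2 < p" and a: "W1 p a" and n: "W1_norm p a < \<delta>"
  shows "AE x in torus. norm (a x) \<le> (1 + 2 / (1 - 2 / p)) * \<delta>"
    and "(LINT x|torus. (norm (wpartial (1, 0) a x))\<^sup>2 + (norm (wpartial (0, 1) a x))\<^sup>2) \<le> 3 * \<delta>\<^sup>2"
proof -
  let ?A1 = "wpartial (1, 0) a" and ?A2 = "wpartial (0, 1) a"
  interpret weak_gradient a ?A1 ?A2 using p by (intro W1_weak_gradient[OF a]) simp
  have b: "(1, 0) \<in> (Basis :: (real \<times> real) set)" "(0, 1) \<in> (Basis :: (real \<times> real) set)" by (simp_all add: Basis_prod_def)
  have "1 \<le> p" using p by simp
  then have L: "Lq p a" "Lq p ?A1" "Lq p ?A2" using a W1_wpartial(1)[OF a _ b(1)] W1_wpartial(1)[OF a _ b(2)] by (simp_all add: W1_def)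
  then have i: "integrable torus (\<lambda>x. norm (a x) powr p)" "integrable torus (\<lambda>x. norm (?A1 x) powr p)" "integrable torus (\<lambda>x. norm (?A2 x) powr p)"
    by (simp_all add: Lq_def)
  have nn: "0 \<le> W1_norm p a" by (simp add: W1_norm_def)
  then have \<delta>: "\<delta> > 0" using n by linarith
  have "grad_energy p a ?A1 ?A2 = W1_norm p a powr p"
    using p grad_energy_nonneg[of p a ?A1 ?A2] by (simp add: W1_norm_eq powr_powr)
  also have "\<dots> \<le> \<delta> powr p" using n nn p by (intro powr_mono2) simp_all
  finally have en: "grad_energy p a ?A1 ?A2 \<le> \<delta> powr p" .
  have es: "grad_energy p a ?A1 ?A2 = (LINT x|torus. norm (a x) powr p) + ((LINT x|torus. norm (?A1 x) powr p) + (LINT x|torus. norm (?A2 x) powr p))"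
    using i by (simp add: grad_energy_def)
  have pos: "0 \<le> (LINT x|torus. norm (a x) powr p)" "0 \<le> (LINT x|torus. norm (?A1 x) powr p)" "0 \<le> (LINT x|torus. norm (?A2 x) powr p)"
    by (rule Bochner_Integration.integral_nonneg, simp)+
  have ens: "(LINT x|torus. norm (a x) powr p) \<le> \<delta> powr p"
    "(LINT x|torus. norm (?A1 x) powr p) + (LINT x|torus. norm (?A2 x) powr p) \<le> \<delta> powr p"
    using en es pos by linarith+
  have mor: "AE x in torus. norm (a x - avg) \<le> (2 * \<delta>) / (1 - 2 / p)"
  proof (rule morrey[OF p])
    show "0 < 2 * \<delta>" using \<delta> by simp
    have "(\<integral>\<^sup>+x. ennreal (slope x powr p) \<partial>torus) \<le> (\<integral>\<^sup>+x. ennreal (2 powr p * (norm (?A1 x) powr p + norm (?A2 x) powr p)) \<partial>torus)"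
      unfolding slope_def using p by (intro nn_integral_mono ennreal_leI powr_add_le_double) simp_all
    also have "\<dots> = ennreal (LINT x|torus. 2 powr p * (norm (?A1 x) powr p + norm (?A2 x) powr p))"
      using i by (intro nn_integral_eq_integral) simp_all
    also have "\<dots> \<le> ennreal ((2 * \<delta>) powr p)"
    proof (rule ennreal_leI)
      have "(LINT x|torus. 2 powr p * (norm (?A1 x) powr p + norm (?A2 x) powr p)) =
          2 powr p * ((LINT x|torus. norm (?A1 x) powr p) + (LINT x|torus. norm (?A2 x) powr p))" using i by simp
      also have "\<dots> \<le> 2 powr p * \<delta> powr p" using ens by (intro mult_left_mono) simp_all
      finally show "(LINT x|torus. 2 powr p * (norm (?A1 x) powr p + norm (?A2 x) powr p)) \<le> (2 * \<delta>) powr p"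
        using \<delta> by (simp add: powr_mult)
    qed
    finally show "(\<integral>\<^sup>+x. ennreal (slope x powr p) \<partial>torus) \<le> ennreal ((2 * \<delta>) powr p)" .
  qed
  have na: "norm avg \<le> \<delta>"
  proof -
    have "norm avg \<le> (LINT x|torus. norm (a x))" unfolding avg_def by (rule integral_norm_bound)
    also have "\<dots> \<le> (LINT x|torus. (1 / p) * \<delta> powr (1 - p) * norm (a x) powr p + (1 - 1 / p) * \<delta>)"
      using f i(1) p \<delta> by (intro integral_mono young_scaled) (simp_all add: Lq_1)
    also have "\<dots> = (1 / p) * \<delta> powr (1 - p) * (LINT x|torus. norm (a x) powr p) + (1 - 1 / p) * \<delta>"
      using i(1) by simp
    also have "\<dots> \<le> (1 / p) * \<delta> powr (1 - p) * \<delta> powr p + (1 - 1 / p) * \<delta>"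
      using ens p by (intro add_right_mono mult_left_mono) simp_all
    also have "\<dots> = (1 / p) * (\<delta> powr (1 - p) * \<delta> powr p) + (1 - 1 / p) * \<delta>" by simp
    also have "\<delta> powr (1 - p) * \<delta> powr p = \<delta>" using \<delta> by (simp add: powr_add[symmetric])
    also have "(1 / p) * \<delta> + (1 - 1 / p) * \<delta> = \<delta>" using p by (simp add: field_simps)
    finally show ?thesis .
  qed
  from mor show "AE x in torus. norm (a x) \<le> (1 + 2 / (1 - 2 / p)) * \<delta>"
  proof eventually_elim
    case (elim x)
    have "norm (a x) \<le> norm (a x - avg) + norm avg" using norm_triangle_ineq[of "a x - avg" avg] by simp
    then show ?case using elim na by (simp add: distrib_right)
  qed
  have sq: "t\<^sup>2 \<le> \<delta>\<^sup>2 + \<delta> powr (2 - p) * t powr p" if "0 \<le> t" for t :: real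
  proof -
    have "(t / \<delta>) powr 2 \<le> 1 + (t / \<delta>) powr p" using that \<delta> p by (intro powr_le_1_plus) simp_all
    then have "\<delta>\<^sup>2 * (t / \<delta>)\<^sup>2 \<le> \<delta>\<^sup>2 * (1 + (t / \<delta>) powr p)" using that \<delta> by (intro mult_left_mono) (simp_all add: powr_numeral)
    moreover have "\<delta>\<^sup>2 * (t / \<delta>)\<^sup>2 = t\<^sup>2" using \<delta> by (simp add: power_divide)
    moreover have "\<delta>\<^sup>2 * (t / \<delta>) powr p = \<delta> powr (2 - p) * t powr p"
      using \<delta> that by (simp add: powr_divide powr_diff powr_numeral)
    ultimately show ?thesis by (simp add: distrib_left)
  qed
  have "(LINT x|torus. (norm (?A1 x))\<^sup>2 + (norm (?A2 x))\<^sup>2) \<le>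
     (LINT x|torus. 2 * \<delta>\<^sup>2 + \<delta> powr (2 - p) * (norm (?A1 x) powr p + norm (?A2 x) powr p))"
  proof (rule integral_mono)
    have "Lq 2 ?A1" "Lq 2 ?A2" using p by (intro Lq_mono[OF L(2)] Lq_mono[OF L(3)]; simp)+
    then show "integrable torus (\<lambda>x. (norm (?A1 x))\<^sup>2 + (norm (?A2 x))\<^sup>2)" by (simp add: Lq2_iff)
    show "integrable torus (\<lambda>x. 2 * \<delta>\<^sup>2 + \<delta> powr (2 - p) * (norm (?A1 x) powr p + norm (?A2 x) powr p))" using i by simp
    show "(norm (?A1 x))\<^sup>2 + (norm (?A2 x))\<^sup>2 \<le> 2 * \<delta>\<^sup>2 + \<delta> powr (2 - p) * (norm (?A1 x) powr p + norm (?A2 x) powr p)" for x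
      using sq[of "norm (?A1 x)"] sq[of "norm (?A2 x)"] by (simp add: distrib_left)
  qed
  also have "\<dots> = 2 * \<delta>\<^sup>2 + \<delta> powr (2 - p) * ((LINT x|torus. norm (?A1 x) powr p) + (LINT x|torus. norm (?A2 x) powr p))"
    using i by simp
  also have "\<dots> \<le> 2 * \<delta>\<^sup>2 + \<delta> powr (2 - p) * \<delta> powr p"
    using ens by (intro add_left_mono mult_left_mono) simp_all
  also have "\<delta> powr (2 - p) * \<delta> powr p = \<delta>\<^sup>2" using \<delta> by (simp add: powr_add[symmetric] powr_numeral)
  finally show "(LINT x|torus. (norm (?A1 x))\<^sup>2 + (norm (?A2 x))\<^sup>2) \<le> 3 * \<delta>\<^sup>2" by simp
qed

section \<open>The gradient map as a functional\<close>

lemma integral_inner_const: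
  fixes g :: "'a \<Rightarrow> 'b::{real_inner, banach, second_countable_topology}"
  assumes "integrable M g"
  shows "(LINT x|M. v \<bullet> g x) = v \<bullet> (LINT x|M. g x)" "integrable M (\<lambda>x. v \<bullet> g x)"
  by (rule integral_bounded_linear[OF bounded_linear_inner_right assms],
      rule integrable_bounded_linear[OF bounded_linear_inner_right assms])

text \<open>The bracket of 1-forms \<open>[u \<and> v]\<close> at one point.\<close>

definition wedge :: "('e \<Rightarrow> 'e \<Rightarrow> 'e::ab_group_add) \<Rightarrow> 'e \<times> 'e \<Rightarrow> 'e \<times> 'e \<Rightarrow> 'e" where
  "wedge br u v = br (fst u) (snd v) - br (snd u) (fst v)"

lemma norm_fst_snd: "norm (fst u) \<le> norm u" "norm (snd u) \<le> norm u"
  using norm_fst_le[of "fst u" "snd u"] norm_snd_le[of "snd u" "fst u"] by simp_all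

lemma bounded_bilinear_wedge:
  fixes br :: "'e::real_normed_vector \<Rightarrow> 'e \<Rightarrow> 'e"
  assumes "bounded_bilinear br" shows "bounded_bilinear (wedge br)"
proof -
  interpret br: bounded_bilinear br by fact
  obtain K where K: "K > 0" "\<And>a b. norm (br a b) \<le> norm a * norm b * K" using br.pos_bounded by blast
  show ?thesis
  proof (rule bounded_bilinear.intro)
    have "norm (wedge br u v) \<le> norm u * norm v * (2 * K)" for u v
    proof -
      have "norm (br (fst u) (snd v)) \<le> norm u * norm v * K" "norm (br (snd u) (fst v)) \<le> norm u * norm v * K"
        using K(1) by (auto intro!: order_trans[OF K(2)] mult_right_mono mult_mono norm_fst_snd)
      moreover have "norm (wedge br u v) \<le> norm (br (fst u) (snd v)) + norm (br (snd u) (fst v))"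
        unfolding wedge_def by (rule norm_triangle_ineq4)
      ultimately show ?thesis by simp
    qed
    then show "\<exists>K. \<forall>u v. norm (wedge br u v) \<le> norm u * norm v * K" by blast
  qed (simp_all add: wedge_def br.add_left br.add_right br.scaleR_left br.scaleR_right scaleR_diff_right)
qed

text \<open>
  The bound \<open>\<sigma>\<close> is the small parameter.  Taking \<open>k \<ge> 1\<close> allows all powers of \<open>k\<close> to be absorbed into \<open>k\<^sup>2\<close>.
\<close>

locale gauge_field =
  fixes br :: "'e::{real_inner, banach, heine_borel, second_countable_topology} \<Rightarrow> 'e \<Rightarrow> 'e"
    and a :: "'e form1" and p \<sigma> k :: real
  assumes br_bilinear: "bounded_bilinear br" and br_anti: "\<And>x y. br x y = - br y x"
    and p: "2 < p" and a: "W1 p a" and a_bound: "AE x in torus. norm (a x) \<le> \<sigma>"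
    and k: "1 \<le> k" "\<And>u v. norm (wedge br u v) \<le> k * norm u * norm v"
begin

abbreviation \<beta> :: "'e \<times> 'e \<Rightarrow> 'e \<times> 'e \<Rightarrow> 'e" where "\<beta> \<equiv> wedge br"
abbreviation A1 where "A1 \<equiv> wpartial (1, 0) a"
abbreviation A2 where "A2 \<equiv> wpartial (0, 1) a"

sublocale \<beta>: bounded_bilinear \<beta> by (rule bounded_bilinear_wedge[OF br_bilinear])
sublocale A: weak_gradient a A1 A2 using p by (intro W1_weak_gradient[OF a]) simp

lemma \<beta>_sym: "\<beta> u v = \<beta> v u"
  using br_anti[of "fst u" "snd v"] br_anti[of "snd u" "fst v"] by (simp add: wedge_def)

text \<open>
  Here \<open>X = da\<close> and \<open>Y = d\<^sup>*a\<close>, \<open>F\<close> is the curvature, \<open>q\<close> the dual exponent, \<open>c\<close> the mean and \<open>w\<close> the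
  oscillation of \<open>a\<close>, \<open>F0\<close> the curvature of the constant field \<open>c\<close>, and \<open>N\<close> the norm of the gradient.
\<close>

definition X where "X x = snd (A1 x) - fst (A2 x)"
definition Y where "Y x = - (fst (A1 x) + snd (A2 x))"
definition F where "F x = X x + (1/2) *\<^sub>R \<beta> (a x) (a x)"
definition q where "q = p / (p - 1)"
definition c where "c = A.avg"
definition w where "w x = a x - c"
definition F0 where "F0 = (1/2) *\<^sub>R \<beta> c c"
definition energy where "energy = (LINT x|torus. (norm (A1 x))\<^sup>2 + (norm (A2 x))\<^sup>2)"
definition N where "N = W_minus1_norm p (M_gf br a)"

lemma q: "1 < q" "q < 2" using p by (simp_all add: q_def field_simps)

lemma curvature_eq: "curvature br a = F" and codiff_eq: "codiff a = Y"
  by (simp_all add: fun_eq_iff F_def X_def Y_def curvature_def ext_d_def codiff_def bracket_wedge_def wedge_def)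

lemma Lq_p: "Lq p a" "Lq p A1" "Lq p A2"
proof -
  have b: "(1, 0) \<in> (Basis :: (real \<times> real) set)" "(0, 1) \<in> (Basis :: (real \<times> real) set)" by (simp_all add: Basis_prod_def)
  have "1 \<le> p" using p by simp
  then show "Lq p a" "Lq p A1" "Lq p A2" using a W1_wpartial(1)[OF a _ b(1)] W1_wpartial(1)[OF a _ b(2)] by (simp_all add: W1_def)
qed

lemma minus_components_linear: "bounded_linear (\<lambda>x. - fst x :: 'e)" "bounded_linear (\<lambda>x. - snd x :: 'e)"
  by (intro bounded_linear_minus bounded_linear_fst bounded_linear_snd)+

lemma Lq_p_XY: "Lq p X" "Lq p Y"
proof -
  have p1: "1 \<le> p" "0 \<le> p" using p by simp_all
  have "Lq p (\<lambda>x. snd (A1 x) + - fst (A2 x))"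
    by (rule Lq_add[OF Lq_linear_image[OF bounded_linear_snd Lq_p(2) p1(1)] Lq_linear_image[OF minus_components_linear(1) Lq_p(3) p1(1)] p1(2)])
  then show "Lq p X" by (simp add: X_def[abs_def])
  have "Lq p (\<lambda>x. - fst (A1 x) + - snd (A2 x))"
    by (rule Lq_add[OF Lq_linear_image[OF minus_components_linear(1) Lq_p(2) p1(1)] Lq_linear_image[OF minus_components_linear(2) Lq_p(3) p1(1)] p1(2)])
  then show "Lq p Y" by (simp add: Y_def[abs_def])
qed

lemma \<beta>_measurable:
  assumes "u \<in> borel_measurable M" "v \<in> borel_measurable M"
  shows "(\<lambda>x. \<beta> (u x) (v x)) \<in> borel_measurable M"
  by (rule borel_measurable_continuous_Pair[OF assms]) (intro \<beta>.continuous_on continuous_intros)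

lemma Lq_\<beta>:
  assumes u: "u \<in> borel_measurable borel" "periodic u" and ub: "AE x in torus. norm (u x) \<le> s"
    and v: "v \<in> borel_measurable borel" "periodic v" and vb: "AE x in torus. norm (v x) \<le> t"
    and r: "0 \<le> r"
  shows "Lq r (\<lambda>x. \<beta> (u x) (v x))"
proof (rule Lq_AE_bounded[OF \<beta>_measurable[OF u(1) v(1)] periodic_comp2[OF u(2) v(2)] _ r])
  show "AE x in torus. norm (\<beta> (u x) (v x)) \<le> k * \<bar>s\<bar> * \<bar>t\<bar>"
    using ub vb
  proof eventually_elim
    case (elim x)
    have "norm (\<beta> (u x) (v x)) \<le> k * norm (u x) * norm (v x)" by (rule k(2))
    also have "\<dots> \<le> k * \<bar>s\<bar> * \<bar>t\<bar>" using elim k(1) by (intro mult_mono) simp_all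
    finally show ?case .
  qed
qed

lemma a_meas: "a \<in> borel_measurable borel" "periodic a" using A.f by (simp_all add: Lq_1)

lemma \<sigma>_nonneg: "0 \<le> \<sigma>"
proof (rule ccontr)
  assume "\<not> 0 \<le> \<sigma>"
  then have "AE x in torus. False" using a_bound by (auto elim: eventually_mono dest: order_trans[OF norm_ge_zero])
  then have "(LINT x|torus. (1::real)) = (LINT x|torus. 0)" by (intro integral_cong_AE) (auto elim: eventually_mono)
  then show False by simp
qed

lemma c_bound: "norm c \<le> \<sigma>"
proof -
  have ai: "integrable torus a" using A.f by (simp add: Lq_1)
  have "norm c \<le> (LINT x|torus. norm (a x))" unfolding c_def A.avg_def by (rule integral_norm_bound)
  also have "\<dots> \<le> (LINT x|torus. \<sigma>)" using ai a_bound by (intro integral_mono_AE) simp_all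
  finally show ?thesis by simp
qed

lemma w_bound: "AE x in torus. norm (w x) \<le> 2 * \<sigma>"
  using a_bound
proof eventually_elim
  case (elim x)
  then show ?case using norm_triangle_ineq4[of "a x" c] c_bound by (simp add: w_def)
qed

lemma w_gradient: "weak_gradient w A1 A2"
  unfolding w_def by (rule weak_gradient_minus_const[OF A.weak_gradient_axioms])

lemma w_meas: "w \<in> borel_measurable borel" "periodic w"
  using weak_gradient.f[OF w_gradient] by (simp_all add: Lq_1)

lemma w_int: "integrable torus w" "(LINT x|torus. w x) = 0"
proof -
  have ai: "integrable torus a" using A.f by (simp add: Lq_1)
  then show "integrable torus w" by (simp add: w_def[abs_def])
  show "(LINT x|torus. w x) = 0" using ai by (simp add: w_def c_def A.avg_def)
qed

lemma Lq_p_F: "Lq p F"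
proof -
  have p0: "0 \<le> p" "1 \<le> p" using p by simp_all
  have "Lq p (\<lambda>x. \<beta> (a x) (a x))" by (rule Lq_\<beta>[OF a_meas a_bound a_meas a_bound p0(1)])
  from Lq_add[OF Lq_p_XY(1) Lq_linear_image[OF bounded_linear_scaleR_right[of "1/2"] this p0(2)] p0(1)]
  show ?thesis by (simp add: F_def[abs_def])
qed

lemma Lq_2: "Lq 2 F" "Lq 2 X" "Lq 2 Y" "Lq 2 A1" "Lq 2 A2" "Lq 2 w"
proof -
  have p0: "0 \<le> (2::real)" "2 \<le> p" using p by simp_all
  show "Lq 2 F" "Lq 2 X" "Lq 2 Y" "Lq 2 A1" "Lq 2 A2"
    by (rule Lq_mono[OF Lq_p_F p0] Lq_mono[OF Lq_p_XY(1) p0] Lq_mono[OF Lq_p_XY(2) p0] Lq_mono[OF Lq_p(2) p0] Lq_mono[OF Lq_p(3) p0])+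
  show "Lq 2 w" by (rule Lq_AE_bounded[OF w_meas w_bound]) simp
qed

text \<open>
  The gradient evaluated at \<open>b\<close>, for arbitrary representatives of the weak derivatives of \<open>b\<close>.
\<close>

definition pairing where "pairing b B1 B2 =
  (LINT x|torus. F x \<bullet> (snd (B1 x) - fst (B2 x) + \<beta> (a x) (b x))) + (LINT x|torus. Y x \<bullet> - (fst (B1 x) + snd (B2 x)))"

lemma fst_snd_borel [measurable]:
  "(fst :: 'e \<times> 'e \<Rightarrow> 'e) \<in> borel_measurable borel" "(snd :: 'e \<times> 'e \<Rightarrow> 'e) \<in> borel_measurable borel"
  by (simp_all add: borel_measurable_continuous_onI continuous_on_fst continuous_on_snd)

lemma M_eq_pairing:
  assumes g: "weak_gradient b B1 B2" shows "M_gf br a b = pairing b B1 B2"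
proof -
  interpret B: weak_gradient b B1 B2 by fact
  let ?W1 = "wpartial (1, 0) b" and ?W2 = "wpartial (0, 1) b"
  have m[measurable]: "?W1 \<in> borel_measurable torus" "?W2 \<in> borel_measurable torus" "B1 \<in> borel_measurable torus" "B2 \<in> borel_measurable torus"
    "b \<in> borel_measurable torus" "F \<in> borel_measurable torus" "Y \<in> borel_measurable torus" "a \<in> borel_measurable torus"
    using wpartial(1)[OF B.u1 B.partial1] wpartial(1)[OF B.u2 B.partial2] B.u1 B.u2 B.f A.f Lq_2(1,3)
    by (simp_all add: Lq_1 Lq2_iff measurable_torus)
  have [measurable]: "(\<lambda>x. \<beta> (a x) (b x)) \<in> borel_measurable torus" by (rule \<beta>_measurable) measurable
  have [measurable]: "(\<lambda>x. fst (h x)) \<in> borel_measurable torus" "(\<lambda>x. snd (h x)) \<in> borel_measurable torus"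
    if "h \<in> borel_measurable torus" for h :: "real \<times> real \<Rightarrow> 'e \<times> 'e"
    by (rule measurable_compose[OF that fst_snd_borel(1)] measurable_compose[OF that fst_snd_borel(2)])+
  have "(LINT x|torus. F x \<bullet> cov_d br a b x) = (LINT x|torus. F x \<bullet> (snd (B1 x) - fst (B2 x) + \<beta> (a x) (b x)))"
    unfolding cov_d_def ext_d_def bracket_wedge_def wedge_def[symmetric]
  proof (rule integral_cong_AE)
    show "AE x in torus. F x \<bullet> (snd (?W1 x) - fst (?W2 x) + \<beta> (a x) (b x)) = F x \<bullet> (snd (B1 x) - fst (B2 x) + \<beta> (a x) (b x))"
      using B.wpartial_AE by eventually_elim simp
  qed measurable
  moreover have "(LINT x|torus. Y x \<bullet> codiff b x) = (LINT x|torus. Y x \<bullet> - (fst (B1 x) + snd (B2 x)))"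
    unfolding codiff_def
  proof (rule integral_cong_AE)
    show "AE x in torus. Y x \<bullet> - (fst (?W1 x) + snd (?W2 x)) = Y x \<bullet> - (fst (B1 x) + snd (B2 x))"
      using B.wpartial_AE by eventually_elim simp
  qed measurable
  ultimately show ?thesis
    by (simp add: M_gf_def cov_d_adj_def weak_d0_def curvature_eq codiff_eq pairing_def)
qed

text \<open>
  Only finiteness matters, so Young's inequality is applied to each product without optimising constants.
\<close>

lemma pairing_bound:
  assumes L: "Lq q b" "Lq q B1" "Lq q B2" and e: "grad_energy q b B1 B2 \<le> 1"
  shows "\<bar>pairing b B1 B2\<bar> \<le> (2 + k * \<sigma>) * ((LINT x|torus. norm (F x) powr p) + 1) + 2 * ((LINT x|torus. norm (Y x) powr p) + 1)"
proof -
  have i: "integrable torus (\<lambda>x. norm (b x) powr q)" "integrable torus (\<lambda>x. norm (B1 x) powr q)" "integrable torus (\<lambda>x. norm (B2 x) powr q)"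
    "integrable torus (\<lambda>x. norm (F x) powr p)" "integrable torus (\<lambda>x. norm (Y x) powr p)"
    using L Lq_p_F Lq_p_XY by (simp_all add: Lq_def)
  define en where "en x = norm (b x) powr q + (norm (B1 x) powr q + norm (B2 x) powr q)" for x
  have ei: "integrable torus en" using i unfolding en_def by simp
  have le: "(LINT x|torus. en x) \<le> 1" using e by (simp add: grad_energy_def en_def)
  have ege: "norm (b x) powr q \<le> en x" "norm (B1 x) powr q \<le> en x" "norm (B2 x) powr q \<le> en x"
    "norm (B1 x) powr q + norm (B2 x) powr q \<le> en x" for x
    by (simp_all add: en_def)
  have ks: "0 \<le> k * \<sigma>" using k(1) \<sigma>_nonneg by simp
  have Y: "s * t \<le> s powr p + t powr q" if "0 \<le> s" "0 \<le> t" for s t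
    unfolding q_def using young_simple[OF that] p by simp
  have "\<bar>LINT x|torus. F x \<bullet> (snd (B1 x) - fst (B2 x) + \<beta> (a x) (b x))\<bar> \<le> (LINT x|torus. (2 + k * \<sigma>) * (norm (F x) powr p + en x))"
  proof (rule abs_integral_le)
    show "integrable torus (\<lambda>x. (2 + k * \<sigma>) * (norm (F x) powr p + en x))" using i(4) ei by simp
    show "AE x in torus. \<bar>F x \<bullet> (snd (B1 x) - fst (B2 x) + \<beta> (a x) (b x))\<bar> \<le> (2 + k * \<sigma>) * (norm (F x) powr p + en x)"
      using a_bound
    proof eventually_elim
      case (elim x)
      have "norm (\<beta> (a x) (b x)) \<le> k * norm (a x) * norm (b x)" by (rule k(2))
      also have "\<dots> \<le> k * \<sigma> * norm (b x)" using elim k(1) by (intro mult_right_mono mult_left_mono) simp_all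
      finally have 1: "norm (\<beta> (a x) (b x)) \<le> k * \<sigma> * norm (b x)" .
      have "norm (snd (B1 x) - fst (B2 x) + \<beta> (a x) (b x)) \<le> norm (B1 x) + norm (B2 x) + k * \<sigma> * norm (b x)"
        using norm_triangle_ineq[of "snd (B1 x) - fst (B2 x)" "\<beta> (a x) (b x)"] norm_triangle_ineq4[of "snd (B1 x)" "fst (B2 x)"]
          norm_fst_snd(2)[of "B1 x"] norm_fst_snd(1)[of "B2 x"] 1 by linarith
      then have "norm (F x) * norm (snd (B1 x) - fst (B2 x) + \<beta> (a x) (b x)) \<le> norm (F x) * (norm (B1 x) + norm (B2 x) + k * \<sigma> * norm (b x))"
        by (rule mult_left_mono) simp
      also have "\<dots> = norm (F x) * norm (B1 x) + norm (F x) * norm (B2 x) + k * \<sigma> * (norm (F x) * norm (b x))"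
        by (simp add: algebra_simps)
      also have "\<dots> \<le> (norm (F x) powr p + en x) + (norm (F x) powr p + en x) + k * \<sigma> * (norm (F x) powr p + en x)"
      proof -
        have "norm (F x) * norm (B1 x) \<le> norm (F x) powr p + en x" "norm (F x) * norm (B2 x) \<le> norm (F x) powr p + en x"
          "norm (F x) * norm (b x) \<le> norm (F x) powr p + en x"
          by (rule order_trans[OF Y[OF norm_ge_zero norm_ge_zero] add_left_mono[OF ege(2)]]
              order_trans[OF Y[OF norm_ge_zero norm_ge_zero] add_left_mono[OF ege(3)]]
              order_trans[OF Y[OF norm_ge_zero norm_ge_zero] add_left_mono[OF ege(1)]])+
        then show ?thesis using ks by (intro add_mono mult_left_mono)
      qed
      also have "\<dots> = (2 + k * \<sigma>) * (norm (F x) powr p + en x)" by (simp add: algebra_simps)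
      finally show ?case using Cauchy_Schwarz_ineq2[of "F x" "snd (B1 x) - fst (B2 x) + \<beta> (a x) (b x)"] by linarith
    qed
  qed
  also have "\<dots> = (2 + k * \<sigma>) * ((LINT x|torus. norm (F x) powr p) + (LINT x|torus. en x))"
    using Bochner_Integration.integral_add[OF i(4) ei] by simp
  also have "\<dots> \<le> (2 + k * \<sigma>) * ((LINT x|torus. norm (F x) powr p) + 1)"
    using le ks by (intro mult_left_mono) simp_all
  finally have 1: "\<bar>LINT x|torus. F x \<bullet> (snd (B1 x) - fst (B2 x) + \<beta> (a x) (b x))\<bar> \<le> (2 + k * \<sigma>) * ((LINT x|torus. norm (F x) powr p) + 1)" .
  have "\<bar>LINT x|torus. Y x \<bullet> - (fst (B1 x) + snd (B2 x))\<bar> \<le> (LINT x|torus. 2 * (norm (Y x) powr p + en x))"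
  proof (rule abs_integral_le)
    show "integrable torus (\<lambda>x. 2 * (norm (Y x) powr p + en x))" using i(5) ei by simp
    show "AE x in torus. \<bar>Y x \<bullet> - (fst (B1 x) + snd (B2 x))\<bar> \<le> 2 * (norm (Y x) powr p + en x)"
    proof (rule AE_I2)
      fix x
      have "norm (- (fst (B1 x) + snd (B2 x))) \<le> norm (B1 x) + norm (B2 x)"
        using norm_triangle_ineq[of "fst (B1 x)" "snd (B2 x)"] norm_fst_snd(1)[of "B1 x"] norm_fst_snd(2)[of "B2 x"] unfolding norm_minus_cancel by linarith
      then have "norm (Y x) * norm (- (fst (B1 x) + snd (B2 x))) \<le> norm (Y x) * (norm (B1 x) + norm (B2 x))"
        by (rule mult_left_mono) simp
      also have "\<dots> = norm (Y x) * norm (B1 x) + norm (Y x) * norm (B2 x)" by (simp add: algebra_simps)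
      also have "\<dots> \<le> 2 * (norm (Y x) powr p + en x)"
        using add_mono[OF order_trans[OF Y[OF norm_ge_zero norm_ge_zero] add_left_mono[OF ege(2)]]
            order_trans[OF Y[OF norm_ge_zero norm_ge_zero] add_left_mono[OF ege(3)]]] by (simp only: mult_2)
      finally show "\<bar>Y x \<bullet> - (fst (B1 x) + snd (B2 x))\<bar> \<le> 2 * (norm (Y x) powr p + en x)"
        using Cauchy_Schwarz_ineq2[of "Y x" "- (fst (B1 x) + snd (B2 x))"] by linarith
    qed
  qed
  also have "\<dots> = 2 * ((LINT x|torus. norm (Y x) powr p) + (LINT x|torus. en x))"
    by (simp only: integral_mult_right_zero Bochner_Integration.integral_add[OF i(5) ei])
  also have "\<dots> \<le> 2 * ((LINT x|torus. norm (Y x) powr p) + 1)" using le by simp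
  finally show ?thesis using 1 unfolding pairing_def by linarith
qed

text \<open>
  Without this bound the supremum that defines the dual norm would say nothing about its members.
\<close>

lemma dual_bdd: "bdd_above ((\<lambda>b. \<bar>M_gf br a b\<bar>) ` {b. W1 q b \<and> W1_norm q b \<le> 1})"
proof (rule bdd_aboveI2)
  fix b :: "'e form1" assume "b \<in> {b. W1 q b \<and> W1_norm q b \<le> 1}"
  then have b: "W1 q b" "W1_norm q b \<le> 1" by simp_all
  have q1: "1 \<le> q" using q by simp
  have bs: "(1, 0) \<in> (Basis :: (real \<times> real) set)" "(0, 1) \<in> (Basis :: (real \<times> real) set)" by (simp_all add: Basis_prod_def)
  have g: "weak_gradient b (wpartial (1, 0) b) (wpartial (0, 1) b)" by (rule W1_weak_gradient[OF b(1) q1])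
  have "grad_energy q b (wpartial (1, 0) b) (wpartial (0, 1) b) powr (1 / q) \<le> 1"
    using b(2) weak_gradient.W1_norm_eq[OF g, of q] by simp
  then have "(grad_energy q b (wpartial (1, 0) b) (wpartial (0, 1) b) powr (1 / q)) powr q \<le> 1 powr q"
    using q by (intro powr_mono2) simp_all
  then have e: "grad_energy q b (wpartial (1, 0) b) (wpartial (0, 1) b) \<le> 1"
    using q grad_energy_nonneg[of q b "wpartial (1, 0) b" "wpartial (0, 1) b"] by (simp add: powr_powr)
  show "\<bar>M_gf br a b\<bar> \<le> (2 + k * \<sigma>) * ((LINT x|torus. norm (F x) powr p) + 1) + 2 * ((LINT x|torus. norm (Y x) powr p) + 1)"
    unfolding M_eq_pairing[OF g]
    by (rule pairing_bound[OF _ W1_wpartial(1)[OF b(1) q1 bs(1)] W1_wpartial(1)[OF b(1) q1 bs(2)] e])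
       (use b(1) in \<open>simp add: W1_def\<close>)
qed

lemma N_ge:
  assumes g: "weak_gradient b B1 B2" and L: "Lq q b" "Lq q B1" "Lq q B2"
    and R: "0 < R" and e: "grad_energy q b B1 B2 \<le> R powr q"
  shows "\<bar>pairing b B1 B2\<bar> \<le> N * R"
proof -
  have q1: "1 \<le> q" using q by simp
  let ?s = "\<lambda>h x. inverse R *\<^sub>R (h x :: 'e \<times> 'e)"
  have bs: "bounded_linear (\<lambda>v :: 'e \<times> 'e. inverse R *\<^sub>R v)" by (rule bounded_linear_scaleR_right)
  have g': "weak_gradient (?s b) (?s B1) (?s B2)" by (rule weak_gradient_linear_image[OF bs g])
  have L': "Lq q (?s b)" "Lq q (?s B1)" "Lq q (?s B2)"
    by (rule Lq_linear_image[OF bs L(1) q1] Lq_linear_image[OF bs L(2) q1] Lq_linear_image[OF bs L(3) q1])+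
  have "grad_energy q (?s b) (?s B1) (?s B2) = inverse R powr q * grad_energy q b B1 B2"
  proof -
    have n: "norm (inverse R *\<^sub>R v) powr q = inverse R powr q * norm v powr q" for v :: "'e \<times> 'e"
      using R by (simp add: powr_mult)
    show ?thesis unfolding grad_energy_def n by (simp only: distrib_left[symmetric] integral_mult_right_zero)
  qed
  also have "\<dots> \<le> inverse R powr q * R powr q" using e by (rule mult_left_mono) simp
  also have "\<dots> = 1" using R by (subst powr_mult[symmetric]) simp_all
  finally have e': "grad_energy q (?s b) (?s B1) (?s B2) \<le> 1" .
  have "grad_energy q (?s b) (?s B1) (?s B2) powr (1 / q) \<le> 1"
    using e' grad_energy_nonneg[of q "?s b" "?s B1" "?s B2"] q by (intro powr_le1) simp_all
  then have "?s b \<in> {b. W1 q b \<and> W1_norm q b \<le> 1}"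
    using weak_gradient.W1_norm_eq[OF g', of q] weak_gradient.W1I[OF g' L'] by simp
  then have "\<bar>M_gf br a (?s b)\<bar> \<le> N"
    unfolding N_def W_minus1_norm_def Let_def q_def[symmetric] by (rule cSUP_upper[OF _ dual_bdd])
  moreover have "M_gf br a (?s b) = inverse R * pairing b B1 B2"
    unfolding M_eq_pairing[OF g'] pairing_def
    by (simp add: \<beta>.scaleR_right scaleR_diff_right[symmetric] scaleR_add_right[symmetric] scaleR_minus_right[symmetric] distrib_left
         del: scaleR_minus_right)
  ultimately have "inverse R * \<bar>pairing b B1 B2\<bar> \<le> N" using R by (simp add: abs_mult)
  then show ?thesis using R by (simp add: field_simps)
qed

end

section \<open>Estimates for small connections\<close>

lemma two_mult_le: "2 * (s * t) \<le> s\<^sup>2 + t\<^sup>2" for s t :: real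
  using sum_squares_bound[of s t] by (simp add: mult.assoc)

context gauge_field
begin

lemma energy_nonneg: "0 \<le> energy"
  unfolding energy_def by (rule Bochner_Integration.integral_nonneg) simp

lemma sq_int: "integrable torus (\<lambda>x. (norm (A1 x))\<^sup>2)" "integrable torus (\<lambda>x. (norm (A2 x))\<^sup>2)"
  "integrable torus (\<lambda>x. (norm (X x))\<^sup>2)" "integrable torus (\<lambda>x. (norm (Y x))\<^sup>2)" "integrable torus (\<lambda>x. (norm (w x))\<^sup>2)"
  "integrable torus (\<lambda>x. (norm (F x))\<^sup>2)"
  using Lq_2 by (simp_all add: Lq2_iff)

text \<open>
  Pointwise, both sides differ by \<open>2 (\<partial>\<^sub>1a\<^sub>1 \<bullet> \<partial>\<^sub>2a\<^sub>2 - \<partial>\<^sub>2a\<^sub>1 \<bullet> \<partial>\<^sub>1a\<^sub>2)\<close>, whose integral vanishes because mixed derivatives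
  commute.
\<close>

lemma div_curl: "(LINT x|torus. (norm (X x))\<^sup>2) + (LINT x|torus. (norm (Y x))\<^sup>2) = energy"
proof -
  have L: "Lq 2 (\<lambda>x. fst (a x))" "Lq 2 (\<lambda>x. fst (A1 x))" "Lq 2 (\<lambda>x. fst (A2 x))"
     "Lq 2 (\<lambda>x. snd (a x))" "Lq 2 (\<lambda>x. snd (A1 x))" "Lq 2 (\<lambda>x. snd (A2 x))"
  proof -
    have 2: "1 \<le> (2::real)" by simp
    have La: "Lq 2 a" using p by (intro Lq_mono[OF Lq_p(1)]) simp_all
    show "Lq 2 (\<lambda>x. fst (a x))" "Lq 2 (\<lambda>x. fst (A1 x))" "Lq 2 (\<lambda>x. fst (A2 x))"
     "Lq 2 (\<lambda>x. snd (a x))" "Lq 2 (\<lambda>x. snd (A1 x))" "Lq 2 (\<lambda>x. snd (A2 x))"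
      by (rule Lq_linear_image[OF bounded_linear_fst La 2] Lq_linear_image[OF bounded_linear_fst Lq_2(4) 2]
        Lq_linear_image[OF bounded_linear_fst Lq_2(5) 2] Lq_linear_image[OF bounded_linear_snd La 2]
        Lq_linear_image[OF bounded_linear_snd Lq_2(4) 2] Lq_linear_image[OF bounded_linear_snd Lq_2(5) 2])+
  qed
  have cross: "(LINT x|torus. fst (A1 x) \<bullet> snd (A2 x)) = (LINT x|torus. fst (A2 x) \<bullet> snd (A1 x))"
    by (rule integral_partials_commute[OF weak_gradient_linear_image[OF bounded_linear_fst A.weak_gradient_axioms]
          weak_gradient_linear_image[OF bounded_linear_snd A.weak_gradient_axioms] L])
  have ci: "integrable torus (\<lambda>x. fst (A1 x) \<bullet> snd (A2 x))" "integrable torus (\<lambda>x. fst (A2 x) \<bullet> snd (A1 x))"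
    by (rule integrable_inner_L2[OF L(2) L(6)], rule integrable_inner_L2[OF L(3) L(5)])
  have pt: "(norm (X x))\<^sup>2 + (norm (Y x))\<^sup>2 = ((norm (A1 x))\<^sup>2 + (norm (A2 x))\<^sup>2) + 2 * (fst (A1 x) \<bullet> snd (A2 x) - fst (A2 x) \<bullet> snd (A1 x))" for x
    by (simp add: X_def Y_def power2_norm_eq_inner inner_prod_def inner_diff_left inner_diff_right inner_add_left inner_add_right inner_commute)
  have "(LINT x|torus. (norm (X x))\<^sup>2) + (LINT x|torus. (norm (Y x))\<^sup>2) = (LINT x|torus. (norm (X x))\<^sup>2 + (norm (Y x))\<^sup>2)"
    by (rule Bochner_Integration.integral_add[symmetric, OF sq_int(3,4)])
  also have "\<dots> = (LINT x|torus. (norm (A1 x))\<^sup>2 + (norm (A2 x))\<^sup>2) + (LINT x|torus. 2 * (fst (A1 x) \<bullet> snd (A2 x) - fst (A2 x) \<bullet> snd (A1 x)))"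
    unfolding pt by (rule Bochner_Integration.integral_add) (use sq_int ci in simp_all)
  also have "(LINT x|torus. 2 * (fst (A1 x) \<bullet> snd (A2 x) - fst (A2 x) \<bullet> snd (A1 x))) = 0"
    unfolding integral_mult_right_zero Bochner_Integration.integral_diff[OF ci] by (simp only: cross) simp
  finally show ?thesis by (simp add: energy_def)
qed

lemma XY_le: "(LINT x|torus. (norm (X x))\<^sup>2) \<le> energy" "(LINT x|torus. (norm (Y x))\<^sup>2) \<le> energy"
proof -
  have "0 \<le> (LINT x|torus. (norm (X x))\<^sup>2)" "0 \<le> (LINT x|torus. (norm (Y x))\<^sup>2)"
    by (rule Bochner_Integration.integral_nonneg, simp)+
  then show "(LINT x|torus. (norm (X x))\<^sup>2) \<le> energy" "(LINT x|torus. (norm (Y x))\<^sup>2) \<le> energy" using div_curl by linarith+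
qed

lemma w_L2: "(LINT x|torus. (norm (w x))\<^sup>2) \<le> 2 * energy"
proof -
  have le: "(A.slope x)\<^sup>2 \<le> 2 * ((norm (A1 x))\<^sup>2 + (norm (A2 x))\<^sup>2)" for x
    unfolding A.slope_def using zero_le_power2[of "norm (A1 x) - norm (A2 x)"] by (simp add: power2_eq_square algebra_simps)
  have i2: "integrable torus (\<lambda>x. 2 * ((norm (A1 x))\<^sup>2 + (norm (A2 x))\<^sup>2))" using sq_int by simp
  have i: "integrable torus (\<lambda>x. (A.slope x)\<^sup>2)"
  proof (rule Bochner_Integration.integrable_bound[OF i2])
    have [measurable]: "A.slope \<in> borel_measurable torus" by (rule measurable_torus[OF A.slope_measurable])
    show "(\<lambda>x. (A.slope x)\<^sup>2) \<in> borel_measurable torus" by measurable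
    show "AE x in torus. norm ((A.slope x)\<^sup>2) \<le> norm (2 * ((norm (A1 x))\<^sup>2 + (norm (A2 x))\<^sup>2))"
      using le by (intro AE_I2) simp
  qed
  have "(LINT x|torus. (norm (w x))\<^sup>2) \<le> (LINT x|torus. (A.slope x)\<^sup>2)"
    using A.poincare(2)[OF i] by (simp add: w_def c_def)
  also have "\<dots> \<le> (LINT x|torus. 2 * ((norm (A1 x))\<^sup>2 + (norm (A2 x))\<^sup>2))" by (rule integral_mono[OF i i2 le])
  also have "\<dots> = 2 * energy" unfolding energy_def by (rule integral_mult_right_zero)
  finally show ?thesis .
qed

lemma Z_int: "integrable torus (\<lambda>x. (norm (w x))\<^sup>2 + (norm (X x))\<^sup>2)"
  "(LINT x|torus. (norm (w x))\<^sup>2 + (norm (X x))\<^sup>2) \<le> 3 * energy"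
proof -
  show "integrable torus (\<lambda>x. (norm (w x))\<^sup>2 + (norm (X x))\<^sup>2)" using sq_int by simp
  show "(LINT x|torus. (norm (w x))\<^sup>2 + (norm (X x))\<^sup>2) \<le> 3 * energy"
    using Bochner_Integration.integral_add[OF sq_int(5,3)] w_L2 XY_le(1) by linarith
qed

lemma X_integral: "integrable torus X" "(LINT x|torus. X x) = 0"
proof -
  have i: "integrable torus A1" "integrable torus A2" using A.u1 A.u2 by (simp_all add: Lq_1)
  have s: "integrable torus (\<lambda>x. snd (A1 x))" "integrable torus (\<lambda>x. fst (A2 x))"
    by (rule integrable_bounded_linear[OF bounded_linear_snd i(1)], rule integrable_bounded_linear[OF bounded_linear_fst i(2)])
  show "integrable torus X" unfolding X_def[abs_def] by (rule Bochner_Integration.integrable_diff[OF s])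
  show "(LINT x|torus. X x) = 0"
    unfolding X_def Bochner_Integration.integral_diff[OF s]
      integral_bounded_linear[OF bounded_linear_snd i(1)] integral_bounded_linear[OF bounded_linear_fst i(2)] A.integral_gradient_0
    by simp
qed

lemma \<beta>w_integral: "integrable torus (\<lambda>x. \<beta> v (w x))" "(LINT x|torus. \<beta> v (w x)) = 0"
proof -
  show "integrable torus (\<lambda>x. \<beta> v (w x))" by (rule integrable_bounded_linear[OF \<beta>.bounded_linear_right w_int(1)])
  show "(LINT x|torus. \<beta> v (w x)) = 0"
    unfolding integral_bounded_linear[OF \<beta>.bounded_linear_right w_int(1)] w_int(2) by (rule \<beta>.zero_right)
qed

text \<open>
  The terms are sorted by their order in \<open>w\<close> and \<open>X\<close>; those of first order have mean zero.
\<close>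

lemma F_decompose: "F x = F0 + (X x + \<beta> c (w x) + (1/2) *\<^sub>R \<beta> (w x) (w x))"
proof -
  have "a x = c + w x" by (simp add: w_def)
  then have "\<beta> (a x) (a x) = \<beta> c c + 2 *\<^sub>R \<beta> c (w x) + \<beta> (w x) (w x)"
    using \<beta>_sym[of "w x" c] by (simp add: \<beta>.add_left \<beta>.add_right scaleR_2)
  then show ?thesis by (simp add: F_def F0_def scaleR_add_right)
qed

lemma G_bound:
  assumes s1: "\<sigma> \<le> 1" and wx: "norm (w x) \<le> 2 * \<sigma>"
  shows "norm (\<beta> c (w x) + (1/2) *\<^sub>R \<beta> (w x) (w x)) \<le> 2 * k * \<sigma> * norm (w x)"
proof -
  have "norm (\<beta> c (w x)) \<le> k * norm c * norm (w x)" by (rule k(2))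
  also have "\<dots> \<le> k * \<sigma> * norm (w x)" using c_bound k(1) by (intro mult_right_mono mult_left_mono) simp_all
  finally have 1: "norm (\<beta> c (w x)) \<le> k * \<sigma> * norm (w x)" .
  have "norm (\<beta> (w x) (w x)) \<le> k * norm (w x) * norm (w x)" by (rule k(2))
  also have "\<dots> \<le> k * (2 * \<sigma>) * norm (w x)" using wx k(1) by (intro mult_right_mono mult_left_mono) simp_all
  finally have 2: "norm ((1/2) *\<^sub>R \<beta> (w x) (w x)) \<le> k * \<sigma> * norm (w x)" by simp
  show ?thesis using norm_triangle_ineq[of "\<beta> c (w x)" "(1/2) *\<^sub>R \<beta> (w x) (w x)"] 1 2 by linarith
qed

text \<open>
  In the pairing of the gradient with \<open>w\<close>, the square of \<open>X\<close> and that of \<open>Y\<close> add up to \<open>energy\<close>, and the terms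
  with \<open>F0\<close> that are linear in \<open>X\<close> or \<open>w\<close> integrate to zero.  Each of the four remaining terms has a factor
  \<open>\<sigma>\<close> and is quadratic in \<open>w\<close> and \<open>X\<close>.
\<close>

lemma gradient_estimate:
  assumes s: "30 * k\<^sup>2 * \<sigma> \<le> 1"
  shows "sqrt energy \<le> 12 * N"
proof -
  have k2: "k \<le> k\<^sup>2" "1 \<le> k\<^sup>2"
    using k(1) mult_left_mono[of 1 k k] by (simp add: power2_eq_square, simp)
  have s1: "\<sigma> \<le> 1"
  proof -
    have "\<sigma> \<le> k\<^sup>2 * \<sigma>" using k2(2) \<sigma>_nonneg mult_right_mono[of 1 "k\<^sup>2" \<sigma>] by simp
    then show ?thesis using s \<sigma>_nonneg by linarith
  qed
  let ?Z = "\<lambda>x. (norm (w x))\<^sup>2 + (norm (X x))\<^sup>2"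
  let ?f = "\<lambda>x. F x \<bullet> (X x + \<beta> (a x) (w x))"
  have L: "Lq 2 (\<lambda>x. X x + \<beta> (a x) (w x))"
    by (rule Lq_add[OF Lq_2(2) Lq_\<beta>[OF a_meas a_bound w_meas w_bound]]) simp_all
  have fi: "integrable torus ?f" by (rule integrable_inner_L2[OF Lq_2(1) L])
  (* a lower bound of \<open>?f\<close>; the last term collects the quadratic errors, and as the integral of \<open>?Z\<close> is
     at most \<open>3 * energy\<close>, the smallness of \<open>\<sigma>\<close> makes it at most half of \<open>energy\<close> *)
  let ?g = "\<lambda>x. (norm (X x))\<^sup>2 + F0 \<bullet> X x + F0 \<bullet> \<beta> c (w x) - 5 * k\<^sup>2 * \<sigma> * ?Z x"
  have gi: "integrable torus ?g"
    using sq_int integral_inner_const(2)[OF X_integral(1)] integral_inner_const(2)[OF \<beta>w_integral(1)] by simp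
  have ge: "AE x in torus. ?g x \<le> ?f x"
    using w_bound a_bound
  proof eventually_elim
    case (elim x)
    define W where "W = norm (w x)"
    define V where "V = norm (X x)"
    have W: "0 \<le> W" "W \<le> 2 * \<sigma>" and V: "0 \<le> V" using elim by (simp_all add: W_def V_def)
    define G where "G = \<beta> c (w x) + (1/2) *\<^sub>R \<beta> (w x) (w x)"
    have G: "norm G \<le> 2 * k * \<sigma> * W" using G_bound[OF s1 elim(1)] by (simp add: G_def W_def)
    have Fx: "F x = F0 + X x + G" unfolding F_decompose G_def by (simp add: add.assoc)
    have aw: "norm (\<beta> (a x) (w x)) \<le> k * \<sigma> * W"
    proof -
      have "norm (\<beta> (a x) (w x)) \<le> k * norm (a x) * norm (w x)" by (rule k(2))
      also have "\<dots> \<le> k * \<sigma> * W" unfolding W_def using elim(2) k(1) by (intro mult_right_mono mult_left_mono) simp_all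
      finally show ?thesis .
    qed
    have F0b: "norm F0 \<le> k * \<sigma>"
    proof -
      have "norm (\<beta> c c) \<le> k * norm c * norm c" by (rule k(2))
      also have "\<dots> \<le> k * \<sigma> * 1" using c_bound s1 k(1) \<sigma>_nonneg by (intro mult_mono mult_left_mono) simp_all
      finally have "norm (\<beta> c c) \<le> k * \<sigma>" by simp
      moreover have "0 \<le> k * \<sigma>" using k(1) \<sigma>_nonneg by simp
      ultimately show ?thesis unfolding F0_def by simp
    qed
    have ww: "norm (\<beta> (w x) (w x)) \<le> k * W\<^sup>2" using k(2)[of "w x" "w x"] by (simp add: W_def power2_eq_square)
    have exp: "?f x = V\<^sup>2 + F0 \<bullet> X x + F0 \<bullet> \<beta> c (w x) + (F0 \<bullet> \<beta> (w x) (w x) + G \<bullet> X x + G \<bullet> \<beta> (a x) (w x) + X x \<bullet> \<beta> (a x) (w x))"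
    proof -
      have "\<beta> (a x) (w x) = \<beta> c (w x) + \<beta> (w x) (w x)" by (simp add: w_def \<beta>.diff_left)
      then have "F0 \<bullet> \<beta> (a x) (w x) = F0 \<bullet> \<beta> c (w x) + F0 \<bullet> \<beta> (w x) (w x)" by (simp add: inner_add_right)
      then show ?thesis unfolding Fx V_def power2_norm_eq_inner by (simp add: inner_add_left inner_add_right)
    qed
    have t1: "\<bar>F0 \<bullet> \<beta> (w x) (w x)\<bar> \<le> k\<^sup>2 * \<sigma> * W\<^sup>2"
    proof -
      have "\<bar>F0 \<bullet> \<beta> (w x) (w x)\<bar> \<le> norm F0 * norm (\<beta> (w x) (w x))" by (rule Cauchy_Schwarz_ineq2)
      also have "\<dots> \<le> (k * \<sigma>) * (k * W\<^sup>2)" using F0b ww k(1) \<sigma>_nonneg by (intro mult_mono) simp_all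
      finally show ?thesis by (simp add: power2_eq_square mult_ac)
    qed
    have t2: "\<bar>G \<bullet> X x\<bar> \<le> k\<^sup>2 * \<sigma> * (W\<^sup>2 + V\<^sup>2)"
    proof -
      have "\<bar>G \<bullet> X x\<bar> \<le> norm G * norm (X x)" by (rule Cauchy_Schwarz_ineq2)
      also have "\<dots> \<le> (2 * k * \<sigma> * W) * V" unfolding V_def using G by (intro mult_right_mono) simp_all
      also have "\<dots> = (k * \<sigma>) * (2 * (W * V))" by simp
      also have "\<dots> \<le> (k * \<sigma>) * (W\<^sup>2 + V\<^sup>2)" using k(1) \<sigma>_nonneg by (intro mult_left_mono two_mult_le) simp_all
      also have "\<dots> \<le> (k\<^sup>2 * \<sigma>) * (W\<^sup>2 + V\<^sup>2)" using k2(1) \<sigma>_nonneg by (intro mult_right_mono) simp_all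
      finally show ?thesis .
    qed
    have t3: "\<bar>G \<bullet> \<beta> (a x) (w x)\<bar> \<le> 2 * k\<^sup>2 * \<sigma> * W\<^sup>2"
    proof -
      have "\<bar>G \<bullet> \<beta> (a x) (w x)\<bar> \<le> norm G * norm (\<beta> (a x) (w x))" by (rule Cauchy_Schwarz_ineq2)
      also have "\<dots> \<le> (2 * k * \<sigma> * W) * (k * \<sigma> * W)" using G aw k(1) \<sigma>_nonneg W by (intro mult_mono) simp_all
      also have "\<dots> = (2 * k\<^sup>2 * \<sigma> * W\<^sup>2) * \<sigma>" by (simp add: power2_eq_square)
      also have "\<dots> \<le> (2 * k\<^sup>2 * \<sigma> * W\<^sup>2) * 1" using s1 \<sigma>_nonneg by (intro mult_left_mono) simp_all
      finally show ?thesis by simp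
    qed
    have t4: "\<bar>X x \<bullet> \<beta> (a x) (w x)\<bar> \<le> k\<^sup>2 * \<sigma> * (W\<^sup>2 + V\<^sup>2)"
    proof -
      have "\<bar>X x \<bullet> \<beta> (a x) (w x)\<bar> \<le> norm (X x) * norm (\<beta> (a x) (w x))" by (rule Cauchy_Schwarz_ineq2)
      also have "\<dots> \<le> V * (k * \<sigma> * W)" unfolding V_def using aw by (intro mult_left_mono) simp_all
      also have "\<dots> = (k * \<sigma>) * (W * V)" by simp
      also have "\<dots> \<le> (k * \<sigma>) * (W\<^sup>2 + V\<^sup>2)" using k(1) \<sigma>_nonneg by (intro mult_left_mono mult_le_sum_squares) simp_all
      also have "\<dots> \<le> (k\<^sup>2 * \<sigma>) * (W\<^sup>2 + V\<^sup>2)" using k2(1) \<sigma>_nonneg by (intro mult_right_mono) simp_all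
      finally show ?thesis .
    qed
    have "\<bar>F0 \<bullet> \<beta> (w x) (w x) + G \<bullet> X x + G \<bullet> \<beta> (a x) (w x) + X x \<bullet> \<beta> (a x) (w x)\<bar> \<le> 5 * k\<^sup>2 * \<sigma> * (W\<^sup>2 + V\<^sup>2)"
    proof -
      define S where "S = k\<^sup>2 * \<sigma>"
      have S: "0 \<le> S * V\<^sup>2" "0 \<le> S * W\<^sup>2" using \<sigma>_nonneg by (simp_all add: S_def)
      have "5 * k\<^sup>2 * \<sigma> * (W\<^sup>2 + V\<^sup>2) = 5 * (S * W\<^sup>2) + 5 * (S * V\<^sup>2)" by (simp add: S_def algebra_simps)
      moreover have "k\<^sup>2 * \<sigma> * (W\<^sup>2 + V\<^sup>2) = S * W\<^sup>2 + S * V\<^sup>2" by (simp add: S_def algebra_simps)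
      moreover have "2 * k\<^sup>2 * \<sigma> * W\<^sup>2 = 2 * (S * W\<^sup>2)" by (simp add: S_def)
      ultimately show ?thesis using t1 t2 t3 t4 S unfolding S_def[symmetric] by linarith
    qed
    then show ?case unfolding exp V_def[symmetric] W_def[symmetric] by linarith
  qed
  have "(LINT x|torus. ?g x) \<le> (LINT x|torus. ?f x)" by (rule integral_mono_AE[OF gi fi ge])
  moreover have "(LINT x|torus. ?g x) = (LINT x|torus. (norm (X x))\<^sup>2) - 5 * k\<^sup>2 * \<sigma> * (LINT x|torus. ?Z x)"
  proof -
    have "(LINT x|torus. ?g x) = (LINT x|torus. (norm (X x))\<^sup>2) + (LINT x|torus. F0 \<bullet> X x) + (LINT x|torus. F0 \<bullet> \<beta> c (w x)) - (LINT x|torus. 5 * k\<^sup>2 * \<sigma> * ?Z x)"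
      using sq_int integral_inner_const(2)[OF X_integral(1)] integral_inner_const(2)[OF \<beta>w_integral(1)]
      by (subst Bochner_Integration.integral_diff Bochner_Integration.integral_add; simp)+
    then show ?thesis
      unfolding integral_inner_const(1)[OF X_integral(1)] integral_inner_const(1)[OF \<beta>w_integral(1)] X_integral(2) \<beta>w_integral(2)
        integral_mult_right_zero by simp
  qed
  moreover have "5 * k\<^sup>2 * \<sigma> * (LINT x|torus. ?Z x) \<le> energy / 2"
  proof -
    have "5 * k\<^sup>2 * \<sigma> * (LINT x|torus. ?Z x) \<le> 5 * k\<^sup>2 * \<sigma> * (3 * energy)"
      using Z_int(2) \<sigma>_nonneg by (intro mult_left_mono) simp_all
    also have "\<dots> = (30 * k\<^sup>2 * \<sigma>) * (energy / 2)" by simp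
    also have "\<dots> \<le> 1 * (energy / 2)" using s energy_nonneg by (intro mult_right_mono) simp_all
    finally show ?thesis by simp
  qed
  moreover have "pairing w A1 A2 = (LINT x|torus. ?f x) + (LINT x|torus. (norm (Y x))\<^sup>2)"
    by (simp only: pairing_def X_def[symmetric] Y_def[symmetric] power2_norm_eq_inner)
  ultimately have low: "energy / 2 \<le> pairing w A1 A2" using div_curl by linarith
  show ?thesis
  proof (cases "energy = 0")
    case True
    (* testing with zero shows that \<open>N\<close> is non-negative *)
    have "\<bar>pairing (\<lambda>_. 0) (\<lambda>_. 0) (\<lambda>_. 0)\<bar> \<le> N * 1"
      by (rule N_ge[OF weak_gradient_const]) (simp_all add: grad_energy_def)
    then show ?thesis using True by simp
  next
    case False
    define r where "r = sqrt energy"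
    have r: "r > 0" "r\<^sup>2 = energy" using False energy_nonneg by (simp_all add: r_def)
    have q01: "0 \<le> q" "q \<le> 2" using q by simp_all
    have Lqs: "Lq q w" "Lq q A1" "Lq q A2" by (rule Lq_mono[OF Lq_2(6) q01] Lq_mono[OF Lq_2(4) q01] Lq_mono[OF Lq_2(5) q01])+
    (* as \<open>q < 2\<close>, the bounds in \<open>L\<^sup>2\<close> control the Sobolev norm of \<open>w\<close> with exponent \<open>q\<close> at the scale \<open>r\<close>;
       summed over \<open>w\<close> and its two derivatives this gives the bound \<open>6 * r\<close> *)
    have pt: "t powr q \<le> r powr q + r powr (q - 2) * t\<^sup>2" if "0 \<le> t" for t
    proof -
      have "(t / r) powr q \<le> 1 + (t / r) powr 2" using that r q by (intro powr_le_1_plus) simp_all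
      then have "r powr q * (t / r) powr q \<le> r powr q * (1 + (t / r)\<^sup>2)" using that r by (intro mult_left_mono) (simp_all add: powr_numeral)
      moreover have "r powr q * (t / r) powr q = t powr q" using that r by (simp add: powr_divide)
      moreover have "r powr q * (t / r)\<^sup>2 = r powr (q - 2) * t\<^sup>2" using r by (simp add: powr_diff powr_numeral power_divide)
      ultimately show ?thesis by (simp add: distrib_left)
    qed
    have "grad_energy q w A1 A2 \<le> (LINT x|torus. 3 * r powr q + r powr (q - 2) * ((norm (w x))\<^sup>2 + ((norm (A1 x))\<^sup>2 + (norm (A2 x))\<^sup>2)))"
      unfolding grad_energy_def
    proof (rule integral_mono)
      show "integrable torus (\<lambda>x. norm (w x) powr q + (norm (A1 x) powr q + norm (A2 x) powr q))" using Lqs by (simp add: Lq_def)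
      show "integrable torus (\<lambda>x. 3 * r powr q + r powr (q - 2) * ((norm (w x))\<^sup>2 + ((norm (A1 x))\<^sup>2 + (norm (A2 x))\<^sup>2)))" using sq_int by simp
      show "norm (w x) powr q + (norm (A1 x) powr q + norm (A2 x) powr q) \<le> 3 * r powr q + r powr (q - 2) * ((norm (w x))\<^sup>2 + ((norm (A1 x))\<^sup>2 + (norm (A2 x))\<^sup>2))" for x
        using pt[OF norm_ge_zero, of "w x"] pt[OF norm_ge_zero, of "A1 x"] pt[OF norm_ge_zero, of "A2 x"] unfolding distrib_left by linarith
    qed
    also have "\<dots> = 3 * r powr q + r powr (q - 2) * ((LINT x|torus. (norm (w x))\<^sup>2) + energy)"
      unfolding energy_def using sq_int by simp
    also have "\<dots> \<le> 3 * r powr q + r powr (q - 2) * (3 * r\<^sup>2)"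
      using w_L2 r by (intro add_left_mono mult_left_mono) simp_all
    also have "r powr (q - 2) * (3 * r\<^sup>2) = 3 * r powr q" using r(1) by (simp add: powr_diff powr_numeral)
    also have "3 * r powr q + 3 * r powr q \<le> (6 * r) powr q"
    proof -
      have "6 powr 1 \<le> (6::real) powr q" using q by (intro powr_mono) simp_all
      then have "6 * r powr q \<le> 6 powr q * r powr q" by (intro mult_right_mono) simp_all
      then show ?thesis using r by (simp add: powr_mult)
    qed
    finally have "\<bar>pairing w A1 A2\<bar> \<le> N * (6 * r)" using r by (intro N_ge[OF w_gradient Lqs]) simp_all
    then have "r\<^sup>2 / 2 \<le> N * (6 * r)" using low r by linarith
    then have "r * (r / 2) \<le> r * (N * 6)" by (simp add: power2_eq_square mult_ac)
    then have "r / 2 \<le> N * 6" using r(1) by (simp only: mult_le_cancel_left_pos)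
    then show ?thesis by (simp add: r_def)
  qed
qed

text \<open>
  With a constant test field \<open>b\<close> no derivatives of \<open>b\<close> occur.  The terms of first order in \<open>w\<close> and \<open>X\<close>,
  collected in \<open>h\<close>, integrate to zero, and only a quadratic remainder is left.
\<close>

lemma constant_test_estimate:
  assumes s1: "\<sigma> \<le> 1"
  shows "\<bar>F0 \<bullet> \<beta> c b\<bar> \<le> norm b * (N + 15 * k\<^sup>2 * energy)"
proof (cases "b = 0")
  case True then show ?thesis by (simp add: \<beta>.zero_right)
next
  case False
  let ?Z = "\<lambda>x. (norm (w x))\<^sup>2 + (norm (X x))\<^sup>2"
  have bm: "(\<lambda>_. b) \<in> borel_measurable borel" "periodic (\<lambda>_. b)" "AE x in torus. norm b \<le> norm b" by (simp_all add: periodic_def)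
  have "\<bar>pairing (\<lambda>_. b) (\<lambda>_. 0) (\<lambda>_. 0)\<bar> \<le> N * norm b"
    using False q by (intro N_ge[OF weak_gradient_const]) (simp_all add: grad_energy_def)
  then have pN: "\<bar>LINT x|torus. F x \<bullet> \<beta> (a x) b\<bar> \<le> N * norm b" by (simp add: pairing_def)
  define h where "h x = X x \<bullet> \<beta> c b + \<beta> c (w x) \<bullet> \<beta> c b + F0 \<bullet> \<beta> (w x) b" for x
  have sw: "\<beta> (w x) b = \<beta> b (w x)" for x by (rule \<beta>_sym)
  have hi: "integrable torus h" "(LINT x|torus. h x) = 0"
  proof -
    note i = integral_inner_const[OF X_integral(1), of "\<beta> c b"] integral_inner_const[OF \<beta>w_integral(1), of "\<beta> c b" c]
       integral_inner_const[OF \<beta>w_integral(1), of F0 b]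
    have "h = (\<lambda>x. \<beta> c b \<bullet> X x + \<beta> c b \<bullet> \<beta> c (w x) + F0 \<bullet> \<beta> b (w x))" by (simp add: fun_eq_iff h_def inner_commute sw)
    then show "integrable torus h" "(LINT x|torus. h x) = 0"
      using i X_integral(2) \<beta>w_integral(2) by simp_all
  qed
  have fi: "integrable torus (\<lambda>x. F x \<bullet> \<beta> (a x) b)"
    by (rule integrable_inner_L2[OF Lq_2(1) Lq_\<beta>[OF a_meas a_bound bm]]) simp
  have "\<bar>LINT x|torus. F x \<bullet> \<beta> (a x) b - h x - F0 \<bullet> \<beta> c b\<bar> \<le> (LINT x|torus. (5 * k\<^sup>2 * norm b) * ?Z x)"
  proof (rule abs_integral_le)
    show "integrable torus (\<lambda>x. (5 * k\<^sup>2 * norm b) * ?Z x)" using Z_int(1) by simp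
    show "AE x in torus. \<bar>F x \<bullet> \<beta> (a x) b - h x - F0 \<bullet> \<beta> c b\<bar> \<le> (5 * k\<^sup>2 * norm b) * ?Z x"
      using w_bound
    proof eventually_elim
      case (elim x)
      define W where "W = norm (w x)"
      define V where "V = norm (X x)"
      have W: "0 \<le> W" and V: "0 \<le> V" by (simp_all add: W_def V_def)
      define G where "G = \<beta> c (w x) + (1/2) *\<^sub>R \<beta> (w x) (w x)"
      have G: "norm G \<le> 2 * k * \<sigma> * W" using G_bound[OF s1 elim] by (simp add: G_def W_def)
      have Fx: "F x = F0 + X x + G" unfolding F_decompose G_def by (simp add: add.assoc)
      have ab: "\<beta> (a x) b = \<beta> c b + \<beta> (w x) b" by (simp add: w_def \<beta>.diff_left)
      have e: "F x \<bullet> \<beta> (a x) b - h x - F0 \<bullet> \<beta> c b = ((1/2) *\<^sub>R \<beta> (w x) (w x)) \<bullet> \<beta> c b + (X x + G) \<bullet> \<beta> (w x) b"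
        unfolding Fx ab h_def G_def by (simp add: inner_add_left inner_add_right algebra_simps)
      have wb: "norm (\<beta> (w x) b) \<le> k * W * norm b" unfolding W_def by (rule k(2))
      have cb: "norm (\<beta> c b) \<le> k * norm b"
      proof -
        have "norm (\<beta> c b) \<le> k * norm c * norm b" by (rule k(2))
        also have "\<dots> \<le> k * 1 * norm b" using c_bound s1 k(1) by (intro mult_right_mono mult_left_mono) simp_all
        finally show ?thesis by simp
      qed
      have ww: "norm ((1/2) *\<^sub>R \<beta> (w x) (w x)) \<le> k * W\<^sup>2"
      proof -
        have "norm (\<beta> (w x) (w x)) \<le> k * W\<^sup>2" using k(2)[of "w x" "w x"] by (simp add: W_def power2_eq_square)
        moreover have "0 \<le> k * W\<^sup>2" using k(1) by simp
        ultimately show ?thesis by simp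
      qed
      have t1: "\<bar>((1/2) *\<^sub>R \<beta> (w x) (w x)) \<bullet> \<beta> c b\<bar> \<le> k\<^sup>2 * norm b * W\<^sup>2"
      proof -
        have "\<bar>((1/2) *\<^sub>R \<beta> (w x) (w x)) \<bullet> \<beta> c b\<bar> \<le> norm ((1/2) *\<^sub>R \<beta> (w x) (w x)) * norm (\<beta> c b)" by (rule Cauchy_Schwarz_ineq2)
        also have "\<dots> \<le> (k * W\<^sup>2) * (k * norm b)" using ww cb k(1) by (intro mult_mono) simp_all
        finally show ?thesis by (simp add: power2_eq_square mult_ac)
      qed
      have XG: "norm (X x + G) \<le> k * (V + 2 * W)"
      proof -
        have "2 * k * \<sigma> * W \<le> 2 * k * 1 * W" using s1 k(1) W by (intro mult_right_mono mult_left_mono) simp_all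
        moreover have "V \<le> k * V" using k(1) V mult_right_mono[of 1 k V] by simp
        ultimately show ?thesis using norm_triangle_ineq[of "X x" G] G unfolding V_def[symmetric] distrib_left by linarith
      qed
      have t2: "\<bar>(X x + G) \<bullet> \<beta> (w x) b\<bar> \<le> k\<^sup>2 * norm b * (3 * W\<^sup>2 + V\<^sup>2)"
      proof -
        have "\<bar>(X x + G) \<bullet> \<beta> (w x) b\<bar> \<le> norm (X x + G) * norm (\<beta> (w x) b)" by (rule Cauchy_Schwarz_ineq2)
        also have "\<dots> \<le> (k * (V + 2 * W)) * (k * W * norm b)" using XG wb k(1) W V by (intro mult_mono) simp_all
        also have "\<dots> = (k\<^sup>2 * norm b) * (W * V + 2 * W\<^sup>2)" by (simp add: power2_eq_square algebra_simps)
        also have "\<dots> \<le> (k\<^sup>2 * norm b) * (3 * W\<^sup>2 + V\<^sup>2)"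
          using mult_le_sum_squares[of W V] by (intro mult_left_mono) simp_all
        finally show ?thesis .
      qed
      have "\<bar>F x \<bullet> \<beta> (a x) b - h x - F0 \<bullet> \<beta> c b\<bar> \<le> k\<^sup>2 * norm b * W\<^sup>2 + k\<^sup>2 * norm b * (3 * W\<^sup>2 + V\<^sup>2)"
        unfolding e using t1 t2 by linarith
      also have "\<dots> = (k\<^sup>2 * norm b) * (4 * W\<^sup>2 + V\<^sup>2)" by (simp add: algebra_simps)
      also have "\<dots> \<le> (k\<^sup>2 * norm b) * (5 * (W\<^sup>2 + V\<^sup>2))" by (intro mult_left_mono) simp_all
      finally show ?case unfolding W_def V_def by (simp add: algebra_simps)
    qed
  qed
  also have "\<dots> = (5 * k\<^sup>2 * norm b) * (LINT x|torus. ?Z x)" by (rule integral_mult_right_zero)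
  also have "\<dots> \<le> (5 * k\<^sup>2 * norm b) * (3 * energy)" by (rule mult_left_mono[OF Z_int(2)]) simp
  finally have "\<bar>(LINT x|torus. F x \<bullet> \<beta> (a x) b) - F0 \<bullet> \<beta> c b\<bar> \<le> (5 * k\<^sup>2 * norm b) * (3 * energy)"
    using fi hi by simp
  then have "\<bar>F0 \<bullet> \<beta> c b\<bar> \<le> N * norm b + (5 * k\<^sup>2 * norm b) * (3 * energy)" using pN by linarith
  then show ?thesis by (simp add: algebra_simps)
qed

lemma E_gf_bound:
  assumes s1: "\<sigma> \<le> 1"
  shows "0 \<le> E_gf br a" "E_gf br a \<le> (norm F0)\<^sup>2 + 20 * k\<^sup>2 * energy"
proof -
  have E: "E_gf br a = (1/2) * (LINT x|torus. (norm (F x))\<^sup>2) + (1/2) * (LINT x|torus. (norm (Y x))\<^sup>2)"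
    by (simp add: E_gf_def curvature_eq codiff_eq)
  have "0 \<le> (LINT x|torus. (norm (F x))\<^sup>2)" "0 \<le> (LINT x|torus. (norm (Y x))\<^sup>2)" by (rule Bochner_Integration.integral_nonneg, simp)+
  then show "0 \<le> E_gf br a" unfolding E by linarith
  have "(LINT x|torus. (norm (F x))\<^sup>2) \<le> (LINT x|torus. 2 * (norm F0)\<^sup>2 + (4 * (norm (X x))\<^sup>2 + 16 * k\<^sup>2 * (norm (w x))\<^sup>2))"
  proof (rule integral_mono_AE[OF sq_int(6)])
    show "integrable torus (\<lambda>x. 2 * (norm F0)\<^sup>2 + (4 * (norm (X x))\<^sup>2 + 16 * k\<^sup>2 * (norm (w x))\<^sup>2))" using sq_int by simp
    show "AE x in torus. (norm (F x))\<^sup>2 \<le> 2 * (norm F0)\<^sup>2 + (4 * (norm (X x))\<^sup>2 + 16 * k\<^sup>2 * (norm (w x))\<^sup>2)"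
      using w_bound
    proof eventually_elim
      case (elim x)
      define G where "G = \<beta> c (w x) + (1/2) *\<^sub>R \<beta> (w x) (w x)"
      have "norm G \<le> 2 * k * \<sigma> * norm (w x)" using G_bound[OF s1 elim] by (simp add: G_def)
      also have "\<dots> \<le> 2 * k * 1 * norm (w x)" using s1 k(1) by (intro mult_right_mono mult_left_mono) simp_all
      finally have "(norm G)\<^sup>2 \<le> (2 * k * 1 * norm (w x))\<^sup>2" by (rule power_mono) simp
      then have G: "(norm G)\<^sup>2 \<le> 4 * k\<^sup>2 * (norm (w x))\<^sup>2" by (simp add: power_mult_distrib)
      have Fx: "F x = F0 + (X x + G)" unfolding F_decompose G_def by (simp add: add.assoc)
      have "4 * k\<^sup>2 * (norm (w x))\<^sup>2 * 4 = 16 * k\<^sup>2 * (norm (w x))\<^sup>2" by simp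
      then show ?case using norm_sq_add_le[of F0 "X x + G"] norm_sq_add_le[of "X x" G] G unfolding Fx by linarith
    qed
  qed
  also have "\<dots> = 2 * (norm F0)\<^sup>2 + (4 * (LINT x|torus. (norm (X x))\<^sup>2) + 16 * k\<^sup>2 * (LINT x|torus. (norm (w x))\<^sup>2))"
    using sq_int by simp
  also have "\<dots> \<le> 2 * (norm F0)\<^sup>2 + (4 * energy + 16 * k\<^sup>2 * (2 * energy))"
    using XY_le(1) w_L2 by (intro add_mono mult_left_mono) simp_all
  finally have F: "(LINT x|torus. (norm (F x))\<^sup>2) \<le> 2 * (norm F0)\<^sup>2 + (4 * energy + 32 * (k\<^sup>2 * energy))" by simp
  have "1 \<le> k\<^sup>2" using k(1) by simp
  then have "energy \<le> k\<^sup>2 * energy" using mult_right_mono[of 1 "k\<^sup>2" energy] energy_nonneg by simp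
  then show "E_gf br a \<le> (norm F0)\<^sup>2 + 20 * k\<^sup>2 * energy"
    unfolding E mult.assoc using F XY_le(2) energy_nonneg by linarith
qed

end

section \<open>The Lojasiewicz exponent\<close>

lemma wedge_bound:
  fixes br :: "'e::{real_inner, banach, heine_borel, second_countable_topology} \<Rightarrow> 'e \<Rightarrow> 'e"
  assumes "bounded_bilinear br"
  obtains k where "1 \<le> k" "\<And>u v. norm (wedge br u v) \<le> k * norm u * norm v"
proof -
  obtain K where K: "\<And>u v. norm (wedge br u v) \<le> norm u * norm v * K"
    using bounded_bilinear.bounded[OF bounded_bilinear_wedge[OF assms]] by blast
  have "norm (wedge br u v) \<le> max 1 K * norm u * norm v" for u v
  proof -
    have "norm u * norm v * K \<le> norm u * norm v * max 1 K" by (intro mult_left_mono) simp_all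
    then show ?thesis using K[of u v] by (simp add: mult_ac)
  qed
  then show ?thesis using that[of "max 1 K"] by simp
qed

text \<open>
  The passage from analysis to algebra: the field enters through its mean \<open>c\<close> and the \<open>L\<^sup>2\<close> norm \<open>r\<close> of its
  derivatives.
\<close>

lemma gauge_field_estimates:
  fixes br :: "'e::{real_inner, banach, heine_borel, second_countable_topology} \<Rightarrow> 'e \<Rightarrow> 'e"
  assumes bil: "bounded_bilinear br" and anti: "\<And>x y. br x y = - br y x" and p: "2 < p"
  shows "\<exists>\<delta>>0. \<exists>k\<ge>1. \<forall>a. W1 p a \<and> W1_norm p a < \<delta> \<longrightarrow>
    (\<exists>c r. 0 \<le> r \<and> r \<le> 1 \<and> r \<le> 12 * W_minus1_norm p (M_gf br a) \<and> 0 \<le> E_gf br a \<and>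
      E_gf br a \<le> (norm (br (fst c) (snd c)))\<^sup>2 + 20 * k\<^sup>2 * r\<^sup>2 \<and>
      (\<forall>b. \<bar>br (fst c) (snd c) \<bullet> wedge br c b\<bar> \<le> norm b * (W_minus1_norm p (M_gf br a) + 15 * k\<^sup>2 * r\<^sup>2)))"
proof -
  obtain k where k: "1 \<le> k" "\<And>u v. norm (wedge br u v) \<le> k * norm u * norm v" using wedge_bound[OF bil] by blast
  define D where "D = 1 + 2 / (1 - 2 / p)"
  have D: "1 \<le> D" using p by (simp add: D_def)
  (* \<open>D\<close> is the Sobolev constant, so that \<open>\<sigma> = D * \<delta>\<close> bounds the field and meets \<open>30 * k\<^sup>2 * \<sigma> \<le> 1\<close> *)
  define \<delta> where "\<delta> = 1 / (30 * k\<^sup>2 * D)"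
  have k2: "1 \<le> k\<^sup>2" using k(1) by simp
  have kD: "1 \<le> k\<^sup>2 * D" using mult_mono[OF k2 D] by simp
  have \<delta>: "\<delta> > 0" "\<delta> \<le> 1 / 30" using kD by (simp_all add: \<delta>_def mult.assoc divide_simps)
  have "\<exists>c r. 0 \<le> r \<and> r \<le> 1 \<and> r \<le> 12 * W_minus1_norm p (M_gf br a) \<and> 0 \<le> E_gf br a \<and>
      E_gf br a \<le> (norm (br (fst c) (snd c)))\<^sup>2 + 20 * k\<^sup>2 * r\<^sup>2 \<and>
      (\<forall>b. \<bar>br (fst c) (snd c) \<bullet> wedge br c b\<bar> \<le> norm b * (W_minus1_norm p (M_gf br a) + 15 * k\<^sup>2 * r\<^sup>2))"
    if small: "W1 p a" "W1_norm p a < \<delta>" for a :: "'e form1"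
  proof -
    have gf: "gauge_field br a p (D * \<delta>) k"
      using sobolev_sup_bound(1)[OF p small] by (intro gauge_field.intro bil anti p small(1) k) (simp add: D_def)
    interpret gauge_field br a p "D * \<delta>" k by (rule gf)
    have s: "30 * k\<^sup>2 * (D * \<delta>) \<le> 1" using kD by (simp add: \<delta>_def)
    have s1: "D * \<delta> \<le> 1"
    proof -
      have "D * \<delta> \<le> k\<^sup>2 * (D * \<delta>)" using k2 \<sigma>_nonneg mult_right_mono[of 1 "k\<^sup>2" "D * \<delta>"] by simp
      then show ?thesis using s \<sigma>_nonneg by linarith
    qed
    have F0: "F0 = br (fst c) (snd c)"
    proof -
      have "wedge br c c = 2 *\<^sub>R br (fst c) (snd c)" using anti[of "snd c" "fst c"] by (simp add: wedge_def scaleR_2)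
      then show ?thesis by (simp add: F0_def)
    qed
    have "energy \<le> 3 * \<delta>\<^sup>2" unfolding energy_def by (rule sobolev_sup_bound(2)[OF \<open>2 < p\<close> small])
    also have "\<dots> \<le> 3 * (1 / 30)\<^sup>2" using \<delta> by (intro mult_left_mono power_mono) simp_all
    also have "\<dots> \<le> 1" by (simp add: power2_eq_square)
    finally have "sqrt energy \<le> 1" by simp
    then show ?thesis
      using gradient_estimate[OF s] E_gf_bound[OF s1] constant_test_estimate[OF s1] energy_nonneg
      unfolding F0 N_def by (intro exI[of _ c] exI[of _ "sqrt energy"]) simp
  qed
  then show ?thesis using \<delta>(1) k(1) by blast
qed

lemma E_gf_zero:
  fixes br :: "'e::{real_inner, banach, heine_borel, second_countable_topology} \<Rightarrow> 'e \<Rightarrow> 'e"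
  assumes bil: "bounded_bilinear br" and anti: "\<And>x y. br x y = - br y x" and p: "2 < (p::real)"
  shows "E_gf br (\<lambda>_. 0) = 0"
proof -
  interpret Z: weak_gradient "\<lambda>_. 0 :: 'e \<times> 'e" "\<lambda>_. 0" "\<lambda>_. 0" by (rule weak_gradient_const)
  have W: "W1 p (\<lambda>_. 0 :: 'e \<times> 'e)" by (rule Z.W1I) simp_all
  obtain k where k: "1 \<le> k" "\<And>u v. norm (wedge br u v) \<le> k * norm u * norm v" using wedge_bound[OF bil] by blast
  interpret gauge_field br "\<lambda>_. 0" p 0 k by (intro gauge_field.intro bil anti p W k) simp
  have "energy = (LINT x|torus. 0)"
    unfolding energy_def
  proof (rule integral_cong_AE)
    show "AE x in torus. (norm (A1 x))\<^sup>2 + (norm (A2 x))\<^sup>2 = 0"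
      using Z.wpartial_AE by eventually_elim simp
    have "A1 \<in> borel_measurable torus" "A2 \<in> borel_measurable torus"
      using A.u1 A.u2 by (simp_all add: Lq_1 measurable_torus)
    then show "(\<lambda>x. (norm (A1 x))\<^sup>2 + (norm (A2 x))\<^sup>2) \<in> borel_measurable torus" by measurable
  qed simp
  moreover have "c = 0" using c_bound by simp
  then have "F0 = 0" by (simp add: F0_def \<beta>.zero_left)
  ultimately show ?thesis using E_gf_bound by simp
qed

lemma abelian_inequality:
  fixes br :: "'e::{real_inner, banach, heine_borel, second_countable_topology} \<Rightarrow> 'e \<Rightarrow> 'e"
  assumes bil: "bounded_bilinear br" and ab: "abelian_bracket br" and p: "2 < p"
  shows "\<exists>C>0. \<exists>\<delta>>0. \<forall>a. W1 p a \<and> W1_norm p a < \<delta> \<longrightarrow> W_minus1_norm p (M_gf br a) \<ge> C * \<bar>E_gf br a\<bar> powr (1/2)"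
proof -
  have z: "br x y = 0" for x y using ab by (simp add: abelian_bracket_def)
  have anti: "br x y = - br y x" for x y by (simp add: z)
  obtain \<delta> k where \<delta>: "\<delta> > 0" "1 \<le> k" and est: "\<And>a. W1 p a \<and> W1_norm p a < \<delta> \<Longrightarrow>
    (\<exists>c r. 0 \<le> r \<and> r \<le> 1 \<and> r \<le> 12 * W_minus1_norm p (M_gf br a) \<and> 0 \<le> E_gf br a \<and>
      E_gf br a \<le> (norm (br (fst c) (snd c)))\<^sup>2 + 20 * k\<^sup>2 * r\<^sup>2 \<and>
      (\<forall>b. \<bar>br (fst c) (snd c) \<bullet> wedge br c b\<bar> \<le> norm b * (W_minus1_norm p (M_gf br a) + 15 * k\<^sup>2 * r\<^sup>2)))"
    using gauge_field_estimates[OF bil anti p] by blast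
  have "W_minus1_norm p (M_gf br a) \<ge> (1 / (60 * k)) * \<bar>E_gf br a\<bar> powr (1/2)" if a: "W1 p a \<and> W1_norm p a < \<delta>" for a
  proof -
    obtain r where r: "0 \<le> r" "r \<le> 12 * W_minus1_norm p (M_gf br a)" "0 \<le> E_gf br a" "E_gf br a \<le> 20 * k\<^sup>2 * r\<^sup>2"
      using est[OF a] by (auto simp: z)
    have "20 * k\<^sup>2 * r\<^sup>2 \<le> (5 * k * r)\<^sup>2" by (simp add: power_mult_distrib)
    then have "E_gf br a \<le> (5 * k * r)\<^sup>2" using r(4) by linarith
    then have "sqrt (E_gf br a) \<le> 5 * k * r" using \<delta>(2) r(1) by (intro real_le_lsqrt) simp_all
    also have "\<dots> \<le> 5 * k * (12 * W_minus1_norm p (M_gf br a))" using r(2) \<delta>(2) by (intro mult_left_mono) simp_all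
    finally have "sqrt (E_gf br a) \<le> 60 * k * W_minus1_norm p (M_gf br a)" by simp
    then have "\<bar>E_gf br a\<bar> powr (1/2) \<le> W_minus1_norm p (M_gf br a) * (60 * k)" using r(3) by (simp add: powr_half_sqrt mult_ac)
    then have "\<bar>E_gf br a\<bar> powr (1/2) / (60 * k) \<le> W_minus1_norm p (M_gf br a)" using \<delta>(2) by (subst pos_divide_le_eq) simp_all
    then show ?thesis by simp
  qed
  then show ?thesis using \<delta> by (intro exI[of _ "1 / (60 * k)"] conjI exI[of _ \<delta>]) simp_all
qed

text \<open>
  With \<open>H = [c\<^sub>1, c\<^sub>2]\<close>, the test fields \<open>(0, [c\<^sub>1, H])\<close> and \<open>([c\<^sub>2, H], 0)\<close> give \<open>|[c\<^sub>1, H]|\<^sup>2\<close> and \<open>|[c\<^sub>2, H]|\<^sup>2\<close> up to sign,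
  because \<open>ad\<close> is skew.  Thus both double brackets are bounded by the norm of the gradient.
\<close>

lemma nonabelian_inequality:
  fixes br :: "'e::{real_inner, banach, heine_borel, second_countable_topology} \<Rightarrow> 'e \<Rightarrow> 'e"
  assumes L: "local_adjoint_action br A N e0" and p: "2 < p"
  shows "\<exists>C>0. \<exists>\<delta>>0. \<forall>a. W1 p a \<and> W1_norm p a < \<delta> \<longrightarrow> \<bar>E_gf br a\<bar> powr (3/4) \<le> C * W_minus1_norm p (M_gf br a)"
proof -
  interpret local_adjoint_action br A N e0 by fact
  obtain \<delta> k where \<delta>: "\<delta> > 0" "1 \<le> k" and est: "\<And>a. W1 p a \<and> W1_norm p a < \<delta> \<Longrightarrow>
    (\<exists>c r. 0 \<le> r \<and> r \<le> 1 \<and> r \<le> 12 * W_minus1_norm p (M_gf br a) \<and> 0 \<le> E_gf br a \<and>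
      E_gf br a \<le> (norm (br (fst c) (snd c)))\<^sup>2 + 20 * k\<^sup>2 * r\<^sup>2 \<and>
      (\<forall>b. \<bar>br (fst c) (snd c) \<bullet> wedge br c b\<bar> \<le> norm b * (W_minus1_norm p (M_gf br a) + 15 * k\<^sup>2 * r\<^sup>2)))"
    using gauge_field_estimates[OF br_bounded_bilinear br_antisym p] by blast
  obtain C where C: "C > 0" "\<And>x y m. norm (br x (br x y)) \<le> m \<Longrightarrow> norm (br y (br x y)) \<le> m \<Longrightarrow> norm (br x y) powr (3/2) \<le> C * m"
    using bracket_lojasiewicz by blast
  define K where "K = 2 * (C * (1 + 180 * k\<^sup>2) + (20 * k\<^sup>2) powr (3/4) * 12)"
  have K: "K > 0" using C(1) by (simp add: K_def add_pos_nonneg)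
  have "\<bar>E_gf br a\<bar> powr (3/4) \<le> K * W_minus1_norm p (M_gf br a)" if a: "W1 p a \<and> W1_norm p a < \<delta>" for a
  proof -
    define n where "n = W_minus1_norm p (M_gf br a)"
    obtain c r where r: "0 \<le> r" "r \<le> 1" "r \<le> 12 * n" "0 \<le> E_gf br a"
      and E: "E_gf br a \<le> (norm (br (fst c) (snd c)))\<^sup>2 + 20 * k\<^sup>2 * r\<^sup>2"
      and t: "\<And>b. \<bar>br (fst c) (snd c) \<bullet> wedge br c b\<bar> \<le> norm b * (n + 15 * k\<^sup>2 * r\<^sup>2)"
      using est[OF a] unfolding n_def by blast
    define H where "H = br (fst c) (snd c)"
    define m where "m = n + 15 * k\<^sup>2 * r\<^sup>2"
    have n0: "0 \<le> n" using r by linarith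
    have m0: "0 \<le> m" using n0 by (simp add: m_def)
    have le_m: "norm z \<le> m" if "z \<bullet> z \<le> norm z * m" for z :: 'e
    proof (cases "norm z = 0")
      case False
      then show ?thesis using that by (simp add: dot_square_norm power2_eq_square)
    qed (use m0 in simp)
    (* the test fields are chosen such that the left-hand side of \<open>t\<close> becomes a square *)
    have 1: "norm (br (fst c) H) \<le> m"
    proof (rule le_m)
      have "H \<bullet> wedge br c (0, br (fst c) H) = H \<bullet> br (fst c) (br (fst c) H)"
        by (simp add: wedge_def br.zero_right)
      also have "\<dots> = - (br (fst c) H \<bullet> br (fst c) H)" using br_skew[of "fst c" H "br (fst c) H"] by simp
      finally show "br (fst c) H \<bullet> br (fst c) H \<le> norm (br (fst c) H) * m"
        using t[of "(0, br (fst c) H)"] unfolding H_def[symmetric] m_def[symmetric] by (simp add: norm_Pair)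
    qed
    have 2: "norm (br (snd c) H) \<le> m"
    proof (rule le_m)
      have "H \<bullet> wedge br c (br (snd c) H, 0) = - (H \<bullet> br (snd c) (br (snd c) H))"
        by (simp add: wedge_def br.zero_right)
      also have "\<dots> = br (snd c) H \<bullet> br (snd c) H" using br_skew[of "snd c" H "br (snd c) H"] by simp
      finally show "br (snd c) H \<bullet> br (snd c) H \<le> norm (br (snd c) H) * m"
        using t[of "(br (snd c) H, 0)"] unfolding H_def[symmetric] m_def[symmetric] by (simp add: norm_Pair)
    qed
    have HC: "norm H powr (3/2) \<le> C * m" using C(2)[OF 1[unfolded H_def] 2[unfolded H_def]] by (simp add: H_def)
    have rr: "r\<^sup>2 \<le> r" using r by (simp add: power2_eq_square mult_left_le)
    have mn: "m \<le> (1 + 180 * k\<^sup>2) * n"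
    proof -
      have "15 * k\<^sup>2 * r\<^sup>2 \<le> 15 * k\<^sup>2 * (12 * n)" using rr r(3) by (intro mult_left_mono) simp_all
      then show ?thesis unfolding m_def by (simp add: algebra_simps)
    qed
    have "E_gf br a powr (3/4) \<le> ((norm H)\<^sup>2 + 20 * k\<^sup>2 * r\<^sup>2) powr (3/4)"
      using E r(4) by (intro powr_mono2) (simp_all add: H_def)
    also have "\<dots> \<le> 2 powr (3/4) * (((norm H)\<^sup>2) powr (3/4) + (20 * k\<^sup>2 * r\<^sup>2) powr (3/4))"
      by (rule powr_add_le_double) simp_all
    also have "\<dots> \<le> 2 * (((norm H)\<^sup>2) powr (3/4) + (20 * k\<^sup>2 * r\<^sup>2) powr (3/4))"
    proof (rule mult_right_mono)
      have "2 powr (3/4) \<le> (2::real) powr 1" by (intro powr_mono) simp_all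
      then show "2 powr (3/4) \<le> (2::real)" by simp
    qed simp
    also have "((norm H)\<^sup>2) powr (3/4) = norm H powr (3/2)"
    proof -
      have "((norm H)\<^sup>2) powr (3/4) = (norm H powr 2) powr (3/4)" by (simp add: powr_numeral)
      then show ?thesis by (simp only: powr_powr) simp
    qed
    also have "(20 * k\<^sup>2 * r\<^sup>2) powr (3/4) = (20 * k\<^sup>2) powr (3/4) * r powr (3/2)"
    proof -
      have "(r\<^sup>2) powr (3/4) = (r powr 2) powr (3/4)" using r(1) by (simp add: powr_numeral)
      also have "\<dots> = r powr (3/2)" by (simp only: powr_powr) simp
      finally show ?thesis by (simp add: powr_mult)
    qed
    also have "r powr (3/2) \<le> 12 * n"
    proof -
      have "r powr (3/2) \<le> r powr 1" using r by (intro powr_mono') simp_all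
      then show ?thesis using r by simp
    qed
    also have "norm H powr (3/2) \<le> C * ((1 + 180 * k\<^sup>2) * n)"
      using HC mult_left_mono[OF mn, of C] C(1) by linarith
    finally have "E_gf br a powr (3/4) \<le> 2 * (C * ((1 + 180 * k\<^sup>2) * n) + (20 * k\<^sup>2) powr (3/4) * (12 * n))"
      by (simp add: mult_left_mono)
    then show ?thesis using r(4) by (simp add: K_def n_def algebra_simps)
  qed
  then show ?thesis using K \<delta>(1) by blast
qed

text \<open>
  At a constant field the gradient sees only the mean of the test field, as weak derivatives have mean zero.
\<close>

lemma constant_field_values:
  fixes br :: "'e::{real_inner, banach, heine_borel, second_countable_topology} \<Rightarrow> 'e \<Rightarrow> 'e"
  assumes bil: "bounded_bilinear br" and anti: "\<And>x y. br x y = - br y x" and p: "2 < p"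
    and k: "1 \<le> k" "\<And>u v. norm (wedge br u v) \<le> k * norm u * norm v"
  shows "W1 p (\<lambda>_. u)" "W1_norm p (\<lambda>_. u) = norm u" "E_gf br (\<lambda>_. u) = (norm (br (fst u) (snd u)))\<^sup>2 / 2"
    "W_minus1_norm p (M_gf br (\<lambda>_. u)) \<le> 2 * k * norm u * norm (br (fst u) (snd u))"
proof -
  interpret Z: weak_gradient "\<lambda>_. u" "\<lambda>_. 0" "\<lambda>_. 0" by (rule weak_gradient_const)
  show W: "W1 p (\<lambda>_. u)" by (rule Z.W1I) simp_all
  show "W1_norm p (\<lambda>_. u) = norm u"
    using p unfolding Z.W1_norm_eq by (simp add: grad_energy_def powr_powr)
  interpret gauge_field br "\<lambda>_. u" p "norm u" k by (intro gauge_field.intro bil anti p W k) simp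
  define H where "H = br (fst u) (snd u)"
  have w0: "w x = 0" for x by (simp add: w_def c_def A.avg_def)
  have XY0: "AE x in torus. X x = 0 \<and> Y x = 0"
    using Z.wpartial_AE by eventually_elim (simp add: X_def Y_def)
  have Hu: "(1/2) *\<^sub>R \<beta> u u = H"
  proof -
    have "\<beta> u u = 2 *\<^sub>R H" using anti[of "snd u" "fst u"] by (simp add: wedge_def H_def scaleR_2)
    then show ?thesis by simp
  qed
  have FH: "AE x in torus. F x = H \<and> Y x = 0" using XY0 by eventually_elim (simp add: F_def Hu)
  have m[measurable]: "F \<in> borel_measurable torus" "Y \<in> borel_measurable torus" using Lq_2(1,3) by (simp_all add: Lq2_iff measurable_torus)
  have "(LINT x|torus. (norm (F x))\<^sup>2) = (LINT x|torus. (norm H)\<^sup>2)"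
    by (rule integral_cong_AE) (use FH in \<open>auto elim: eventually_mono\<close>)
  moreover have "(LINT x|torus. (norm (Y x))\<^sup>2) = (LINT x|torus. 0)"
    by (rule integral_cong_AE) (use FH in \<open>auto elim: eventually_mono\<close>)
  ultimately show "E_gf br (\<lambda>_. u) = (norm (br (fst u) (snd u)))\<^sup>2 / 2"
    by (simp add: E_gf_def curvature_eq codiff_eq H_def)
  show "W_minus1_norm p (M_gf br (\<lambda>_. u)) \<le> 2 * k * norm u * norm (br (fst u) (snd u))"
    unfolding W_minus1_norm_def Let_def q_def[symmetric]
  proof (rule cSUP_least)
    have "(\<lambda>_. 0) \<in> {b :: 'e form1. W1 q b \<and> W1_norm q b \<le> 1}"
    proof -
      interpret O: weak_gradient "\<lambda>_. 0 :: 'e \<times> 'e" "\<lambda>_. 0" "\<lambda>_. 0" by (rule weak_gradient_const)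
      show ?thesis using q O.W1I[of q] by (simp add: O.W1_norm_eq grad_energy_def)
    qed
    then show "{b :: 'e form1. W1 q b \<and> W1_norm q b \<le> 1} \<noteq> {}" by blast
    fix b :: "'e form1" assume "b \<in> {b. W1 q b \<and> W1_norm q b \<le> 1}"
    then have b: "W1 q b" "W1_norm q b \<le> 1" by simp_all
    have q1: "1 \<le> q" using q by simp
    let ?B1 = "wpartial (1, 0) b" and ?B2 = "wpartial (0, 1) b"
    have g: "weak_gradient b ?B1 ?B2" by (rule W1_weak_gradient[OF b(1) q1])
    interpret B: weak_gradient b ?B1 ?B2 by (rule g)
    have bi: "integrable torus b" "integrable torus ?B1" "integrable torus ?B2" using B.f B.u1 B.u2 by (simp_all add: Lq_1)
    have bm[measurable]: "b \<in> borel_measurable torus" "?B1 \<in> borel_measurable torus" "?B2 \<in> borel_measurable torus"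
      using bi by auto
    have [measurable]: "(\<lambda>x. fst (?B1 x)) \<in> borel_measurable torus" "(\<lambda>x. snd (?B1 x)) \<in> borel_measurable torus"
      "(\<lambda>x. fst (?B2 x)) \<in> borel_measurable torus" "(\<lambda>x. snd (?B2 x)) \<in> borel_measurable torus"
      by (rule measurable_compose[OF bm(2) fst_snd_borel(1)] measurable_compose[OF bm(2) fst_snd_borel(2)]
        measurable_compose[OF bm(3) fst_snd_borel(1)] measurable_compose[OF bm(3) fst_snd_borel(2)])+
    have [measurable]: "(\<lambda>x. \<beta> u (b x)) \<in> borel_measurable torus" by (rule \<beta>_measurable) measurable
    have pi: "integrable torus (\<lambda>x. snd (?B1 x))" "integrable torus (\<lambda>x. fst (?B2 x))" "integrable torus (\<lambda>x. \<beta> u (b x))"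
      by (rule integrable_bounded_linear[OF bounded_linear_snd bi(2)] integrable_bounded_linear[OF bounded_linear_fst bi(3)]
          integrable_bounded_linear[OF \<beta>.bounded_linear_right bi(1)])+
    have "M_gf br (\<lambda>_. u) b = pairing b ?B1 ?B2" by (rule M_eq_pairing[OF g])
    also have "\<dots> = (LINT x|torus. H \<bullet> (snd (?B1 x) - fst (?B2 x) + \<beta> u (b x))) + (LINT x|torus. 0)"
      unfolding pairing_def
    proof (intro arg_cong2[where f="(+)"] integral_cong_AE)
      show "AE x in torus. F x \<bullet> (snd (?B1 x) - fst (?B2 x) + \<beta> u (b x)) = H \<bullet> (snd (?B1 x) - fst (?B2 x) + \<beta> u (b x))"
        using FH by eventually_elim simp
      show "AE x in torus. Y x \<bullet> - (fst (?B1 x) + snd (?B2 x)) = 0" using FH by eventually_elim simp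
    qed measurable
    also have "\<dots> = H \<bullet> (LINT x|torus. snd (?B1 x) - fst (?B2 x) + \<beta> u (b x))"
      using pi by (subst integral_inner_const(1)) simp_all
    also have "(LINT x|torus. snd (?B1 x) - fst (?B2 x) + \<beta> u (b x)) = (LINT x|torus. snd (?B1 x)) - (LINT x|torus. fst (?B2 x)) + (LINT x|torus. \<beta> u (b x))"
      using pi by simp
    also have "\<dots> = \<beta> u (LINT x|torus. b x)"
      unfolding integral_bounded_linear[OF bounded_linear_snd bi(2)] integral_bounded_linear[OF bounded_linear_fst bi(3)]
        integral_bounded_linear[OF \<beta>.bounded_linear_right bi(1)] B.integral_gradient_0 by simp
    finally have M: "M_gf br (\<lambda>_. u) b = H \<bullet> \<beta> u (LINT x|torus. b x)" .
    have "norm (LINT x|torus. b x) \<le> 2"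
    proof -
      have "grad_energy q b ?B1 ?B2 powr (1 / q) \<le> 1" using b(2) by (simp add: B.W1_norm_eq)
      then have "(grad_energy q b ?B1 ?B2 powr (1 / q)) powr q \<le> 1 powr q" using q by (intro powr_mono2) simp_all
      then have e: "grad_energy q b ?B1 ?B2 \<le> 1" using q grad_energy_nonneg[of q b ?B1 ?B2] by (simp add: powr_powr)
      have bs: "(1, 0) \<in> (Basis :: (real \<times> real) set)" "(0, 1) \<in> (Basis :: (real \<times> real) set)" by (simp_all add: Basis_prod_def)
      have ei: "integrable torus (\<lambda>x. norm (b x) powr q + (norm (?B1 x) powr q + norm (?B2 x) powr q))"
        using b(1) W1_wpartial(1)[OF b(1) q1 bs(1)] W1_wpartial(1)[OF b(1) q1 bs(2)] by (simp add: W1_def Lq_def)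
      have "norm (LINT x|torus. b x) \<le> (LINT x|torus. norm (b x))" by (rule integral_norm_bound)
      also have "\<dots> \<le> (LINT x|torus. 1 + (norm (b x) powr q + (norm (?B1 x) powr q + norm (?B2 x) powr q)))"
      proof (rule integral_mono)
        fix x
        have "norm (b x) powr 1 \<le> 1 + norm (b x) powr q" using q by (intro powr_le_1_plus) simp_all
        then show "norm (b x) \<le> 1 + (norm (b x) powr q + (norm (?B1 x) powr q + norm (?B2 x) powr q))"
          using powr_ge_zero[of "norm (?B1 x)" q] powr_ge_zero[of "norm (?B2 x)" q] norm_ge_zero[of "b x"] by (simp only: powr_one)
      qed (use bi(1) ei in simp_all)
      also have "\<dots> = 1 + grad_energy q b ?B1 ?B2"
        unfolding grad_energy_def by (subst Bochner_Integration.integral_add[OF _ ei]) simp_all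
      finally show ?thesis using e by linarith
    qed
    then have "norm (\<beta> u (LINT x|torus. b x)) \<le> k * norm u * 2"
      using k(2)[of u "LINT x|torus. b x"] mult_left_mono[OF _ mult_nonneg_nonneg[of k "norm u"], of "norm (LINT x|torus. b x)" 2] k(1) by (auto intro: order_trans)
    then have "norm H * norm (\<beta> u (LINT x|torus. b x)) \<le> norm H * (k * norm u * 2)" by (rule mult_left_mono) simp
    then show "\<bar>M_gf br (\<lambda>_. u) b\<bar> \<le> 2 * k * norm u * norm (br (fst u) (snd u))"
      unfolding M H_def[symmetric] using Cauchy_Schwarz_ineq2[of H "\<beta> u (LINT x|torus. b x)"] by (simp add: mult_ac)
  qed
qed

text \<open>
  On the fields \<open>t u\<close> with \<open>u = (x, y)\<close> and \<open>[x, y] \<noteq> 0\<close>, the inequality compares \<open>t\<^sup>4\<^sup>\<theta>\<close> with \<open>t\<^sup>3\<close>; let \<open>t\<close> tend to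
  zero.
\<close>

lemma exponent_lower_bound:
  fixes br :: "'e::{real_inner, banach, heine_borel, second_countable_topology} \<Rightarrow> 'e \<Rightarrow> 'e"
  assumes bil: "bounded_bilinear br" and anti: "\<And>x y. br x y = - br y x" and p: "2 < p"
    and na: "\<not> abelian_bracket br" and C: "C > 0" and \<delta>: "\<delta> > 0"
    and ineq: "\<And>a. W1 p a \<and> W1_norm p a < \<delta> \<Longrightarrow> W_minus1_norm p (M_gf br a) \<ge> C * \<bar>E_gf br a\<bar> powr \<theta>"
  shows "3/4 \<le> \<theta>"
proof (rule ccontr)
  assume th: "\<not> 3/4 \<le> \<theta>"
  obtain x y where xy: "br x y \<noteq> 0" using na by (auto simp: abelian_bracket_def)
  obtain k where k: "1 \<le> k" "\<And>u v. norm (wedge br u v) \<le> k * norm u * norm v" using wedge_bound[OF bil] by blast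
  interpret br: bounded_bilinear br by (rule bil)
  define u where "u = (x, y)"
  define h where "h = norm (br x y)"
  have h: "h > 0" using xy by (simp add: h_def)
  have u: "norm u > 0" using xy by (auto simp: u_def br.zero_left zero_prod_def)
  note cf = constant_field_values[OF bil anti p k]
  have key: "C * (h\<^sup>2 / 2) powr \<theta> \<le> (2 * k * norm u * h) * t powr (3 - 4 * \<theta>)" if t: "0 < t" "t < \<delta> / norm u" for t
  proof -
    have "W1_norm p (\<lambda>_. t *\<^sub>R u) < \<delta>" using t u unfolding cf(2) by (simp add: pos_less_divide_eq)
    then have "C * \<bar>E_gf br (\<lambda>_. t *\<^sub>R u)\<bar> powr \<theta> \<le> W_minus1_norm p (M_gf br (\<lambda>_. t *\<^sub>R u))" using ineq cf(1) by blast
    also have "\<dots> \<le> 2 * k * norm (t *\<^sub>R u) * norm (br (fst (t *\<^sub>R u)) (snd (t *\<^sub>R u)))" by (rule cf(4))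
    also have "norm (br (fst (t *\<^sub>R u)) (snd (t *\<^sub>R u))) = t\<^sup>2 * h"
      by (simp add: u_def h_def br.scaleR_left br.scaleR_right power2_eq_square)
    also have "E_gf br (\<lambda>_. t *\<^sub>R u) = t powr 4 * (h\<^sup>2 / 2)"
      using t unfolding cf(3) by (simp add: u_def h_def br.scaleR_left br.scaleR_right power_mult_distrib power2_eq_square powr_numeral power4_eq_xxxx)
    also have "\<bar>t powr 4 * (h\<^sup>2 / 2)\<bar> powr \<theta> = t powr (4 * \<theta>) * (h\<^sup>2 / 2) powr \<theta>"
    proof -
      have "\<bar>t powr 4 * (h\<^sup>2 / 2)\<bar> = t powr 4 * (h\<^sup>2 / 2)" by simp
      then show ?thesis by (simp only: powr_mult powr_powr)
    qed
    also have "2 * k * norm (t *\<^sub>R u) * (t\<^sup>2 * h) = (2 * k * norm u * h) * t powr 3"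
      using t by (simp add: powr_numeral power2_eq_square power3_eq_cube)
    also have "t powr 3 = t powr (4 * \<theta>) * t powr (3 - 4 * \<theta>)" by (simp add: powr_add[symmetric])
    finally have "t powr (4 * \<theta>) * (C * (h\<^sup>2 / 2) powr \<theta>) \<le> t powr (4 * \<theta>) * ((2 * k * norm u * h) * t powr (3 - 4 * \<theta>))"
      by (simp add: mult_ac)
    then show ?thesis using t by (simp only: mult_le_cancel_left_pos powr_gt_zero)
  qed
  have "((\<lambda>t. (2 * k * norm u * h) * t powr (3 - 4 * \<theta>)) \<longlongrightarrow> (2 * k * norm u * h) * 0) (at_right 0)"
  proof (intro tendsto_mult tendsto_const)
    have "((\<lambda>t. t powr (3 - 4 * \<theta>)) \<longlongrightarrow> 0 powr (3 - 4 * \<theta>)) (at_right (0::real))"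
      using th by (intro tendsto_powr' tendsto_const tendsto_ident_at) (auto simp: eventually_at_right_less eventually_at_filter)
    then show "((\<lambda>t. t powr (3 - 4 * \<theta>)) \<longlongrightarrow> 0) (at_right (0::real))" using th by simp
  qed
  moreover have "\<forall>\<^sub>F t in at_right 0. C * (h\<^sup>2 / 2) powr \<theta> \<le> (2 * k * norm u * h) * t powr (3 - 4 * \<theta>)"
    unfolding eventually_at_right_field using key \<delta> u by (intro exI[of _ "\<delta> / norm u"]) simp
  ultimately have "C * (h\<^sup>2 / 2) powr \<theta> \<le> (2 * k * norm u * h) * 0" by (rule tendsto_lowerbound) simp
  moreover have "0 < C * (h\<^sup>2 / 2) powr \<theta>" using C h by (intro mult_pos_pos) simp_all
  ultimately show False by simp
qed

theorem theorem4p5: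
  fixes G :: "('g, 'm) monoid_scheme"
    and T :: "'g topology"
    and \<A> :: "('g set \<times>
      ('g \<Rightarrow> 'e::{real_inner, banach, heine_borel, second_countable_topology})) set"
    and U :: "'g set" and \<phi> :: "'g \<Rightarrow> 'e"
    and p :: real
  assumes "lie_group G T \<A>" and "compact_space T"
    and "(U, \<phi>) \<in> \<A>" and "\<one>\<^bsub>G\<^esub> \<in> U"
    and Ad_invariant: "\<And>g x y. g \<in> carrier G \<Longrightarrow> Ad G (U, \<phi>) g x \<bullet> Ad G (U, \<phi>) g y = x \<bullet> y"
    and "p > 2"
  defines "br \<equiv> lie_bracket G (U, \<phi>)"
  shows "(abelian_bracket br \<longrightarrow> theta_LS p (E_gf br) (M_gf br) = ereal (1/2))
    \<and> (\<not> abelian_bracket br \<longrightarrow>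
         (\<exists>C>0. \<exists>\<epsilon>>0. \<forall>a. W1 p a \<and> W1_norm p a < \<epsilon> \<longrightarrow>
            \<bar>E_gf br a - E_gf br (\<lambda>_. 0)\<bar> powr (3/4) \<le> C * W_minus1_norm p (M_gf br a))
         \<and> theta_LS p (E_gf br) (M_gf br) = ereal (3/4))"
proof -
  interpret lie_group_chart G T \<A> U \<phi>
    using assms(1,3,4) by (simp add: lie_group_chart_def lie_group_chart_axioms_def)
  have "br = lie_group_chart.br G U \<phi>" unfolding assms(7) by (rule lie_group_chart.br_def[OF lie_group_chart_axioms, symmetric])
  then have L: "local_adjoint_action br Adc N e0" using local_adjoint_action[OF Ad_invariant] by simp
  interpret L: local_adjoint_action br Adc N e0 by (rule L)
  have inf_eq: "theta_LS p (E_gf br) (M_gf br) = ereal t"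
    if t: "1/2 \<le> t" "t < 1" and mem: "\<exists>C>0. \<exists>\<delta>>0. \<forall>a. W1 p a \<and> W1_norm p a < \<delta> \<longrightarrow> W_minus1_norm p (M_gf br a) \<ge> C * \<bar>E_gf br a\<bar> powr t"
      and low: "\<And>\<theta>. 1/2 \<le> \<theta> \<Longrightarrow> \<exists>C>0. \<exists>\<delta>>0. \<forall>a. W1 p a \<and> W1_norm p a < \<delta> \<longrightarrow> W_minus1_norm p (M_gf br a) \<ge> C * \<bar>E_gf br a\<bar> powr \<theta> \<Longrightarrow> t \<le> \<theta>"
    for t
    unfolding theta_LS_def
  proof (rule antisym)
    show "Inf (ereal ` {\<theta>. 1/2 \<le> \<theta> \<and> \<theta> < 1 \<and> (\<exists>C>0. \<exists>\<delta>>0. \<forall>a. W1 p a \<and> W1_norm p a < \<delta> \<longrightarrow>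
        W_minus1_norm p (M_gf br a) \<ge> C * \<bar>E_gf br a\<bar> powr \<theta>)}) \<le> ereal t"
      by (rule Inf_lower) (use t mem in blast)
    show "ereal t \<le> Inf (ereal ` {\<theta>. 1/2 \<le> \<theta> \<and> \<theta> < 1 \<and> (\<exists>C>0. \<exists>\<delta>>0. \<forall>a. W1 p a \<and> W1_norm p a < \<delta> \<longrightarrow>
        W_minus1_norm p (M_gf br a) \<ge> C * \<bar>E_gf br a\<bar> powr \<theta>)})"
    proof (rule Inf_greatest)
      fix s assume "s \<in> ereal ` {\<theta>. 1/2 \<le> \<theta> \<and> \<theta> < 1 \<and> (\<exists>C>0. \<exists>\<delta>>0. \<forall>a. W1 p a \<and> W1_norm p a < \<delta> \<longrightarrow>
        W_minus1_norm p (M_gf br a) \<ge> C * \<bar>E_gf br a\<bar> powr \<theta>)}"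
      then obtain \<theta> where s: "s = ereal \<theta>" and "1/2 \<le> \<theta>" "\<exists>C>0. \<exists>\<delta>>0. \<forall>a. W1 p a \<and> W1_norm p a < \<delta> \<longrightarrow>
        W_minus1_norm p (M_gf br a) \<ge> C * \<bar>E_gf br a\<bar> powr \<theta>" by blast
      then show "ereal t \<le> s" using low[of \<theta>] by simp
    qed
  qed
  show ?thesis
  proof (intro conjI impI)
    assume ab: "abelian_bracket br"
    show "theta_LS p (E_gf br) (M_gf br) = ereal (1/2)"
      by (rule inf_eq[OF _ _ abelian_inequality[OF L.br_bounded_bilinear ab assms(6)]]) simp_all
  next
    obtain C \<delta> where C: "C > 0" "\<delta> > 0" "\<And>a. W1 p a \<and> W1_norm p a < \<delta> \<Longrightarrow> \<bar>E_gf br a\<bar> powr (3/4) \<le> C * W_minus1_norm p (M_gf br a)"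
      using nonabelian_inequality[OF L assms(6)] by blast
    have E0: "E_gf br (\<lambda>_. 0) = 0" by (rule E_gf_zero[OF L.br_bounded_bilinear L.br_antisym assms(6)])
    show "\<exists>C>0. \<exists>\<epsilon>>0. \<forall>a. W1 p a \<and> W1_norm p a < \<epsilon> \<longrightarrow>
            \<bar>E_gf br a - E_gf br (\<lambda>_. 0)\<bar> powr (3/4) \<le> C * W_minus1_norm p (M_gf br a)"
      unfolding E0 diff_0_right using C by blast
    assume na: "\<not> abelian_bracket br"
    show "theta_LS p (E_gf br) (M_gf br) = ereal (3/4)"
    proof (rule inf_eq)
      have "W_minus1_norm p (M_gf br a) \<ge> (1 / C) * \<bar>E_gf br a\<bar> powr (3/4)" if "W1 p a \<and> W1_norm p a < \<delta>" for a
        using C(3)[OF that] C(1) by (simp add: divide_simps mult.commute)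
      then show "\<exists>C>0. \<exists>\<delta>>0. \<forall>a. W1 p a \<and> W1_norm p a < \<delta> \<longrightarrow> W_minus1_norm p (M_gf br a) \<ge> C * \<bar>E_gf br a\<bar> powr (3/4)"
        using C(1,2) by (intro exI[of _ "1 / C"] conjI exI[of _ \<delta>]) simp_all
      show "3/4 \<le> \<theta>" if "\<exists>C>0. \<exists>\<delta>>0. \<forall>a. W1 p a \<and> W1_norm p a < \<delta> \<longrightarrow> W_minus1_norm p (M_gf br a) \<ge> C * \<bar>E_gf br a\<bar> powr \<theta>" for \<theta>
        using that exponent_lower_bound[OF L.br_bounded_bilinear L.br_antisym assms(6) na] by blast
    qed simp_all
  qed
qed

end
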